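(* Fix $L\ge0$ and some set $\tilde\Omega$ with $\Omega^L\subseteq\tilde\Omega\subseteq C([0,T],H)$. (i) Let $u\in\mathrm{LSC}([0,T]\times\tilde\Omega)$. Then $u$ is a minimax $L$-supersolution of (TVP) on $[0,T]\times\tilde\Omega$ if and only if $u(T,\cdot)\ge h$ on $\tilde\Omega$ and, for every $(t_0,x_0,z)\in[0,T)\times\tilde\Omega\times H$, $$\inf_{x\in\mathcal{X}^L(t_0,x_0)}\ \liminf_{\delta\downarrow0}\ \frac1\delta\left[u(t_0+\delta,x)-u(t_0,x_0)+\int_{t_0}^{t_0+\delta}\left[(-f^x(s),z)+F(s,x,z)\right]ds\right]\le0.$$ (ii) Let $u\in\mathrm{USC}([0,T]\times\tilde\Omega)$. Then $u$ is a minimax $L$-subsolution of (TVP) on $[0,T]\times\tilde\Omega$ if and only if $u(T,\cdot)\le h$ on $\tilde\Omega$ and, for every $(t_0,x_0,z)\in[0,T)\times\tilde\Omega\times H$, $$\sup_{x\in\mathcal{X}^L(t_0,x_0)}\ \limsup_{\delta\downarrow0}\ \frac1\delta\left[u(t_0+\delta,x)-u(t_0,x_0)+\int_{t_0}^{t_0+\delta}\left[(-f^x(s),z)+F(s,x,z)\right]ds\right]\ge0.$$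
   Context: Spaces. Let $T>0$. $H$ is a real Hilbert space with inner product $(\cdot,\cdot)$ and norm $|\cdot|$; $V$ is a separable reflexive Banach space with norm $\|\cdot\|$, continuously, densely and compactly embedded into $H$; $V^\ast$ is its dual with norm $\|\cdot\|_\ast$ and duality pairing $\langle x^\ast,x\rangle=x^\ast(x)$. With the usual identifications, $V\subseteq H\subseteq V^\ast$ and $\langle x,y\rangle=(x,y)$ for $x\in H$, $y\in V$. Fix $p\ge 2$, $q>1$ with $1/p+1/q=1$. For $t_0\in[0,T)$, $W_{pq}(t_0,T)$ is the space of all $\mathbf{x}\in L^p(t_0,T;V)$ possessing a generalized derivative $\mathbf{x}'\in L^q(t_0,T;V^\ast)$. Operator. $A:[0,T]\times V\to V^\ast$ is fixed and satisfies: (i) $t\mapsto\langle A(t,x),v\rangle$ is measurable for all $x,v\in V$; (ii) for a.e. $t$ and all $x,y\in V$, $\langle A(t,x)-A(t,y),x-y\rangle\ge 0$; (iii) for a.e. $t$ and all $x,y,v\in V$, $s\mapsto\langle A(t,x+sy),v\rangle$ is continuous on $[0,1]$; (iv) there are $a_1\in L^q(0,T)$, $c_1\ge0$ with $\|A(t,x)\|_\ast\le a_1(t)+c_1\|x\|^{p-1}$ for all $x\in V$ and a.e. $t$; (v) there is $c_2>0$ with $\langle A(t,x),x\rangle\ge c_2\|x\|^p$ for all $x\in V$ and a.e. $t$. Paths and continuity. $C([0,T],H)$ carries the sup norm. On $[0,T]\times C([0,T],H)$ and its subsets use the pseudo-metric $\mathbf{d}_\infty((t,x),(s,y))=|t-s|+\sup_{r\in[0,T]}|x(r\wedge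 t)-y(r\wedge s)|$; (semi-)continuity in $(t,x)$ is meant with respect to $\mathbf{d}_\infty$ (so such functions are non-anticipating, i.e. their value at time $t$ depends only on the path up to time $t$). USC and LSC denote real-valued upper and lower semicontinuous functions. Trajectories. For $L\ge 0$ and $(t_0,x_0)\in[0,T)\times C([0,T],H)$, $\mathcal{X}^L(t_0,x_0)$ is the set of all $x\in C([0,T],H)$ with $x=x_0$ on $[0,t_0]$ for which there exist $\mathbf{x}\in W_{pq}(t_0,T)$ and $f^x\in L^2(t_0,T;H)$ with $x=\mathbf{x}$ a.e. on $(t_0,T)$, $\mathbf{x}'(t)+A(t,\mathbf{x}(t))=f^x(t)$ a.e. on $(t_0,T)$, and $|f^x(t)|\le L(1+\sup_{0\le s\le t}|x(s)|)$ a.e. on $(t_0,T)$ ($\mathbf{x}$, $f^x$ are uniquely determined by $x$). Fix $x_\ast\in H$, regarded as a constant path, and put $\Omega^L:=\mathcal{X}^L(0,x_\ast)$. Data. $h:C([0,T],H)\to\mathbb{R}$ is continuous. $F:[0,T]\times C([0,T],H)\times H\to\mathbb{R}$ satisfies: (i) $F$ is continuous; (ii) there is $L_0\ge0$ with $|F(t,x,z)-F(t,x,\tilde z)|\le L_0(1+\sup_{0\le s\le t}|x(s)|)|z-\tilde z|$ for all $t,x,z,\tilde z$; (iii) for every $L\ge0$ and $(t_0,x_0)\in[0,T)\times C([0,T],H)$ there is a modulus of continuity $m_{L,t_0,x_0}$ such that for all $\varepsilon>0$, $t\in[t_0,T]$, $x,y\in\mathcal{X}^L(t_0,x_0)$: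 $F(t,x,\varepsilon^{-1}[x(t)-y(t)])-F(t,y,\varepsilon^{-1}[x(t)-y(t)])\le m_{L,t_0,x_0}(\varepsilon^{-1}|x(t)-y(t)|^2+\sup_{s\le t}|x(s)-y(s)|)$. (TVP) denotes the terminal-value problem $\partial_tu-\langle A(t,x(t)),\partial_xu\rangle+F(t,x,\partial_xu)=0$ on $[0,T)\times C([0,T],H)$, $u(T,x)=h(x)$. Minimax semisolutions. $u:[0,T]\times\tilde\Omega\to\mathbb{R}$ is a minimax $L$-subsolution (resp. $L$-supersolution) of (TVP) on $[0,T]\times\tilde\Omega$ if $u\in\mathrm{USC}([0,T]\times\tilde\Omega)$ (resp. $\mathrm{LSC}$), $u(T,\cdot)\le h$ (resp. $\ge h$) on $\tilde\Omega$, and for every $(t_0,x_0,z)\in[0,T)\times\tilde\Omega\times H$ there is $x\in\mathcal{X}^L(t_0,x_0)\cap\tilde\Omega$ such that for every $t\in[t_0,T]$: $u(t_0,x_0)\le$ (resp. $\ge$) $\int_{t_0}^t[(-f^x(s),z)+F(s,x,z)]\,ds+u(t,x)$.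
   Formalization: It is assumed in addition that X^L(t_0,x_0) ⊆ Ω̃ for all t_0 in [0,T) and x_0 in Ω̃ (true for Ω^L and for C([0,T],H)); otherwise u(t_0+δ,x) in the displayed inf and sup is undefined. *)

theory Defs
  imports "HOL-Analysis.Analysis"
begin

section \<open>Spaces\<close>

text \<open>
  The Hilbert space is a type \<open>'h\<close> of classes \<open>real_inner\<close> and \<open>banach\<close>, the space \<open>V\<close> a type \<open>'v\<close>
  of class \<open>banach\<close>, the dual of \<open>V\<close> is \<open>'v \<Rightarrow>\<^sub>L real\<close> with the operator norm, and the inclusion of
  \<open>V\<close> in \<open>H\<close> is an explicit map \<open>emb\<close>. Separability is the class \<open>second_countable_topology\<close>; for
  \<open>'h\<close> it is implied by the density of the range of \<open>emb\<close>.
\<close>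

definition reflexive_space :: "'v::real_normed_vector itself \<Rightarrow> bool" where
  "reflexive_space _ \<longleftrightarrow>
     (\<forall>\<Phi> :: ('v \<Rightarrow>\<^sub>L real) \<Rightarrow>\<^sub>L real. \<exists>v::'v. \<forall>g. blinfun_apply \<Phi> g = blinfun_apply g v)"

definition compact_dense_embedding ::
    "('v::real_normed_vector \<Rightarrow>\<^sub>L 'h::real_normed_vector) \<Rightarrow> bool" where
  "compact_dense_embedding emb \<longleftrightarrow>
     inj (blinfun_apply emb) \<and>
     closure (range (blinfun_apply emb)) = UNIV \<and>
     (\<forall>B. bounded B \<longrightarrow> compact (closure (blinfun_apply emb ` B)))"

text \<open>The embedding of \<open>H\<close> into the dual of \<open>V\<close>: \<open>y\<close> becomes the functional \<open>v \<mapsto> (y, v)\<close>.\<close>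

definition to_dual ::
    "('v::real_normed_vector \<Rightarrow>\<^sub>L 'h::real_inner) \<Rightarrow> 'h \<Rightarrow> ('v \<Rightarrow>\<^sub>L real)" where
  "to_dual emb y = blinfun_inner_right y o\<^sub>L emb"

text \<open>
  For a separable target, Borel and strong (Bochner) measurability coincide. The targets used are
  the reals, \<open>H\<close>, \<open>V\<close> and the dual of \<open>V\<close>, the last being separable because \<open>V\<close> is separable and
  reflexive.
\<close>

definition Lp_fun :: "real \<Rightarrow> real set \<Rightarrow> (real \<Rightarrow> 'b::real_normed_vector) \<Rightarrow> bool" where
  "Lp_fun r S f \<longleftrightarrow>
     f \<in> borel_measurable (lebesgue_on S) \<and> integrable (lebesgue_on S) (\<lambda>t. norm (f t) powr r)"

definition test_function :: "real \<Rightarrow> real \<Rightarrow> (real \<Rightarrow> real) \<Rightarrow> bool" where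
  "test_function a b \<phi> \<longleftrightarrow>
     (\<forall>k t. (deriv ^^ k) \<phi> differentiable (at t)) \<and>
     (\<exists>c d. a < c \<and> d < b \<and> (\<forall>t. t \<notin> {c..d} \<longrightarrow> \<phi> t = 0))"

text \<open>
  The defining identity of \<open>w = y'\<close> is the equality of the integrals of \<open>\<phi>' y\<close> and of \<open>- \<phi> w\<close> in
  the dual of \<open>V\<close>. It is written as equality of their values at each \<open>v\<close>, since the library's
  Bochner integral needs a target type of class \<open>second_countable_topology\<close>, of which
  \<open>'v \<Rightarrow>\<^sub>L real\<close> is not an instance.
\<close>

definition generalized_derivative ::
    "('v::real_normed_vector \<Rightarrow>\<^sub>L 'h::real_inner) \<Rightarrow> real \<Rightarrow> real \<Rightarrow>
     (real \<Rightarrow> 'v) \<Rightarrow> (real \<Rightarrow> ('v \<Rightarrow>\<^sub>L real)) \<Rightarrow> bool" where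
  "generalized_derivative emb a b y w \<longleftrightarrow>
     (\<forall>\<phi>. test_function a b \<phi> \<longrightarrow>
        (\<forall>v. (LINT t|lebesgue_on {a<..<b}. deriv \<phi> t * blinfun_apply (to_dual emb (blinfun_apply emb (y t))) v)
           = - (LINT t|lebesgue_on {a<..<b}. \<phi> t * blinfun_apply (w t) v)))"

text \<open>\<open>W_pq_deriv emb p q a b y w\<close>: \<open>y\<close> belongs to \<open>W\<^sub>p\<^sub>q(a,b)\<close> and \<open>w\<close> is its generalized derivative.\<close>

definition W_pq_deriv ::
    "('v::real_normed_vector \<Rightarrow>\<^sub>L 'h::real_inner) \<Rightarrow> real \<Rightarrow> real \<Rightarrow> real \<Rightarrow> real \<Rightarrow>
     (real \<Rightarrow> 'v) \<Rightarrow> (real \<Rightarrow> ('v \<Rightarrow>\<^sub>L real)) \<Rightarrow> bool" where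
  "W_pq_deriv emb p q a b y w \<longleftrightarrow>
     Lp_fun p {a<..<b} y \<and> Lp_fun q {a<..<b} w \<and> generalized_derivative emb a b y w"


section \<open>The operator\<close>

definition admissible_operator ::
    "real \<Rightarrow> real \<Rightarrow> real \<Rightarrow> (real \<Rightarrow> 'v::real_normed_vector \<Rightarrow> ('v \<Rightarrow>\<^sub>L real)) \<Rightarrow> bool" where
  "admissible_operator T p q A \<longleftrightarrow>
     (\<forall>x v. (\<lambda>t. blinfun_apply (A t x) v) \<in> borel_measurable (lebesgue_on {0..T})) \<and>
     (AE t in lebesgue_on {0..T}. \<forall>x y. blinfun_apply (A t x - A t y) (x - y) \<ge> 0) \<and>
     (AE t in lebesgue_on {0..T}. \<forall>x y v.
        continuous_on {0..1} (\<lambda>s. blinfun_apply (A t (x + s *\<^sub>R y)) v)) \<and>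
     (\<exists>a1 :: real \<Rightarrow> real. \<exists>c1\<ge>0. Lp_fun q {0<..<T} a1 \<and>
        (AE t in lebesgue_on {0..T}. \<forall>x. norm (A t x) \<le> a1 t + c1 * norm x powr (p - 1))) \<and>
     (\<exists>c2>0. AE t in lebesgue_on {0..T}. \<forall>x. blinfun_apply (A t x) x \<ge> c2 * norm x powr p)"


section \<open>Paths and continuity\<close>

text \<open>
  The elements of \<open>cfunspace\<close> are extensional (\<open>undefined\<close> outside \<open>[0,T]\<close>), so distinct elements
  are distinct paths, and its metric is the supremum distance on \<open>[0,T]\<close>.
\<close>

definition path_metric :: "real \<Rightarrow> (real \<Rightarrow> 'h::metric_space) metric" where
  "path_metric T = cfunspace (top_of_set {0..T}) euclidean_metric"

definition paths :: "real \<Rightarrow> (real \<Rightarrow> 'h::metric_space) set" where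
  "paths T = mspace (path_metric T)"

definition const_path :: "real \<Rightarrow> 'h \<Rightarrow> real \<Rightarrow> 'h" where
  "const_path T c = restrict (\<lambda>_. c) {0..T}"

definition d_inf :: "real \<Rightarrow> real \<times> (real \<Rightarrow> 'h::real_normed_vector) \<Rightarrow> real \<times> (real \<Rightarrow> 'h) \<Rightarrow> real" where
  "d_inf T = (\<lambda>(t, x) (s, y). \<bar>t - s\<bar> + (SUP r\<in>{0..T}. norm (x (min r t) - y (min r s))))"

definition LSC_on ::
    "real \<Rightarrow> (real \<Rightarrow> 'h::real_normed_vector) set \<Rightarrow> (real \<Rightarrow> (real \<Rightarrow> 'h) \<Rightarrow> real) \<Rightarrow> bool" where
  "LSC_on T \<Omega> u \<longleftrightarrow>
     (\<forall>t\<in>{0..T}. \<forall>x\<in>\<Omega>. \<forall>e>0. \<exists>d>0. \<forall>s\<in>{0..T}. \<forall>y\<in>\<Omega>.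
        d_inf T (t, x) (s, y) < d \<longrightarrow> u s y > u t x - e)"

definition USC_on ::
    "real \<Rightarrow> (real \<Rightarrow> 'h::real_normed_vector) set \<Rightarrow> (real \<Rightarrow> (real \<Rightarrow> 'h) \<Rightarrow> real) \<Rightarrow> bool" where
  "USC_on T \<Omega> u \<longleftrightarrow>
     (\<forall>t\<in>{0..T}. \<forall>x\<in>\<Omega>. \<forall>e>0. \<exists>d>0. \<forall>s\<in>{0..T}. \<forall>y\<in>\<Omega>.
        d_inf T (t, x) (s, y) < d \<longrightarrow> u s y < u t x + e)"

definition sup_norm_upto :: "(real \<Rightarrow> 'h::real_normed_vector) \<Rightarrow> real \<Rightarrow> real" where
  "sup_norm_upto x t = (SUP s\<in>{0..t}. norm (x s))"


section \<open>Trajectories\<close>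

text \<open>\<open>f\<close> is square integrable and \<open>x\<close> solves \<open>x' + A(t,x) = f\<close> on \<open>(t0,T)\<close>.\<close>

definition solves_evolution ::
    "real \<Rightarrow> real \<Rightarrow> real \<Rightarrow> ('v::real_normed_vector \<Rightarrow>\<^sub>L 'h::real_inner) \<Rightarrow>
     (real \<Rightarrow> 'v \<Rightarrow> ('v \<Rightarrow>\<^sub>L real)) \<Rightarrow> real \<Rightarrow> (real \<Rightarrow> 'h) \<Rightarrow> (real \<Rightarrow> 'h) \<Rightarrow> bool" where
  "solves_evolution T p q emb A t0 x f \<longleftrightarrow>
     Lp_fun 2 {t0<..<T} f \<and>
     (\<exists>y w. W_pq_deriv emb p q t0 T y w \<and>
        (AE t in lebesgue_on {t0<..<T}. x t = blinfun_apply emb (y t)) \<and>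
        (AE t in lebesgue_on {t0<..<T}. w t + A t (y t) = to_dual emb (f t)))"

definition trajectories ::
    "real \<Rightarrow> real \<Rightarrow> real \<Rightarrow> ('v::real_normed_vector \<Rightarrow>\<^sub>L 'h::real_inner) \<Rightarrow>
     (real \<Rightarrow> 'v \<Rightarrow> ('v \<Rightarrow>\<^sub>L real)) \<Rightarrow> real \<Rightarrow> real \<Rightarrow> (real \<Rightarrow> 'h) \<Rightarrow> (real \<Rightarrow> 'h) set" where
  "trajectories T p q emb A L t0 x0 =
     {x \<in> paths T. (\<forall>t\<in>{0..t0}. x t = x0 t) \<and>
        (\<exists>f. solves_evolution T p q emb A t0 x f \<and>
           (AE t in lebesgue_on {t0<..<T}. norm (f t) \<le> L * (1 + sup_norm_upto x t)))}"

text \<open>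
  The function \<open>f\<^sup>x\<close>. It is determined by \<open>x\<close> up to null sets, so the choice of representative
  affects neither the integrals below nor the almost-everywhere bound in \<open>trajectories\<close>.
\<close>

definition forcing ::
    "real \<Rightarrow> real \<Rightarrow> real \<Rightarrow> ('v::real_normed_vector \<Rightarrow>\<^sub>L 'h::real_inner) \<Rightarrow>
     (real \<Rightarrow> 'v \<Rightarrow> ('v \<Rightarrow>\<^sub>L real)) \<Rightarrow> real \<Rightarrow> (real \<Rightarrow> 'h) \<Rightarrow> real \<Rightarrow> 'h" where
  "forcing T p q emb A t0 x = (SOME f. solves_evolution T p q emb A t0 x f)"


section \<open>Data of the terminal-value problem\<close>

definition admissible_terminal :: "real \<Rightarrow> ((real \<Rightarrow> 'h::metric_space) \<Rightarrow> real) \<Rightarrow> bool" where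
  "admissible_terminal T h \<longleftrightarrow> continuous_map (mtopology_of (path_metric T)) euclidean h"

definition modulus_of_continuity :: "(real \<Rightarrow> real) \<Rightarrow> bool" where
  "modulus_of_continuity m \<longleftrightarrow> (\<forall>r\<ge>0. m r \<ge> 0) \<and> m 0 = 0 \<and> (m \<longlongrightarrow> 0) (at_right 0)"

definition admissible_hamiltonian ::
    "real \<Rightarrow> real \<Rightarrow> real \<Rightarrow> ('v::real_normed_vector \<Rightarrow>\<^sub>L 'h::real_inner) \<Rightarrow>
     (real \<Rightarrow> 'v \<Rightarrow> ('v \<Rightarrow>\<^sub>L real)) \<Rightarrow> (real \<Rightarrow> (real \<Rightarrow> 'h) \<Rightarrow> 'h \<Rightarrow> real) \<Rightarrow> bool" where
  "admissible_hamiltonian T p q emb A F \<longleftrightarrow>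
     (\<forall>t\<in>{0..T}. \<forall>x\<in>paths T. \<forall>z. \<forall>e>0. \<exists>d>0. \<forall>s\<in>{0..T}. \<forall>y\<in>paths T. \<forall>z'.
        d_inf T (t, x) (s, y) + norm (z - z') < d \<longrightarrow> \<bar>F t x z - F s y z'\<bar> < e) \<and>
     (\<exists>L0\<ge>0. \<forall>t\<in>{0..T}. \<forall>x\<in>paths T. \<forall>z z'.
        \<bar>F t x z - F t x z'\<bar> \<le> L0 * (1 + sup_norm_upto x t) * norm (z - z')) \<and>
     (\<forall>L\<ge>0. \<forall>t0\<in>{0..<T}. \<forall>x0\<in>paths T. \<exists>m. modulus_of_continuity m \<and>
        (\<forall>e>0. \<forall>t\<in>{t0..T}. \<forall>x\<in>trajectories T p q emb A L t0 x0.
           \<forall>y\<in>trajectories T p q emb A L t0 x0.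
             F t x ((1 / e) *\<^sub>R (x t - y t)) - F t y ((1 / e) *\<^sub>R (x t - y t))
               \<le> m ((1 / e) * (norm (x t - y t))\<^sup>2 + sup_norm_upto (\<lambda>s. x s - y s) t)))"


section \<open>Minimax semisolutions\<close>

text \<open>The integral of \<open>(-f\<^sup>x(s), z) + F(s,x,z)\<close> over \<open>[t0,t]\<close>.\<close>

definition running_integral ::
    "real \<Rightarrow> real \<Rightarrow> real \<Rightarrow> ('v::real_normed_vector \<Rightarrow>\<^sub>L 'h::real_inner) \<Rightarrow>
     (real \<Rightarrow> 'v \<Rightarrow> ('v \<Rightarrow>\<^sub>L real)) \<Rightarrow> (real \<Rightarrow> (real \<Rightarrow> 'h) \<Rightarrow> 'h \<Rightarrow> real) \<Rightarrow>
     real \<Rightarrow> (real \<Rightarrow> 'h) \<Rightarrow> 'h \<Rightarrow> real \<Rightarrow> real" where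
  "running_integral T p q emb A F t0 x z t =
     (LINT s|lebesgue_on {t0..t}. (- forcing T p q emb A t0 x s) \<bullet> z + F s x z)"

definition minimax_supersolution ::
    "real \<Rightarrow> real \<Rightarrow> real \<Rightarrow> ('v::real_normed_vector \<Rightarrow>\<^sub>L 'h::real_inner) \<Rightarrow>
     (real \<Rightarrow> 'v \<Rightarrow> ('v \<Rightarrow>\<^sub>L real)) \<Rightarrow> (real \<Rightarrow> (real \<Rightarrow> 'h) \<Rightarrow> 'h \<Rightarrow> real) \<Rightarrow>
     ((real \<Rightarrow> 'h) \<Rightarrow> real) \<Rightarrow> real \<Rightarrow> (real \<Rightarrow> 'h) set \<Rightarrow> (real \<Rightarrow> (real \<Rightarrow> 'h) \<Rightarrow> real) \<Rightarrow> bool" where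
  "minimax_supersolution T p q emb A F h L \<Omega> u \<longleftrightarrow>
     LSC_on T \<Omega> u \<and> (\<forall>x\<in>\<Omega>. u T x \<ge> h x) \<and>
     (\<forall>t0\<in>{0..<T}. \<forall>x0\<in>\<Omega>. \<forall>z. \<exists>x\<in>trajectories T p q emb A L t0 x0 \<inter> \<Omega>. \<forall>t\<in>{t0..T}.
        u t0 x0 \<ge> running_integral T p q emb A F t0 x z t + u t x)"

definition minimax_subsolution ::
    "real \<Rightarrow> real \<Rightarrow> real \<Rightarrow> ('v::real_normed_vector \<Rightarrow>\<^sub>L 'h::real_inner) \<Rightarrow>
     (real \<Rightarrow> 'v \<Rightarrow> ('v \<Rightarrow>\<^sub>L real)) \<Rightarrow> (real \<Rightarrow> (real \<Rightarrow> 'h) \<Rightarrow> 'h \<Rightarrow> real) \<Rightarrow>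
     ((real \<Rightarrow> 'h) \<Rightarrow> real) \<Rightarrow> real \<Rightarrow> (real \<Rightarrow> 'h) set \<Rightarrow> (real \<Rightarrow> (real \<Rightarrow> 'h) \<Rightarrow> real) \<Rightarrow> bool" where
  "minimax_subsolution T p q emb A F h L \<Omega> u \<longleftrightarrow>
     USC_on T \<Omega> u \<and> (\<forall>x\<in>\<Omega>. u T x \<le> h x) \<and>
     (\<forall>t0\<in>{0..<T}. \<forall>x0\<in>\<Omega>. \<forall>z. \<exists>x\<in>trajectories T p q emb A L t0 x0 \<inter> \<Omega>. \<forall>t\<in>{t0..T}.
        u t0 x0 \<le> running_integral T p q emb A F t0 x z t + u t x)"

end

theory Submission
  imports Defs "HOL-Complex_Analysis.Great_Picard"
begin

text \<open>
  A minimax semisolution satisfies the infinitesimal condition along its own trajectory. For the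
  converse, fix \<open>z\<close> and \<open>e > 0\<close>. The infinitesimal condition lets one extend a trajectory a little
  while \<open>u\<close> plus the running integral increases at rate at most \<open>e\<close>; concatenating such steps and
  passing to limits, one reaches the time \<open>T\<close>, and then \<open>e\<close> tends to \<open>0\<close>. All limits exist because
  the set of trajectories is compact in the supremum norm and the forcing terms converge weakly
  along a convergent sequence of trajectories. The compactness rests on the compact embedding, which
  yields convergence in \<open>L\<^sup>1\<close> with values in \<open>H\<close>, on the energy identity, which together with
  monotonicity upgrades it to uniform convergence, and on Minty's trick, which identifies the limit of the operator. Subsolutions
  are treated by passing to \<open>- u\<close> and changing the sign of the integral.
\<close>

section \<open>Functional analysis\<close>

text \<open>Three obstacles shape the argument. A trajectory has no derivative in H, so its energy
  cannot simply be differentiated; the pairing of w with y is compared instead with the double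
  average of w(t)(y(s)) over |t - s| < h, whose inner integral is an increment of x and telescopes.
  The comparison is uniform over w bounded in L^q, so one estimate yields both the energy identity
  and the limit of the pairings of w_n with y when x_n tends to x uniformly. Next, functions with
  values in the dual of V are reached through their values at vectors, and their limits are argued
  for each vector separately; reflexivity enters by way of Hahn-Banach, as density of H in the dual
  and as closedness in H of embedded balls. Finally, weak topologies on function spaces are avoided:
  the scalars A(t,y_n)(y_n - y) tend to 0 in L^1, hence almost everywhere along a subsequence, so
  that Minty's trick acts at single times; and the limit of the forcings is built from midpoint
  averages of tails, which also preserve the pointwise growth bound.\<close>

definition sublinear :: "('a::real_vector \<Rightarrow> real) \<Rightarrow> bool" where
  "sublinear p \<longleftrightarrow> (\<forall>x y. p (x + y) \<le> p x + p y) \<and> (\<forall>c\<ge>0. \<forall>x. p (c *\<^sub>R x) = c * p x)"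

lemma sublinear_add: "sublinear p \<Longrightarrow> p (x + y) \<le> p x + p y"
  and sublinear_scale: "sublinear p \<Longrightarrow> c \<ge> 0 \<Longrightarrow> p (c *\<^sub>R x) = c * p x"
  by (auto simp: sublinear_def)

lemma sublinear_zero: "sublinear p \<Longrightarrow> p 0 = 0"
  using sublinear_scale[of p 0 0] by simp

lemma sublinear_minus: "sublinear p \<Longrightarrow> - p (- x) \<le> p x"
  using sublinear_add[of p x "- x"] by (simp add: sublinear_zero)

text \<open>The common source of the three infima behind the Hahn-Banach extension: over a
  half-line, over a chain, over a parameter space. The index set has to absorb sums and positive
  multiples only up to an inequality, and the lower bound \<open>b\<close> keeps the infimum
  finite.\<close>

lemma sublinear_INF:
  fixes p :: "'a::real_vector \<Rightarrow> real"
  assumes ne: "I \<noteq> {}"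
    and bdd: "\<And>x i. i \<in> I \<Longrightarrow> b x \<le> P i x"
    and add: "\<And>x y i j. i \<in> I \<Longrightarrow> j \<in> I \<Longrightarrow> \<exists>k\<in>I. P k (x + y) \<le> P i x + P j y"
    and scl: "\<And>x i c. i \<in> I \<Longrightarrow> c > 0 \<Longrightarrow> \<exists>k\<in>I. P k (c *\<^sub>R x) \<le> c * P i x"
    and zero: "(INF i\<in>I. P i 0) = 0"
  shows "sublinear (\<lambda>x. INF i\<in>I. P i x)"
proof -
  have bb: "bdd_below ((\<lambda>i. P i x) ` I)" for x
    using bdd by (auto intro!: bdd_belowI2)
  have lower: "(INF i\<in>I. P i x) \<le> P i x" if "i \<in> I" for i x
    by (rule cINF_lower[OF bb that])
  have approx: "\<exists>i\<in>I. P i x < (INF i\<in>I. P i x) + e" if "e > 0" for x e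
    using cINF_less_iff[OF ne bb, of x "(INF i\<in>I. P i x) + e"] that by auto
  have 1: "(INF i\<in>I. P i (x + y)) \<le> (INF i\<in>I. P i x) + (INF i\<in>I. P i y)" for x y
  proof (rule field_le_epsilon)
    fix e :: real assume "e > 0"
    then obtain i j where "i \<in> I" "P i x < (INF i\<in>I. P i x) + e/2" "j \<in> I" "P j y < (INF i\<in>I. P i y) + e/2"
      using approx[of "e/2"] by (meson half_gt_zero)
    moreover obtain k where "k \<in> I" "P k (x + y) \<le> P i x + P j y" using add calculation by blast
    ultimately show "(INF i\<in>I. P i (x + y)) \<le> (INF i\<in>I. P i x) + (INF i\<in>I. P i y) + e"
      using lower[of k "x+y"] by linarith
  qed
  have 2: "(INF i\<in>I. P i (c *\<^sub>R x)) \<le> c * (INF i\<in>I. P i x)" if "c > 0" for c x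
  proof (rule field_le_epsilon)
    fix e :: real assume "e > 0"
    then have "e / c > 0" using that by simp
    from approx[OF this, of x] obtain i where i: "i \<in> I" "P i x < (INF i\<in>I. P i x) + e/c"
      by blast
    from scl[OF i(1) that, of x] obtain k where "k \<in> I" "P k (c *\<^sub>R x) \<le> c * P i x" by blast
    moreover have "c * P i x \<le> c * ((INF i\<in>I. P i x) + e/c)"
      using i that by (intro mult_left_mono) auto
    ultimately show "(INF i\<in>I. P i (c *\<^sub>R x)) \<le> c * (INF i\<in>I. P i x) + e"
      using lower[of k "c *\<^sub>R x"] that by (simp add: distrib_left)
  qed
  have 3: "(INF i\<in>I. P i (c *\<^sub>R x)) = c * (INF i\<in>I. P i x)" if "c \<ge> 0" for c x
  proof (cases "c = 0")
    case True then show ?thesis using zero by simp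
  next
    case False
    then have c: "c > 0" using that by simp
    have "(INF i\<in>I. P i x) \<le> inverse c * (INF i\<in>I. P i (c *\<^sub>R x))"
      using 2[of "inverse c" "c *\<^sub>R x"] c by simp
    then show ?thesis using 2[OF c, of x] c by (simp add: field_simps)
  qed
  show ?thesis unfolding sublinear_def using 1 3 by blast
qed

text \<open>Hahn--Banach through minimal sublinear functionals: these are exactly the linear ones.\<close>

lemma sublinear_minimal_linear:
  fixes q :: "'a::real_vector \<Rightarrow> real"
  assumes q: "sublinear q" and min: "\<And>r. sublinear r \<Longrightarrow> (\<And>x. r x \<le> q x) \<Longrightarrow> r = q"
  shows "linear q"
proof -
  have add: "q (x + y) = q x + q y" for x y
  proof -
    \<comment> \<open>\<open>r\<close> lowers \<open>q\<close> as far as possible along the ray of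
      \<open>y\<close>. Minimality forces \<open>r = q\<close>, and the choice t = 1 in the infimum
      is then superadditivity of \<open>q\<close>.\<close>
    define r where "r = (\<lambda>x. INF t\<in>{0..}. q (x + t *\<^sub>R y) - t * q y)"
    have low: "- q (- x) \<le> q (x + t *\<^sub>R y) - t * q y" if "t \<ge> 0" for x t
      using sublinear_add[OF q, of "x + t *\<^sub>R y" "- x"] sublinear_scale[OF q that, of y] by simp
    have bb: "bdd_below ((\<lambda>t. q (x + t *\<^sub>R y) - t * q y) ` {0..})" for x
      using low by (auto intro!: bdd_belowI2)
    have r: "sublinear r" unfolding r_def
    proof (rule sublinear_INF[where b = "\<lambda>x. - q (- x)"])
      fix u v :: 'a and s t :: real assume st: "s \<in> {0..}" "t \<in> {0..}"
      have "q ((u + v) + (s + t) *\<^sub>R y) \<le> q (u + s *\<^sub>R y) + q (v + t *\<^sub>R y)"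
        using sublinear_add[OF q, of "u + s *\<^sub>R y" "v + t *\<^sub>R y"] by (simp add: algebra_simps)
      then show "\<exists>k\<in>{0..}. q (u + v + k *\<^sub>R y) - k * q y
          \<le> q (u + s *\<^sub>R y) - s * q y + (q (v + t *\<^sub>R y) - t * q y)"
        using st by (intro bexI[of _ "s + t"]) (auto simp: algebra_simps)
    next
      fix u :: 'a and t c :: real assume st: "t \<in> {0..}" "c > 0"
      have "q (c *\<^sub>R u + (c * t) *\<^sub>R y) = c * q (u + t *\<^sub>R y)"
        using sublinear_scale[OF q, of c "u + t *\<^sub>R y"] st by (simp add: algebra_simps)
      then show "\<exists>k\<in>{0..}. q (c *\<^sub>R u + k *\<^sub>R y) - k * q y \<le> c * (q (u + t *\<^sub>R y) - t * q y)"
        using st by (intro bexI[of _ "c * t"]) (auto simp: algebra_simps)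
    next
      have "(\<lambda>t. q (0 + t *\<^sub>R y) - t * q y) ` {0..} = {0}"
        using sublinear_scale[OF q] by (auto simp: image_iff intro!: exI[of _ 0])
      then show "(INF t\<in>{0..}. q (0 + t *\<^sub>R y) - t * q y) = 0" by simp
    qed (use low in auto)
    have le: "r x \<le> q (x + t *\<^sub>R y) - t * q y" if "t \<ge> 0" for x t
      unfolding r_def by (rule cINF_lower[OF bb]) (use that in auto)
    have "r = q" by (rule min[OF r]) (use le[of 0] in simp)
    then have "q x \<le> q (x + y) - q y" using le[of 1 x] by simp
    then show ?thesis using sublinear_add[OF q, of x y] by simp
  qed
  have neg: "q (- x) = - q x" for x
    using add[of x "- x"] sublinear_zero[OF q] by simp
  have "q (c *\<^sub>R x) = c * q x" for c x
  proof (cases "c \<ge> 0")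
    case False
    then show ?thesis using sublinear_scale[OF q, of "- c" x] neg[of "c *\<^sub>R x"] by simp
  qed (use sublinear_scale[OF q] in simp)
  then show ?thesis using add by (intro linearI) auto
qed

text \<open>Zorn's lemma for the reversed pointwise order, so that a maximal element is a minimal
  sublinear functional. A chain is bounded below by -p(-x), hence its pointwise infimum is finite
  and, the chain being directed, again sublinear.\<close>

lemma sublinear_dominates_linear:
  fixes p :: "'a::real_vector \<Rightarrow> real"
  assumes p: "sublinear p"
  obtains q where "linear q" "\<And>x. q x \<le> p x"
proof -
  define S where "S = {q. sublinear q \<and> (\<forall>x. q x \<le> p x)}"
  define le where "le = (\<lambda>a b :: 'a \<Rightarrow> real. \<forall>x. b x \<le> a x)"
  have "\<exists>m\<in>S. \<forall>a\<in>S. le m a \<longrightarrow> a = m"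
  proof (rule predicate_Zorn)
    show "partial_order_on S (relation_of le S)"
      by (rule partial_order_on_relation_ofI) (auto simp: le_def intro: order_trans intro!: ext order_antisym)
  next
    fix C assume C: "C \<in> Chains (relation_of le S)"
    have CS: "C \<subseteq> S" using C by (auto simp: Chains_def relation_of_def)
    have ch: "le a b \<or> le b a" if "a \<in> C" "b \<in> C" for a b
      using C that by (auto simp: Chains_def relation_of_def)
    show "\<exists>u\<in>S. \<forall>a\<in>C. le a u"
    proof (cases "C = {}")
      case True then show ?thesis using p by (auto simp: S_def)
    next
      case False
      have low: "- p (- x) \<le> f x" if "f \<in> C" for f x
      proof -
        have "sublinear f" "f (- x) \<le> p (- x)" using that CS by (auto simp: S_def)
        then show ?thesis using sublinear_minus[of f x] by linarith
      qed
      have bb: "bdd_below ((\<lambda>f. f x) ` C)" for x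
        using low by (auto intro!: bdd_belowI2)
      define m where "m = (\<lambda>x. INF f\<in>C. f x)"
      have lem: "m x \<le> f x" if "f \<in> C" for f x
        unfolding m_def by (rule cINF_lower[OF bb that])
      have "sublinear m" unfolding m_def
      proof (rule sublinear_INF[where b = "\<lambda>x. - p (- x)"])
        fix x y i j assume ij: "i \<in> C" "j \<in> C"
        show "\<exists>k\<in>C. k (x + y) \<le> i x + j y"
          using ch[OF ij]
        proof
          assume "le i j"
          then have "j (x + y) \<le> i x + j y"
            using ij CS sublinear_add[of j x y] unfolding le_def S_def by (smt (verit) mem_Collect_eq subsetD)
          then show ?thesis using ij by blast
        next
          assume "le j i"
          then have "i (x + y) \<le> i x + j y"
            using ij CS sublinear_add[of i x y] unfolding le_def S_def by (smt (verit) mem_Collect_eq subsetD)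
          then show ?thesis using ij by blast
        qed
      next
        fix x i and c :: real assume "i \<in> C" "c > 0"
        then show "\<exists>k\<in>C. k (c *\<^sub>R x) \<le> c * i x"
          using CS sublinear_scale[of i c x] by (intro bexI[of _ i]) (auto simp: S_def)
      next
        have "(\<lambda>f. f 0) ` C = {0}" using False CS sublinear_zero by (force simp: S_def)
        then show "(INF f\<in>C. f 0) = 0" by simp
      qed (use False low in auto)
      moreover have "m x \<le> p x" for x
      proof -
        obtain f where "f \<in> C" using False by blast
        then have "m x \<le> f x" "f x \<le> p x" using lem[of f x] CS by (auto simp: S_def)
        then show ?thesis by linarith
      qed
      ultimately show ?thesis using lem by (intro bexI[of _ m]) (auto simp: S_def le_def)
    qed
  qed
  then obtain m where m: "sublinear m" "\<And>x. m x \<le> p x" "\<And>a. a \<in> S \<Longrightarrow> le m a \<Longrightarrow> a = m"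
    by (auto simp: S_def)
  have "linear m"
  proof (rule sublinear_minimal_linear[OF m(1)])
    fix r assume "sublinear r" "\<And>x. r x \<le> m x"
    then show "r = m" using m by (intro m(3)) (auto simp: S_def le_def intro: order_trans)
  qed
  then show ?thesis using that m by blast
qed

text \<open>The subspace is presented as the range of a linear \<open>j\<close>, with the functional
  given on the parameters. The bound forces \<open>f\<close> to vanish on the kernel of
  \<open>j\<close>, so this is a functional on the range. The applications take
  \<open>to_dual emb\<close>, a line, or a line added to a range as \<open>j\<close>.\<close>

lemma Hahn_Banach_along:
  fixes p :: "'a::real_vector \<Rightarrow> real" and j :: "'b::real_vector \<Rightarrow> 'a" and f :: "'b \<Rightarrow> real"
  assumes p: "sublinear p" and j: "linear j" and f: "linear f" and le: "\<And>\<xi>. f \<xi> \<le> p (j \<xi>)"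
  obtains q where "linear q" "\<And>x. q x \<le> p x" "\<And>\<xi>. q (j \<xi>) = f \<xi>"
proof -
  \<comment> \<open>Infimal convolution of \<open>p\<close> with \<open>f\<close> along
    \<open>j\<close>. A linear functional below it is at most \<open>f\<close> on the range of
    \<open>j\<close>, hence equal to \<open>f\<close> there after a change of sign.\<close>
  define r where "r = (\<lambda>x. INF \<xi>\<in>UNIV. p (x - j \<xi>) + f \<xi>)"
  have low: "- p (- x) \<le> p (x - j \<xi>) + f \<xi>" for x \<xi>
    using sublinear_add[OF p, of "x - j \<xi>" "- x"] le[of "- \<xi>"] linear_neg[OF f, of \<xi>] linear_neg[OF j, of \<xi>]
    by simp
  have bb: "bdd_below ((\<lambda>\<xi>. p (x - j \<xi>) + f \<xi>) ` UNIV)" for x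
    using low by (auto intro!: bdd_belowI2)
  have rle: "r x \<le> p (x - j \<xi>) + f \<xi>" for x \<xi>
    unfolding r_def by (rule cINF_lower[OF bb]) auto
  have "sublinear r" unfolding r_def
  proof (rule sublinear_INF[where b = "\<lambda>x. - p (- x)"])
    fix x y \<xi> \<eta>
    have "p (x + y - j (\<xi> + \<eta>)) + f (\<xi> + \<eta>) \<le> p (x - j \<xi>) + f \<xi> + (p (y - j \<eta>) + f \<eta>)"
      using sublinear_add[OF p, of "x - j \<xi>" "y - j \<eta>"] linear_add[OF f] linear_add[OF j]
      by (simp add: algebra_simps)
    then show "\<exists>k\<in>UNIV. p (x + y - j k) + f k \<le> p (x - j \<xi>) + f \<xi> + (p (y - j \<eta>) + f \<eta>)" by blast
  next
    fix x \<xi> and c :: real assume "c > 0"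
    then have "p (c *\<^sub>R x - j (c *\<^sub>R \<xi>)) + f (c *\<^sub>R \<xi>) = c * (p (x - j \<xi>) + f \<xi>)"
      using sublinear_scale[OF p, of c "x - j \<xi>"] linear_scale[OF f] linear_scale[OF j]
      by (simp add: algebra_simps)
    then show "\<exists>k\<in>UNIV. p (c *\<^sub>R x - j k) + f k \<le> c * (p (x - j \<xi>) + f \<xi>)"
      by (metis UNIV_I order_refl)
  next
    have "r 0 \<le> 0" using rle[of 0 0] linear_0[OF j] linear_0[OF f] sublinear_zero[OF p] by simp
    moreover have "0 \<le> r 0" unfolding r_def
      using low[of 0] sublinear_zero[OF p] by (intro cINF_greatest) auto
    ultimately show "(INF \<xi>\<in>UNIV. p (0 - j \<xi>) + f \<xi>) = 0" by (simp add: r_def)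
  qed (use low in auto)
  then obtain q where q: "linear q" "\<And>x. q x \<le> r x" using sublinear_dominates_linear by blast
  have qf: "q (j \<xi>) \<le> f \<xi>" for \<xi>
    using q(2)[of "j \<xi>"] rle[of "j \<xi>" \<xi>] sublinear_zero[OF p] by simp
  have "q (j \<xi>) = f \<xi>" for \<xi>
    using qf[of \<xi>] qf[of "- \<xi>"] linear_neg[OF f, of \<xi>] linear_neg[OF j, of \<xi>] linear_neg[OF q(1), of "j \<xi>"]
    by simp
  moreover have "q x \<le> p x" for x
    using q(2)[of x] rle[of x 0] linear_0[OF j] linear_0[OF f] by simp
  ultimately show ?thesis using that q(1) by blast
qed

lemma bounded_extension_along:
  fixes j :: "'b::real_vector \<Rightarrow> 'a::real_normed_vector" and f :: "'b \<Rightarrow> real"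
  assumes j: "linear j" and f: "linear f" and C: "C \<ge> 0" and le: "\<And>\<xi>. f \<xi> \<le> C * norm (j \<xi>)"
  obtains g :: "'a \<Rightarrow>\<^sub>L real" where "norm g \<le> C" "\<And>\<xi>. g (j \<xi>) = f \<xi>"
proof -
  have "sublinear (\<lambda>x::'a. C * norm x)"
    unfolding sublinear_def using C norm_triangle_ineq
    by (auto simp: distrib_left[symmetric] intro!: mult_left_mono)
  then obtain q where q: "linear q" "\<And>x. q x \<le> C * norm x" "\<And>\<xi>. q (j \<xi>) = f \<xi>"
    using Hahn_Banach_along[OF _ j f le] by blast
  have ab: "\<bar>q x\<bar> \<le> C * norm x" for x
    using q(2)[of x] q(2)[of "- x"] linear_neg[OF q(1), of x] by auto
  have bl: "bounded_linear q"
    using q(1) ab by (auto intro!: bounded_linear_intro[where K = C] simp: linear_add linear_scale mult.commute)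
  have "norm (Blinfun q) \<le> C"
    using ab C by (intro norm_blinfun_bound) (auto simp: bounded_linear_Blinfun_apply[OF bl])
  then show ?thesis using that[of "Blinfun q"] q(3) by (simp add: bounded_linear_Blinfun_apply[OF bl])
qed

lemma norming_functional:
  fixes v :: "'a::real_normed_vector"
  obtains g :: "'a \<Rightarrow>\<^sub>L real" where "norm g \<le> 1" "g v = norm v"
proof -
  obtain g :: "'a \<Rightarrow>\<^sub>L real" where "norm g \<le> 1" "\<And>t. g (t *\<^sub>R v) = t * norm v"
    by (rule bounded_extension_along[of "\<lambda>t. t *\<^sub>R v" "\<lambda>t::real. t * norm v" 1])
       (auto simp: abs_le_iff intro!: linearI mult_right_mono simp: algebra_simps)
  from this(1) this(2)[of 1] show ?thesis using that by simp
qed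

text \<open>Extension of the functional t x + j \<xi> -> t d from the span of \<open>x\<close> and
  the range of \<open>j\<close>, where d > 0 is the distance of \<open>x\<close> from that range.
  The bound 1 holds because t x + j \<xi> with t > 0 is t times the difference of \<open>x\<close>
  and a vector of the range.\<close>

lemma functional_vanishing_off_closure:
  fixes j :: "'b::real_vector \<Rightarrow> 'a::real_normed_vector"
  assumes j: "linear j" and x: "x \<notin> closure (range j)"
  obtains g :: "'a \<Rightarrow>\<^sub>L real" where "\<And>\<xi>. g (j \<xi>) = 0" "g x \<noteq> 0"
proof -
  define S where "S = range j"
  have ne: "S \<noteq> {}" by (simp add: S_def)
  define d where "d = infdist x S"
  have d: "d > 0"
    using x in_closure_iff_infdist_zero[OF ne, of x] infdist_nonneg[of x S]
    by (auto simp: S_def d_def)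
  have dle: "d \<le> norm (x - j \<xi>)" for \<xi>
    using infdist_le[of "j \<xi>" S x] by (auto simp: S_def d_def dist_norm)
  define j' where "j' = (\<lambda>(t::real, \<xi>). t *\<^sub>R x + j \<xi>)"
  define f' where "f' = (\<lambda>(t::real, \<xi>::'b). t * d)"
  have "f' (t, \<xi>) \<le> 1 * norm (j' (t, \<xi>))" for t \<xi>
  proof (cases "t \<le> 0")
    case True
    then have "t * d \<le> 0" using d by (simp add: mult_nonpos_nonneg)
    then show ?thesis by (auto simp: f'_def j'_def intro: order_trans)
  next
    case False
    have "t *\<^sub>R x + j \<xi> = t *\<^sub>R (x - j ((- inverse t) *\<^sub>R \<xi>))"
      using False by (simp only: linear_scale[OF j]) (simp add: scaleR_diff_right scaleR_right_distrib)
    then have "norm (t *\<^sub>R x + j \<xi>) = t * norm (x - j ((- inverse t) *\<^sub>R \<xi>))"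
      using False by simp
    then show ?thesis using dle[of "(- inverse t) *\<^sub>R \<xi>"] False by (simp add: f'_def j'_def)
  qed
  then have le: "f' z \<le> 1 * norm (j' z)" for z by (cases z) simp
  have l1: "linear j'" and l2: "linear f'"
    by (auto intro!: linearI simp: j'_def f'_def linear_add[OF j] linear_scale[OF j] algebra_simps)
  obtain g :: "'a \<Rightarrow>\<^sub>L real" where "\<And>z. g (j' z) = f' z"
    using bounded_extension_along[OF l1 l2 zero_le_one le] by blast
  from this[of "(0, _)"] this[of "(1, 0)"] have "\<And>\<xi>. g (j \<xi>) = 0" "g x \<noteq> 0"
    using d linear_0[OF j] by (auto simp: j'_def f'_def)
  then show ?thesis by (rule that)
qed

section \<open>Consequences of reflexivity and of the compact embedding\<close>

lemma to_dual_apply [simp]: "blinfun_apply (to_dual emb y) v = y \<bullet> blinfun_apply emb v"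
  by (simp add: to_dual_def)

lemma linear_to_dual: "linear (to_dual emb)"
  by (rule linearI) (auto intro!: blinfun_eqI simp: inner_add_left blinfun.add_left blinfun.scaleR_left)

lemma norm_to_dual_le: "norm (to_dual emb y) \<le> norm emb * norm y"
proof (rule norm_blinfun_bound)
  fix x
  have "\<bar>y \<bullet> blinfun_apply emb x\<bar> \<le> norm y * norm (blinfun_apply emb x)"
    by (rule Cauchy_Schwarz_ineq2)
  also have "\<dots> \<le> norm y * (norm emb * norm x)"
    by (intro mult_left_mono norm_blinfun) auto
  finally show "norm (blinfun_apply (to_dual emb y) x) \<le> norm emb * norm y * norm x"
    by (simp add: mult_ac)
qed simp

lemma reflexive_spaceD:
  fixes \<Phi> :: "('v::real_normed_vector \<Rightarrow>\<^sub>L real) \<Rightarrow>\<^sub>L real"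
  assumes "reflexive_space TYPE('v)"
  obtains v where "\<And>g. blinfun_apply \<Phi> g = blinfun_apply g v"
  using assms unfolding reflexive_space_def by metis

text \<open>Reflexivity replaces weak compactness of the ball. The limit \<open>x\<close> defines h
  -> (h, x) on the copy of H in the dual, with bound \<open>R\<close> because every term of the
  sequence comes from a vector of norm at most \<open>R\<close>. The extension to the whole dual is
  evaluation at some \<open>u\<close>, and this \<open>u\<close> is the preimage of
  \<open>x\<close>.\<close>

lemma closed_emb_cball_0:
  fixes emb :: "'v::real_normed_vector \<Rightarrow>\<^sub>L 'h::real_inner"
  assumes refl: "reflexive_space TYPE('v)" and R: "R \<ge> 0"
  shows "closed (blinfun_apply emb ` cball 0 R)"
  unfolding closed_sequential_limits
proof (intro allI impI, elim conjE)
  fix X :: "nat \<Rightarrow> 'h" and x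
  assume "\<forall>n. X n \<in> blinfun_apply emb ` cball 0 R" and lim: "X \<longlonglongrightarrow> x"
  then have "\<forall>n. \<exists>v. X n = emb v \<and> norm v \<le> R" by (simp add: image_iff) (metis mem_cball_0)
  then obtain v where v: "\<And>n. X n = emb (v n)" "\<And>n. norm (v n) \<le> R" by metis
  have le: "h \<bullet> x \<le> R * norm (to_dual emb h)" for h
  proof (rule LIMSEQ_le_const2)
    show "(\<lambda>n. h \<bullet> X n) \<longlonglongrightarrow> h \<bullet> x" by (intro tendsto_intros lim)
    have "h \<bullet> X n \<le> R * norm (to_dual emb h)" for n
    proof -
      have "h \<bullet> X n = to_dual emb h (v n)" by (simp add: v)
      also have "\<dots> \<le> norm (to_dual emb h) * norm (v n)"
        using norm_blinfun[of "to_dual emb h" "v n"] abs_ge_self order_trans unfolding real_norm_def by blast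
      also have "\<dots> \<le> norm (to_dual emb h) * R" by (intro mult_left_mono v) auto
      finally show ?thesis by (simp add: mult.commute)
    qed
    then show "\<exists>N. \<forall>n\<ge>N. h \<bullet> X n \<le> R * norm (to_dual emb h)" by blast
  qed
  have "linear (\<lambda>h. h \<bullet> x)" by (rule linearI) (auto simp: inner_add_left)
  from bounded_extension_along[OF linear_to_dual this R le]
  obtain \<Phi> where \<Phi>: "norm \<Phi> \<le> R" "\<And>h. blinfun_apply \<Phi> (to_dual emb h) = h \<bullet> x" by blast
  obtain u where u: "\<And>g. blinfun_apply \<Phi> g = blinfun_apply g u"
    using reflexive_spaceD[OF refl] by blast
  \<comment> \<open>Testing the representation with h = x and with h = emb u gives just the
    identities that reduce |x - emb u|^2 to 0.\<close>
  have "x \<bullet> emb u = x \<bullet> x" "emb u \<bullet> emb u = emb u \<bullet> x"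
    using \<Phi>(2)[of x] \<Phi>(2)[of "emb u"] u by auto
  then have "(x - emb u) \<bullet> (x - emb u) = 0"
    by (simp add: inner_diff_left inner_diff_right inner_commute)
  then have "x = emb u" by simp
  moreover obtain g :: "'v \<Rightarrow>\<^sub>L real" where g: "norm g \<le> 1" "g u = norm u" using norming_functional by blast
  have "norm u \<le> R"
  proof -
    have "norm u = \<Phi> g" using u g by simp
    also have "\<dots> \<le> norm \<Phi> * norm g" using norm_blinfun[of \<Phi> g] by simp
    also have "\<dots> \<le> R * 1" using \<Phi> g R by (intro mult_mono) auto
    finally show ?thesis by simp
  qed
  ultimately show "x \<in> blinfun_apply emb ` cball 0 R" by auto
qed

lemma closed_emb_cball:
  fixes emb :: "'v::real_normed_vector \<Rightarrow>\<^sub>L 'h::real_inner"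
  assumes refl: "reflexive_space TYPE('v)"
  shows "closed (blinfun_apply emb ` cball v R)"
proof (cases "R \<ge> 0")
  case True
  have "cball v R = (+) v ` cball 0 R" using cball_translation[of v 0 R] by simp
  then have "blinfun_apply emb ` cball v R = (+) (emb v) ` (blinfun_apply emb ` cball 0 R)"
    by (simp only: image_image blinfun.add_right)
  then show ?thesis using closed_translation[OF closed_emb_cball_0[OF refl True]] by metis
qed auto

text \<open>Otherwise a nonzero functional on the dual would vanish on all of H. By reflexivity it
  is evaluation at some \<open>u\<close>, the vanishing says \<open>emb u = 0\<close>, and
  injectivity of \<open>emb\<close> makes it zero.\<close>

lemma to_dual_dense:
  fixes emb :: "'v::real_normed_vector \<Rightarrow>\<^sub>L 'h::real_inner"
  assumes refl: "reflexive_space TYPE('v)" and inj: "inj (blinfun_apply emb)"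
  shows "closure (range (to_dual emb)) = UNIV"
proof (rule ccontr)
  assume "closure (range (to_dual emb)) \<noteq> UNIV"
  then obtain g where "g \<notin> closure (range (to_dual emb))" by blast
  then obtain \<Phi> :: "('v \<Rightarrow>\<^sub>L real) \<Rightarrow>\<^sub>L real"
    where \<Phi>: "\<And>h. blinfun_apply \<Phi> (to_dual emb h) = 0" "blinfun_apply \<Phi> g \<noteq> 0"
    by (rule functional_vanishing_off_closure[OF linear_to_dual]) (rule that)
  obtain u where u: "\<And>g. blinfun_apply \<Phi> g = blinfun_apply g u"
    using reflexive_spaceD[OF refl] by blast
  have "emb u = 0" using \<Phi>(1)[of "emb u"] u[of "to_dual emb (emb u)"] by simp
  then have "u = 0" using inj by (metis blinfun.zero_right injD)
  then show False using \<Phi>(2) u[of g] by simp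
qed

lemma to_dual_inject:
  assumes "closure (range (blinfun_apply emb)) = UNIV" "to_dual emb y = to_dual emb z"
  shows "y = z"
proof -
  have 1: "(y - z) \<bullet> emb v = 0" for v
    using arg_cong[OF assms(2), of "\<lambda>g. blinfun_apply g v"] by (simp add: inner_diff_left)
  have "closed {u. (y - z) \<bullet> u = 0}"
    by (intro closed_Collect_eq continuous_intros)
  then have "closure (range (blinfun_apply emb)) \<subseteq> {u. (y - z) \<bullet> u = 0}"
    by (intro closure_minimal) (use 1 in auto)
  then have "(y - z) \<bullet> (y - z) = 0" using assms(1) by blast
  then show ?thesis by simp
qed

text \<open>Separability of the dual, inherited from H through the dense image of
  \<open>to_dual\<close>. It is what upgrades weak measurability of dual-valued functions to Borel
  measurability.\<close>

lemma dual_countable_dense: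
  fixes emb :: "'v::real_normed_vector \<Rightarrow>\<^sub>L 'h::{real_inner, second_countable_topology}"
  assumes "reflexive_space TYPE('v)" "inj (blinfun_apply emb)"
  obtains D :: "('v \<Rightarrow>\<^sub>L real) set" where "countable D" "\<And>g e. e > 0 \<Longrightarrow> \<exists>d\<in>D. dist d g < e"
proof -
  obtain B :: "'h set" where B: "countable B" "\<And>X. open X \<Longrightarrow> X \<noteq> {} \<Longrightarrow> \<exists>d\<in>B. d \<in> X"
    using countable_dense_setE by blast
  show ?thesis
  proof (rule that[of "to_dual emb ` B"])
    fix g :: "'v \<Rightarrow>\<^sub>L real" and e :: real assume e: "e > 0"
    have "g \<in> closure (range (to_dual emb))" using to_dual_dense[OF assms] by simp
    then obtain h where h: "dist (to_dual emb h) g < e/2"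
      unfolding closure_approachable using e by (metis half_gt_zero rangeE)
    \<comment> \<open>The radius is scaled by the Lipschitz constant \<open>norm emb\<close> of
      \<open>to_dual\<close>; the added 1 keeps the quotient meaningful if that constant is
      0.\<close>
    define r where "r = e / (2 * (norm emb + 1))"
    have r: "r > 0" using e by (simp add: r_def add_nonneg_pos)
    obtain b where b: "b \<in> B" "b \<in> ball h r"
      using B(2)[of "ball h r"] r by auto
    have "dist (to_dual emb b) (to_dual emb h) \<le> norm emb * norm (b - h)"
      using norm_to_dual_le[of emb "b - h"] by (simp add: dist_norm linear_diff[OF linear_to_dual])
    also have "\<dots> \<le> (norm emb + 1) * r"
      using b by (intro mult_mono) (auto simp: dist_norm norm_minus_commute)
    also have "\<dots> = e/2"
    proof -
      have "norm emb + 1 \<noteq> 0" using norm_ge_zero[of emb] by linarith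
      then show ?thesis by (simp add: r_def divide_simps)
    qed
    finally have "dist (to_dual emb b) g < e" using h dist_triangle[of "to_dual emb b" g "to_dual emb h"] by linarith
    then show "\<exists>d\<in>to_dual emb ` B. dist d g < e" using b by blast
  qed (use B in auto)
qed

text \<open>Convergence in H tests exactly the functionals that come from H. These are dense in the
  dual, and the bound \<open>C\<close> on the norms in V carries the convergence over to every
  \<open>g\<close>.\<close>

lemma weak_convergence_of_embedded:
  fixes emb :: "'v::real_normed_vector \<Rightarrow>\<^sub>L 'h::real_inner"
  assumes "reflexive_space TYPE('v)" "inj (blinfun_apply emb)"
    and bd: "\<And>n. norm (v n) \<le> C" and lim: "(\<lambda>n. emb (v n)) \<longlonglongrightarrow> emb u"
  shows "(\<lambda>n. blinfun_apply (g :: 'v \<Rightarrow>\<^sub>L real) (v n)) \<longlonglongrightarrow> blinfun_apply g u"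
proof (rule LIMSEQ_I)
  fix e :: real assume e: "e > 0"
  have C: "C \<ge> 0" using bd[of 0] norm_ge_zero order_trans by blast
  define r where "r = e / (2 * (C + norm u + 1))"
  have r: "r > 0" using e C by (simp add: r_def add_nonneg_pos)
  have "g \<in> closure (range (to_dual emb))" using to_dual_dense[OF assms(1,2)] by simp
  then obtain h where h: "dist (to_dual emb h) g < r"
    unfolding closure_approachable using r by (metis rangeE)
  have "(\<lambda>n. h \<bullet> emb (v n)) \<longlonglongrightarrow> h \<bullet> emb u" by (intro tendsto_intros lim)
  then obtain N where N: "\<And>n. n \<ge> N \<Longrightarrow> norm (h \<bullet> emb (v n) - h \<bullet> emb u) < e/2"
    using LIMSEQ_D half_gt_zero[OF e] by metis
  show "\<exists>N. \<forall>n\<ge>N. norm (g (v n) - g u) < e"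
  proof (intro exI allI impI)
    fix n assume "n \<ge> N"
    have "norm ((g - to_dual emb h) (v n - u)) \<le> norm (g - to_dual emb h) * norm (v n - u)"
      by (rule norm_blinfun)
    also have "\<dots> \<le> r * (C + norm u)"
      using h bd[of n] norm_triangle_ineq4[of "v n" u] r
      by (intro mult_mono) (auto simp: dist_norm norm_minus_commute)
    also have "\<dots> \<le> e/2"
    proof -
      have "r * (C + norm u) \<le> r * (C + norm u + 1)" using r by simp
      also have "\<dots> = e/2"
      proof -
        have "C + norm u + 1 \<noteq> 0" using C norm_ge_zero[of u] by linarith
        then show ?thesis by (simp add: r_def divide_simps)
      qed
      finally show ?thesis .
    qed
    finally have "\<bar>(g - to_dual emb h) (v n - u)\<bar> \<le> e/2" by simp
    moreover have "g (v n) - g u = (g - to_dual emb h) (v n - u) + (h \<bullet> emb (v n) - h \<bullet> emb u)"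
      by (simp add: blinfun.diff_left blinfun.diff_right inner_diff_right)
    ultimately show "norm (g (v n) - g u) < e" using N[OF \<open>N \<le> n\<close>] unfolding real_norm_def by linarith
  qed
qed

text \<open>An inequality of Ehrling type, with finitely many coordinates along a total sequence in
  the place of a weaker norm. If every \<open>k\<close> failed, normalized counterexamples would be
  bounded in V and of norm 1 in H, and compactness would give a limit of norm 1 orthogonal to all
  \<open>e i\<close>. The same \<open>k\<close> is both the factor and the number of coordinates, so
  that its growth forces each fixed coordinate to 0.\<close>

lemma compact_embedding_interpolation:
  fixes emb :: "'v::real_normed_vector \<Rightarrow>\<^sub>L 'h::real_inner" and e :: "nat \<Rightarrow> 'h"
  assumes cpt: "\<And>B. bounded B \<Longrightarrow> compact (closure (blinfun_apply emb ` B))"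
    and tot: "\<And>x. (\<And>i. x \<bullet> e i = 0) \<Longrightarrow> x = 0" and \<eta>: "\<eta> > 0"
  obtains k :: nat where "\<And>v. norm (emb v) \<le> \<eta> * norm v + real k * (\<Sum>i<k. \<bar>emb v \<bullet> e i\<bar>)"
proof (rule ccontr)
  assume "\<not> thesis"
  then have "\<forall>k. \<exists>v. norm (emb v) > \<eta> * norm v + real k * (\<Sum>i<k. \<bar>emb v \<bullet> e i\<bar>)"
    using that by (metis not_le)
  then obtain v0 where v0: "\<And>k. norm (emb (v0 k)) > \<eta> * norm (v0 k) + real k * (\<Sum>i<k. \<bar>emb (v0 k) \<bullet> e i\<bar>)"
    by metis
  have pos: "norm (emb (v0 k)) > 0" for k
  proof -
    have "0 \<le> \<eta> * norm (v0 k) + real k * (\<Sum>i<k. \<bar>emb (v0 k) \<bullet> e i\<bar>)"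
      using \<eta> by (intro add_nonneg_nonneg mult_nonneg_nonneg sum_nonneg) auto
    then show ?thesis using v0[of k] by linarith
  qed
  define v where "v = (\<lambda>k. (1 / norm (emb (v0 k))) *\<^sub>R v0 k)"
  have nv: "norm (emb (v k)) = 1" for k using pos[of k] by (simp add: v_def blinfun.scaleR_right)
  have v: "\<eta> * norm (v k) + real k * (\<Sum>i<k. \<bar>emb (v k) \<bullet> e i\<bar>) < 1" for k
  proof -
    have "\<eta> * norm (v k) + real k * (\<Sum>i<k. \<bar>emb (v k) \<bullet> e i\<bar>)
        = (\<eta> * norm (v0 k) + real k * (\<Sum>i<k. \<bar>emb (v0 k) \<bullet> e i\<bar>)) / norm (emb (v0 k))"
    proof -
      have "\<bar>emb (v k) \<bullet> e i\<bar> = \<bar>emb (v0 k) \<bullet> e i\<bar> / norm (emb (v0 k))" for i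
        using pos[of k] by (simp add: v_def blinfun.scaleR_right abs_mult)
      then have "(\<Sum>i<k. \<bar>emb (v k) \<bullet> e i\<bar>) = (\<Sum>i<k. \<bar>emb (v0 k) \<bullet> e i\<bar>) / norm (emb (v0 k))"
        by (simp add: sum_divide_distrib)
      moreover have "norm (v k) = norm (v0 k) / norm (emb (v0 k))" using pos[of k] by (simp add: v_def)
      ultimately show ?thesis by (simp add: add_divide_distrib)
    qed
    then show ?thesis using v0[of k] pos[of k] by (simp add: divide_less_eq)
  qed
  have "norm (v k) \<le> 1 / \<eta>" for k
  proof -
    have "0 \<le> real k * (\<Sum>i<k. \<bar>emb (v k) \<bullet> e i\<bar>)" by (intro mult_nonneg_nonneg sum_nonneg) auto
    then have "\<eta> * norm (v k) < 1" using v[of k] by linarith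
    then show ?thesis using \<eta> by (simp add: field_simps)
  qed
  then have "bounded (range v)" by (auto simp: bounded_iff)
  from cpt[OF this] have "compact (closure (blinfun_apply emb ` range v))" .
  moreover have "\<forall>n. emb (v n) \<in> closure (blinfun_apply emb ` range v)"
    by (meson closure_subset image_eqI rangeI subsetD)
  ultimately obtain x r where r: "strict_mono (r :: nat \<Rightarrow> nat)" and lim: "((\<lambda>n. emb (v n)) \<circ> r) \<longlonglongrightarrow> x"
    unfolding compact_def by metis
  have "(\<lambda>n. norm (emb (v (r n)))) \<longlonglongrightarrow> norm x" using lim by (auto simp: o_def intro: tendsto_norm)
  then have nx: "norm x = 1" using nv by (simp add: LIMSEQ_const_iff)
  have "x \<bullet> e i = 0" for i
  proof -
    have "(\<lambda>n. \<bar>emb (v (r n)) \<bullet> e i\<bar>) \<longlonglongrightarrow> \<bar>x \<bullet> e i\<bar>"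
      using lim by (auto simp: o_def intro!: tendsto_intros)
    moreover have "(\<lambda>n. \<bar>emb (v (r n)) \<bullet> e i\<bar>) \<longlonglongrightarrow> 0"
    proof (rule tendsto_sandwich[OF _ _ tendsto_const lim_1_over_n])
      have "\<bar>emb (v (r n)) \<bullet> e i\<bar> \<le> 1 / real n" if n: "n > i" for n
      proof -
        have rn: "n \<le> r n" using r by (rule seq_suble)
        have "real n * \<bar>emb (v (r n)) \<bullet> e i\<bar> \<le> real (r n) * (\<Sum>i<r n. \<bar>emb (v (r n)) \<bullet> e i\<bar>)"
          using rn n by (intro mult_mono member_le_sum) auto
        also have "\<dots> < 1"
        proof -
          have "0 \<le> \<eta> * norm (v (r n))" using \<eta> by simp
          then show ?thesis using v[of "r n"] by linarith
        qed
        finally show ?thesis using n by (simp add: field_simps)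
      qed
      then show "\<forall>\<^sub>F n in sequentially. \<bar>emb (v (r n)) \<bullet> e i\<bar> \<le> 1 / real n"
        unfolding eventually_sequentially by (meson Suc_le_lessD)
    qed auto
    ultimately show ?thesis using LIMSEQ_unique by fastforce
  qed
  then have "x = 0" by (rule tot)
  then show False using nx by simp
qed

section \<open>Measurability of functions with values in the dual\<close>

lemma measurable_norm_dual:
  fixes w :: "'a \<Rightarrow> ('v::{real_normed_vector, second_countable_topology} \<Rightarrow>\<^sub>L real)"
  assumes w: "\<And>v. (\<lambda>t. blinfun_apply (w t) v) \<in> borel_measurable M"
  shows "(\<lambda>t. norm (w t)) \<in> borel_measurable M"
proof (rule borel_measurableI_le)
  obtain B :: "'v set" where B: "countable B" "\<And>X. open X \<Longrightarrow> X \<noteq> {} \<Longrightarrow> \<exists>d\<in>B. d \<in> X"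
    using countable_dense_setE by blast
  fix c :: real
  have dense: "closure B = UNIV"
  proof -
    have "x \<in> closure B" for x
      unfolding closure_approachable
    proof (intro allI impI)
      fix e :: real assume "e > 0"
      then obtain d where "d \<in> B" "d \<in> ball x e" using B(2)[of "ball x e"] by auto
      then show "\<exists>y\<in>B. dist y x < e" by (auto simp: dist_commute)
    qed
    then show ?thesis by blast
  qed
  \<comment> \<open>A countable dense set of test vectors suffices by continuity, so a level set of
    the norm is a countable intersection of measurable sets. The condition c \<ge> 0 is stated
    separately because the test at the zero vector is vacuous.\<close>
  have "norm (w t) \<le> c \<longleftrightarrow> c \<ge> 0 \<and> (\<forall>v\<in>B. \<bar>w t v\<bar> \<le> c * norm v)" for t
  proof
    assume "norm (w t) \<le> c"
    then show "c \<ge> 0 \<and> (\<forall>v\<in>B. \<bar>w t v\<bar> \<le> c * norm v)"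
      by (metis norm_blinfun norm_ge_zero order_trans real_norm_def mult_right_mono)
  next
    assume R: "c \<ge> 0 \<and> (\<forall>v\<in>B. \<bar>w t v\<bar> \<le> c * norm v)"
    have "closed {v. \<bar>w t v\<bar> \<le> c * norm v}"
      by (intro closed_Collect_le continuous_intros)
    then have "closure B \<subseteq> {v. \<bar>w t v\<bar> \<le> c * norm v}"
      by (intro closure_minimal) (use R in auto)
    then show "norm (w t) \<le> c" using dense R by (intro norm_blinfun_bound) auto
  qed
  then have eq: "{t \<in> space M. norm (w t) \<le> c} = {t \<in> space M. c \<ge> 0 \<and> (\<forall>v\<in>B. \<bar>w t v\<bar> \<le> c * norm v)}"
    by auto
  have "{t \<in> space M. \<forall>v\<in>B. \<bar>w t v\<bar> \<le> c * norm v} \<in> sets M"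
  proof (rule sets.sets_Collect_countable_All'[OF _ B(1)])
    fix v assume "v \<in> B"
    have "(\<lambda>t. \<bar>w t v\<bar>) \<in> borel_measurable M" using w by (rule borel_measurable_abs)
    then show "{t \<in> space M. \<bar>w t v\<bar> \<le> c * norm v} \<in> sets M" by simp
  qed
  then show "{t \<in> space M. norm (w t) \<le> c} \<in> sets M"
    unfolding eq by (cases "c \<ge> 0") simp_all
qed

text \<open>Pettis's argument: with a countable dense set \<open>D\<close>, every open set is a
  countable union of closed balls, and the preimage of a ball is a level set of
  \<open>norm (w t - d)\<close>.\<close>

lemma measurable_dual_valued:
  fixes w :: "'a \<Rightarrow> ('v::{real_normed_vector, second_countable_topology} \<Rightarrow>\<^sub>L real)"
  assumes D: "countable (D :: ('v \<Rightarrow>\<^sub>L real) set)" "\<And>g e. e > 0 \<Longrightarrow> \<exists>d\<in>D. dist d g < e"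
    and w: "\<And>v. (\<lambda>t. blinfun_apply (w t) v) \<in> borel_measurable M"
  shows "w \<in> borel_measurable M"
proof (rule borel_measurableI)
  fix S :: "('v \<Rightarrow>\<^sub>L real) set" assume S: "open S"
  define I where "I = {(d, r). d \<in> D \<and> r \<in> \<rat> \<and> cball d r \<subseteq> S}"
  have cI: "countable I"
    by (rule countable_subset[of _ "D \<times> \<rat>"]) (auto simp: I_def D countable_rat)
  have "S = (\<Union>(d, r)\<in>I. cball d r)"
  proof (intro equalityI subsetI)
    fix g assume "g \<in> S"
    then obtain e where e: "e > 0" "ball g e \<subseteq> S" using S open_contains_ball by blast
    obtain r where r: "r \<in> \<rat>" "e/4 < r" "r < e/2" using Rats_dense_in_real[of "e/4" "e/2"] e by auto
    obtain d where d: "d \<in> D" "dist d g < e/4" using D(2)[of "e/4"] e by auto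
    have "cball d r \<subseteq> ball g e"
    proof
      fix y assume "y \<in> cball d r"
      then have "dist d y \<le> r" by simp
      then show "y \<in> ball g e" using d r e dist_triangle[of g y d] by (simp add: dist_commute)
    qed
    then have "(d, r) \<in> I" using d r e by (auto simp: I_def)
    moreover have "g \<in> cball d r" using d r by auto
    ultimately show "g \<in> (\<Union>(d, r)\<in>I. cball d r)" by blast
  qed (auto simp: I_def)
  note SU = this
  have "w -` S \<inter> space M = (\<Union>(d, r)\<in>I. {t \<in> space M. norm (w t - d) \<le> r})"
    by (subst SU) (force simp: dist_norm norm_minus_commute split: prod.splits)
  also have "\<dots> \<in> sets M"
  proof (rule sets.countable_UN'[OF cI], clarsimp)
    fix d r assume "(d, r) \<in> I"
    have "(\<lambda>t. norm (w t - d)) \<in> borel_measurable M"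
      by (rule measurable_norm_dual)
         (simp only: blinfun.diff_left, intro borel_measurable_diff w borel_measurable_const)
    then show "{t \<in> space M. norm (w t - d) \<le> r} \<in> sets M" by simp
  qed
  finally show "w -` S \<inter> space M \<in> sets M" .
qed

text \<open>Simple functions approximate \<open>y\<close> pointwise. For a function with finitely
  many values the pairing is measurable piece by piece, and continuity of each \<open>w t\<close>
  passes to the limit.\<close>

lemma measurable_dual_pairing:
  fixes w :: "'a \<Rightarrow> ('v::{real_normed_vector, second_countable_topology} \<Rightarrow>\<^sub>L real)"
  assumes w: "\<And>v. (\<lambda>t. blinfun_apply (w t) v) \<in> borel_measurable M"
    and y: "y \<in> borel_measurable M"
  shows "(\<lambda>t. blinfun_apply (w t) (y t)) \<in> borel_measurable M"
proof -
  obtain s where s: "\<And>i. simple_function M (s i)" "\<And>t. t \<in> space M \<Longrightarrow> (\<lambda>i. s i t) \<longlonglongrightarrow> y t"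
    using borel_measurable_implies_sequence_metric[OF y, of 0] by blast
  show ?thesis
  proof (rule borel_measurable_LIMSEQ_metric)
    fix t assume "t \<in> space M"
    then show "(\<lambda>i. w t (s i t)) \<longlonglongrightarrow> w t (y t)" using s by (intro tendsto_intros) auto
  next
    fix i
    show "(\<lambda>t. w t (s i t)) \<in> borel_measurable M"
    proof (rule measurable_compose_countable'[where f = "\<lambda>v t. blinfun_apply (w t) v" and g = "s i" and I = "s i ` space M"])
      show "s i \<in> measurable M (count_space (s i ` space M))"
        using s(1)[of i] by (auto simp: simple_function_def measurable_def)
          (metis (no_types, lifting) finite_subset inf_commute s(1) simple_functionD(2))
      show "countable (s i ` space M)" using s(1)[of i] by (simp add: simple_function_def countable_finite)
    qed (use w in auto)
  qed
qed

section \<open>Smooth test functions\<close>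

text \<open>Differentiability of finite order by recursion, in which form closure under sums,
  products and affine substitution is an induction on the order with the functions arbitrary. The
  smoothness clause of \<open>test_function\<close> is \<open>ndiff n\<close> for all n, by
  \<open>ndiff_iff\<close>.\<close>

primrec ndiff :: "nat \<Rightarrow> (real \<Rightarrow> real) \<Rightarrow> bool" where
  "ndiff 0 f \<longleftrightarrow> True"
| "ndiff (Suc n) f \<longleftrightarrow> (\<forall>t. f differentiable (at t)) \<and> ndiff n (deriv f)"

lemma ndiff_iff: "ndiff n f \<longleftrightarrow> (\<forall>k<n. \<forall>t. (deriv ^^ k) f differentiable (at t))"
proof (induction n arbitrary: f)
  case (Suc n)
  have "(\<forall>k<Suc n. \<forall>t. (deriv ^^ k) f differentiable (at t)) \<longleftrightarrow>
      (\<forall>t. f differentiable (at t)) \<and> (\<forall>k<n. \<forall>t. (deriv ^^ Suc k) f differentiable (at t))"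
    by (subst All_less_Suc2) simp
  then show ?case by (simp add: Suc funpow_Suc_right del: funpow.simps)
qed simp

lemma deriv_eqI: "(\<And>t. (f has_real_derivative f' t) (at t)) \<Longrightarrow> deriv f = f'"
  by (rule ext) (rule DERIV_imp_deriv)

lemma ndiff_SucI: "(\<And>t. (f has_real_derivative f' t) (at t)) \<Longrightarrow> ndiff n f' \<Longrightarrow> ndiff (Suc n) f"
  using deriv_eqI[of f f'] by (auto simp: real_differentiable_def)

lemma ndiff_SucE:
  assumes "ndiff (Suc n) f"
  shows "(f has_real_derivative deriv f t) (at t)"
  using assms by (simp add: DERIV_deriv_iff_real_differentiable)

lemma ndiff_Suc_imp: "ndiff (Suc n) f \<Longrightarrow> ndiff n f"
  by (auto simp: ndiff_iff)

lemma ndiff_add: "ndiff n f \<Longrightarrow> ndiff n g \<Longrightarrow> ndiff n (\<lambda>t. f t + g t)"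
proof (induction n arbitrary: f g)
  case (Suc n)
  show ?case
    by (rule ndiff_SucI[OF DERIV_add[OF ndiff_SucE[OF Suc.prems(1)] ndiff_SucE[OF Suc.prems(2)]]])
       (use Suc in auto)
qed simp

lemma ndiff_mult: "ndiff n f \<Longrightarrow> ndiff n g \<Longrightarrow> ndiff n (\<lambda>t. f t * g t)"
proof (induction n arbitrary: f g)
  case (Suc n)
  show ?case
    by (rule ndiff_SucI[OF DERIV_mult[OF ndiff_SucE[OF Suc.prems(1)] ndiff_SucE[OF Suc.prems(2)]]])
       (use Suc ndiff_Suc_imp in \<open>auto intro!: ndiff_add simp del: ndiff.simps(2)\<close>, auto)
qed simp

lemma ndiff_const: "ndiff n (\<lambda>t. c)"
proof (induction n arbitrary: c)
  case (Suc n)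
  show ?case by (rule ndiff_SucI[of _ "\<lambda>t. 0"]) (auto intro: Suc)
qed simp

lemma ndiff_affine: "ndiff n f \<Longrightarrow> ndiff n (\<lambda>t. f (c * t + d))"
proof (induction n arbitrary: f)
  case (Suc n)
  have "((\<lambda>t. f (c * t + d)) has_real_derivative deriv f (c * t + d) * c) (at t)" for t
    by (rule DERIV_chain2[OF ndiff_SucE[OF Suc.prems]]) (auto intro!: derivative_eq_intros)
  then show ?case
    by (rule ndiff_SucI) (use Suc in \<open>auto intro!: ndiff_mult ndiff_const\<close>)
qed simp

text \<open>A class closed under taking derivatives consists of smooth functions; the class it is
  made for is that of the \<open>flat p\<close>.\<close>

lemma ndiff_coinduct:
  assumes "P f" "\<And>f. P f \<Longrightarrow> \<exists>f'. P f' \<and> (\<forall>t. (f has_real_derivative f' t) (at t))"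
  shows "ndiff n f"
  using assms(1)
proof (induction n arbitrary: f)
  case (Suc n)
  then show ?case using assms(2)[OF Suc.prems] ndiff_SucI by blast
qed simp

text \<open>The classical flat functions at 0, with an arbitrary polynomial factor in 1/r so that
  the derivative stays within the class.\<close>

definition flat :: "real poly \<Rightarrow> real \<Rightarrow> real" where
  "flat p r = (if r > 0 then poly p (1 / r) * exp (- (1 / r)) else 0)"

lemma poly_times_exp_minus_tendsto_0: "((\<lambda>x::real. poly p x * exp (- x)) \<longlongrightarrow> 0) at_top"
proof -
  have "((\<lambda>x::real. \<Sum>i\<le>degree p. coeff p i * (x ^ i / exp x)) \<longlongrightarrow> (\<Sum>i\<le>degree p. coeff p i * 0)) at_top"
    by (intro tendsto_intros tendsto_power_div_exp_0)
  then show ?thesis by (simp add: poly_altdef exp_minus sum_distrib_right divide_inverse mult.assoc)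
qed

text \<open>With s = 1/r one has ds/dr = -s^2, and the derivative of p(s) exp(-s) in s is (p' -
  p)(s) exp(-s); this produces the new polynomial s^2 (p - p'). At r = 0 the difference quotient is
  again a polynomial in s times exp(-s), which tends to 0.\<close>

lemma flat_derivative:
  "(flat p has_real_derivative flat ([:0, 0, 1:] * (p - pderiv p)) r) (at r)"
proof -
  consider "r > 0" | "r < 0" | "r = 0" by linarith
  then show ?thesis
  proof cases
    case 1
    have "((\<lambda>r. poly p (1 / r) * exp (- (1 / r))) has_real_derivative
        flat ([:0, 0, 1:] * (p - pderiv p)) r) (at r)"
      using 1 by (auto intro!: derivative_eq_intros DERIV_chain2[OF poly_DERIV]
          simp: flat_def power2_eq_square algebra_simps)
    then show ?thesis
      by (rule has_field_derivative_transform_within_open[of _ _ _ "{0<..}"])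
         (use 1 in \<open>auto simp: flat_def\<close>)
  next
    case 2
    have "((\<lambda>r. 0) has_real_derivative flat ([:0, 0, 1:] * (p - pderiv p)) r) (at r)"
      using 2 by (auto simp: flat_def)
    then show ?thesis
      by (rule has_field_derivative_transform_within_open[of _ _ _ "{..<0}"])
         (use 2 in \<open>auto simp: flat_def\<close>)
  next
    case 3
    have "((\<lambda>h. flat p h / h) \<longlongrightarrow> 0) (at 0)"
    proof (rule filterlim_split_at)
      have "((\<lambda>h::real. 0::real) \<longlongrightarrow> 0) (at_left 0)" by simp
      then show "((\<lambda>h. flat p h / h) \<longlongrightarrow> 0) (at_left 0)"
        by (rule Lim_transform_eventually) (auto simp: flat_def eventually_at_filter)
      have "((\<lambda>h::real. poly (pCons 0 p) (inverse h) * exp (- (inverse h))) \<longlongrightarrow> 0) (at_right 0)"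
        by (rule filterlim_compose[OF poly_times_exp_minus_tendsto_0 filterlim_inverse_at_top_right])
      then show "((\<lambda>h. flat p h / h) \<longlongrightarrow> 0) (at_right 0)"
        by (rule Lim_transform_eventually)
           (auto simp: flat_def eventually_at_filter divide_inverse mult_ac)
    qed
    then show ?thesis using 3 by (simp add: DERIV_def flat_def)
  qed
qed

lemma ndiff_flat: "ndiff n (flat p)"
  by (rule ndiff_coinduct[where P = "\<lambda>f. \<exists>p. f = flat p"]) (use flat_derivative in blast)+

text \<open>The normalized primitive of a product of two flat functions, a bump that is positive
  exactly on (0,1). The derivative is returned with the step because it serves as a
  mollifier.\<close>

lemma smooth_step:
  obtains S S' :: "real \<Rightarrow> real"
  where "\<And>n. ndiff n S" "\<And>r. (S has_real_derivative S' r) (at r)"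
    "\<And>r. r \<le> 0 \<Longrightarrow> S r = 0" "\<And>r. r \<ge> 1 \<Longrightarrow> S r = 1" "\<And>r. 0 \<le> S r" "\<And>r. S r \<le> 1"
    "\<And>r. S' r \<ge> 0" "\<And>r. r \<le> 0 \<or> r \<ge> 1 \<Longrightarrow> S' r = 0" "continuous_on UNIV S'"
proof -
  define \<rho> where "\<rho> = (\<lambda>r. flat 1 r * flat 1 ((-1) * r + 1))"
  have \<rho>n: "ndiff n \<rho>" for n
    unfolding \<rho>_def by (intro ndiff_mult ndiff_affine ndiff_flat)
  have \<rho>0: "\<rho> r \<ge> 0" "r \<le> 0 \<or> r \<ge> 1 \<Longrightarrow> \<rho> r = 0" "0 < r \<Longrightarrow> r < 1 \<Longrightarrow> \<rho> r > 0" for r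
    by (auto simp: \<rho>_def flat_def)
  have c\<rho>: "continuous_on A \<rho>" for A
    using ndiff_SucE[OF \<rho>n] by (meson DERIV_continuous_on has_field_derivative_at_within)
  \<comment> \<open>Integration starts at -1, where the bump vanishes, so that 0 is an interior
    point of the interval and the derivative of \<open>J\<close> at 0 is two-sided.\<close>
  define J where "J = (\<lambda>r. integral {-1..r} \<rho>)"
  have J1: "J r = 0" if "r < 0" for r
  proof -
    have "integral {-1..r} \<rho> = integral {-1..r} (\<lambda>_. 0)"
      by (rule integral_cong) (use that \<rho>0 in auto)
    then show ?thesis by (simp add: J_def)
  qed
  have DJ: "(J has_real_derivative \<rho> r) (at r)" for r
  proof (cases "r < 0")
    case True
    have "((\<lambda>_. 0) has_real_derivative \<rho> r) (at r)" using True \<rho>0 by auto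
    then show ?thesis
      by (rule has_field_derivative_transform_within_open[of _ _ _ "{..<0}"]) (use True J1 in auto)
  next
    case False
    have "(J has_real_derivative \<rho> r) (at r within {-1..r+1})"
      unfolding J_def by (rule integral_has_real_derivative[OF c\<rho>]) (use False in auto)
    then show ?thesis using at_within_interior[of r "{-1..r+1}"] False by simp
  qed
  have mono: "J x \<le> J y" if "x \<le> y" for x y
    using that DJ \<rho>0(1) by (meson DERIV_nonneg_imp_nondecreasing)
  have Jc: "continuous_on A J" for A
    using DJ by (meson DERIV_continuous_on has_field_derivative_at_within)
  have J0: "J 0 = 0"
  proof -
    have "J 0 = J (-1)" using DERIV_isconst_end[of "-1" 0 J] DJ \<rho>0(2) Jc
      by (metis less_eq_real_def less_minus_one_simps(1))
    then show ?thesis using J1 by simp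
  qed
  have Jpos: "J 1 > 0"
    using DERIV_pos_imp_increasing_open[of 0 1 J] DJ \<rho>0(3) Jc J0 by auto
  have J2: "J r = J 1" if "r \<ge> 1" for r
  proof (cases "r = 1")
    case False
    then show ?thesis using DERIV_isconst_end[of 1 r J] DJ \<rho>0(2) Jc that
      by (metis less_eq_real_def)
  qed simp
  define S where "S = (\<lambda>r. inverse (J 1) * J r)"
  define S' where "S' = (\<lambda>r. inverse (J 1) * \<rho> r)"
  have DS: "(S has_real_derivative S' r) (at r)" for r
    unfolding S_def S'_def by (intro DERIV_cmult DJ)
  show ?thesis
  proof (rule that[of S S'])
    show "ndiff n S" for n
    proof (cases n)
      case (Suc m)
      have "ndiff m S'" unfolding S'_def by (intro ndiff_mult ndiff_const \<rho>n)
      then show ?thesis using ndiff_SucI[OF DS, of m] Suc by blast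
    qed simp
    show "S r = 0" if "r \<le> 0" for r using that J0 J1[of r] by (cases "r = 0") (auto simp: S_def)
    show "S r = 1" if "r \<ge> 1" for r using J2[OF that] Jpos by (simp add: S_def)
    show "0 \<le> S r" for r
    proof -
      have "0 \<le> J r" using mono[of 0 r] J0 J1[of r] by (cases "r < 0") auto
      then show ?thesis using Jpos by (simp add: S_def)
    qed
    show "S r \<le> 1" for r
      using mono[of r "max r 1"] J2[of "max r 1"] Jpos by (auto simp: S_def field_simps)
    show "S' r \<ge> 0" for r using \<rho>0(1) Jpos by (simp add: S'_def)
    show "S' r = 0" if "r \<le> 0 \<or> r \<ge> 1" for r using \<rho>0(2) that by (simp add: S'_def)
    show "continuous_on UNIV S'" unfolding S'_def by (intro continuous_intros c\<rho>)
  qed (rule DS)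
qed

section \<open>Integrals over subintervals\<close>

abbreviation ivl :: "real \<Rightarrow> real \<Rightarrow> real measure" where
  "ivl a b \<equiv> lebesgue_on {a<..<b}"

lemma norm_integral_le:
  fixes f :: "'a \<Rightarrow> 'b::{banach, second_countable_topology}"
  assumes "integrable M f" "integrable M g" "AE x in M. norm (f x) \<le> g x"
  shows "norm (integral\<^sup>L M f) \<le> integral\<^sup>L M g"
proof -
  have "norm (integral\<^sup>L M f) \<le> (\<integral>x. norm (f x) \<partial>M)" by (rule integral_norm_bound)
  also have "\<dots> \<le> integral\<^sup>L M g" using assms by (intro integral_mono_AE) auto
  finally show ?thesis .
qed

lemma finite_measure_ivl: "finite_measure (ivl a b)"
  by (rule finite_measure_lebesgue_on) simp

lemma pair_sigma_finite_ivl: "pair_sigma_finite (ivl a b) (ivl c d)"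
  using finite_measure_ivl finite_measure.axioms(1) by (auto simp: pair_sigma_finite_def)

lemma integrable_ivl_bounded:
  fixes f :: "real \<Rightarrow> 'b::{banach, second_countable_topology}"
  assumes "f \<in> borel_measurable (ivl a b)" "AE t in ivl a b. norm (f t) \<le> B"
  shows "integrable (ivl a b) f"
  by (rule finite_measure.integrable_const_bound[OF finite_measure_ivl assms(2,1)])

lemma integrable_ivl_const [simp]: "integrable (ivl a b) (\<lambda>t. c :: 'b::{banach, second_countable_topology})"
  by (rule finite_measure.integrable_const[OF finite_measure_ivl])

lemma borel_measurable_ivl: "f \<in> borel_measurable borel \<Longrightarrow> f \<in> borel_measurable (ivl a b)"
  by (rule measurable_restrict_space1) (simp add: measurable_completion)

lemma indicator_measurable_ivl [simp, intro]:
  "(indicator {s<..<t} :: real \<Rightarrow> real) \<in> borel_measurable (ivl a b)"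
  by (rule borel_measurable_ivl) simp

lemma integrable_indicator_ivl:
  fixes g :: "real \<Rightarrow> 'b::{banach, second_countable_topology}"
  assumes "integrable (ivl a b) g"
  shows "integrable (ivl a b) (\<lambda>r. indicator {s<..<t} r *\<^sub>R g r)"
  by (rule Bochner_Integration.integrable_bound[OF assms])
     (use assms in \<open>auto intro!: borel_measurable_scaleR mult_left_le_one_le\<close>)

lemma continuous_measurable_ivl: "continuous_on {a..b} f \<Longrightarrow> f \<in> borel_measurable (ivl a b)"
  by (rule continuous_imp_measurable_on_sets_lebesgue) (auto intro: continuous_on_subset)

lemma continuous_integrable_ivl:
  fixes f :: "real \<Rightarrow> 'b::{banach, second_countable_topology}"
  assumes "continuous_on {a..b} f"
  shows "integrable (ivl a b) f"
proof -
  have "bounded (f ` {a..b})" using assms by (intro compact_imp_bounded compact_continuous_image) auto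
  then obtain B where "\<And>t. t \<in> {a..b} \<Longrightarrow> norm (f t) \<le> B" unfolding bounded_iff by blast
  then show ?thesis
    by (intro integrable_ivl_bounded[of _ _ _ B] continuous_measurable_ivl assms) (auto simp: AE_restrict_space_iff)
qed

lemma ivl_mono_measurable:
  "f \<in> borel_measurable (ivl a b) \<Longrightarrow> a \<le> s \<Longrightarrow> t \<le> b \<Longrightarrow> f \<in> borel_measurable (ivl s t)"
  by (erule measurable_restrict_mono) auto

lemma ivl_mono_AE: "AE r in ivl a b. P r \<Longrightarrow> a \<le> s \<Longrightarrow> t \<le> b \<Longrightarrow> AE r in ivl s t. P r"
  by (simp add: AE_restrict_space_iff) (elim AE_mp, auto)

text \<open>Moves integrals over varying subintervals to one fixed measure, where dominated
  convergence and Fubini apply.\<close>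

lemma ivl_integral_indicator:
  fixes g :: "real \<Rightarrow> 'b::{banach, second_countable_topology}"
  assumes "a \<le> s" "t \<le> b"
  shows "integral\<^sup>L (ivl s t) g = (\<integral>r. indicator {s<..<t} r *\<^sub>R g r \<partial>ivl a b)"
proof -
  have "indicator {a<..<b} r *\<^sub>R indicator {s<..<t} r *\<^sub>R g r = indicator {s<..<t} r *\<^sub>R g r" for r
    using assms by (auto simp: indicator_def)
  then show ?thesis by (simp add: integral_restrict_space del: scaleR_scaleR)
qed

lemma ivl_mono_integrable:
  fixes g :: "real \<Rightarrow> 'b::{banach, second_countable_topology}"
  assumes "integrable (ivl a b) g" "a \<le> s" "t \<le> b"
  shows "integrable (ivl s t) g"
proof -
  have "integrable lebesgue (\<lambda>r. indicator {a<..<b} r *\<^sub>R g r)"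
    using assms(1) by (simp add: integrable_restrict_space)
  from integrable_mult_indicator[OF _ this, of "{s<..<t}"]
  have "integrable lebesgue (\<lambda>r. indicator {s<..<t} r *\<^sub>R indicator {a<..<b} r *\<^sub>R g r)"
    by simp
  moreover have "indicator {s<..<t} r *\<^sub>R indicator {a<..<b} r *\<^sub>R g r = indicator {s<..<t} r *\<^sub>R g r" for r
    using assms by (auto simp: indicator_def)
  ultimately show ?thesis by (simp add: integrable_restrict_space del: scaleR_scaleR)
qed

lemma AE_ivl_neq: "AE r in ivl a b. r \<noteq> c"
proof -
  have "AE r in lebesgue. r \<noteq> c"
    by (rule AE_I'[of "{c}"]) auto
  then show ?thesis by (auto simp: AE_restrict_space_iff elim!: AE_mp)
qed

lemma ivl_integral_add:
  fixes g :: "real \<Rightarrow> 'b::{banach, second_countable_topology}"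
  assumes "integrable (ivl a b) g" "a \<le> c" "c \<le> b"
  shows "integral\<^sup>L (ivl a b) g = integral\<^sup>L (ivl a c) g + integral\<^sup>L (ivl c b) g"
proof -
  note i = integrable_indicator_ivl[OF assms(1)]
  have "integral\<^sup>L (ivl a c) g + integral\<^sup>L (ivl c b) g
      = (\<integral>r. indicator {a<..<c} r *\<^sub>R g r + indicator {c<..<b} r *\<^sub>R g r \<partial>ivl a b)"
    using assms by (subst (1 2) ivl_integral_indicator[of a _ _ b]) (auto simp: i)
  also have "\<dots> = integral\<^sup>L (ivl a b) g"
  proof (rule integral_cong_AE)
    show "AE r in ivl a b. indicator {a<..<c} r *\<^sub>R g r + indicator {c<..<b} r *\<^sub>R g r = g r"
      using AE_ivl_neq[of c a b] AE_space[of "ivl a b"] by eventually_elim (auto simp: indicator_def)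
  qed (use assms i in \<open>auto intro!: borel_measurable_add borel_measurable_integrable\<close>)
  finally show ?thesis by simp
qed

text \<open>Connects \<open>running_integral\<close>, taken over a closed interval, with the open
  intervals used everywhere else.\<close>

lemma integral_closed_ivl:
  fixes g :: "real \<Rightarrow> 'b::{banach, second_countable_topology}"
  assumes "g \<in> borel_measurable (ivl s t)"
  shows "integral\<^sup>L (lebesgue_on {s..t}) g = integral\<^sup>L (ivl s t) g"
proof -
  have 1: "(\<lambda>r. indicator {s<..<t} r *\<^sub>R g r) \<in> borel_measurable lebesgue"
    using assms by (subst (asm) borel_measurable_restrict_space_iff) auto
  have ae: "AE r in lebesgue. indicator {s<..<t} r *\<^sub>R g r = indicator {s..t} r *\<^sub>R g r"
  proof (rule AE_I'[of "{s, t}"])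
    show "{s, t} \<in> null_sets lebesgue" by (simp add: negligible_iff_null_sets[symmetric])
  qed (auto simp: indicator_def)
  \<comment> \<open>Measurability is known on the open interval only, so the values at the two end
    points are inserted by hand; the conditions s \<le> t cover an empty closed interval.\<close>
  have "(\<lambda>r. if r = s \<and> s \<le> t then g s else if r = t \<and> s \<le> t then g t else indicator {s<..<t} r *\<^sub>R g r)
      \<in> borel_measurable lebesgue"
    using 1 by (intro measurable_If) auto
  moreover have "(if r = s \<and> s \<le> t then g s else if r = t \<and> s \<le> t then g t else indicator {s<..<t} r *\<^sub>R g r)
      = indicator {s..t} r *\<^sub>R g r" for r
    by (auto simp: indicator_def)
  ultimately have 2: "(\<lambda>r. indicator {s..t} r *\<^sub>R g r) \<in> borel_measurable lebesgue" by simp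
  show ?thesis
    using integral_cong_AE[OF 1 2 ae] by (simp add: integral_restrict_space)
qed

lemma ivl_integral_nonneg_mono:
  fixes g :: "real \<Rightarrow> real"
  assumes "integrable (ivl a b) g" "AE r in ivl a b. 0 \<le> g r" "a \<le> s" "t \<le> b"
  shows "integral\<^sup>L (ivl s t) g \<le> integral\<^sup>L (ivl a b) g"
proof -
  note i = integrable_indicator_ivl[OF assms(1)]
  show ?thesis
    unfolding ivl_integral_indicator[OF assms(3,4)]
    by (rule integral_mono_AE[OF i assms(1)]) (use assms(2) in \<open>eventually_elim, auto simp: indicator_def\<close>)
qed

text \<open>The indicators of the subintervals converge at every point other than the two limiting
  end points, which form a null set.\<close>

lemma ivl_integral_shrink:
  fixes g :: "real \<Rightarrow> real"
  assumes g: "integrable (ivl a b) g" and st: "a \<le> s" "t \<le> b"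
    and lim: "sn \<longlonglongrightarrow> s" "tn \<longlonglongrightarrow> t" and bd: "\<And>n. a \<le> sn n" "\<And>n. tn n \<le> b"
  shows "(\<lambda>n. integral\<^sup>L (ivl (sn n) (tn n)) g) \<longlonglongrightarrow> integral\<^sup>L (ivl s t) g"
proof -
  have "(\<lambda>n. \<integral>r. indicator {sn n<..<tn n} r *\<^sub>R g r \<partial>ivl a b)
      \<longlonglongrightarrow> (\<integral>r. indicator {s<..<t} r *\<^sub>R g r \<partial>ivl a b)"
  proof (rule integral_dominated_convergence[where w = "\<lambda>r. \<bar>g r\<bar>"])
    show "AE r in ivl a b. (\<lambda>n. indicator {sn n<..<tn n} r *\<^sub>R g r) \<longlonglongrightarrow> indicator {s<..<t} r *\<^sub>R g r"
      using AE_ivl_neq[of s a b] AE_ivl_neq[of t a b]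
    proof eventually_elim
      case (elim r)
      have 1: "\<forall>\<^sub>F n in sequentially. (sn n < r) = (s < r)"
      proof (cases "s < r")
        case True with order_tendstoD(2)[OF lim(1) True] show ?thesis by (auto elim: eventually_mono)
      next
        case False
        then have "r < s" using elim by simp
        from order_tendstoD(1)[OF lim(1) this] show ?thesis using False by (auto elim!: eventually_mono)
      qed
      have 2: "\<forall>\<^sub>F n in sequentially. (r < tn n) = (r < t)"
      proof (cases "r < t")
        case True with order_tendstoD(1)[OF lim(2) True] show ?thesis by (auto elim: eventually_mono)
      next
        case False
        then have "t < r" using elim by simp
        from order_tendstoD(2)[OF lim(2) this] show ?thesis using False by (auto elim!: eventually_mono)
      qed
      from 1 2 have "\<forall>\<^sub>F n in sequentially. indicator {s<..<t} r *\<^sub>R g r = indicator {sn n<..<tn n} r *\<^sub>R g r"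
        by eventually_elim (auto simp: indicator_def)
      then show ?case by (rule Lim_transform_eventually[OF tendsto_const])
    qed
  qed (use g in \<open>auto intro!: borel_measurable_times borel_measurable_scaleR mult_left_le_one_le simp: abs_mult\<close>)
  then show ?thesis using ivl_integral_indicator[of a _ _ b g] st bd by simp
qed

lemma ivl_integral_cont:
  fixes f :: "real \<Rightarrow> real"
  assumes "continuous_on {a..b} f"
  shows "integral\<^sup>L (ivl a b) f = integral {a..b} f"
  using lebesgue_integral_eq_integral[OF continuous_integrable_ivl[OF assms]] integral_open_interval_real[of a b f]
  by simp

section \<open>Generalized derivatives and integral identities\<close>

text \<open>Testing with the difference of two smooth steps placed at \<open>s\<close> and at
  \<open>t\<close>. As the steps steepen, the test function tends to the indicator of (s,t), while
  its derivative mollifies \<open>g\<close> at \<open>s\<close> and, with the opposite sign, at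
  \<open>t\<close>.\<close>

lemma deriv_antideriv_on_ivl:
  fixes g \<omega> :: "real \<Rightarrow> real"
  assumes g: "continuous_on {a..b} g" and \<omega>: "integrable (ivl a b) \<omega>"
    and test: "\<And>\<phi>. test_function a b \<phi> \<Longrightarrow> (\<integral>t. deriv \<phi> t * g t \<partial>ivl a b) = - (\<integral>t. \<phi> t * \<omega> t \<partial>ivl a b)"
    and st: "a < s" "s < t" "t < b"
  shows "g t - g s = integral\<^sup>L (ivl s t) \<omega>"
proof -
  obtain S S' :: "real \<Rightarrow> real" where nS: "\<And>n. ndiff n S" and DS: "\<And>r. (S has_real_derivative S' r) (at r)"
    and S0: "\<And>r. r \<le> 0 \<Longrightarrow> S r = 0" and S1: "\<And>r. r \<ge> 1 \<Longrightarrow> S r = 1"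
    and Sb: "\<And>r. 0 \<le> S r" "\<And>r. S r \<le> 1"
    and S': "\<And>r. S' r \<ge> 0" "\<And>r. r \<le> 0 \<or> r \<ge> 1 \<Longrightarrow> S' r = 0" "continuous_on UNIV S'"
    using smooth_step by metis
  \<comment> \<open>The step rises on [c, c + 1/n], to the right of \<open>c\<close>. The difference
    of the steps at \<open>s\<close> and \<open>t\<close> then lives on [s, t + 1/n], a compact part
    of (a,b) once 1/n < b - t.\<close>
  define \<sigma> where "\<sigma> = (\<lambda>(n::nat) c r. S (real n * r + (- real n * c)))"
  define \<psi> where "\<psi> = (\<lambda>(n::nat) c r. real n * S' (real n * r + (- real n * c)))"
  have D\<sigma>: "(\<sigma> n c has_real_derivative \<psi> n c r) (at r)" for n c r
  proof -
    have "((\<lambda>r. S (real n * r + (- real n * c))) has_real_derivative S' (real n * r + (- real n * c)) * real n) (at r)"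
      by (rule DERIV_chain2[OF DS]) (auto intro!: derivative_eq_intros)
    then show ?thesis by (simp add: \<sigma>_def \<psi>_def mult.commute)
  qed
  have c\<sigma>: "continuous_on A (\<sigma> n c)" for A n c
    using D\<sigma> by (meson DERIV_continuous_on has_field_derivative_at_within)
  have c\<psi>: "continuous_on A (\<psi> n c)" for A n c
    unfolding \<psi>_def
    by (intro continuous_intros continuous_on_compose2[OF S'(3)]) auto
  have mollify: "(\<lambda>n. \<integral>r. \<psi> n c r * g r \<partial>ivl a b) \<longlonglongrightarrow> g c" if c: "a < c" "c < b" for c
  proof (rule LIMSEQ_I)
    fix e :: real assume e: "e > 0"
    have "continuous (at c within {a..b}) g" using g c by (auto simp: continuous_on_eq_continuous_within)
    then obtain d where d: "d > 0" "\<And>r. r \<in> {a..b} \<Longrightarrow> dist r c < d \<Longrightarrow> dist (g r) (g c) < e/2"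
      unfolding continuous_within_eps_delta using e by (metis half_gt_zero)
    obtain N :: nat where N: "N > 0" "1 / real N < min d (b - c)"
      using real_arch_inverse[of "min d (b - c)"] d c by (auto simp: inverse_eq_divide)
    show "\<exists>N. \<forall>n\<ge>N. norm ((\<integral>r. \<psi> n c r * g r \<partial>ivl a b) - g c) < e"
    proof (intro exI allI impI)
      fix n assume n: "n \<ge> N"
      have n0: "n > 0" using n N by linarith
      have nN: "1 / real n \<le> 1 / real N" using n N by (intro divide_left_mono) auto
      then have n1: "1 / real n < d" "1 / real n < b - c" using N by auto
      have z: "\<psi> n c r = 0" if "r \<le> c \<or> r \<ge> c + 1 / real n" for r
      proof -
        have "real n * r + - real n * c \<le> 0 \<or> real n * r + - real n * c \<ge> 1"
          using that
        proof
          assume "r \<le> c"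
          then have "real n * r \<le> real n * c" by (intro mult_left_mono) auto
          then show ?thesis by simp
        next
          assume "c + 1 / real n \<le> r"
          then have "real n * (c + 1 / real n) \<le> real n * r" by (intro mult_left_mono) auto
          then show ?thesis using n0 by (simp add: algebra_simps)
        qed
        then show ?thesis using S'(2) by (simp add: \<psi>_def)
      qed
      have "(\<psi> n c has_integral \<sigma> n c b - \<sigma> n c a) {a..b}"
        using c D\<sigma> by (intro fundamental_theorem_of_calculus)
          (auto simp: has_real_derivative_iff_has_vector_derivative[symmetric] intro: has_field_derivative_at_within)
      moreover have "\<sigma> n c b = 1"
      proof -
        have "real n * (b - c) \<ge> real n * (1 / real n)" using n1 n0 by (intro mult_left_mono) auto
        then show ?thesis using n0 by (auto simp: \<sigma>_def right_diff_distrib intro!: S1)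
      qed
      moreover have "\<sigma> n c a = 0"
      proof -
        have "real n * a \<le> real n * c" using c by (intro mult_left_mono) auto
        then show ?thesis by (auto simp: \<sigma>_def intro!: S0)
      qed
      ultimately have one: "integral\<^sup>L (ivl a b) (\<psi> n c) = 1"
        using ivl_integral_cont[OF c\<psi>] by (simp add: integral_unique)
      have i1: "integrable (ivl a b) (\<psi> n c)" by (rule continuous_integrable_ivl[OF c\<psi>])
      have i2: "integrable (ivl a b) (\<lambda>r. \<psi> n c r * g r)"
        by (intro continuous_integrable_ivl continuous_intros c\<psi> g)
      have "(\<integral>r. \<psi> n c r * g r \<partial>ivl a b) - g c = (\<integral>r. \<psi> n c r * g r - \<psi> n c r * g c \<partial>ivl a b)"
        using i1 i2 one by simp
      also have "norm \<dots> \<le> (\<integral>r. \<psi> n c r * (e/2) \<partial>ivl a b)"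
      proof (rule norm_integral_le[OF _ _ AE_I2])
        fix r assume r: "r \<in> space (ivl a b)"
        show "norm (\<psi> n c r * g r - \<psi> n c r * g c) \<le> \<psi> n c r * (e/2)"
        proof (cases "r \<le> c \<or> r \<ge> c + 1 / real n")
          case False
          then have "dist (g r) (g c) < e/2" using r n1 by (intro d) (auto simp: dist_real_def)
          then have "\<psi> n c r * \<bar>g r - g c\<bar> \<le> \<psi> n c r * (e/2)"
            using S'(1) by (intro mult_left_mono) (auto simp: \<psi>_def dist_real_def)
          moreover have "\<bar>\<psi> n c r * g r - \<psi> n c r * g c\<bar> = \<psi> n c r * \<bar>g r - g c\<bar>"
            using S'(1) by (simp add: right_diff_distrib[symmetric] abs_mult \<psi>_def)
          ultimately show ?thesis by simp
        qed (simp add: z)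
      qed (use i1 i2 in auto)
      also have "\<dots> = e/2" using one by simp
      finally show "norm ((\<integral>r. \<psi> n c r * g r \<partial>ivl a b) - g c) < e" using e by linarith
    qed
  qed
  define \<phi> where "\<phi> = (\<lambda>n r. \<sigma> n s r + (-1) * \<sigma> n t r)"
  have D\<phi>: "(\<phi> n has_real_derivative \<psi> n s r - \<psi> n t r) (at r)" for n r
    unfolding \<phi>_def by (auto intro!: derivative_eq_intros D\<sigma>)
  have \<phi>01: "\<sigma> n c r = 0" if "n > 0" "r \<le> c" for n c r
  proof -
    have "real n * r \<le> real n * c" using that by (intro mult_left_mono) auto
    then show ?thesis by (auto simp: \<sigma>_def intro!: S0)
  qed
  have \<phi>02: "\<sigma> n c r = 1" if "n > 0" "r \<ge> c + 1 / real n" for n c r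
  proof -
    have "real n * (c + 1 / real n) \<le> real n * r" using that by (intro mult_left_mono) auto
    then show ?thesis using that by (auto simp: \<sigma>_def distrib_left intro!: S1)
  qed
  have conv: "\<forall>\<^sub>F n in sequentially. n > 0 \<and> 1 / real n < d" if "d > 0" for d
  proof -
    have "\<forall>\<^sub>F n in sequentially. 1 / real n < d" using order_tendstoD(2)[OF lim_1_over_n that] .
    then show ?thesis using eventually_gt_at_top[of 0] by eventually_elim auto
  qed
  have tf: "\<forall>\<^sub>F n in sequentially. test_function a b (\<phi> n)"
    using conv[of "b - t"] st(3)
  proof (simp, elim eventually_mono conjE)
    fix n :: nat assume n: "n > 0" "1 / real n < b - t"
    have "ndiff m (\<phi> n)" for m
      unfolding \<phi>_def \<sigma>_def by (intro ndiff_add ndiff_mult ndiff_const ndiff_affine nS)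
    then have "\<forall>k r. (deriv ^^ k) (\<phi> n) differentiable (at r)" by (meson ndiff_iff lessI)
    moreover have "\<phi> n r = 0" if "r \<notin> {s..t + 1 / real n}" for r
    proof -
      have "r < s \<or> r > t + 1 / real n" using that by auto
      then show ?thesis
      proof
        assume "r < s"
        then show ?thesis using \<phi>01[of n r s] \<phi>01[of n r t] st n by (simp add: \<phi>_def)
      next
        assume "r > t + 1 / real n"
        then show ?thesis using \<phi>02[of n s r] \<phi>02[of n t r] st n by (simp add: \<phi>_def)
      qed
    qed
    ultimately show "test_function a b (\<phi> n)"
      unfolding test_function_def using st n by (intro conjI exI[of _ s] exI[of _ "t + 1 / real n"]) auto
  qed
  have "(\<lambda>n. (\<integral>r. \<psi> n s r * g r \<partial>ivl a b) - (\<integral>r. \<psi> n t r * g r \<partial>ivl a b)) \<longlonglongrightarrow> g s - g t"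
    using st by (intro tendsto_diff mollify) auto
  moreover have "\<forall>\<^sub>F n in sequentially. (\<integral>r. \<psi> n s r * g r \<partial>ivl a b) - (\<integral>r. \<psi> n t r * g r \<partial>ivl a b)
      = - (\<integral>r. \<phi> n r * \<omega> r \<partial>ivl a b)"
    using tf
  proof eventually_elim
    case (elim n)
    have i2: "integrable (ivl a b) (\<lambda>r. \<psi> n c r * g r)" for c
      by (intro continuous_integrable_ivl continuous_intros c\<psi> g)
    have "deriv (\<phi> n) = (\<lambda>r. \<psi> n s r - \<psi> n t r)" by (rule deriv_eqI[OF D\<phi>])
    then show ?case using test[OF elim] i2 by (simp add: left_diff_distrib)
  qed
  ultimately have "(\<lambda>n. - (\<integral>r. \<phi> n r * \<omega> r \<partial>ivl a b)) \<longlonglongrightarrow> g s - g t"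
    by (rule Lim_transform_eventually)
  moreover have "(\<lambda>n. - (\<integral>r. \<phi> n r * \<omega> r \<partial>ivl a b)) \<longlonglongrightarrow> - (\<integral>r. indicator {s<..<t} r *\<^sub>R \<omega> r \<partial>ivl a b)"
  proof (intro tendsto_minus integral_dominated_convergence[where w = "\<lambda>r. \<bar>\<omega> r\<bar>"])
    show "AE r in ivl a b. (\<lambda>n. \<phi> n r * \<omega> r) \<longlonglongrightarrow> indicator {s<..<t} r *\<^sub>R \<omega> r"
      using AE_ivl_neq[of t a b]
    proof eventually_elim
      case (elim r)
      consider "r \<le> s" | "s < r" "r < t" | "t < r" using elim by linarith
      then have "\<forall>\<^sub>F n in sequentially. indicator {s<..<t} r = \<phi> n r"
      proof cases
        case 1
        show ?thesis by (rule eventually_mono[OF conv[OF zero_less_one]]) (use st 1 in \<open>auto simp: \<phi>_def \<phi>01 indicator_def\<close>)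
      next
        case 2
        then show ?thesis using conv[of "r - s"]
          by (simp, elim eventually_mono) (auto simp: \<phi>_def \<phi>01 \<phi>02 indicator_def)
      next
        case 3
        then show ?thesis using conv[of "r - t"]
          by (simp, elim eventually_mono) (use st in \<open>auto simp: \<phi>_def \<phi>01 \<phi>02 indicator_def\<close>)
      qed
      then have "\<forall>\<^sub>F n in sequentially. indicator {s<..<t} r *\<^sub>R \<omega> r = \<phi> n r * \<omega> r" by eventually_elim simp
      then show ?case by (rule Lim_transform_eventually[OF tendsto_const])
    qed
    show "AE r in ivl a b. norm (\<phi> n r * \<omega> r) \<le> \<bar>\<omega> r\<bar>" for n
    proof (rule AE_I2)
      fix r
      have "\<bar>\<phi> n r\<bar> \<le> 1" using Sb[of "real n * r + (- real n * s)"] Sb[of "real n * r + (- real n * t)"]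
        unfolding \<phi>_def \<sigma>_def abs_le_iff by linarith
      then show "norm (\<phi> n r * \<omega> r) \<le> \<bar>\<omega> r\<bar>" by (simp add: abs_mult mult_left_le_one_le)
    qed
    have "continuous_on {a..b} (\<phi> n)" for n unfolding \<phi>_def by (intro continuous_intros c\<sigma>)
    then show "(\<lambda>r. \<phi> n r * \<omega> r) \<in> borel_measurable (ivl a b)" for n
      using \<omega> by (intro borel_measurable_times continuous_measurable_ivl[of a b "\<phi> n"]) auto
  qed (use \<omega> in \<open>auto intro!: borel_measurable_times borel_measurable_scaleR\<close>)
  ultimately have "g s - g t = - (\<integral>r. indicator {s<..<t} r *\<^sub>R \<omega> r \<partial>ivl a b)"
    by (rule LIMSEQ_unique)
  then show ?thesis using ivl_integral_indicator[of a s t b \<omega>] st by simp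
qed

text \<open>From left to right, interior times come from the preceding lemma and the end points from
  continuity. From right to left, inserting the integral formula for \<open>g\<close> and exchanging
  the order of integration is integration by parts.\<close>

lemma test_function_integral_identity:
  fixes g \<omega> :: "real \<Rightarrow> real"
  assumes ab: "a < b" and g: "continuous_on {a..b} g" and \<omega>: "integrable (ivl a b) \<omega>"
  shows "(\<forall>\<phi>. test_function a b \<phi> \<longrightarrow> (\<integral>t. deriv \<phi> t * g t \<partial>ivl a b) = - (\<integral>t. \<phi> t * \<omega> t \<partial>ivl a b))
    \<longleftrightarrow> (\<forall>s t. a \<le> s \<longrightarrow> s \<le> t \<longrightarrow> t \<le> b \<longrightarrow> g t - g s = integral\<^sup>L (ivl s t) \<omega>)"
    (is "?L \<longleftrightarrow> ?R")
proof
  assume L: ?L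
  show ?R
  proof (intro allI impI)
    fix s t assume st: "a \<le> s" "s \<le> t" "t \<le> b"
    show "g t - g s = integral\<^sup>L (ivl s t) \<omega>"
    proof (cases "s = t")
      case False
      \<comment> \<open>Interior approximations of both end points. The offset 3 makes 1/(n + 3) <
        1/2, which keeps \<open>sn n < tn n\<close>.\<close>
      define sn where "sn = (\<lambda>n. s + (t - s) * (1 / real (n + 3)))"
      define tn where "tn = (\<lambda>n. t - (t - s) * (1 / real (n + 3)))"
      have z: "(\<lambda>n. 1 / real (n + 3)) \<longlonglongrightarrow> 0" by (rule LIMSEQ_ignore_initial_segment[OF lim_1_over_n])
      have lim: "sn \<longlonglongrightarrow> s" "tn \<longlonglongrightarrow> t"
        using tendsto_add[OF tendsto_const tendsto_mult[OF tendsto_const z], of s "t - s"]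
          tendsto_diff[OF tendsto_const tendsto_mult[OF tendsto_const z], of t "t - s"]
        by (simp_all add: sn_def tn_def)
      have d: "0 < (t - s) * (1 / real (n + 3))" "(t - s) * (1 / real (n + 3)) < (t - s) * (1 / 2)" for n
      proof -
        have "0 < 1 / real (n + 3)" "1 / real (n + 3) < 1 / 2" by (auto simp: field_simps)
        then show "0 < (t - s) * (1 / real (n + 3))" "(t - s) * (1 / real (n + 3)) < (t - s) * (1 / 2)"
          using st False by (intro mult_pos_pos mult_strict_left_mono; simp)+
      qed
      have bd: "a < sn n" "sn n < tn n" "tn n < b" for n
      proof -
        obtain \<delta> where \<delta>: "\<delta> = (t - s) * (1 / real (n + 3))" by blast
        have "0 < \<delta>" "\<delta> < (t - s) / 2" "sn n = s + \<delta>" "tn n = t - \<delta>"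
          using d[of n] by (simp_all only: \<delta> sn_def tn_def)
        then show "a < sn n" "sn n < tn n" "tn n < b" using st by (simp_all add: field_simps)
      qed
      have "g (tn n) - g (sn n) = integral\<^sup>L (ivl (sn n) (tn n)) \<omega>" for n
        using deriv_antideriv_on_ivl[OF g \<omega> _ bd(1,2,3)] L by blast
      moreover have "(\<lambda>n. g (tn n) - g (sn n)) \<longlonglongrightarrow> g t - g s"
        using bd st by (intro tendsto_diff continuous_on_tendsto_compose[OF g] lim)
          (auto intro!: always_eventually less_imp_le intro: less_trans)
      ultimately have "(\<lambda>n. integral\<^sup>L (ivl (sn n) (tn n)) \<omega>) \<longlonglongrightarrow> g t - g s" by simp
      moreover have "(\<lambda>n. integral\<^sup>L (ivl (sn n) (tn n)) \<omega>) \<longlonglongrightarrow> integral\<^sup>L (ivl s t) \<omega>"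
        by (rule ivl_integral_shrink[OF \<omega>]) (use st lim bd in \<open>auto intro: less_imp_le\<close>)
      ultimately show ?thesis by (rule LIMSEQ_unique)
    qed (simp add: integral_restrict_space)
  qed
next
  assume R: ?R
  show ?L
  proof (intro allI impI)
    fix \<phi> assume tf: "test_function a b \<phi>"
    have nd: "ndiff n \<phi>" for n using tf by (auto simp: test_function_def ndiff_iff)
    have D: "(\<phi> has_real_derivative deriv \<phi> r) (at r)" for r using ndiff_SucE[OF nd] .
    have "ndiff (Suc 0) (deriv \<phi>)" using nd[of "Suc (Suc 0)"] by simp
    then have c': "continuous_on A (deriv \<phi>)" for A
      using ndiff_SucE by (meson DERIV_continuous_on has_field_derivative_at_within)
    have c: "continuous_on A \<phi>" for A
      using D by (meson DERIV_continuous_on has_field_derivative_at_within)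
    have z: "\<phi> a = 0" "\<phi> b = 0" using tf by (auto simp: test_function_def)
    have ftc: "integral\<^sup>L (ivl s b) (deriv \<phi>) = - \<phi> s" if "s \<le> b" for s
    proof -
      have "(deriv \<phi> has_integral \<phi> b - \<phi> s) {s..b}"
        using that D by (intro fundamental_theorem_of_calculus)
          (auto simp: has_real_derivative_iff_has_vector_derivative[symmetric] intro: has_field_derivative_at_within)
      then show ?thesis using ivl_integral_cont[OF c'] z by (simp add: integral_unique)
    qed
    obtain B where B: "\<And>r. r \<in> {a..b} \<Longrightarrow> norm (deriv \<phi> r) \<le> B"
      using compact_imp_bounded[OF compact_continuous_image[OF c' compact_Icc, of a b]]
      unfolding bounded_iff by blast
    interpret P: pair_sigma_finite "ivl a b" "ivl a b" by (rule pair_sigma_finite_ivl)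
    \<comment> \<open>Integrand on the triangle r < t. Integrating first in t leaves -\<phi>(r)
      \<omega>(r), since \<phi> vanishes at b; the constant g(a) drops out since \<phi> vanishes at
      both ends.\<close>
    define f where "f = (\<lambda>t r. indicator {a<..<t} r * (deriv \<phi> t * \<omega> r))"
    have [measurable]: "\<omega> \<in> borel_measurable (ivl a b)" "deriv \<phi> \<in> borel_measurable (ivl a b)"
      using \<omega> continuous_measurable_ivl[OF c'] by auto
    have [measurable]: "(\<lambda>t. t) \<in> borel_measurable (ivl a b)" by (rule borel_measurable_ivl) simp
    have fm: "case_prod f \<in> borel_measurable (ivl a b \<Otimes>\<^sub>M ivl a b)"
    proof -
      have "(\<lambda>(t, r). (if a < r \<and> r < t then 1 else 0) * (deriv \<phi> t * \<omega> r)) \<in> borel_measurable (ivl a b \<Otimes>\<^sub>M ivl a b)"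
        by measurable
      then show ?thesis by (simp add: f_def indicator_def cong: if_cong)
    qed
    have fb: "norm (f t r) \<le> B * \<bar>\<omega> r\<bar>" if "t \<in> {a<..<b}" for t r
    proof -
      have "\<bar>deriv \<phi> t\<bar> \<le> B" "B \<ge> 0" using B[of t] B[of a] ab that norm_ge_zero order_trans by fastforce+
      then show ?thesis using that by (auto simp: f_def indicator_def abs_mult intro!: mult_right_mono)
    qed
    have fi: "integrable (ivl a b \<Otimes>\<^sub>M ivl a b) (case_prod f)"
    proof (rule P.Fubini_integrable[OF fm])
      have meas: "(\<lambda>r. f t r) \<in> borel_measurable (ivl a b)" if "t \<in> space (ivl a b)" for t
        using measurable_compose_Pair1[OF that fm] by simp
      have ti: "integrable (ivl a b) (\<lambda>r. f t r)" if "t \<in> space (ivl a b)" for t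
        by (rule Bochner_Integration.integrable_bound[of _ "\<lambda>r. B * \<bar>\<omega> r\<bar>"])
           (use that meas fb[of t] \<omega> in \<open>auto intro: order_trans[OF _ abs_ge_self]\<close>)
      then show "AE t in ivl a b. integrable (ivl a b) (\<lambda>r. case_prod f (t, r))" by auto
      show "integrable (ivl a b) (\<lambda>t. \<integral>r. norm (case_prod f (t, r)) \<partial>ivl a b)"
      proof (rule integrable_ivl_bounded[of _ _ _ "\<integral>r. B * \<bar>\<omega> r\<bar> \<partial>ivl a b"])
        show "(\<lambda>t. \<integral>r. norm (case_prod f (t, r)) \<partial>ivl a b) \<in> borel_measurable (ivl a b)"
          using fm by measurable
        show "AE t in ivl a b. norm (\<integral>r. norm (case_prod f (t, r)) \<partial>ivl a b) \<le> (\<integral>r. B * \<bar>\<omega> r\<bar> \<partial>ivl a b)"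
        proof (rule AE_I2)
          fix t assume t: "t \<in> space (ivl a b)"
          show "norm (\<integral>r. norm (case_prod f (t, r)) \<partial>ivl a b) \<le> (\<integral>r. B * \<bar>\<omega> r\<bar> \<partial>ivl a b)"
            by (rule norm_integral_le[OF _ _ AE_I2]) (use ti t fb[of t] \<omega> in auto)
        qed
      qed
    qed
    have "(\<integral>t. deriv \<phi> t * g t \<partial>ivl a b) = (\<integral>t. deriv \<phi> t * g a + (\<integral>r. f t r \<partial>ivl a b) \<partial>ivl a b)"
    proof (rule Bochner_Integration.integral_cong[OF refl])
      fix t assume "t \<in> space (ivl a b)"
      then have t: "a < t" "t < b" by auto
      have "g t = g a + integral\<^sup>L (ivl a t) \<omega>"
        using R[rule_format, of a t] t by simp
      also have "integral\<^sup>L (ivl a t) \<omega> = (\<integral>r. indicator {a<..<t} r *\<^sub>R \<omega> r \<partial>ivl a b)"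
        using t by (intro ivl_integral_indicator) auto
      finally have "deriv \<phi> t * g t = deriv \<phi> t * g a + deriv \<phi> t * (\<integral>r. indicator {a<..<t} r *\<^sub>R \<omega> r \<partial>ivl a b)"
        by (simp add: distrib_left)
      then show "deriv \<phi> t * g t = deriv \<phi> t * g a + (\<integral>r. f t r \<partial>ivl a b)"
        by (simp add: f_def mult.left_commute)
    qed
    also have "\<dots> = (\<integral>t. deriv \<phi> t * g a \<partial>ivl a b) + (\<integral>t. (\<integral>r. f t r \<partial>ivl a b) \<partial>ivl a b)"
      using continuous_integrable_ivl[OF c', of a b] P.integrable_fst'[OF fi]
      by (intro Bochner_Integration.integral_add) auto
    also have "(\<integral>t. deriv \<phi> t * g a \<partial>ivl a b) = 0" using ftc[of a] ab z by simp
    also have "(\<integral>t. (\<integral>r. f t r \<partial>ivl a b) \<partial>ivl a b) = (\<integral>r. (\<integral>t. f t r \<partial>ivl a b) \<partial>ivl a b)"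
      by (rule P.Fubini_integral[OF fi, symmetric])
    also have "\<dots> = (\<integral>r. - (\<phi> r * \<omega> r) \<partial>ivl a b)"
    proof (rule Bochner_Integration.integral_cong[OF refl])
      fix r assume "r \<in> space (ivl a b)"
      then have r: "a < r" "r < b" by auto
      have "(\<integral>t. f t r \<partial>ivl a b) = (\<integral>t. \<omega> r * (indicator {r<..<b} t *\<^sub>R deriv \<phi> t) \<partial>ivl a b)"
        using r by (intro Bochner_Integration.integral_cong) (auto simp: f_def indicator_def)
      also have "\<dots> = \<omega> r * integral\<^sup>L (ivl r b) (deriv \<phi>)"
        using ivl_integral_indicator[of a r b b "deriv \<phi>"] r by simp
      finally show "(\<integral>t. f t r \<partial>ivl a b) = - (\<phi> r * \<omega> r)" using ftc[of r] r by simp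
    qed
    finally show "(\<integral>t. deriv \<phi> t * g t \<partial>ivl a b) = - (\<integral>t. \<phi> t * \<omega> t \<partial>ivl a b)" by simp
  qed
qed

text \<open>The integrated form of the generalized derivative, stated for the continuous
  representative \<open>x\<close> so that increments up to the end points make sense.\<close>

definition weak_deriv ::
  "('v::real_normed_vector \<Rightarrow>\<^sub>L 'h::real_inner) \<Rightarrow> real \<Rightarrow> real \<Rightarrow> (real \<Rightarrow> 'h) \<Rightarrow> (real \<Rightarrow> 'v \<Rightarrow>\<^sub>L real) \<Rightarrow> bool" where
  "weak_deriv emb a b x w \<longleftrightarrow>
    (\<forall>s t v. a \<le> s \<longrightarrow> s \<le> t \<longrightarrow> t \<le> b \<longrightarrow>
      (x t - x s) \<bullet> blinfun_apply emb v = (\<integral>r. blinfun_apply (w r) v \<partial>ivl s t))"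

text \<open>Passing from \<open>y\<close> to its continuous representative changes the test
  integrals on a null set only; the two forms then agree for each \<open>v\<close> by the scalar
  identity. Afterwards only increments of \<open>x\<close> occur.\<close>

lemma generalized_derivative_iff:
  fixes emb :: "'v::real_normed_vector \<Rightarrow>\<^sub>L 'h::{real_inner, second_countable_topology}"
  assumes ab: "a < b" and x: "continuous_on {a..b} x" and xy: "AE t in ivl a b. x t = emb (y t)"
    and w: "\<And>v. integrable (ivl a b) (\<lambda>t. blinfun_apply (w t) v)"
    and y: "(\<lambda>t. emb (y t)) \<in> borel_measurable (ivl a b)"
  shows "generalized_derivative emb a b y w \<longleftrightarrow> weak_deriv emb a b x w"
proof -
  have c: "continuous_on {a..b} (\<lambda>t. x t \<bullet> emb v)" for v by (intro continuous_intros x)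
  have "(\<integral>t. deriv \<phi> t * to_dual emb (emb (y t)) v \<partial>ivl a b) = (\<integral>t. deriv \<phi> t * (x t \<bullet> emb v) \<partial>ivl a b)"
    if "test_function a b \<phi>" for \<phi> v
  proof (rule integral_cong_AE)
    have "ndiff (Suc 0) (deriv \<phi>)"
      using that by (simp add: test_function_def ndiff_iff funpow_Suc_right del: funpow.simps) (metis funpow_0 funpow_simps_right(2) o_apply)
    then have "continuous_on {a..b} (deriv \<phi>)"
      using ndiff_SucE by (meson DERIV_continuous_on has_field_derivative_at_within)
    then have [measurable]: "deriv \<phi> \<in> borel_measurable (ivl a b)" by (rule continuous_measurable_ivl)
    show "(\<lambda>t. deriv \<phi> t * to_dual emb (emb (y t)) v) \<in> borel_measurable (ivl a b)"
      using y by simp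
    show "(\<lambda>t. deriv \<phi> t * (x t \<bullet> emb v)) \<in> borel_measurable (ivl a b)"
      using continuous_measurable_ivl[OF x] by simp
    show "AE t in ivl a b. deriv \<phi> t * to_dual emb (emb (y t)) v = deriv \<phi> t * (x t \<bullet> emb v)"
      using xy by eventually_elim simp
  qed
  then have "generalized_derivative emb a b y w \<longleftrightarrow>
      (\<forall>v. \<forall>\<phi>. test_function a b \<phi> \<longrightarrow>
        (\<integral>t. deriv \<phi> t * (x t \<bullet> emb v) \<partial>ivl a b) = - (\<integral>t. \<phi> t * w t v \<partial>ivl a b))"
    unfolding generalized_derivative_def by auto
  also have "\<dots> \<longleftrightarrow> weak_deriv emb a b x w"
    unfolding weak_deriv_def test_function_integral_identity[OF ab c w] by (auto simp: inner_diff_left)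
  finally show ?thesis .
qed

section \<open>Conjugate exponents\<close>

lemma powr_add_le:
  fixes r s p :: real
  assumes "p \<ge> 0" "r \<ge> 0" "s \<ge> 0"
  shows "(r + s) powr p \<le> 2 powr p * (r powr p + s powr p)"
proof -
  have "(r + s) powr p \<le> (2 * max r s) powr p" using assms by (intro powr_mono2) auto
  also have "\<dots> = 2 powr p * max r s powr p" using assms by (simp add: powr_mult)
  also have "\<dots> \<le> 2 powr p * (r powr p + s powr p)" by (intro mult_left_mono) (auto simp: max_def)
  finally show ?thesis .
qed

text \<open>The weight \<kappa> goes to the power q, typically of a dual norm known only to be
  bounded, and the possibly large \<open>C\<close> to the power p, typically of something that can
  still be made small.\<close>

lemma Young_small:
  fixes p q \<kappa> :: real
  assumes pq: "p > 1" "q > 1" "1 / p + 1 / q = 1" and "\<kappa> > 0"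
  obtains C where "C \<ge> 0" "\<And>r s. r \<ge> 0 \<Longrightarrow> s \<ge> 0 \<Longrightarrow> r * s \<le> \<kappa> * r powr q + C * s powr p"
proof
  \<comment> \<open>Young's inequality is applied to s/\<mu> and \<mu> r; raising \<mu> to the power
    q returns \<kappa>, and the factors 1/p and 1/q are bounded by 1.\<close>
  define \<mu> where "\<mu> = \<kappa> powr (1 / q)"
  have \<mu>: "\<mu> > 0" "\<mu> powr q = \<kappa>" using assms by (auto simp: \<mu>_def powr_powr)
  show "(1 / \<mu>) powr p \<ge> 0" by simp
  fix r s :: real assume rs: "r \<ge> 0" "s \<ge> 0"
  have "r * s = (s / \<mu>) * (\<mu> * r)" using \<mu> by simp
  also have "\<dots> \<le> (s / \<mu>) powr p / p + (\<mu> * r) powr q / q"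
    using Youngs_inequality[OF pq, of "s / \<mu>" "\<mu> * r"] rs \<mu> by simp
  also have "\<dots> \<le> (s / \<mu>) powr p + (\<mu> * r) powr q"
    using pq by (intro add_mono) (auto simp: divide_le_eq mult_le_cancel_left1)
  also have "\<dots> = \<kappa> * r powr q + (1 / \<mu>) powr p * s powr p"
    using rs \<mu> by (simp add: powr_mult powr_divide)
  finally show "r * s \<le> \<kappa> * r powr q + (1 / \<mu>) powr p * s powr p" .
qed

lemma mult_le_powr_add:
  fixes p q r s :: real
  assumes pq: "p > 1" "q > 1" "1 / p + 1 / q = 1" and rs: "r \<ge> 0" "s \<ge> 0"
  shows "r * s \<le> r powr q + s powr p"
proof -
  have "r * s \<le> s powr p / p + r powr q / q"
    using Youngs_inequality[OF pq, of s r] rs by (simp add: mult.commute)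
  also have "\<dots> \<le> s powr p + r powr q"
    using pq by (intro add_mono) (auto simp: divide_le_eq mult_le_cancel_left1)
  finally show ?thesis by simp
qed

lemma le_one_add_powr:
  fixes r p :: real
  assumes "r \<ge> 0" "p \<ge> 1"
  shows "r \<le> 1 + r powr p"
proof (cases "r \<le> 1")
  case True then show ?thesis by (simp add: add_increasing2)
next
  case False
  then have "r powr 1 \<le> r powr p" using assms by (intro powr_mono) auto
  then show ?thesis using False by simp
qed

section \<open>Lebesgue--Bochner functions on an interval\<close>

lemma measurable_real_powr:
  fixes r :: "'a \<Rightarrow> real"
  shows "r \<in> borel_measurable M \<Longrightarrow> (\<lambda>t. r t powr q) \<in> borel_measurable M"
  by simp

lemma Lp_fun_measurable: "Lp_fun p S y \<Longrightarrow> y \<in> borel_measurable (lebesgue_on S)"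
  and Lp_fun_integrable: "Lp_fun p S y \<Longrightarrow> integrable (lebesgue_on S) (\<lambda>t. norm (y t) powr p)"
  by (auto simp: Lp_fun_def)

lemma Lp_fun_bound:
  fixes y :: "real \<Rightarrow> 'b::real_normed_vector"
  assumes "y \<in> borel_measurable (lebesgue_on S)" "integrable (lebesgue_on S) g"
    and "AE t in lebesgue_on S. norm (y t) powr p \<le> g t"
  shows "Lp_fun p S y"
  unfolding Lp_fun_def
proof
  have "(\<lambda>t. norm (y t)) \<in> borel_measurable (lebesgue_on S)"
    by (rule measurable_compose[OF assms(1)]) simp
  then show "integrable (lebesgue_on S) (\<lambda>t. norm (y t) powr p)"
    by (rule_tac Bochner_Integration.integrable_bound[OF assms(2)])
       (use assms(3) in \<open>auto elim!: eventually_mono\<close>)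
qed (rule assms)

lemma Lp_fun_mono:
  assumes "Lp_fun p {a<..<b} y" "a \<le> s" "t \<le> b"
  shows "Lp_fun p {s<..<t} y"
  using assms ivl_mono_measurable[of y a b s t] ivl_mono_integrable[of a b _ s t] unfolding Lp_fun_def by blast

lemma Lp_fun_diff:
  fixes y z :: "real \<Rightarrow> 'b::{real_normed_vector, second_countable_topology}"
  assumes "p \<ge> 0" "Lp_fun p S y" "Lp_fun p S z"
  shows "Lp_fun p S (\<lambda>t. y t - z t)"
proof (rule Lp_fun_bound)
  show "(\<lambda>t. y t - z t) \<in> borel_measurable (lebesgue_on S)" using assms(2,3) by (auto simp: Lp_fun_def)
  show "integrable (lebesgue_on S) (\<lambda>t. 2 powr p * (norm (y t) powr p + norm (z t) powr p))"
    using assms(2,3) by (auto simp: Lp_fun_def)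
  show "AE t in lebesgue_on S. norm (y t - z t) powr p \<le> 2 powr p * (norm (y t) powr p + norm (z t) powr p)"
  proof (rule AE_I2)
    fix t
    have "norm (y t - z t) powr p \<le> (norm (y t) + norm (z t)) powr p"
      using assms(1) by (intro powr_mono2) (auto simp: norm_triangle_ineq4)
    also have "\<dots> \<le> 2 powr p * (norm (y t) powr p + norm (z t) powr p)"
      using assms(1) by (intro powr_add_le) auto
    finally show "norm (y t - z t) powr p \<le> 2 powr p * (norm (y t) powr p + norm (z t) powr p)" .
  qed
qed

text \<open>Measurability is asked of the values at each vector only, a form that is easy to verify
  for pointwise limits and on product spaces. \<open>Lp_fun_dual_iff\<close> shows that nothing is
  lost for the spaces at hand.\<close>

definition weak_Lq :: "real \<Rightarrow> real set \<Rightarrow> (real \<Rightarrow> 'v::real_normed_vector \<Rightarrow>\<^sub>L real) \<Rightarrow> bool" where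
  "weak_Lq q S w \<longleftrightarrow> (\<forall>v. (\<lambda>t. blinfun_apply (w t) v) \<in> borel_measurable (lebesgue_on S)) \<and>
     integrable (lebesgue_on S) (\<lambda>t. norm (w t) powr q)"

lemma weak_Lq_measurable: "weak_Lq q S w \<Longrightarrow> (\<lambda>t. blinfun_apply (w t) v) \<in> borel_measurable (lebesgue_on S)"
  and weak_Lq_integrable: "weak_Lq q S w \<Longrightarrow> integrable (lebesgue_on S) (\<lambda>t. norm (w t) powr q)"
  by (auto simp: weak_Lq_def)

lemma Lp_fun_imp_weak_Lq: "Lp_fun q S w \<Longrightarrow> weak_Lq q S w"
  unfolding Lp_fun_def weak_Lq_def
proof (intro conjI allI; elim conjE)
  fix v assume "w \<in> borel_measurable (lebesgue_on S)"
  then show "(\<lambda>t. blinfun_apply (w t) v) \<in> borel_measurable (lebesgue_on S)"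
    by (rule borel_measurable_continuous_on[of "\<lambda>g. blinfun_apply g v", rotated]) (intro continuous_intros)
qed

lemma weak_Lq_mono:
  assumes "weak_Lq q {a<..<b} w" "a \<le> s" "t \<le> b"
  shows "weak_Lq q {s<..<t} w"
  using assms ivl_mono_measurable[of _ a b s t] ivl_mono_integrable[of a b _ s t]
  unfolding weak_Lq_def by blast

lemma weak_Lq_diff:
  fixes w z :: "real \<Rightarrow> 'v::{real_normed_vector, second_countable_topology} \<Rightarrow>\<^sub>L real"
  assumes "q \<ge> 0" "weak_Lq q S w" "weak_Lq q S z"
  shows "weak_Lq q S (\<lambda>t. w t - z t)"
  unfolding weak_Lq_def
proof (intro conjI allI)
  show m: "(\<lambda>t. blinfun_apply (w t - z t) v) \<in> borel_measurable (lebesgue_on S)" for v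
    unfolding blinfun.diff_left using assms by (intro borel_measurable_diff weak_Lq_measurable)
  have "(\<lambda>t. norm (w t - z t)) \<in> borel_measurable (lebesgue_on S)" by (rule measurable_norm_dual[OF m])
  moreover have "norm (w t - z t) powr q \<le> 2 powr q * (norm (w t) powr q + norm (z t) powr q)" for t
  proof -
    have "norm (w t - z t) powr q \<le> (norm (w t) + norm (z t)) powr q"
      using assms(1) by (intro powr_mono2) (auto simp: norm_triangle_ineq4)
    also have "\<dots> \<le> 2 powr q * (norm (w t) powr q + norm (z t) powr q)"
      using assms(1) by (intro powr_add_le) auto
    finally show ?thesis .
  qed
  moreover have "integrable (lebesgue_on S) (\<lambda>t. 2 powr q * (norm (w t) powr q + norm (z t) powr q))"
    using weak_Lq_integrable[OF assms(2)] weak_Lq_integrable[OF assms(3)] by simp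
  moreover have "norm (w t - z t) powr q \<ge> 0" for t by simp
  ultimately show "integrable (lebesgue_on S) (\<lambda>t. norm (w t - z t) powr q)"
    by (intro Bochner_Integration.integrable_bound[of _ "\<lambda>t. 2 powr q * (norm (w t) powr q + norm (z t) powr q)"
        "\<lambda>t. norm (w t - z t) powr q"] measurable_real_powr AE_I2) simp_all
qed

lemma integrable_norm_of_powr:
  fixes r :: "real \<Rightarrow> real"
  assumes "p \<ge> 1" "r \<in> borel_measurable (ivl a b)" "\<And>t. r t \<ge> 0" "integrable (ivl a b) (\<lambda>t. r t powr p)"
  shows "integrable (ivl a b) r"
  by (rule Bochner_Integration.integrable_bound[of _ "\<lambda>t. 1 + r t powr p"])
     (use assms le_one_add_powr[of _ p] in \<open>auto intro!: AE_I2\<close>)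

lemma borel_measurable_norm': "norm \<in> borel_measurable borel"
  by (intro borel_measurable_continuous_onI continuous_intros)

lemma Lp_fun_integrable_norm:
  assumes "p \<ge> 1" "Lp_fun p {a<..<b} y"
  shows "integrable (ivl a b) (\<lambda>t. norm (y t))"
  by (rule integrable_norm_of_powr[OF assms(1)
      measurable_compose[OF Lp_fun_measurable[OF assms(2)] borel_measurable_norm'] norm_ge_zero
      Lp_fun_integrable[OF assms(2)]])

lemma weak_Lq_integrable_norm:
  fixes w :: "real \<Rightarrow> 'v::{real_normed_vector, second_countable_topology} \<Rightarrow>\<^sub>L real"
  assumes "q \<ge> 1" "weak_Lq q {a<..<b} w"
  shows "integrable (ivl a b) (\<lambda>t. norm (w t))"
  by (rule integrable_norm_of_powr[OF assms(1) measurable_norm_dual[OF weak_Lq_measurable[OF assms(2)]]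
      norm_ge_zero weak_Lq_integrable[OF assms(2)]])

lemma weak_Lq_integrable_apply:
  fixes w :: "real \<Rightarrow> 'v::{real_normed_vector, second_countable_topology} \<Rightarrow>\<^sub>L real"
  assumes "q \<ge> 1" "weak_Lq q {a<..<b} w"
  shows "integrable (ivl a b) (\<lambda>t. w t v)"
proof (rule Bochner_Integration.integrable_bound[of _ "\<lambda>t. norm (w t) * norm v"])
  show "AE t in ivl a b. norm (w t v) \<le> norm (norm (w t) * norm v)"
  proof (rule AE_I2)
    fix t
    show "norm (w t v) \<le> norm (norm (w t) * norm v)"
      using norm_blinfun[of "w t" v] by simp
  qed
qed (use weak_Lq_integrable_norm[OF assms] weak_Lq_measurable[OF assms(2)] in auto)

lemma dual_pairing_abs_le: "\<bar>blinfun_apply w v\<bar> \<le> norm w * norm v"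
  using norm_blinfun[of w v] by simp

lemma integrable_dual_pairing:
  fixes w :: "real \<Rightarrow> 'v::{real_normed_vector, second_countable_topology} \<Rightarrow>\<^sub>L real"
  assumes pq: "p > 1" "q > 1" "1 / p + 1 / q = 1"
    and w: "weak_Lq q S w" and y: "Lp_fun p S y"
  shows "integrable (lebesgue_on S) (\<lambda>t. w t (y t))"
proof (rule Bochner_Integration.integrable_bound[of _ "\<lambda>t. norm (w t) powr q + norm (y t) powr p"])
  show "(\<lambda>t. w t (y t)) \<in> borel_measurable (lebesgue_on S)"
    by (rule measurable_dual_pairing[OF weak_Lq_measurable[OF w] Lp_fun_measurable[OF y]])
  show "AE t in lebesgue_on S. norm (w t (y t)) \<le> norm (norm (w t) powr q + norm (y t) powr p)"
  proof (rule AE_I2)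
    fix t
    have "norm (w t (y t)) \<le> norm (w t) * norm (y t)" by (rule norm_blinfun)
    also have "\<dots> \<le> norm (w t) powr q + norm (y t) powr p" by (rule mult_le_powr_add[OF pq]) auto
    finally show "norm (w t (y t)) \<le> norm (norm (w t) powr q + norm (y t) powr p)" by simp
  qed
qed (use weak_Lq_integrable[OF w] Lp_fun_integrable[OF y] in auto)

section \<open>Approximation of the duality pairing by symmetric averages\<close>

text \<open>Urysohn's lemma between a closed subset and an open superset of \<open>E\<close> that
  both differ from it by measure less than e/2; the error is supported in the difference of the
  two.\<close>

lemma indicator_continuous_approx:
  assumes E: "E \<in> sets lebesgue" and e: "e > 0"
  obtains \<phi> :: "real \<Rightarrow> real" where "continuous_on UNIV \<phi>" "\<And>t. 0 \<le> \<phi> t" "\<And>t. \<phi> t \<le> 1"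
    "(\<integral>t. \<bar>\<phi> t - indicator E t\<bar> \<partial>ivl a b) < e"
proof -
  obtain U where U: "open U" "E \<subseteq> U" "U - E \<in> lmeasurable" "emeasure lebesgue (U - E) < ennreal (e/2)"
    using sets_lebesgue_outer_open[OF E, of "e/2"] e by auto
  obtain K where K: "closed K" "K \<subseteq> E" "E - K \<in> lmeasurable" "emeasure lebesgue (E - K) < ennreal (e/2)"
    using sets_lebesgue_inner_closed[OF E, of "e/2"] e by auto
  obtain \<phi> :: "real \<Rightarrow> real" where \<phi>: "continuous_on UNIV \<phi>" "\<And>x. \<phi> x \<in> closed_segment 1 0"
      "\<And>x. x \<in> K \<Longrightarrow> \<phi> x = 1" "\<And>x. x \<in> - U \<Longrightarrow> \<phi> x = 0"
  proof (rule Urysohn[of K "- U" "1::real" 0])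
    show "closed K" "closed (- U)" "K \<inter> - U = {}" using K U by auto
  qed (rule that)
  have \<phi>01: "0 \<le> \<phi> t" "\<phi> t \<le> 1" for t using \<phi>(2)[of t] by (auto simp: closed_segment_eq_real_ivl split: if_splits)
  have UK: "U - K = (U - E) \<union> (E - K)" using U K by blast
  have lm: "U - K \<in> lmeasurable" unfolding UK using U K by (intro fmeasurable.Un)
  have "measure lebesgue (U - K) \<le> measure lebesgue (U - E) + measure lebesgue (E - K)"
    unfolding UK using U K by (intro measure_Un_le) auto
  also have "\<dots> < e/2 + e/2"
  proof -
    have "measure lebesgue A < e/2" if "A \<in> lmeasurable" "emeasure lebesgue A < ennreal (e/2)" for A :: "real set"
      using that(2) unfolding emeasure_eq_measure2[OF that(1)] by (simp add: ennreal_less_iff)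
    then show ?thesis using U(3,4) K(3,4) by (intro add_strict_mono)
  qed
  finally have me: "measure lebesgue (U - K) < e" by simp
  have im: "integrable lebesgue (indicator (U - K) :: real \<Rightarrow> real)"
    using lm lmeasurable_iff_integrable by blast
  have "(\<integral>t. \<bar>\<phi> t - indicator E t\<bar> \<partial>ivl a b) = (\<integral>t. indicator {a<..<b} t *\<^sub>R \<bar>\<phi> t - indicator E t\<bar> \<partial>lebesgue)"
    by (simp add: integral_restrict_space)
  also have "\<dots> \<le> (\<integral>t. indicator (U - K) t \<partial>lebesgue)"
  proof (rule integral_mono')
    show "indicator {a<..<b} t *\<^sub>R \<bar>\<phi> t - indicator E t\<bar> \<le> indicator (U - K) t" for t
      using \<phi>01[of t] \<phi>(3,4)[of t] U K by (auto simp: indicator_def)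
  qed (use im in auto)
  also have "\<dots> = measure lebesgue (U - K)" using lm by simp
  finally show ?thesis using that[OF \<phi>(1) \<phi>01] me by simp
qed

text \<open>Kernel of the symmetric average over (t - h, t + h). Its mass in either variable is 1,
  except within \<open>h\<close> of an end of the interval, where part of it is cut off.\<close>

definition window :: "real \<Rightarrow> real \<Rightarrow> real \<Rightarrow> real" where
  "window h t s = (if \<bar>t - s\<bar> < h then 1 / (2 * h) else 0)"

lemma window_measurable [measurable]:
  "case_prod (window h) \<in> borel_measurable (ivl a b \<Otimes>\<^sub>M ivl a b)"
proof -
  have [measurable]: "(\<lambda>t. t) \<in> borel_measurable (ivl a b)" by (rule borel_measurable_ivl) simp
  show ?thesis unfolding window_def by measurable
qed

lemma window_nonneg: "h > 0 \<Longrightarrow> window h t s \<ge> 0" by (simp add: window_def)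

lemma window_commute: "window h t s = window h s t" by (simp add: window_def abs_minus_commute)

lemma measure_ivl_le: "c \<le> d \<Longrightarrow> measure (ivl a b) ({c<..<d} \<inter> {a<..<b}) \<le> d - c"
proof -
  assume "c \<le> d"
  have "measure (ivl a b) ({c<..<d} \<inter> {a<..<b}) = measure lebesgue ({c<..<d} \<inter> {a<..<b})"
    by (rule measure_restrict_space) auto
  also have "\<dots> \<le> measure lebesgue {c<..<d}" by (rule measure_mono_fmeasurable) auto
  finally show ?thesis using \<open>c \<le> d\<close> by simp
qed

lemma window_eq: "h > 0 \<Longrightarrow> window h t = (\<lambda>s. indicator {t - h<..<t + h} s / (2 * h))"
  by (auto simp: window_def indicator_def fun_eq_iff)

lemma window_integral_eq:
  assumes "h > 0"
  shows "(\<integral>s. window h t s \<partial>ivl a b) = measure lebesgue ({t - h<..<t + h} \<inter> {a<..<b}) / (2 * h)"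
proof -
  have "(\<integral>s. window h t s \<partial>ivl a b) = (\<integral>s. indicator {a<..<b} s *\<^sub>R (indicator {t - h<..<t + h} s / (2 * h)) \<partial>lebesgue)"
    unfolding window_eq[OF assms] by (rule integral_restrict_space) simp
  also have "\<dots> = (\<integral>s. indicator ({t - h<..<t + h} \<inter> {a<..<b}) s / (2 * h) \<partial>lebesgue)"
    by (rule Bochner_Integration.integral_cong) (auto simp: indicator_def)
  also have "\<dots> = measure lebesgue ({t - h<..<t + h} \<inter> {a<..<b}) / (2 * h)" by simp
  finally show ?thesis .
qed

lemma window_integral_le: "h > 0 \<Longrightarrow> (\<integral>s. window h t s \<partial>ivl a b) \<le> 1"
proof -
  assume h: "h > 0"
  have "measure lebesgue ({t - h<..<t + h} \<inter> {a<..<b}) \<le> measure lebesgue {t - h<..<t + h}"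
    by (rule measure_mono_fmeasurable) auto
  then show ?thesis using h by (simp add: window_integral_eq)
qed

lemma window_integral_interior:
  assumes "h > 0" "a + h \<le> t" "t \<le> b - h"
  shows "(\<integral>s. window h t s \<partial>ivl a b) = 1"
proof -
  have "{t - h<..<t + h} \<inter> {a<..<b} = {t - h<..<t + h}" using assms by auto
  then show ?thesis using assms by (simp add: window_integral_eq)
qed

lemma window_integrable: "h > 0 \<Longrightarrow> integrable (ivl a b) (window h t)"
  by (rule integrable_ivl_bounded[of _ _ _ "1 / (2 * h)"])
     (auto simp: window_eq indicator_def intro!: borel_measurable_ivl)

text \<open>Averaging does not increase an integral, whichever of the two variables carries the
  weight. The second case is the first after exchanging the variables, as the kernel is
  symmetric.\<close>

lemma window_weighted_integral:
  fixes \<phi> :: "real \<Rightarrow> real"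
  assumes h: "h > 0" and \<phi>: "integrable (ivl a b) \<phi>" "\<And>t. \<phi> t \<ge> 0"
  shows "integrable (ivl a b \<Otimes>\<^sub>M ivl a b) (\<lambda>(t, s). window h t s * \<phi> t)"
    and "integrable (ivl a b \<Otimes>\<^sub>M ivl a b) (\<lambda>(t, s). window h t s * \<phi> s)"
    and "(\<integral>z. (case z of (t, s) \<Rightarrow> window h t s * \<phi> t) \<partial>(ivl a b \<Otimes>\<^sub>M ivl a b)) \<le> integral\<^sup>L (ivl a b) \<phi>"
    and "(\<integral>z. (case z of (t, s) \<Rightarrow> window h t s * \<phi> s) \<partial>(ivl a b \<Otimes>\<^sub>M ivl a b)) \<le> integral\<^sup>L (ivl a b) \<phi>"
proof -
  interpret P: pair_sigma_finite "ivl a b" "ivl a b" by (rule pair_sigma_finite_ivl)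
  have [measurable]: "\<phi> \<in> borel_measurable (ivl a b)" using \<phi> by auto
  have m: "(\<lambda>(t, s). window h t s * \<phi> t) \<in> borel_measurable (ivl a b \<Otimes>\<^sub>M ivl a b)" by measurable
  have le: "(\<integral>s. window h t s \<partial>ivl a b) * \<phi> t \<le> \<phi> t" for t
    using window_integral_le[OF h] \<phi>(2)[of t] by (intro mult_left_le_one_le) (auto simp: h intro!: integral_nonneg_AE window_nonneg)
  have ge: "(\<integral>s. window h t s \<partial>ivl a b) * \<phi> t \<ge> 0" for t
    using \<phi>(2)[of t] by (auto simp: h intro!: integral_nonneg_AE window_nonneg mult_nonneg_nonneg)
  have m2: "(\<lambda>t. \<integral>s. window h t s \<partial>ivl a b) \<in> borel_measurable (ivl a b)" by measurable
  have i1: "integrable (ivl a b) (\<lambda>t. (\<integral>s. window h t s \<partial>ivl a b) * \<phi> t)"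
    by (rule Bochner_Integration.integrable_bound[OF \<phi>(1)]) (use le ge \<phi>(2) m2 in auto)
  show A: "integrable (ivl a b \<Otimes>\<^sub>M ivl a b) (\<lambda>(t, s). window h t s * \<phi> t)"
  proof (rule P.Fubini_integrable[OF m])
    show "integrable (ivl a b) (\<lambda>t. \<integral>s. norm (case (t, s) of (t, s) \<Rightarrow> window h t s * \<phi> t) \<partial>ivl a b)"
      using i1 \<phi>(2) window_nonneg[OF h] by (simp add: abs_mult)
    show "AE t in ivl a b. integrable (ivl a b) (\<lambda>s. case (t, s) of (t, s) \<Rightarrow> window h t s * \<phi> t)"
      using window_integrable[OF h] by auto
  qed
  have "(\<integral>z. (case z of (t, s) \<Rightarrow> window h t s * \<phi> t) \<partial>(ivl a b \<Otimes>\<^sub>M ivl a b))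
      = (\<integral>t. (\<integral>s. window h t s * \<phi> t \<partial>ivl a b) \<partial>ivl a b)"
    using P.integral_fst'[OF A] by simp
  also have "\<dots> \<le> integral\<^sup>L (ivl a b) \<phi>"
    using le by (auto intro!: integral_mono i1 \<phi>)
  finally show B: "(\<integral>z. (case z of (t, s) \<Rightarrow> window h t s * \<phi> t) \<partial>(ivl a b \<Otimes>\<^sub>M ivl a b)) \<le> integral\<^sup>L (ivl a b) \<phi>" .
  have sw: "(\<lambda>(x, y). case (y, x) of (t, s) \<Rightarrow> window h t s * \<phi> t) = (\<lambda>(t, s). window h t s * \<phi> s)"
    by (auto simp: window_commute)
  show "integrable (ivl a b \<Otimes>\<^sub>M ivl a b) (\<lambda>(t, s). window h t s * \<phi> s)"
    using P.integrable_product_swap[OF A] unfolding sw .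
  show "(\<integral>z. (case z of (t, s) \<Rightarrow> window h t s * \<phi> s) \<partial>(ivl a b \<Otimes>\<^sub>M ivl a b)) \<le> integral\<^sup>L (ivl a b) \<phi>"
    using B P.integral_product_swap[of "\<lambda>(t, s). window h t s * \<phi> t"] m unfolding sw by simp
qed

section \<open>Convergence of window averages of the duality pairing\<close>

locale conjugate_exponents =
  fixes p q :: real
  assumes pq: "p > 1" "q > 1" "1 / p + 1 / q = 1"
begin

lemma measurable_window_pairing:
  fixes w :: "real \<Rightarrow> 'v::{real_normed_vector, second_countable_topology} \<Rightarrow>\<^sub>L real"
  assumes w: "weak_Lq q {a<..<b} w" and y: "y \<in> borel_measurable (ivl a b)"
  shows "(\<lambda>(t, s). window h t s * w t (y s)) \<in> borel_measurable (ivl a b \<Otimes>\<^sub>M ivl a b)"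
proof -
  have "(\<lambda>z. blinfun_apply (w (fst z)) (y (snd z))) \<in> borel_measurable (ivl a b \<Otimes>\<^sub>M ivl a b)"
  proof (rule measurable_dual_pairing)
    show "(\<lambda>z. blinfun_apply (w (fst z)) v) \<in> borel_measurable (ivl a b \<Otimes>\<^sub>M ivl a b)" for v
      by (rule measurable_compose[OF measurable_fst weak_Lq_measurable[OF w]])
    show "(\<lambda>z. y (snd z)) \<in> borel_measurable (ivl a b \<Otimes>\<^sub>M ivl a b)"
      by (rule measurable_compose[OF measurable_snd y])
  qed
  from borel_measurable_times[OF window_measurable[of h] this] show ?thesis
    by (simp add: split_beta')
qed

text \<open>Young's inequality under the kernel; since averaging does not increase integrals, the
  bound is the same for every \<open>h\<close>.\<close>

lemma window_pairing_bound:
  fixes w :: "real \<Rightarrow> 'v::{real_normed_vector, second_countable_topology} \<Rightarrow>\<^sub>L real"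
  assumes w: "weak_Lq q {a<..<b} w" and y: "Lp_fun p {a<..<b} y" and h: "h > 0"
    and C: "C \<ge> 0" "\<kappa> \<ge> 0" "\<And>r s. r \<ge> 0 \<Longrightarrow> s \<ge> 0 \<Longrightarrow> r * s \<le> \<kappa> * r powr q + C * s powr p"
  shows "integrable (ivl a b \<Otimes>\<^sub>M ivl a b) (\<lambda>(t, s). window h t s * w t (y s))" (is ?A)
    and "\<bar>\<integral>z. (case z of (t, s) \<Rightarrow> window h t s * w t (y s)) \<partial>(ivl a b \<Otimes>\<^sub>M ivl a b)\<bar>
      \<le> \<kappa> * (\<integral>t. norm (w t) powr q \<partial>ivl a b) + C * (\<integral>t. norm (y t) powr p \<partial>ivl a b)" (is ?B)
proof -
  let ?P = "ivl a b \<Otimes>\<^sub>M ivl a b"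
  let ?g = "\<lambda>z. (case z of (t, s) \<Rightarrow> window h t s * (\<kappa> * norm (w t) powr q))
    + (case z of (t, s) \<Rightarrow> window h t s * (C * norm (y s) powr p))"
  have iw: "integrable (ivl a b) (\<lambda>t. \<kappa> * norm (w t) powr q)" using weak_Lq_integrable[OF w] by simp
  have iy: "integrable (ivl a b) (\<lambda>t. C * norm (y t) powr p)" using Lp_fun_integrable[OF y] by simp
  have wp: "\<kappa> * norm (w t) powr q \<ge> 0" and yp: "C * norm (y t) powr p \<ge> 0" for t
    using C by auto
  note W = window_weighted_integral[OF h iw wp] and Y = window_weighted_integral[OF h iy yp]
  have ig: "integrable ?P ?g" by (rule Bochner_Integration.integrable_add[OF W(1) Y(2)])
  have le: "norm (case z of (t, s) \<Rightarrow> window h t s * w t (y s)) \<le> ?g z" for z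
  proof (cases z)
    case (Pair t s)
    have "\<bar>w t (y s)\<bar> \<le> norm (w t) * norm (y s)" by (rule dual_pairing_abs_le)
    also have "\<dots> \<le> \<kappa> * norm (w t) powr q + C * norm (y s) powr p" by (rule C) auto
    finally have "window h t s * \<bar>w t (y s)\<bar> \<le> window h t s * (\<kappa> * norm (w t) powr q + C * norm (y s) powr p)"
      using window_nonneg[OF h] by (intro mult_left_mono)
    then show ?thesis using window_nonneg[OF h, of t s] by (simp add: Pair abs_mult distrib_left)
  qed

  show A: ?A
  proof (rule Bochner_Integration.integrable_bound[OF ig measurable_window_pairing[OF w Lp_fun_measurable[OF y]]])
    show "AE z in ?P. norm (case z of (t, s) \<Rightarrow> window h t s * w t (y s)) \<le> norm (?g z)"
    proof (rule AE_I2)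
      fix z show "norm (case z of (t, s) \<Rightarrow> window h t s * w t (y s)) \<le> norm (?g z)"
        by (rule order_trans[OF le]) (simp only: real_norm_def abs_ge_self)
    qed
  qed
  have "norm (\<integral>z. (case z of (t, s) \<Rightarrow> window h t s * w t (y s)) \<partial>?P) \<le> integral\<^sup>L ?P ?g"
  proof (rule norm_integral_le[OF A ig])
    show "AE z in ?P. norm (case z of (t, s) \<Rightarrow> window h t s * w t (y s)) \<le> ?g z"
      by (rule AE_I2) (rule le)
  qed
  also have "\<dots> \<le> (\<integral>t. \<kappa> * norm (w t) powr q \<partial>ivl a b) + (\<integral>t. C * norm (y t) powr p \<partial>ivl a b)"
    unfolding Bochner_Integration.integral_add[OF W(1) Y(2)] by (intro add_mono W(3) Y(4))
  also have "\<dots> = \<kappa> * (\<integral>t. norm (w t) powr q \<partial>ivl a b) + C * (\<integral>t. norm (y t) powr p \<partial>ivl a b)"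
    by simp
  finally show ?B by simp
qed

lemma dual_pairing_bound:
  fixes w :: "real \<Rightarrow> 'v::{real_normed_vector, second_countable_topology} \<Rightarrow>\<^sub>L real"
  assumes w: "weak_Lq q S w" and y: "Lp_fun p S y"
    and C: "\<And>r s. r \<ge> 0 \<Longrightarrow> s \<ge> 0 \<Longrightarrow> r * s \<le> \<kappa> * r powr q + C * s powr p"
  shows "\<bar>\<integral>t. w t (y t) \<partial>lebesgue_on S\<bar>
      \<le> \<kappa> * (\<integral>t. norm (w t) powr q \<partial>lebesgue_on S) + C * (\<integral>t. norm (y t) powr p \<partial>lebesgue_on S)"
proof -
  have "norm (\<integral>t. w t (y t) \<partial>lebesgue_on S) \<le> (\<integral>t. \<kappa> * norm (w t) powr q + C * norm (y t) powr p \<partial>lebesgue_on S)"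
  proof (rule norm_integral_le[OF integrable_dual_pairing[OF pq w y]])
    show "integrable (lebesgue_on S) (\<lambda>t. \<kappa> * norm (w t) powr q + C * norm (y t) powr p)"
      using weak_Lq_integrable[OF w] Lp_fun_integrable[OF y] by simp
    show "AE t in lebesgue_on S. norm (w t (y t)) \<le> \<kappa> * norm (w t) powr q + C * norm (y t) powr p"
    proof (rule AE_I2)
      fix t
      have "norm (w t (y t)) \<le> norm (w t) * norm (y t)" by (rule norm_blinfun)
      also have "\<dots> \<le> \<kappa> * norm (w t) powr q + C * norm (y t) powr p" by (rule C) auto
      finally show "norm (w t (y t)) \<le> \<kappa> * norm (w t) powr q + C * norm (y t) powr p" .
    qed
  qed
  then show ?thesis using weak_Lq_integrable[OF w] Lp_fun_integrable[OF y] by simp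
qed

abbreviation window_pairing :: "real \<Rightarrow> real \<Rightarrow> real \<Rightarrow> (real \<Rightarrow> 'v::real_normed_vector \<Rightarrow>\<^sub>L real) \<Rightarrow> (real \<Rightarrow> 'v) \<Rightarrow> real" where
  "window_pairing a b h w y \<equiv>
     (\<integral>z. (case z of (t, s) \<Rightarrow> window h t s * blinfun_apply (w t) (y s)) \<partial>(ivl a b \<Otimes>\<^sub>M ivl a b))"

text \<open>The threshold h0 depends on \<open>w\<close> only through the bound \<open>K\<close>.
  This uniformity allows \<open>h\<close> to be fixed before a sequence of functions
  \<open>w\<close> is sent to its limit.\<close>

definition averages_well :: "real \<Rightarrow> real \<Rightarrow> (real \<Rightarrow> 'v::real_normed_vector) \<Rightarrow> bool" where
  "averages_well a b y \<longleftrightarrow> (\<forall>K\<ge>0. \<forall>e>0. \<exists>h0>0. \<forall>h. 0 < h \<longrightarrow> h < h0 \<longrightarrow> (\<forall>w.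
     weak_Lq q {a<..<b} w \<longrightarrow> (\<integral>t. norm (w t) powr q \<partial>ivl a b) \<le> K \<longrightarrow>
     \<bar>window_pairing a b h w y - (\<integral>t. w t (y t) \<partial>ivl a b)\<bar> \<le> e))"

lemma averages_wellD:
  assumes "averages_well a b y" "K \<ge> 0" "e > 0"
  obtains h0 where "h0 > 0" "\<And>h w. 0 < h \<Longrightarrow> h < h0 \<Longrightarrow> weak_Lq q {a<..<b} w \<Longrightarrow>
     (\<integral>t. norm (w t) powr q \<partial>ivl a b) \<le> K \<Longrightarrow>
     \<bar>window_pairing a b h w y - (\<integral>t. w t (y t) \<partial>ivl a b)\<bar> \<le> e"
proof -
  from assms(1)[unfolded averages_well_def, THEN spec, THEN mp, OF assms(2), THEN spec, THEN mp, OF assms(3)]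
  obtain h0 where h0: "h0 > 0" and H: "\<forall>h. 0 < h \<longrightarrow> h < h0 \<longrightarrow> (\<forall>w. weak_Lq q {a<..<b} w \<longrightarrow>
     (\<integral>t. norm (w t) powr q \<partial>ivl a b) \<le> K \<longrightarrow>
     \<bar>window_pairing a b h w y - (\<integral>t. w t (y t) \<partial>ivl a b)\<bar> \<le> e)"
    by (elim exE conjE) (rule that)
  show ?thesis
    by (rule that[OF h0]) (rule H[rule_format])
qed

lemma one_Young: "r \<ge> 0 \<Longrightarrow> s \<ge> 0 \<Longrightarrow> r * s \<le> 1 * r powr q + 1 * s powr p"
  using mult_le_powr_add[OF pq] by simp

lemma window_pairing_diff:
  fixes w :: "real \<Rightarrow> 'v::{real_normed_vector, second_countable_topology} \<Rightarrow>\<^sub>L real"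
  assumes w: "weak_Lq q {a<..<b} w" and y: "Lp_fun p {a<..<b} y" and z: "Lp_fun p {a<..<b} z" and h: "h > 0"
  shows "window_pairing a b h w (\<lambda>t. y t - z t) = window_pairing a b h w y - window_pairing a b h w z"
    and "(\<integral>t. w t (y t - z t) \<partial>ivl a b) = (\<integral>t. w t (y t) \<partial>ivl a b) - (\<integral>t. w t (z t) \<partial>ivl a b)"
proof -
  note i = window_pairing_bound(1)[OF w _ h zero_le_one zero_le_one one_Young]
  have "(\<lambda>(t, s). window h t s * w t (y s - z s)) =
      (\<lambda>z'. (case z' of (t, s) \<Rightarrow> window h t s * w t (y s)) - (case z' of (t, s) \<Rightarrow> window h t s * w t (z s)))"
    by (auto simp: fun_eq_iff blinfun.diff_right right_diff_distrib)
  then show "window_pairing a b h w (\<lambda>t. y t - z t) = window_pairing a b h w y - window_pairing a b h w z"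
    using Bochner_Integration.integral_diff[OF i[OF y] i[OF z]] by simp
  show "(\<integral>t. w t (y t - z t) \<partial>ivl a b) = (\<integral>t. w t (y t) \<partial>ivl a b) - (\<integral>t. w t (z t) \<partial>ivl a b)"
    unfolding blinfun.diff_right
    by (rule Bochner_Integration.integral_diff[OF integrable_dual_pairing[OF pq w y] integrable_dual_pairing[OF pq w z]])
qed

text \<open>Closure under L^p limits: replacing \<open>y\<close> by \<open>z\<close> changes both
  pairings by amounts whose bounds do not depend on \<open>h\<close>.\<close>

lemma averages_well_limit:
  fixes y :: "real \<Rightarrow> 'v::{real_normed_vector, second_countable_topology}"
  assumes y: "Lp_fun p {a<..<b} y"
    and approx: "\<And>\<delta>. \<delta> > 0 \<Longrightarrow> \<exists>z. Lp_fun p {a<..<b} z \<and> averages_well a b z \<and>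
        (\<integral>t. norm (y t - z t) powr p \<partial>ivl a b) \<le> \<delta>"
  shows "averages_well a b y"
  unfolding averages_well_def
proof (intro allI impI)
  fix K e :: real assume K: "K \<ge> 0" and e: "e > 0"
  \<comment> \<open>The order of choice matters: \<kappa> tames the part with \<open>w\<close>, of
    which only the bound \<open>K\<close> is known, and \<delta> is chosen for the constant
    \<open>C\<close> that \<kappa> produces. Each contributes e/6 to an error of e/3.\<close>
  define \<kappa> where "\<kappa> = e / (6 * (K + 1))"
  have \<kappa>: "\<kappa> > 0" "\<kappa> * K \<le> e/6" using K e by (auto simp: \<kappa>_def field_simps)
  obtain C where C: "C \<ge> 0" "\<And>r s. r \<ge> 0 \<Longrightarrow> s \<ge> 0 \<Longrightarrow> r * s \<le> \<kappa> * r powr q + C * s powr p"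
    using Young_small[OF pq \<kappa>(1)] by blast
  define \<delta> where "\<delta> = e / (6 * (C + 1))"
  have \<delta>: "\<delta> > 0" "C * \<delta> \<le> e/6" using C e by (auto simp: \<delta>_def field_simps)
  obtain z where z: "Lp_fun p {a<..<b} z" "averages_well a b z" "(\<integral>t. norm (y t - z t) powr p \<partial>ivl a b) \<le> \<delta>"
    using approx[OF \<delta>(1)] by blast
  have e3: "e / 3 > 0" using e by simp
  obtain h0 where h0: "h0 > 0" "\<And>h w. 0 < h \<Longrightarrow> h < h0 \<Longrightarrow> weak_Lq q {a<..<b} w \<Longrightarrow>
     (\<integral>t. norm (w t) powr q \<partial>ivl a b) \<le> K \<Longrightarrow>
     \<bar>window_pairing a b h w z - (\<integral>t. w t (z t) \<partial>ivl a b)\<bar> \<le> e/3"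
    using averages_wellD[OF z(2) K e3] by blast
  have d: "Lp_fun p {a<..<b} (\<lambda>t. y t - z t)" using pq y z by (intro Lp_fun_diff) auto
  show "\<exists>h0>0. \<forall>h. 0 < h \<longrightarrow> h < h0 \<longrightarrow> (\<forall>w. weak_Lq q {a<..<b} w \<longrightarrow> (\<integral>t. norm (w t) powr q \<partial>ivl a b) \<le> K \<longrightarrow>
     \<bar>window_pairing a b h w y - (\<integral>t. w t (y t) \<partial>ivl a b)\<bar> \<le> e)"
  proof (intro exI[of _ h0] conjI allI impI h0(1))
    fix h :: real and w :: "real \<Rightarrow> 'v \<Rightarrow>\<^sub>L real"
    assume h: "0 < h" "h < h0" and w: "weak_Lq q {a<..<b} w" "(\<integral>t. norm (w t) powr q \<partial>ivl a b) \<le> K"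
    have bd: "\<kappa> * (\<integral>t. norm (w t) powr q \<partial>ivl a b) + C * (\<integral>t. norm (y t - z t) powr p \<partial>ivl a b) \<le> e/3"
    proof -
      have "\<kappa> * (\<integral>t. norm (w t) powr q \<partial>ivl a b) \<le> \<kappa> * K" using \<kappa> w by (intro mult_left_mono) auto
      moreover have "C * (\<integral>t. norm (y t - z t) powr p \<partial>ivl a b) \<le> C * \<delta>" using C z by (intro mult_left_mono) auto
      ultimately show ?thesis using \<kappa> \<delta> by linarith
    qed
    have 1: "\<bar>window_pairing a b h w (\<lambda>t. y t - z t)\<bar> \<le> e/3"
      using window_pairing_bound(2)[OF w(1) d h(1) C(1) less_imp_le[OF \<kappa>(1)] C(2)] bd by linarith
    have 2: "\<bar>\<integral>t. w t (y t - z t) \<partial>ivl a b\<bar> \<le> e/3"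
      using dual_pairing_bound[OF w(1) d C(2)] bd by linarith
    show "\<bar>window_pairing a b h w y - (\<integral>t. w t (y t) \<partial>ivl a b)\<bar> \<le> e"
      using 1 2 h0(2)[OF h w] unfolding window_pairing_diff[OF w(1) y z(1) h(1)] by linarith
  qed
qed

lemma averages_well_add:
  fixes y z :: "real \<Rightarrow> 'v::{real_normed_vector, second_countable_topology}"
  assumes y: "Lp_fun p {a<..<b} y" "averages_well a b y" and z: "Lp_fun p {a<..<b} z" "averages_well a b z"
  shows "Lp_fun p {a<..<b} (\<lambda>t. y t + z t)" and "averages_well a b (\<lambda>t. y t + z t)"
proof -
  have nz: "Lp_fun p {a<..<b} (\<lambda>t. - z t)"
    using z(1) by (auto simp: Lp_fun_def)
  have "Lp_fun p {a<..<b} (\<lambda>t. y t - (- z t))" by (rule Lp_fun_diff[OF _ y(1) nz]) (use pq in auto)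
  then show yz: "Lp_fun p {a<..<b} (\<lambda>t. y t + z t)" by simp
  show "averages_well a b (\<lambda>t. y t + z t)"
    unfolding averages_well_def
  proof (intro allI impI)
    fix K e :: real assume K: "K \<ge> 0" and e: "e > 0"
    then have e2: "e / 2 > 0" by simp
    obtain h1 where h1: "h1 > 0" "\<And>h w. 0 < h \<Longrightarrow> h < h1 \<Longrightarrow> weak_Lq q {a<..<b} w \<Longrightarrow>
       (\<integral>t. norm (w t) powr q \<partial>ivl a b) \<le> K \<Longrightarrow>
       \<bar>window_pairing a b h w y - (\<integral>t. w t (y t) \<partial>ivl a b)\<bar> \<le> e/2"
      using averages_wellD[OF y(2) K e2] by blast
    obtain h2 where h2: "h2 > 0" "\<And>h w. 0 < h \<Longrightarrow> h < h2 \<Longrightarrow> weak_Lq q {a<..<b} w \<Longrightarrow>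
       (\<integral>t. norm (w t) powr q \<partial>ivl a b) \<le> K \<Longrightarrow>
       \<bar>window_pairing a b h w z - (\<integral>t. w t (z t) \<partial>ivl a b)\<bar> \<le> e/2"
      using averages_wellD[OF z(2) K e2] by blast
    show "\<exists>h0>0. \<forall>h. 0 < h \<longrightarrow> h < h0 \<longrightarrow> (\<forall>w. weak_Lq q {a<..<b} w \<longrightarrow> (\<integral>t. norm (w t) powr q \<partial>ivl a b) \<le> K \<longrightarrow>
       \<bar>window_pairing a b h w (\<lambda>t. y t + z t) - (\<integral>t. w t (y t + z t) \<partial>ivl a b)\<bar> \<le> e)"
    proof (intro exI[of _ "min h1 h2"] conjI allI impI)
      fix h :: real and w :: "real \<Rightarrow> 'v \<Rightarrow>\<^sub>L real"
      assume h: "0 < h" "h < min h1 h2" and w: "weak_Lq q {a<..<b} w" "(\<integral>t. norm (w t) powr q \<partial>ivl a b) \<le> K"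
      have eq: "window_pairing a b h w y = window_pairing a b h w (\<lambda>t. y t + z t) - window_pairing a b h w z"
        "(\<integral>t. w t (y t) \<partial>ivl a b) = (\<integral>t. w t (y t + z t) \<partial>ivl a b) - (\<integral>t. w t (z t) \<partial>ivl a b)"
        using window_pairing_diff[OF w(1) yz z(1) h(1)] by simp_all
      have "\<bar>(Y - Z) - (Y' - Z')\<bar> \<le> e/2 \<Longrightarrow> \<bar>Z - Z'\<bar> \<le> e/2 \<Longrightarrow> \<bar>Y - Y'\<bar> \<le> e" for Y Z Y' Z' :: real
        by linarith
      from this[OF h1(2)[OF h(1) _ w, unfolded eq] h2(2)[OF h(1) _ w]] h show "\<bar>window_pairing a b h w (\<lambda>t. y t + z t) - (\<integral>t. w t (y t + z t) \<partial>ivl a b)\<bar> \<le> e"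
        by simp
    qed (use h1 h2 in auto)
  qed
qed

lemma continuous_Lp_fun:
  fixes y :: "real \<Rightarrow> 'v::{banach, second_countable_topology}"
  assumes y: "continuous_on {a..b} y"
  shows "Lp_fun p {a<..<b} y"
proof -
  have "continuous_on {a..b} (\<lambda>t. norm (y t) powr p)"
    using pq by (intro continuous_intros y continuous_on_powr') auto
  then show ?thesis
    unfolding Lp_fun_def using continuous_integrable_ivl continuous_measurable_ivl[OF y] by blast
qed

text \<open>Two errors arise. Replacing y(s) by y(t) under the kernel costs the modulus of
  continuity of \<open>y\<close> times the L^1 norm of \<open>w\<close>; and the kernel loses mass
  within \<open>h\<close> of the ends, on a set of measure at most 2h.\<close>

lemma averages_well_continuous:
  fixes y :: "real \<Rightarrow> 'v::{banach, second_countable_topology}"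
  assumes ab: "a < b" and y: "continuous_on {a..b} y"
  shows "averages_well a b y"
  unfolding averages_well_def
proof (intro allI impI)
  fix K e :: real assume K: "K \<ge> 0" and e: "e > 0"
  interpret P: pair_sigma_finite "ivl a b" "ivl a b" by (rule pair_sigma_finite_ivl)
  let ?P = "ivl a b \<Otimes>\<^sub>M ivl a b"
  have Lpy: "Lp_fun p {a<..<b} y" by (rule continuous_Lp_fun[OF y])
  obtain B where B: "\<And>t. t \<in> {a..b} \<Longrightarrow> norm (y t) \<le> B"
    using compact_imp_bounded[OF compact_continuous_image[OF y compact_Icc]] unfolding bounded_iff by blast
  have B0: "B \<ge> 0"
  proof -
    have "norm (y a) \<le> B" using B[of a] ab by simp
    then show ?thesis using norm_ge_zero[of "y a"] by linarith
  qed
  \<comment> \<open>K + (b - a) bounds the L^1 norm of \<open>w\<close>, because r \<le> 1 +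
    r^q.\<close>
  define \<eta> where "\<eta> = e / (2 * (K + (b - a)))"
  have \<eta>: "\<eta> > 0" "\<eta> * (K + (b - a)) = e/2" using K e ab by (auto simp: \<eta>_def field_simps)
  have "uniformly_continuous_on {a..b} y" using y by (rule compact_uniformly_continuous) simp
  then obtain \<delta> where \<delta>: "\<delta> > 0" "\<And>s t. s \<in> {a..b} \<Longrightarrow> t \<in> {a..b} \<Longrightarrow> dist s t < \<delta> \<Longrightarrow> dist (y s) (y t) < \<eta>"
    unfolding uniformly_continuous_on_def using \<eta>(1) by metis
  \<comment> \<open>The boundary error is at most B times the integral of |w| over the boundary
    layers. Young's inequality splits it into a part with \<kappa> K and a part with 2h C; \<kappa>
    and h0 make each at most e/4.\<close>
  define \<kappa> where "\<kappa> = e / (4 * (B + 1) * (K + 1))"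
  have \<kappa>: "\<kappa> > 0" using K e B0 by (auto simp: \<kappa>_def)
  have B\<kappa>: "B * (\<kappa> * K) \<le> e/4"
  proof -
    have "B * (\<kappa> * K) \<le> (B + 1) * (\<kappa> * (K + 1))"
      using B0 K \<kappa> by (intro mult_mono) auto
    also have "\<dots> = e/4"
    proof -
      have "B + 1 \<noteq> 0" "K + 1 \<noteq> 0" using B0 K by linarith+
      then show ?thesis by (simp add: \<kappa>_def divide_simps)
    qed
    finally show ?thesis .
  qed
  obtain C where C: "C \<ge> 0" "\<And>r s. r \<ge> 0 \<Longrightarrow> s \<ge> 0 \<Longrightarrow> r * s \<le> \<kappa> * r powr q + C * s powr p"
    using Young_small[OF pq \<kappa>] by blast
  define h0 where "h0 = min \<delta> (e / (8 * (B + 1) * (C + 1)))"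
  have h0: "h0 > 0" using \<delta> e B0 C by (auto simp: h0_def)
  have Bh: "B * (C * (2 * h)) \<le> e/4" if "0 < h" "h < h0" for h
  proof -
    have "B * (C * (2 * h)) \<le> (B + 1) * ((C + 1) * (2 * (e / (8 * (B + 1) * (C + 1)))))"
      using that C B0 by (intro mult_mono) (auto simp: h0_def)
    also have "\<dots> = e/4"
    proof -
      have "B + 1 \<noteq> 0" "C + 1 \<noteq> 0" using B0 C by linarith+
      then show ?thesis by (simp add: divide_simps)
    qed
    finally show ?thesis .
  qed
  show "\<exists>h0>0. \<forall>h. 0 < h \<longrightarrow> h < h0 \<longrightarrow> (\<forall>w. weak_Lq q {a<..<b} w \<longrightarrow> (\<integral>t. norm (w t) powr q \<partial>ivl a b) \<le> K \<longrightarrow>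
     \<bar>window_pairing a b h w y - (\<integral>t. w t (y t) \<partial>ivl a b)\<bar> \<le> e)"
  proof (intro exI[of _ h0] conjI allI impI h0)
    fix h :: real and w :: "real \<Rightarrow> 'v \<Rightarrow>\<^sub>L real"
    assume h: "0 < h" "h < h0" and w: "weak_Lq q {a<..<b} w" "(\<integral>t. norm (w t) powr q \<partial>ivl a b) \<le> K"
    note iwy = integrable_dual_pairing[OF pq w(1) Lpy]
    define g where "g = (\<lambda>t. w t (y t))"
    have ig: "integrable (ivl a b) g" using iwy by (simp add: g_def)
    have inw: "integrable (ivl a b) (\<lambda>t. norm (w t))"
      by (rule weak_Lq_integrable_norm[OF less_imp_le[OF pq(2)] w(1)])
    have nw: "(\<integral>t. norm (w t) \<partial>ivl a b) \<le> K + (b - a)"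
    proof -
      have "(\<integral>t. norm (w t) \<partial>ivl a b) \<le> (\<integral>t. 1 + norm (w t) powr q \<partial>ivl a b)"
        using inw weak_Lq_integrable[OF w(1)] pq
        by (intro integral_mono) (auto intro!: le_one_add_powr)
      also have "\<dots> = (b - a) + (\<integral>t. norm (w t) powr q \<partial>ivl a b)"
        using weak_Lq_integrable[OF w(1)] ab by (simp add: measure_restrict_space)
      finally show ?thesis using w by linarith
    qed
    have i1: "integrable ?P (\<lambda>(t, s). window h t s * w t (y s))"
      by (rule window_pairing_bound(1)[OF w(1) Lpy h(1) zero_le_one zero_le_one one_Young])
    have i2: "integrable ?P (\<lambda>(t, s). window h t s * g t)"
    proof (rule Bochner_Integration.integrable_bound)
      show "integrable ?P (\<lambda>(t, s). window h t s * \<bar>g t\<bar>)"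
        by (rule window_weighted_integral(1)[OF h(1)]) (use ig in auto)
      have [measurable]: "g \<in> borel_measurable (ivl a b)" using ig by auto
      show "(\<lambda>(t, s). window h t s * g t) \<in> borel_measurable ?P" by measurable
    qed (auto simp: abs_mult)
    have "window_pairing a b h w y - (\<integral>z. (case z of (t, s) \<Rightarrow> window h t s * g t) \<partial>?P)
        = (\<integral>z. (case z of (t, s) \<Rightarrow> window h t s * w t (y s)) - (case z of (t, s) \<Rightarrow> window h t s * g t) \<partial>?P)"
      by (rule Bochner_Integration.integral_diff[OF i1 i2, symmetric])
    also have "norm \<dots> \<le> (\<integral>z. (case z of (t, s) \<Rightarrow> window h t s * (\<eta> * norm (w t))) \<partial>?P)"
    proof (rule norm_integral_le[OF Bochner_Integration.integrable_diff[OF i1 i2]])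
      show "integrable ?P (\<lambda>(t, s). window h t s * (\<eta> * norm (w t)))"
        by (rule window_weighted_integral(1)[OF h(1)]) (use inw \<eta> in auto)
      show "AE z in ?P. norm ((case z of (t, s) \<Rightarrow> window h t s * w t (y s)) - (case z of (t, s) \<Rightarrow> window h t s * g t))
          \<le> (case z of (t, s) \<Rightarrow> window h t s * (\<eta> * norm (w t)))"
      proof (rule AE_I2, clarify)
        fix t s assume "(t, s) \<in> space ?P"
        then have ts: "t \<in> {a..b}" "s \<in> {a..b}" by (auto simp: space_pair_measure)
        show "norm (window h t s * w t (y s) - window h t s * g t) \<le> window h t s * (\<eta> * norm (w t))"
        proof (cases "\<bar>t - s\<bar> < h")
          case True
          then have "dist (y s) (y t) < \<eta>" using ts h by (intro \<delta>) (auto simp: dist_real_def h0_def)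
          then have "norm (w t) * norm (y s - y t) \<le> norm (w t) * \<eta>"
            by (intro mult_left_mono) (auto simp: dist_norm)
          then have "\<bar>w t (y s - y t)\<bar> \<le> \<eta> * norm (w t)"
            using dual_pairing_abs_le[of "w t" "y s - y t"] by (simp add: mult.commute)
          then have "window h t s * \<bar>w t (y s - y t)\<bar> \<le> window h t s * (\<eta> * norm (w t))"
            using window_nonneg[OF h(1)] by (intro mult_left_mono)
          then show ?thesis using window_nonneg[OF h(1), of t s]
            by (simp add: g_def blinfun.diff_right right_diff_distrib[symmetric] abs_mult)
        qed (simp add: window_def)
      qed
    qed
    also have "\<dots> \<le> (\<integral>t. \<eta> * norm (w t) \<partial>ivl a b)"
      by (rule window_weighted_integral(3)[OF h(1)]) (use inw \<eta> in auto)
    also have "\<dots> \<le> \<eta> * (K + (b - a))" using nw \<eta> by simp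
    finally have 1: "\<bar>window_pairing a b h w y - (\<integral>z. (case z of (t, s) \<Rightarrow> window h t s * g t) \<partial>?P)\<bar> \<le> e/2"
      using \<eta> by simp
    \<comment> \<open>Indicators of the two boundary layers. They are added rather than united, so
      that the layers may overlap and the integral is still at most 2h.\<close>
    define ch :: "real \<Rightarrow> real" where "ch = (\<lambda>t. indicator {a<..<a+h} t + indicator {b-h<..<b} t)"
    have chm: "ch \<in> borel_measurable (ivl a b)" unfolding ch_def by (intro borel_measurable_add indicator_measurable_ivl)
    have chI: "integrable (ivl a b) ch" "integral\<^sup>L (ivl a b) ch \<le> 2 * h"
    proof -
      have i: "integrable (ivl a b) (indicator {c<..<d} :: real \<Rightarrow> real)" for c d
        using integrable_indicator_ivl[of a b "\<lambda>_. 1::real" c d] by simp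
      show "integrable (ivl a b) ch" unfolding ch_def using i by auto
      have "(\<integral>t. indicator {c<..<c+h} t \<partial>ivl a b) \<le> h" for c
        using measure_ivl_le[of c "c+h" a b] h by (simp add: Int_commute)
      from this[of a] this[of "b - h"] show "integral\<^sup>L (ivl a b) ch \<le> 2 * h"
        unfolding ch_def using i by simp
    qed
    define k where "k = (\<lambda>t. \<integral>s. window h t s \<partial>ivl a b)"
    have k01: "0 \<le> k t" "k t \<le> 1" for t
      using window_integral_le[OF h(1)] by (auto simp: k_def h intro!: integral_nonneg_AE window_nonneg)
    have ik: "integrable (ivl a b) (\<lambda>t. k t * g t)"
      using P.integrable_fst'[OF i2] by (simp add: k_def)
    have "(\<integral>z. (case z of (t, s) \<Rightarrow> window h t s * g t) \<partial>?P) = (\<integral>t. k t * g t \<partial>ivl a b)"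
      using P.integral_fst'[OF i2] by (simp add: k_def)
    then have "(\<integral>z. (case z of (t, s) \<Rightarrow> window h t s * g t) \<partial>?P) - integral\<^sup>L (ivl a b) g
        = (\<integral>t. k t * g t - g t \<partial>ivl a b)" using ik ig by simp
    also have "norm \<dots> \<le> (\<integral>t. B * (\<kappa> * norm (w t) powr q + C * ch t) \<partial>ivl a b)"
    proof (rule norm_integral_le)
      show "AE t in ivl a b. norm (k t * g t - g t) \<le> B * (\<kappa> * norm (w t) powr q + C * ch t)"
        using AE_ivl_neq[of "a + h" a b] AE_ivl_neq[of "b - h" a b] AE_space[of "ivl a b"]
      proof eventually_elim
        case (elim t)
        have rhs: "0 \<le> B * (\<kappa> * norm (w t) powr q + C * ch t)"
          using B0 \<kappa> C by (auto simp: ch_def intro!: mult_nonneg_nonneg add_nonneg_nonneg)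
        show ?case
        proof (cases "a + h \<le> t \<and> t \<le> b - h")
          case True
          then have "k t = 1" using window_integral_interior[OF h(1)] by (simp add: k_def)
          then show ?thesis using rhs by simp
        next
          case False
          then have ch1: "1 \<le> ch t" using elim by (auto simp: ch_def indicator_def)
          have "\<bar>k t * g t - g t\<bar> = (1 - k t) * \<bar>g t\<bar>"
          proof -
            have "k t * g t - g t = - ((1 - k t) * g t)" by (simp add: algebra_simps)
            then show ?thesis using k01[of t] by (simp add: abs_mult)
          qed
          also have "\<dots> \<le> 1 * \<bar>g t\<bar>" using k01[of t] by (intro mult_right_mono) auto
          also have "\<dots> \<le> norm (w t) * B"
            using dual_pairing_abs_le[of "w t" "y t"] B[of t] elim
              mult_left_mono[of "norm (y t)" B "norm (w t)"] by (simp add: g_def)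
          also have "\<dots> = B * (norm (w t) * 1)" by simp
          also have "\<dots> \<le> B * (\<kappa> * norm (w t) powr q + C * 1 powr p)"
            using B0 by (intro mult_left_mono C) auto
          also have "\<dots> \<le> B * (\<kappa> * norm (w t) powr q + C * ch t)"
            using B0 C(1) ch1 mult_left_mono[of 1 "ch t" C] by (intro mult_left_mono) auto
          finally show ?thesis by simp
        qed
      qed
    qed (use ik ig chI weak_Lq_integrable[OF w(1)] in auto)
    also have "\<dots> = B * (\<kappa> * (\<integral>t. norm (w t) powr q \<partial>ivl a b)) + B * (C * integral\<^sup>L (ivl a b) ch)"
      using chI weak_Lq_integrable[OF w(1)] by (simp add: distrib_left)
    also have "\<dots> \<le> B * (\<kappa> * K) + B * (C * (2 * h))"
      using B0 \<kappa> C w chI by (intro add_mono mult_left_mono) auto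
    also have "\<dots> \<le> e/2" using B\<kappa> Bh[OF h] by linarith
    finally have 2: "\<bar>(\<integral>z. (case z of (t, s) \<Rightarrow> window h t s * g t) \<partial>?P) - integral\<^sup>L (ivl a b) g\<bar> \<le> e/2" by simp
    show "\<bar>window_pairing a b h w y - (\<integral>t. w t (y t) \<partial>ivl a b)\<bar> \<le> e"
      using 1 2 unfolding g_def[symmetric] by linarith
  qed
qed

lemma Lp_fun_bounded:
  fixes y :: "real \<Rightarrow> 'v::{real_normed_vector}"
  assumes "y \<in> borel_measurable (ivl a b)" "\<And>t. t \<in> {a<..<b} \<Longrightarrow> norm (y t) \<le> B"
  shows "Lp_fun p {a<..<b} y"
  by (rule Lp_fun_bound[OF assms(1), of "\<lambda>_. B powr p"])
     (use assms(2) pq in \<open>auto intro!: AE_I2 powr_mono2\<close>)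

text \<open>The approximating functions and the indicator take values in [0,1], so the p-th power of
  their distance is at most the distance; approximation in L^1 is therefore enough.\<close>

lemma averages_well_indicator:
  fixes v :: "'v::{banach, second_countable_topology}"
  assumes ab: "a < b" and E: "E \<in> sets (ivl a b)"
  shows "averages_well a b (\<lambda>t. indicator E t *\<^sub>R v)"
proof (rule averages_well_limit)
  have Em: "(indicator E :: real \<Rightarrow> real) \<in> borel_measurable (ivl a b)" using E by simp
  show "Lp_fun p {a<..<b} (\<lambda>t. indicator E t *\<^sub>R v)"
    by (rule Lp_fun_bounded[of _ _ _ "norm v"])
       (use Em in \<open>auto intro!: borel_measurable_scaleR mult_left_le_one_le\<close>)
  fix \<delta> :: real assume \<delta>: "\<delta> > 0"
  have E': "E \<in> sets lebesgue" using E by (auto simp: sets_restrict_space)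
  define c where "c = norm v powr p + 1"
  have c: "c > 0" by (simp add: c_def add_nonneg_pos)
  obtain \<phi> :: "real \<Rightarrow> real" where \<phi>: "continuous_on UNIV \<phi>" "\<And>t. 0 \<le> \<phi> t" "\<And>t. \<phi> t \<le> 1"
    "(\<integral>t. \<bar>\<phi> t - indicator E t\<bar> \<partial>ivl a b) < \<delta> / c"
    using indicator_continuous_approx[OF E', of "\<delta> / c"] \<delta> c by (metis divide_pos_pos)
  have cz: "continuous_on {a..b} (\<lambda>t. \<phi> t *\<^sub>R v)"
    by (intro continuous_intros continuous_on_subset[OF \<phi>(1)]) auto
  have \<phi>m: "\<phi> \<in> borel_measurable (ivl a b)"
    by (rule continuous_measurable_ivl) (rule continuous_on_subset[OF \<phi>(1)], auto)
  have d01: "\<bar>\<phi> t - indicator E t\<bar> \<le> 1" for t using \<phi>(2,3)[of t] by (auto simp: indicator_def)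
  have i: "integrable (ivl a b) (\<lambda>t. \<bar>\<phi> t - indicator E t\<bar>)"
    by (rule integrable_ivl_bounded[of _ _ _ 1])
       (use \<phi>m Em d01 in \<open>auto intro!: borel_measurable_abs borel_measurable_diff AE_I2\<close>)
  have le: "norm (indicator E t *\<^sub>R v - \<phi> t *\<^sub>R v) powr p \<le> c * \<bar>\<phi> t - indicator E t\<bar>" for t
  proof -
    define d where "d = \<bar>\<phi> t - indicator E t\<bar>"
    have d: "0 \<le> d" "d \<le> 1" using \<phi>(2,3)[of t] by (auto simp: d_def indicator_def)
    have "norm (indicator E t *\<^sub>R v - \<phi> t *\<^sub>R v) = d * norm v"
      by (simp add: d_def scaleR_diff_left[symmetric] abs_minus_commute)
    then have "norm (indicator E t *\<^sub>R v - \<phi> t *\<^sub>R v) powr p = d powr p * norm v powr p"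
      using d by (simp add: powr_mult)
    also have "\<dots> \<le> d * c"
    proof (rule mult_mono)
      show "d powr p \<le> d" using d pq powr_mono'[of 1 p d] by (cases "d = 0") auto
    qed (use d in \<open>auto simp: c_def\<close>)
    finally show ?thesis by (simp add: d_def mult.commute)
  qed
  have "(\<integral>t. norm (indicator E t *\<^sub>R v - \<phi> t *\<^sub>R v) powr p \<partial>ivl a b) \<le> (\<integral>t. c * \<bar>\<phi> t - indicator E t\<bar> \<partial>ivl a b)"
    by (rule integral_mono') (use le i c in \<open>auto intro!: mult_nonneg_nonneg\<close>)
  also have "\<dots> \<le> \<delta>" using \<phi>(4) c by (simp add: field_simps)
  finally show "\<exists>z. Lp_fun p {a<..<b} z \<and> averages_well a b z \<and>
      (\<integral>t. norm (indicator E t *\<^sub>R v - z t) powr p \<partial>ivl a b) \<le> \<delta>"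
    using averages_well_continuous[OF ab cz] continuous_Lp_fun[OF cz] by blast
qed

lemma averages_well_simple:
  fixes y :: "real \<Rightarrow> 'v::{banach, second_countable_topology}"
  assumes ab: "a < b" and y: "simple_function (ivl a b) y"
  shows "Lp_fun p {a<..<b} y \<and> averages_well a b y"
proof -
  have fin: "finite (y ` {a<..<b})" using simple_functionD(1)[OF y] by simp
  have E: "y -` {c} \<inter> {a<..<b} \<in> sets (ivl a b)" for c using simple_functionD(2)[OF y, of "{c}"] by simp
  have ind: "Lp_fun p {a<..<b} (\<lambda>t. \<Sum>c\<in>I. indicator (y -` {c} \<inter> {a<..<b}) t *\<^sub>R c) \<and>
      averages_well a b (\<lambda>t. \<Sum>c\<in>I. indicator (y -` {c} \<inter> {a<..<b}) t *\<^sub>R c)" if "finite I" for I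
    using that
  proof (induction I rule: finite_induct)
    case empty
    show ?case using continuous_Lp_fun[of a b "\<lambda>_. 0::'v"] averages_well_continuous[OF ab, of "\<lambda>_. 0::'v"] by simp
  next
    case (insert c I)
    have "Lp_fun p {a<..<b} (\<lambda>t. indicator (y -` {c} \<inter> {a<..<b}) t *\<^sub>R c)"
      by (rule Lp_fun_bounded[of _ _ _ "norm c"])
         (use E[of c] in \<open>auto intro!: borel_measurable_scaleR mult_left_le_one_le simp del: indicator_simps\<close>)
    note add = averages_well_add[OF this averages_well_indicator[OF ab E[of c], of c] conjunct1[OF insert.IH] conjunct2[OF insert.IH]]
    show ?case unfolding sum.insert[OF insert.hyps] using add by (rule conjI)
  qed
  define z where "z = (\<lambda>t. \<Sum>c\<in>y ` {a<..<b}. indicator (y -` {c} \<inter> {a<..<b}) t *\<^sub>R c)"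
  have zy: "z t = y t" if "t \<in> {a<..<b}" for t
  proof -
    have "z t = (\<Sum>c\<in>y ` {a<..<b}. if c = y t then y t else 0)"
      unfolding z_def using that by (intro sum.cong) (auto simp: indicator_def)
    then show ?thesis using fin that by (simp add: sum.delta)
  qed
  have z: "Lp_fun p {a<..<b} z" "averages_well a b z" using ind[OF fin] by (auto simp: z_def)
  have ym: "y \<in> borel_measurable (ivl a b)" using y by (rule borel_measurable_simple_function)
  have "Lp_fun p {a<..<b} y"
    by (rule Lp_fun_bound[OF ym Lp_fun_integrable[OF z(1)]]) (use zy in \<open>auto intro!: AE_I2\<close>)
  moreover have "averages_well a b y"
  proof (rule averages_well_limit[OF calculation])
    fix \<delta> :: real assume "\<delta> > 0"
    have "(\<integral>t. norm (y t - z t) powr p \<partial>ivl a b) = (\<integral>t. 0 \<partial>ivl a b)"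
      by (rule Bochner_Integration.integral_cong) (use zy in auto)
    then show "\<exists>z. Lp_fun p {a<..<b} z \<and> averages_well a b z \<and> (\<integral>t. norm (y t - z t) powr p \<partial>ivl a b) \<le> \<delta>"
      using z \<open>\<delta> > 0\<close> by (intro exI[of _ z]) auto
  qed
  ultimately show ?thesis by simp
qed

text \<open>Simple functions dominated by 2 |y| converge pointwise, so |y - s|^p is dominated by 3^p
  |y|^p and the convergence holds in L^p.\<close>

lemma averages_well_Lp:
  fixes y :: "real \<Rightarrow> 'v::{banach, second_countable_topology}"
  assumes ab: "a < b" and y: "Lp_fun p {a<..<b} y"
  shows "averages_well a b y"
proof (rule averages_well_limit[OF y])
  fix \<delta> :: real assume \<delta>: "\<delta> > 0"
  obtain s where s: "\<And>i. simple_function (ivl a b) (s i)"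
      "\<And>t. t \<in> space (ivl a b) \<Longrightarrow> (\<lambda>i. s i t) \<longlonglongrightarrow> y t"
      "\<And>i t. t \<in> space (ivl a b) \<Longrightarrow> dist (s i t) 0 \<le> 2 * dist (y t) 0"
    using borel_measurable_implies_sequence_metric[OF Lp_fun_measurable[OF y], of 0] by blast
  note sl = averages_well_simple[OF ab s(1)]
  have sm: "s i \<in> borel_measurable (ivl a b)" for i using s(1) by (rule borel_measurable_simple_function)
  have "(\<lambda>i. \<integral>t. norm (y t - s i t) powr p \<partial>ivl a b) \<longlonglongrightarrow> (\<integral>t. 0 \<partial>ivl a b)"
  proof (rule integral_dominated_convergence[where w = "\<lambda>t. 3 powr p * norm (y t) powr p"])
    show "integrable (ivl a b) (\<lambda>t. 3 powr p * norm (y t) powr p)" using Lp_fun_integrable[OF y] by simp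
    show "AE t in ivl a b. (\<lambda>i. norm (y t - s i t) powr p) \<longlonglongrightarrow> 0"
    proof (rule AE_I2)
      fix t assume t: "t \<in> space (ivl a b)"
      have "(\<lambda>i. norm (y t - s i t)) \<longlonglongrightarrow> norm (y t - y t)" by (intro tendsto_intros s(2)[OF t])
      then have "(\<lambda>i. norm (y t - s i t)) \<longlonglongrightarrow> 0" by simp
      from tendsto_powr'[OF this tendsto_const, of p] show "(\<lambda>i. norm (y t - s i t) powr p) \<longlonglongrightarrow> 0"
        using pq by simp
    qed
    show "AE t in ivl a b. norm (norm (y t - s i t) powr p) \<le> 3 powr p * norm (y t) powr p" for i
    proof (rule AE_I2)
      fix t assume t: "t \<in> space (ivl a b)"
      have "norm (y t - s i t) \<le> 3 * norm (y t)"
        using s(3)[OF t, of i] norm_triangle_ineq4[of "y t" "s i t"] by simp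
      then have "norm (y t - s i t) powr p \<le> (3 * norm (y t)) powr p" using pq by (intro powr_mono2) auto
      then show "norm (norm (y t - s i t) powr p) \<le> 3 powr p * norm (y t) powr p" by (simp add: powr_mult)
    qed
    show "(\<lambda>t. norm (y t - s i t) powr p) \<in> borel_measurable (ivl a b)" for i
      using Lp_fun_measurable[OF y] sm[of i] by measurable
  qed simp
  then have "(\<lambda>i. \<integral>t. norm (y t - s i t) powr p \<partial>ivl a b) \<longlonglongrightarrow> 0" by simp
  from order_tendstoD(2)[OF this \<delta>] obtain i where "(\<integral>t. norm (y t - s i t) powr p \<partial>ivl a b) < \<delta>"
    by (auto simp: eventually_sequentially)
  then show "\<exists>z. Lp_fun p {a<..<b} z \<and> averages_well a b z \<and> (\<integral>t. norm (y t - z t) powr p \<partial>ivl a b) \<le> \<delta>"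
    using sl[of i] by (intro exI[of _ "s i"]) auto
qed

end

section \<open>The energy identity\<close>

lemma weak_derivD:
  "weak_deriv emb a b x w \<Longrightarrow> a \<le> s \<Longrightarrow> s \<le> t \<Longrightarrow> t \<le> b \<Longrightarrow>
    (\<integral>r. blinfun_apply (w r) v \<partial>ivl s t) = (x t - x s) \<bullet> blinfun_apply emb v"
  by (simp add: weak_deriv_def)

lemma weak_deriv_mono: "weak_deriv emb a b x w \<Longrightarrow> a \<le> c \<Longrightarrow> d \<le> b \<Longrightarrow> weak_deriv emb c d x w"
  by (simp add: weak_deriv_def)

text \<open>The window is clipped to [a,b] by min and max; the averaged derivative is then an
  increment of \<open>x\<close> between points of the interval, divided by 2h.\<close>

lemma window_inner_integral:
  assumes "weak_deriv emb a b x w" "a < s" "s < b" "h > 0"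
  shows "(\<integral>t. window h t s * blinfun_apply (w t) v \<partial>ivl a b)
    = (1 / (2 * h)) * ((x (min (s + h) b) - x (max (s - h) a)) \<bullet> blinfun_apply emb v)"
proof -
  let ?c = "max (s - h) a" and ?d = "min (s + h) b"
  have "(\<integral>t. window h t s * blinfun_apply (w t) v \<partial>ivl a b)
      = (\<integral>t. (1 / (2 * h)) * (indicator {?c<..<?d} t *\<^sub>R blinfun_apply (w t) v) \<partial>ivl a b)"
    using assms by (intro Bochner_Integration.integral_cong) (auto simp: window_def indicator_def)
  also have "\<dots> = (1 / (2 * h)) * (\<integral>t. indicator {?c<..<?d} t *\<^sub>R blinfun_apply (w t) v \<partial>ivl a b)" by simp
  also have "(\<integral>t. indicator {?c<..<?d} t *\<^sub>R blinfun_apply (w t) v \<partial>ivl a b) = (\<integral>t. blinfun_apply (w t) v \<partial>ivl ?c ?d)"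
    by (rule ivl_integral_indicator[symmetric]) auto
  also have "\<dots> = (x ?d - x ?c) \<bullet> blinfun_apply emb v"
    by (rule weak_derivD[OF assms(1)]) (use assms in auto)
  finally show ?thesis .
qed

lemma continuous_shifted_difference:
  fixes x x' :: "real \<Rightarrow> 'h::real_inner"
  assumes "a < b" "h > 0" "continuous_on {a..b} x" "continuous_on {a..b} x'"
  shows "continuous_on {a..b} (\<lambda>s. (x (min (s + h) b) - x (max (s - h) a)) \<bullet> x' s)"
  using assms(1,2)
  by (intro continuous_intros assms(4) continuous_on_compose2[OF assms(3)]) auto

lemma integral_shift_ivl:
  fixes f :: "real \<Rightarrow> real"
  assumes "continuous_on {a + h..b} f"
  shows "integral\<^sup>L (ivl a (b - h)) (\<lambda>s. f (s + h)) = integral\<^sup>L (ivl (a + h) b) f"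
proof -
  have "continuous_on {a..b - h} (\<lambda>s. f (s + h))"
    by (intro continuous_on_compose2[OF assms] continuous_intros) auto
  then have "integral\<^sup>L (ivl a (b - h)) (\<lambda>s. f (s + h)) = integral {a..b - h} (\<lambda>s. f (s + h))"
    by (rule ivl_integral_cont)
  also have "\<dots> = integral {a + h..b - h + h} f"
    using integral_shift[of a h "b - h" f] assms by (simp add: o_def)
  also have "\<dots> = integral\<^sup>L (ivl (a + h) b) f" using ivl_integral_cont[OF assms] by simp
  finally show ?thesis .
qed

text \<open>The symmetric difference makes the middle part cancel exactly and leaves two boundary
  layers. A forward difference would leave the integral of |x(s + h) - x(s)|^2 / 2, which continuity
  of \<open>x\<close> alone does not make small relative to h.\<close>

lemma telescoping_shift:
  fixes x :: "real \<Rightarrow> 'h::{real_inner, banach, second_countable_topology}"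
  assumes ab: "0 < h" "h < b - a" and x: "continuous_on {a..b} x"
  shows "(\<integral>s. (x (min (s + h) b) - x (max (s - h) a)) \<bullet> x s \<partial>ivl a b)
    = (\<integral>s. x b \<bullet> x s \<partial>ivl (b - h) b) - (\<integral>s. x a \<bullet> x s \<partial>ivl a (a + h))"
proof -
  have c1: "continuous_on {a..b} (\<lambda>s. x (min (s + h) b) \<bullet> x s)"
    using ab by (intro continuous_intros x continuous_on_compose2[OF x]) auto
  have c2: "continuous_on {a..b} (\<lambda>s. x (max (s - h) a) \<bullet> x s)"
    using ab by (intro continuous_intros x continuous_on_compose2[OF x]) auto
  have "(\<integral>s. x (min (s + h) b) \<bullet> x s \<partial>ivl a b)
      = (\<integral>s. x (min (s + h) b) \<bullet> x s \<partial>ivl a (b - h)) + (\<integral>s. x (min (s + h) b) \<bullet> x s \<partial>ivl (b - h) b)"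
    using ab by (intro ivl_integral_add continuous_integrable_ivl c1) auto
  also have "(\<integral>s. x (min (s + h) b) \<bullet> x s \<partial>ivl a (b - h)) = (\<integral>s. x (s + h) \<bullet> x s \<partial>ivl a (b - h))"
    by (intro Bochner_Integration.integral_cong) (auto simp: min_def)
  also have "(\<integral>s. x (min (s + h) b) \<bullet> x s \<partial>ivl (b - h) b) = (\<integral>s. x b \<bullet> x s \<partial>ivl (b - h) b)"
    by (intro Bochner_Integration.integral_cong) (auto simp: min_def)
  finally have 1: "(\<integral>s. x (min (s + h) b) \<bullet> x s \<partial>ivl a b)
      = (\<integral>s. x (s + h) \<bullet> x s \<partial>ivl a (b - h)) + (\<integral>s. x b \<bullet> x s \<partial>ivl (b - h) b)" .
  have "(\<integral>s. x (max (s - h) a) \<bullet> x s \<partial>ivl a b)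
      = (\<integral>s. x (max (s - h) a) \<bullet> x s \<partial>ivl a (a + h)) + (\<integral>s. x (max (s - h) a) \<bullet> x s \<partial>ivl (a + h) b)"
    using ab by (intro ivl_integral_add continuous_integrable_ivl c2) auto
  also have "(\<integral>s. x (max (s - h) a) \<bullet> x s \<partial>ivl a (a + h)) = (\<integral>s. x a \<bullet> x s \<partial>ivl a (a + h))"
    by (intro Bochner_Integration.integral_cong) (auto simp: max_def)
  also have "(\<integral>s. x (max (s - h) a) \<bullet> x s \<partial>ivl (a + h) b) = (\<integral>s. x (s - h) \<bullet> x s \<partial>ivl (a + h) b)"
    by (intro Bochner_Integration.integral_cong) (auto simp: max_def)
  also have "\<dots> = (\<integral>s. x s \<bullet> x (s + h) \<partial>ivl a (b - h))"
  proof -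
    have "continuous_on {a + h..b} (\<lambda>s. x (s - h) \<bullet> x s)"
      using ab by (intro continuous_intros continuous_on_compose2[OF x]) auto
    from integral_shift_ivl[OF this] show ?thesis by simp
  qed
  finally have 2: "(\<integral>s. x (max (s - h) a) \<bullet> x s \<partial>ivl a b)
      = (\<integral>s. x a \<bullet> x s \<partial>ivl a (a + h)) + (\<integral>s. x (s + h) \<bullet> x s \<partial>ivl a (b - h))"
    by (simp add: inner_commute)
  have "(\<integral>s. (x (min (s + h) b) - x (max (s - h) a)) \<bullet> x s \<partial>ivl a b)
      = (\<integral>s. x (min (s + h) b) \<bullet> x s \<partial>ivl a b) - (\<integral>s. x (max (s - h) a) \<bullet> x s \<partial>ivl a b)"
    unfolding inner_diff_left
    by (intro Bochner_Integration.integral_diff continuous_integrable_ivl c1 c2)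
  then show ?thesis using 1 2 by simp
qed

lemma ivl_integral_const: "c \<le> d \<Longrightarrow> (\<integral>s. k \<partial>ivl c d) = (d - c) * (k :: real)"
  by (simp add: measure_restrict_space)

lemma short_average:
  fixes f :: "real \<Rightarrow> real"
  assumes f: "continuous_on {a..b} f" and t: "t \<in> {a..b}" and e: "e > 0"
  obtains h0 where "h0 > 0"
    "\<And>c d. a \<le> c \<Longrightarrow> c \<le> d \<Longrightarrow> d \<le> b \<Longrightarrow> t - h0 < c \<Longrightarrow> d < t + h0 \<Longrightarrow>
       \<bar>(\<integral>s. f s \<partial>ivl c d) - (d - c) * f t\<bar> \<le> (d - c) * e"
proof -
  have "continuous (at t within {a..b}) f" using f t by (auto simp: continuous_on_eq_continuous_within)
  then obtain h0 where h0: "h0 > 0" "\<And>r. r \<in> {a..b} \<Longrightarrow> dist r t < h0 \<Longrightarrow> dist (f r) (f t) < e"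
    unfolding continuous_within_eps_delta using e by metis
  show ?thesis
  proof (rule that[OF h0(1)])
    fix c d assume cd: "a \<le> c" "c \<le> d" "d \<le> b" "t - h0 < c" "d < t + h0"
    have i: "integrable (ivl c d) f"
      by (rule continuous_integrable_ivl) (use cd in \<open>auto intro: continuous_on_subset[OF f]\<close>)
    have "(\<integral>s. f s \<partial>ivl c d) - (d - c) * f t = (\<integral>s. f s - f t \<partial>ivl c d)"
      using i ivl_integral_const[OF cd(2), of "f t"] by (simp del: lebesgue_integral_const)
    also have "norm \<dots> \<le> (\<integral>s. e \<partial>ivl c d)"
    proof (rule norm_integral_le)
      show "AE s in ivl c d. norm (f s - f t) \<le> e"
      proof (rule AE_I2)
        fix s assume "s \<in> space (ivl c d)"
        then have "dist (f s) (f t) < e" using cd by (intro h0) (auto simp: dist_real_def)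
        then show "norm (f s - f t) \<le> e" by (simp add: dist_real_def)
      qed
    qed (use i in auto)
    also have "\<dots> = (d - c) * e" by (rule ivl_integral_const[OF cd(2)])
    finally show "\<bar>(\<integral>s. f s \<partial>ivl c d) - (d - c) * f t\<bar> \<le> (d - c) * e" by simp
  qed
qed

context conjugate_exponents
begin

text \<open>Fubini with the integration in t done first: it acts on \<open>w\<close> alone and turns
  it into increments of \<open>x\<close>, tested with the fixed vector y(s).\<close>

lemma window_pairing_eq:
  fixes w :: "real \<Rightarrow> 'v::{banach, second_countable_topology} \<Rightarrow>\<^sub>L real"
    and emb :: "'v \<Rightarrow>\<^sub>L 'h::{real_inner, banach, second_countable_topology}"
  assumes ab: "a < b" and w: "weak_Lq q {a<..<b} w" and y: "Lp_fun p {a<..<b} y"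
    and x: "continuous_on {a..b} x" "weak_deriv emb a b x w"
    and x': "continuous_on {a..b} x'" "AE t in ivl a b. x' t = emb (y t)" and h: "h > 0"
  shows "window_pairing a b h w y
    = (1 / (2 * h)) * (\<integral>s. (x (min (s + h) b) - x (max (s - h) a)) \<bullet> x' s \<partial>ivl a b)"
proof -
  interpret P: pair_sigma_finite "ivl a b" "ivl a b" by (rule pair_sigma_finite_ivl)
  have i: "integrable (ivl a b \<Otimes>\<^sub>M ivl a b) (\<lambda>(t, s). window h t s * w t (y s))"
    by (rule window_pairing_bound(1)[OF w y h zero_le_one zero_le_one one_Young])
  note c = continuous_shifted_difference[OF ab h x(1) x'(1)]
  have "window_pairing a b h w y = (\<integral>s. (\<integral>t. window h t s * w t (y s) \<partial>ivl a b) \<partial>ivl a b)"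
    using P.integral_snd[OF i] by simp
  also have "\<dots> = (\<integral>s. (1 / (2 * h)) * ((x (min (s + h) b) - x (max (s - h) a)) \<bullet> x' s) \<partial>ivl a b)"
  proof (rule integral_cong_AE)
    show "(\<lambda>s. \<integral>t. window h t s * w t (y s) \<partial>ivl a b) \<in> borel_measurable (ivl a b)"
      using P.integrable_snd[OF i] by (rule borel_measurable_integrable)
    show "(\<lambda>s. (1 / (2 * h)) * ((x (min (s + h) b) - x (max (s - h) a)) \<bullet> x' s)) \<in> borel_measurable (ivl a b)"
      using continuous_measurable_ivl[OF c] by (intro borel_measurable_times) auto
    show "AE s in ivl a b. (\<integral>t. window h t s * w t (y s) \<partial>ivl a b)
        = (1 / (2 * h)) * ((x (min (s + h) b) - x (max (s - h) a)) \<bullet> x' s)"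
      using x'(2) AE_space[of "ivl a b"]
    proof eventually_elim
      case (elim s)
      then have "a < s" "s < b" by auto
      from window_inner_integral[OF x(2) this h, of "y s"] show ?case using elim by simp
    qed
  qed
  also have "\<dots> = (1 / (2 * h)) * (\<integral>s. (x (min (s + h) b) - x (max (s - h) a)) \<bullet> x' s \<partial>ivl a b)"
    by simp
  finally show ?thesis .
qed

text \<open>\<open>averages_well\<close> fixes \<open>h\<close> once for all \<open>wn n\<close>.
  With \<open>h\<close> fixed, the averaged pairing is a continuous expression in
  \<open>xn n\<close> and passes to the uniform limit, where the telescoped boundary layers average
  to the squared norms at the ends. The final factor 1/2 comes from the kernel height 1/(2h) against
  layers of length h.\<close>

lemma pairing_limit:
  fixes wn :: "nat \<Rightarrow> real \<Rightarrow> 'v::{banach, second_countable_topology} \<Rightarrow>\<^sub>L real"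
    and emb :: "'v \<Rightarrow>\<^sub>L 'h::{real_inner, banach, second_countable_topology}"
  assumes ab: "a < b" and x: "continuous_on {a..b} x" and y: "Lp_fun p {a<..<b} y"
    and xy: "AE t in ivl a b. x t = emb (y t)"
    and xn: "\<And>n. continuous_on {a..b} (xn n)" "\<And>n. weak_deriv emb a b (xn n) (wn n)"
    and wn: "\<And>n. weak_Lq q {a<..<b} (wn n)" "\<And>n. (\<integral>t. norm (wn n t) powr q \<partial>ivl a b) \<le> K"
    and lim: "uniform_limit {a..b} xn x sequentially"
  shows "(\<lambda>n. \<integral>t. wn n t (y t) \<partial>ivl a b) \<longlonglongrightarrow> ((norm (x b))\<^sup>2 - (norm (x a))\<^sup>2) / 2"
proof (rule LIMSEQ_I)
  fix e :: real assume e: "e > 0"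
  then have e8: "e / 8 > 0" by simp
  have "0 \<le> (\<integral>t. norm (wn 0 t) powr q \<partial>ivl a b)" by (rule Bochner_Integration.integral_nonneg) simp
  then have K: "K \<ge> 0" using wn(2)[of 0] by linarith
  obtain h1 where h1: "h1 > 0" "\<And>h w. 0 < h \<Longrightarrow> h < h1 \<Longrightarrow> weak_Lq q {a<..<b} w \<Longrightarrow>
       (\<integral>t. norm (w t) powr q \<partial>ivl a b) \<le> K \<Longrightarrow>
       \<bar>window_pairing a b h w y - (\<integral>t. w t (y t) \<partial>ivl a b)\<bar> \<le> e/8"
    by (rule averages_wellD[OF averages_well_Lp[OF ab y] K e8]) (rule that)
  have cb: "continuous_on {a..b} (\<lambda>s. x b \<bullet> x s)" and ca: "continuous_on {a..b} (\<lambda>s. x a \<bullet> x s)"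
    by (intro continuous_intros x)+
  obtain h2 where h2: "h2 > 0" "\<And>c d. a \<le> c \<Longrightarrow> c \<le> d \<Longrightarrow> d \<le> b \<Longrightarrow> b - h2 < c \<Longrightarrow> d < b + h2 \<Longrightarrow>
       \<bar>(\<integral>s. x b \<bullet> x s \<partial>ivl c d) - (d - c) * (x b \<bullet> x b)\<bar> \<le> (d - c) * (e/8)"
    by (rule short_average[OF cb _ e8, of b]) (use ab that in auto)
  obtain h3 where h3: "h3 > 0" "\<And>c d. a \<le> c \<Longrightarrow> c \<le> d \<Longrightarrow> d \<le> b \<Longrightarrow> a - h3 < c \<Longrightarrow> d < a + h3 \<Longrightarrow>
       \<bar>(\<integral>s. x a \<bullet> x s \<partial>ivl c d) - (d - c) * (x a \<bullet> x a)\<bar> \<le> (d - c) * (e/8)"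
    by (rule short_average[OF ca _ e8, of a]) (use ab that in auto)
  define h where "h = min (min h1 h2) (min h3 (b - a)) / 2"
  have h: "0 < h" "h < h1" "h < h2" "h < h3" "h < b - a"
    using h1(1) h2(1) h3(1) ab by (auto simp: h_def)
  let ?J = "\<lambda>x'. (\<integral>s. (x' (min (s + h) b) - x' (max (s - h) a)) \<bullet> x s \<partial>ivl a b)"
  define Jb where "Jb = (\<integral>s. x b \<bullet> x s \<partial>ivl (b - h) b)"
  define Ja where "Ja = (\<integral>s. x a \<bullet> x s \<partial>ivl a (a + h))"
  have Jx: "?J x = Jb - Ja" unfolding Jb_def Ja_def by (rule telescoping_shift[OF h(1,5) x])
  have b2: "\<bar>Jb - h * (x b \<bullet> x b)\<bar> \<le> h * (e/8)"
    using h2(2)[of "b - h" b] h ab by (simp add: Jb_def)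
  have b3: "\<bar>Ja - h * (x a \<bullet> x a)\<bar> \<le> h * (e/8)"
    using h3(2)[of a "a + h"] h ab by (simp add: Ja_def)
  have lim1: "\<bar>(1 / (2 * h)) * ?J x - ((norm (x b))\<^sup>2 - (norm (x a))\<^sup>2) / 2\<bar> \<le> e/8"
  proof -
    have "(1 / (2 * h)) * ?J x - ((norm (x b))\<^sup>2 - (norm (x a))\<^sup>2) / 2
        = (1 / (2 * h)) * ((Jb - h * (x b \<bullet> x b)) - (Ja - h * (x a \<bullet> x a)))"
      unfolding Jx power2_norm_eq_inner using h(1) by (simp add: field_simps)
    then have "\<bar>(1 / (2 * h)) * ?J x - ((norm (x b))\<^sup>2 - (norm (x a))\<^sup>2) / 2\<bar>
        = (1 / (2 * h)) * \<bar>(Jb - h * (x b \<bullet> x b)) - (Ja - h * (x a \<bullet> x a))\<bar>"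
      using h(1) by (simp only: abs_mult) simp
    also have "\<dots> \<le> (1 / (2 * h)) * (2 * (h * (e/8)))"
    proof (rule mult_left_mono)
      show "\<bar>(Jb - h * (x b \<bullet> x b)) - (Ja - h * (x a \<bullet> x a))\<bar> \<le> 2 * (h * (e/8))"
        using b2 b3 by linarith
    qed (use h(1) in simp)
    also have "\<dots> = e/8" using h(1) by simp
    finally show ?thesis .
  qed
  obtain B where B: "\<And>t. t \<in> {a..b} \<Longrightarrow> norm (x t) \<le> B"
    using compact_imp_bounded[OF compact_continuous_image[OF x compact_Icc]] unfolding bounded_iff by blast
  have B0: "B \<ge> 0"
  proof -
    have "norm (x a) \<le> B" using B[of a] ab by simp
    then show ?thesis using norm_ge_zero[of "x a"] by linarith
  qed
  \<comment> \<open>The closeness demanded of \<open>xn n\<close> compensates 1/(2h), which is a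
    constant by now; the final errors are e/8 for the window, e/4 for this replacement and e/8 for
    the boundary layers.\<close>
  define \<eta> where "\<eta> = e * h / (4 * (B + 1) * (b - a))"
  have \<eta>: "\<eta> > 0" using e h(1) B0 ab by (simp add: \<eta>_def)
  have \<eta>B: "(1 / (2 * h)) * ((b - a) * (2 * \<eta> * B)) \<le> e/4"
  proof -
    have "(1 / (2 * h)) * ((b - a) * (2 * \<eta> * B)) \<le> (1 / (2 * h)) * ((b - a) * (2 * \<eta> * (B + 1)))"
      using h(1) ab \<eta> by (intro mult_left_mono) auto
    also have "\<dots> = e/4"
    proof -
      have "B + 1 \<noteq> 0" "b - a \<noteq> 0" "h \<noteq> 0" using B0 ab h by linarith+
      then show ?thesis by (simp add: \<eta>_def divide_simps)
    qed
    finally show ?thesis .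
  qed
  obtain N where N: "\<And>n t. n \<ge> N \<Longrightarrow> t \<in> {a..b} \<Longrightarrow> dist (xn n t) (x t) < \<eta>"
    using uniform_limitD[OF lim \<eta>] unfolding eventually_sequentially by blast
  show "\<exists>N. \<forall>n\<ge>N. norm ((\<integral>t. wn n t (y t) \<partial>ivl a b) - ((norm (x b))\<^sup>2 - (norm (x a))\<^sup>2) / 2) < e"
  proof (intro exI allI impI)
    fix n assume n: "n \<ge> N"
    have 1: "\<bar>window_pairing a b h (wn n) y - (\<integral>t. wn n t (y t) \<partial>ivl a b)\<bar> \<le> e/8"
      by (rule h1(2)[OF h(1,2) wn])
    note weq = window_pairing_eq[OF ab wn(1) y xn(1) xn(2) x xy h(1), of n]
    have i: "integrable (ivl a b) (\<lambda>s. (x' (min (s + h) b) - x' (max (s - h) a)) \<bullet> x s)"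
      if "continuous_on {a..b} x'" for x'
      by (rule continuous_integrable_ivl[OF continuous_shifted_difference[OF ab h(1) that x]])
    have "?J (xn n) - ?J x = (\<integral>s. (xn n (min (s + h) b) - xn n (max (s - h) a)) \<bullet> x s
        - (x (min (s + h) b) - x (max (s - h) a)) \<bullet> x s \<partial>ivl a b)"
      by (rule Bochner_Integration.integral_diff[OF i[OF xn(1)] i[OF x], symmetric])
    also have "norm \<dots> \<le> (\<integral>s. 2 * \<eta> * B \<partial>ivl a b)"
    proof (rule norm_integral_le[OF Bochner_Integration.integrable_diff[OF i[OF xn(1)] i[OF x]]])
      show "AE s in ivl a b. norm ((xn n (min (s + h) b) - xn n (max (s - h) a)) \<bullet> x s
        - (x (min (s + h) b) - x (max (s - h) a)) \<bullet> x s) \<le> 2 * \<eta> * B"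
      proof (rule AE_I2)
        fix s assume "s \<in> space (ivl a b)"
        then have s: "s \<in> {a..b}" "min (s + h) b \<in> {a..b}" "max (s - h) a \<in> {a..b}" using h by auto
        have eq: "(xn n (min (s + h) b) - xn n (max (s - h) a)) \<bullet> x s - (x (min (s + h) b) - x (max (s - h) a)) \<bullet> x s
          = ((xn n (min (s + h) b) - x (min (s + h) b)) - (xn n (max (s - h) a) - x (max (s - h) a))) \<bullet> x s"
          by (simp add: inner_diff_left)
        have "norm (((xn n (min (s + h) b) - x (min (s + h) b)) - (xn n (max (s - h) a) - x (max (s - h) a))) \<bullet> x s)
          \<le> norm ((xn n (min (s + h) b) - x (min (s + h) b)) - (xn n (max (s - h) a) - x (max (s - h) a))) * norm (x s)"
          by (simp add: Cauchy_Schwarz_ineq2)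
        also have "\<dots> \<le> (2 * \<eta>) * B"
        proof (rule mult_mono)
          show "norm ((xn n (min (s + h) b) - x (min (s + h) b)) - (xn n (max (s - h) a) - x (max (s - h) a))) \<le> 2 * \<eta>"
            using N[OF n s(2)] N[OF n s(3)]
              norm_triangle_ineq4[of "xn n (min (s + h) b) - x (min (s + h) b)" "xn n (max (s - h) a) - x (max (s - h) a)"]
            unfolding dist_norm by linarith
        qed (use B[OF s(1)] \<eta> in auto)
        finally show "norm ((xn n (min (s + h) b) - xn n (max (s - h) a)) \<bullet> x s
          - (x (min (s + h) b) - x (max (s - h) a)) \<bullet> x s) \<le> 2 * \<eta> * B" unfolding eq .
      qed
    qed simp
    also have "\<dots> = (b - a) * (2 * \<eta> * B)" by (rule ivl_integral_const) (use ab in simp)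
    finally have "(1 / (2 * h)) * \<bar>?J (xn n) - ?J x\<bar> \<le> (1 / (2 * h)) * ((b - a) * (2 * \<eta> * B))"
      using h(1) by (intro mult_left_mono) auto
    moreover have "\<bar>(1 / (2 * h)) * ?J (xn n) - (1 / (2 * h)) * ?J x\<bar> = (1 / (2 * h)) * \<bar>?J (xn n) - ?J x\<bar>"
      using h(1) by (simp only: right_diff_distrib[symmetric] abs_mult) simp
    ultimately have 2: "\<bar>(1 / (2 * h)) * ?J (xn n) - (1 / (2 * h)) * ?J x\<bar> \<le> e/4" using \<eta>B by linarith
    show "norm ((\<integral>t. wn n t (y t) \<partial>ivl a b) - ((norm (x b))\<^sup>2 - (norm (x a))\<^sup>2) / 2) < e"
      using 1[unfolded weq] 2 lim1 e unfolding real_norm_def by linarith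
  qed
qed

text \<open>The constant sequence in \<open>pairing_limit\<close>: the pairing does not depend on n
  and therefore equals its limit.\<close>

lemma energy_identity:
  fixes w :: "real \<Rightarrow> 'v::{banach, second_countable_topology} \<Rightarrow>\<^sub>L real"
    and emb :: "'v \<Rightarrow>\<^sub>L 'h::{real_inner, banach, second_countable_topology}"
  assumes ab: "a \<le> b" and x: "continuous_on {a..b} x" and y: "Lp_fun p {a<..<b} y"
    and xy: "AE t in ivl a b. x t = emb (y t)"
    and w: "weak_deriv emb a b x w" "weak_Lq q {a<..<b} w"
  shows "(norm (x b))\<^sup>2 - (norm (x a))\<^sup>2 = 2 * (\<integral>t. w t (y t) \<partial>ivl a b)"
proof (cases "a = b")
  case True
  then show ?thesis by (simp add: integral_restrict_space)
next
  case False
  then have "a < b" using ab by simp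
  from pairing_limit[OF this x y xy x w(1) w(2) order_refl] have
    "(\<lambda>n::nat. \<integral>t. w t (y t) \<partial>ivl a b) \<longlonglongrightarrow> ((norm (x b))\<^sup>2 - (norm (x a))\<^sup>2) / 2"
    by (simp add: uniform_limit_const)
  then show ?thesis by (simp add: LIMSEQ_const_iff)
qed

text \<open>Pairing \<open>w\<close> with sgn(w t v) v gives the integral of |w t v|. Its window
  averages are built from increments of the zero path, hence vanish for every \<open>h\<close>.
  Countably many \<open>v\<close> then suffice for one null set.\<close>

lemma weak_deriv_zero:
  fixes w :: "real \<Rightarrow> 'v::{banach, second_countable_topology} \<Rightarrow>\<^sub>L real"
    and emb :: "'v \<Rightarrow>\<^sub>L 'h::{real_inner, banach, second_countable_topology}"
  assumes ab: "a < b" and w: "weak_deriv emb a b (\<lambda>_. 0) w" "weak_Lq q {a<..<b} w"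
  shows "AE t in ivl a b. w t = 0"
proof -
  interpret P: pair_sigma_finite "ivl a b" "ivl a b" by (rule pair_sigma_finite_ivl)
  have ae: "AE t in ivl a b. w t v = 0" for v
  proof -
    have wm: "(\<lambda>t. w t v) \<in> borel_measurable (ivl a b)" by (rule weak_Lq_measurable[OF w(2)])
    define y where "y = (\<lambda>t. sgn (w t v) *\<^sub>R v)"
    have "y \<in> borel_measurable (ivl a b)" unfolding y_def sgn_real_def
      using wm by measurable
    then have y: "Lp_fun p {a<..<b} y"
      by (rule Lp_fun_bounded[of _ _ _ "norm v"]) (auto simp: y_def sgn_real_def)
    have z: "window_pairing a b h w y = 0" if h: "h > 0" for h
    proof -
      have i: "integrable (ivl a b \<Otimes>\<^sub>M ivl a b) (\<lambda>(t, s). window h t s * w t (y s))"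
        by (rule window_pairing_bound(1)[OF w(2) y h zero_le_one zero_le_one one_Young])
      have "window_pairing a b h w y = (\<integral>s. (\<integral>t. window h t s * w t (y s) \<partial>ivl a b) \<partial>ivl a b)"
        using P.integral_snd[OF i] by simp
      also have "\<dots> = (\<integral>s. 0 \<partial>ivl a b)"
        by (rule Bochner_Integration.integral_cong) (use window_inner_integral[OF w(1) _ _ h] in auto)
      finally show ?thesis by simp
    qed
    have "\<bar>\<integral>t. w t (y t) \<partial>ivl a b\<bar> \<le> e" if e: "e > 0" for e
    proof -
      have K: "(\<integral>t. norm (w t) powr q \<partial>ivl a b) \<ge> 0" by (rule Bochner_Integration.integral_nonneg) simp
      obtain h1 where h1: "h1 > 0" "\<And>h w'. 0 < h \<Longrightarrow> h < h1 \<Longrightarrow> weak_Lq q {a<..<b} w' \<Longrightarrow>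
           (\<integral>t. norm (w' t) powr q \<partial>ivl a b) \<le> (\<integral>t. norm (w t) powr q \<partial>ivl a b) \<Longrightarrow>
           \<bar>window_pairing a b h w' y - (\<integral>t. w' t (y t) \<partial>ivl a b)\<bar> \<le> e"
        by (rule averages_wellD[OF averages_well_Lp[OF ab y] K e]) (rule that)
      have "h1/2 > 0" "h1/2 < h1" using h1(1) by auto
      from h1(2)[OF this w(2) order_refl] z[OF this(1)] show ?thesis by simp
    qed
    then have "(\<integral>t. w t (y t) \<partial>ivl a b) = 0" by (meson abs_le_zero_iff dense_ge)
    moreover have "w t (y t) = \<bar>w t v\<bar>" for t
      by (simp add: y_def blinfun.scaleR_right abs_sgn mult.commute)
    ultimately have "(\<integral>t. \<bar>w t v\<bar> \<partial>ivl a b) = 0" by simp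
    moreover have "integrable (ivl a b) (\<lambda>t. \<bar>w t v\<bar>)"
      using weak_Lq_integrable_apply[OF less_imp_le[OF pq(2)] w(2)] by simp
    ultimately show ?thesis using integral_nonneg_eq_0_iff_AE[of "ivl a b" "\<lambda>t. \<bar>w t v\<bar>"] by simp
  qed
  obtain D :: "'v set" where D: "countable D" "\<And>X. open X \<Longrightarrow> X \<noteq> {} \<Longrightarrow> \<exists>d\<in>D. d \<in> X"
    using countable_dense_setE by blast
  have "AE t in ivl a b. \<forall>v\<in>D. w t v = 0" using D(1) ae by (simp add: AE_ball_countable)
  then show ?thesis
  proof eventually_elim
    case (elim t)
    show ?case
    proof (rule ccontr)
      assume "w t \<noteq> 0"
      then obtain v where "w t v \<noteq> 0" by (metis blinfun_eqI zero_blinfun.rep_eq)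
      then have "{v. w t v \<noteq> 0} \<noteq> {}" by blast
      moreover have "open {v. w t v \<noteq> 0}" by (intro open_Collect_neq continuous_intros)
      ultimately obtain d where "d \<in> D" "w t d \<noteq> 0" using D(2) by blast
      then show False using elim by simp
    qed
  qed
qed

end

section \<open>Monotone hemicontinuous maps\<close>

text \<open>Monotonicity between y_k and y + s v, divided by s, bounds B(y_k) v from above by B(y +
  s v) v plus terms that vanish as k grows; hemicontinuity handles small s. The lower bound is the
  same statement for -v.\<close>

lemma Minty_trick:
  fixes B :: "'v::real_normed_vector \<Rightarrow> 'v \<Rightarrow>\<^sub>L real"
  assumes mono: "\<And>x y. blinfun_apply (B x - B y) (x - y) \<ge> 0"
    and hemi: "\<And>x y v. continuous_on {0..1} (\<lambda>s. blinfun_apply (B (x + s *\<^sub>R y)) v)"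
    and weak: "\<And>g :: 'v \<Rightarrow>\<^sub>L real. (\<lambda>k. blinfun_apply g (yk k)) \<longlonglongrightarrow> blinfun_apply g y"
    and lim: "(\<lambda>k. blinfun_apply (B (yk k)) (yk k - y)) \<longlonglongrightarrow> 0"
  shows "(\<lambda>k. blinfun_apply (B (yk k)) v) \<longlonglongrightarrow> blinfun_apply (B y) v"
proof -
  have upper: "\<forall>\<^sub>F k in sequentially. B (yk k) v < B y v + e" if e: "e > 0" for v e
  proof -
    have "continuous (at 0 within {0..1}) (\<lambda>s. B (y + s *\<^sub>R v) v)"
      using hemi[of y v v] by (auto simp: continuous_on_eq_continuous_within)
    then obtain d where d: "d > 0" "\<And>s. s \<in> {0..1} \<Longrightarrow> dist s 0 < d \<Longrightarrow> dist (B (y + s *\<^sub>R v) v) (B (y + 0 *\<^sub>R v) v) < e/2"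
      unfolding continuous_within_eps_delta using e by (metis half_gt_zero)
    define s where "s = min (d/2) 1"
    have s: "s > 0" "s \<le> 1" "s < d" using d(1) by (auto simp: s_def)
    then have "dist (B (y + s *\<^sub>R v) v) (B (y + 0 *\<^sub>R v) v) < e/2" by (intro d(2)) auto
    then have Bs: "B (y + s *\<^sub>R v) v < B y v + e/2" unfolding dist_real_def scaleR_zero_left add_0_right by linarith
    have le: "B (yk k) v \<le> (B (yk k) (yk k - y) - B (y + s *\<^sub>R v) (yk k - y)) / s + B (y + s *\<^sub>R v) v" for k
    proof -
      have "0 \<le> (B (yk k) - B (y + s *\<^sub>R v)) (yk k - (y + s *\<^sub>R v))" by (rule mono)
      also have "\<dots> = B (yk k) (yk k - y) - s * B (yk k) v - B (y + s *\<^sub>R v) (yk k - y) + s * B (y + s *\<^sub>R v) v"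
        by (simp add: blinfun.diff_left blinfun.diff_right blinfun.add_right blinfun.scaleR_right algebra_simps)
      finally have "s * B (yk k) v \<le> (B (yk k) (yk k - y) - B (y + s *\<^sub>R v) (yk k - y)) + s * B (y + s *\<^sub>R v) v" by linarith
      then show ?thesis using s(1) by (simp add: field_simps)
    qed
    have "(\<lambda>k. B (y + s *\<^sub>R v) (yk k) - B (y + s *\<^sub>R v) y) \<longlonglongrightarrow> B (y + s *\<^sub>R v) y - B (y + s *\<^sub>R v) y"
      by (intro tendsto_diff weak tendsto_const)
    then have w0: "(\<lambda>k. B (y + s *\<^sub>R v) (yk k - y)) \<longlonglongrightarrow> 0" by (simp add: blinfun.diff_right)
    have "(\<lambda>k. (B (yk k) (yk k - y) - B (y + s *\<^sub>R v) (yk k - y)) / s + B (y + s *\<^sub>R v) v) \<longlonglongrightarrow> (0 - 0) / s + B (y + s *\<^sub>R v) v"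
      by (intro tendsto_intros lim w0) (use s in simp)
    then have "\<forall>\<^sub>F k in sequentially. (B (yk k) (yk k - y) - B (y + s *\<^sub>R v) (yk k - y)) / s + B (y + s *\<^sub>R v) v < B y v + e"
      by (rule order_tendstoD) (use Bs e in simp)
    then show ?thesis by eventually_elim (use le in \<open>auto intro: le_less_trans\<close>)
  qed
  show ?thesis
  proof (rule tendstoI)
    fix e :: real assume e: "e > 0"
    from upper[OF e, of v] upper[OF e, of "- v"] show "\<forall>\<^sub>F k in sequentially. dist (B (yk k) v) (B y v) < e"
      by eventually_elim (simp add: dist_real_def blinfun.minus_right)
  qed
qed

section \<open>The evolution equation and its solutions\<close>

locale evolution =
  fixes T p q :: real
    and emb :: "'v::{banach, second_countable_topology} \<Rightarrow>\<^sub>L 'h::{real_inner, banach, second_countable_topology}"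
    and A :: "real \<Rightarrow> 'v \<Rightarrow> ('v \<Rightarrow>\<^sub>L real)"
  assumes T: "T > 0" and p2: "p \<ge> 2" and q1: "q > 1" and conj: "1 / p + 1 / q = 1"
    and refl: "reflexive_space TYPE('v)"
    and emb: "compact_dense_embedding emb"
    and A: "admissible_operator T p q A"

sublocale evolution \<subseteq> conjugate_exponents p q
  using p2 q1 conj by unfold_locales auto

context evolution
begin

lemma inj_emb: "inj (blinfun_apply emb)"
  and dense_emb: "closure (range (blinfun_apply emb)) = UNIV"
  and compact_emb: "bounded B \<Longrightarrow> compact (closure (blinfun_apply emb ` B))"
  using emb by (auto simp: compact_dense_embedding_def)

lemma AE_subinterval:
  assumes "AE t in lebesgue_on {0..T}. P t" "0 \<le> t0"
  shows "AE t in ivl t0 T. P t"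
  using assms(1) unfolding AE_restrict_space_iff[of "{0..T}" lebesgue, simplified]
    AE_restrict_space_iff[of "{t0<..<T}" lebesgue, simplified]
  by (rule AE_mp) (use assms(2) in auto)

lemma A_monotone: "0 \<le> t0 \<Longrightarrow> AE t in ivl t0 T. \<forall>x y. blinfun_apply (A t x - A t y) (x - y) \<ge> 0"
  using A unfolding admissible_operator_def by (intro AE_subinterval) auto

lemma A_hemicontinuous:
  "0 \<le> t0 \<Longrightarrow> AE t in ivl t0 T. \<forall>x y v. continuous_on {0..1} (\<lambda>s. blinfun_apply (A t (x + s *\<^sub>R y)) v)"
  using A unfolding admissible_operator_def by (intro AE_subinterval) auto

lemma A_growth:
  obtains a1 c1 where "c1 \<ge> 0" "\<And>t. a1 t \<ge> 0" "\<And>t0. 0 \<le> t0 \<Longrightarrow> Lp_fun q {t0<..<T} a1"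
    "\<And>t0. 0 \<le> t0 \<Longrightarrow> AE t in ivl t0 T. \<forall>x. norm (A t x) \<le> a1 t + c1 * norm x powr (p - 1)"
proof -
  obtain a1 :: "real \<Rightarrow> real" and c1 where a1: "c1 \<ge> 0" "Lp_fun q {0<..<T} a1"
    "AE t in lebesgue_on {0..T}. \<forall>x. norm (A t x) \<le> a1 t + c1 * norm x powr (p - 1)"
    using A unfolding admissible_operator_def by auto
  show ?thesis
  proof (rule that[of c1 "\<lambda>t. \<bar>a1 t\<bar>"])
    fix t0 :: real assume t0: "0 \<le> t0"
    have "Lp_fun q {t0<..<T} a1" by (rule Lp_fun_mono[OF a1(2) t0 order_refl])
    then show "Lp_fun q {t0<..<T} (\<lambda>t. \<bar>a1 t\<bar>)" by (auto simp: Lp_fun_def)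
    show "AE t in ivl t0 T. \<forall>x. norm (A t x) \<le> \<bar>a1 t\<bar> + c1 * norm x powr (p - 1)"
      using AE_subinterval[OF a1(3) t0]
    proof eventually_elim
      case (elim t)
      show ?case
      proof
        fix x show "norm (A t x) \<le> \<bar>a1 t\<bar> + c1 * norm x powr (p - 1)"
          using elim[rule_format, of x] by linarith
      qed
    qed
  qed (use a1 in auto)
qed

lemma A_coercive:
  obtains c2 where "c2 > 0" "\<And>t0. 0 \<le> t0 \<Longrightarrow> AE t in ivl t0 T. \<forall>x. blinfun_apply (A t x) x \<ge> c2 * norm x powr p"
proof -
  obtain c2 where c2: "c2 > 0" "AE t in lebesgue_on {0..T}. \<forall>x. blinfun_apply (A t x) x \<ge> c2 * norm x powr p"
    using A unfolding admissible_operator_def by blast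
  show ?thesis by (rule that[OF c2(1) AE_subinterval[OF c2(2)]])
qed

text \<open>This turns the growth of order p - 1 into a bound in L^q: the q-th power of |y|^(p - 1)
  is |y|^p.\<close>

lemma pm1_q: "(p - 1) * q = p"
  using pq by (simp add: field_simps)

text \<open>\<open>solves_evolution\<close> with its witnesses exposed and with the measurability
  and derivative of \<open>w\<close> in weak form; for a path continuous on [t0,T] the two agree by
  \<open>solves_evolution_iff\<close>.\<close>

definition sol :: "real \<Rightarrow> (real \<Rightarrow> 'h) \<Rightarrow> (real \<Rightarrow> 'h) \<Rightarrow> (real \<Rightarrow> 'v) \<Rightarrow> (real \<Rightarrow> 'v \<Rightarrow>\<^sub>L real) \<Rightarrow> bool" where
  "sol t0 x f y w \<longleftrightarrow> Lp_fun 2 {t0<..<T} f \<and> Lp_fun p {t0<..<T} y \<and> weak_Lq q {t0<..<T} w \<and>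
     (AE t in ivl t0 T. x t = emb (y t)) \<and> weak_deriv emb t0 T x w \<and>
     (AE t in ivl t0 T. w t + A t (y t) = to_dual emb (f t))"

lemma solD:
  assumes "sol t0 x f y w"
  shows "Lp_fun 2 {t0<..<T} f" "Lp_fun p {t0<..<T} y" "weak_Lq q {t0<..<T} w"
    "AE t in ivl t0 T. x t = emb (y t)" "weak_deriv emb t0 T x w"
    "AE t in ivl t0 T. w t + A t (y t) = to_dual emb (f t)"
  using assms unfolding sol_def by blast+

lemma measurable_emb: "y \<in> borel_measurable M \<Longrightarrow> (\<lambda>t. emb (y t)) \<in> borel_measurable M"
  by (rule borel_measurable_continuous_on[of "blinfun_apply emb"]) (intro continuous_intros)

lemma Lp_fun_dual_iff: "Lp_fun q S w \<longleftrightarrow> weak_Lq q S (w :: real \<Rightarrow> 'v \<Rightarrow>\<^sub>L real)"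
proof
  assume w: "weak_Lq q S w"
  obtain D :: "('v \<Rightarrow>\<^sub>L real) set" where D: "countable D" "\<And>g e. e > 0 \<Longrightarrow> \<exists>d\<in>D. dist d g < e"
    using dual_countable_dense[OF refl inj_emb] by blast
  show "Lp_fun q S w"
    unfolding Lp_fun_def
  proof
    show "w \<in> borel_measurable (lebesgue_on S)"
      by (rule measurable_dual_valued[OF D(1)]) (erule D(2), rule weak_Lq_measurable[OF w])
  qed (rule weak_Lq_integrable[OF w])
qed (rule Lp_fun_imp_weak_Lq)

lemma solves_evolution_iff:
  assumes t0: "t0 < T" and x: "continuous_on {t0..T} x"
  shows "solves_evolution T p q emb A t0 x f \<longleftrightarrow> (\<exists>y w. sol t0 x f y w)"
proof -
  have "generalized_derivative emb t0 T y w \<longleftrightarrow> weak_deriv emb t0 T x w"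
    if "Lp_fun p {t0<..<T} y" "weak_Lq q {t0<..<T} w" "AE t in ivl t0 T. x t = emb (y t)" for y w
    by (rule generalized_derivative_iff[OF t0 x that(3)
      weak_Lq_integrable_apply[OF less_imp_le[OF q1] that(2)] measurable_emb[OF Lp_fun_measurable[OF that(1)]]])
  then show ?thesis
    unfolding solves_evolution_def W_pq_deriv_def sol_def Lp_fun_dual_iff by blast
qed

text \<open>Up to null sets, \<open>x\<close> determines its derivative \<open>w\<close>, and
  \<open>y\<close> by injectivity of \<open>emb\<close>; the equation then determines f, as
  \<open>to_dual\<close> is injective by density. Hence the arbitrary choice in
  \<open>forcing\<close> is harmless.\<close>

lemma sol_unique:
  assumes t0: "t0 < T" and s: "sol t0 x f y w" and s': "sol t0 x f' y' w'"
  shows "AE t in ivl t0 T. f t = f' t"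
proof -
  have ww: "AE t in ivl t0 T. w t - w' t = 0"
  proof (rule weak_deriv_zero[OF t0])
    show "weak_Lq q {t0<..<T} (\<lambda>t. w t - w' t)"
      using q1 by (intro weak_Lq_diff solD(3)[OF s] solD(3)[OF s']) auto
    show "weak_deriv emb t0 T (\<lambda>_. 0) (\<lambda>t. w t - w' t)"
      unfolding weak_deriv_def
    proof (intro allI impI)
      fix a b v assume ab: "t0 \<le> a" "a \<le> b" "b \<le> T"
      have i: "integrable (ivl a b) (\<lambda>t. u t v)" if "weak_Lq q {t0<..<T} u" for u :: "real \<Rightarrow> 'v \<Rightarrow>\<^sub>L real"
        by (rule ivl_mono_integrable[OF weak_Lq_integrable_apply[OF less_imp_le[OF q1] that] ab(1,3)])
      show "(0 - 0) \<bullet> emb v = (\<integral>r. (w r - w' r) v \<partial>ivl a b)"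
        using weak_derivD[OF solD(5)[OF s] ab, of v] weak_derivD[OF solD(5)[OF s'] ab, of v]
          i[OF solD(3)[OF s]] i[OF solD(3)[OF s']]
        by (simp add: blinfun.diff_left)
    qed
  qed
  show ?thesis
    using ww solD(4)[OF s] solD(4)[OF s'] solD(6)[OF s] solD(6)[OF s']
  proof eventually_elim
    case (elim t)
    have "y t = y' t" using elim(2,3) inj_emb by (simp add: inj_eq)
    then have "to_dual emb (f t) = to_dual emb (f' t)" using elim by simp
    then show ?case by (rule to_dual_inject[OF dense_emb])
  qed
qed

text \<open>The lower bound together with the convergent pairing keeps the sequence bounded in V, so
  its convergence in H is weak convergence in V, as Minty's trick requires.\<close>

lemma weak_convergence_pointwise:
  fixes yk :: "nat \<Rightarrow> 'v"
  assumes mono: "\<And>x y. blinfun_apply (A t x - A t y) (x - y) \<ge> 0"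
    and hemi: "\<And>x y v. continuous_on {0..1} (\<lambda>s. blinfun_apply (A t (x + s *\<^sub>R y)) v)"
    and c2: "c2 > 0" and bd: "\<And>k. blinfun_apply (A t (yk k)) (yk k - y) \<ge> c2 * norm (yk k) powr p - G"
    and lim: "(\<lambda>k. emb (yk k)) \<longlonglongrightarrow> emb y" "(\<lambda>k. blinfun_apply (A t (yk k)) (yk k - y)) \<longlonglongrightarrow> 0"
  shows "(\<lambda>k. blinfun_apply (A t (yk k)) v) \<longlonglongrightarrow> blinfun_apply (A t y) v"
proof (rule Minty_trick[OF mono hemi _ lim(2)])
  fix g :: "'v \<Rightarrow>\<^sub>L real"
  obtain M where M: "\<And>k. \<bar>A t (yk k) (yk k - y)\<bar> \<le> M"
    using Bseq_def convergent_imp_Bseq[OF convergentI[OF lim(2)]] by (auto simp: Bseq_def)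
  have "norm (yk k) \<le> 1 + (M + G) / c2" for k
  proof -
    have "c2 * norm (yk k) powr p \<le> M + G" using bd[of k] M[of k] by linarith
    then have "norm (yk k) powr p \<le> (M + G) / c2" using c2 by (simp add: field_simps)
    then show ?thesis using le_one_add_powr[of "norm (yk k)" p] pq by simp
  qed
  then show "(\<lambda>k. g (yk k)) \<longlonglongrightarrow> g y"
    by (rule weak_convergence_of_embedded[OF refl inj_emb _ lim(1)])
qed

text \<open>Half of the coercivity survives the subtraction of A(t,z) y. The remainder
  \<open>G\<close> depends on t and \<open>y\<close> but not on \<open>z\<close>, so it is one
  integrable bound for a whole sequence of \<open>z\<close>.\<close>

lemma A_lower_bound:
  obtains c G where "c > 0" and "\<And>t0 y. 0 \<le> t0 \<Longrightarrow> Lp_fun p {t0<..<T} y \<Longrightarrow> integrable (ivl t0 T) (\<lambda>t. G t (y t) :: real)"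
    and "\<And>t0. 0 \<le> t0 \<Longrightarrow> AE t in ivl t0 T. \<forall>z y. blinfun_apply (A t z) (z - y) \<ge> c * norm z powr p - G t y"
    and "\<And>t y. G t y \<ge> 0"
proof -
  obtain a1 c1 where a1: "c1 \<ge> 0" "\<And>t. a1 t \<ge> 0" "\<And>t0. 0 \<le> t0 \<Longrightarrow> Lp_fun q {t0<..<T} a1"
    "\<And>t0. 0 \<le> t0 \<Longrightarrow> AE t in ivl t0 T. \<forall>x. norm (A t x) \<le> a1 t + c1 * norm x powr (p - 1)"
    by (rule A_growth) (rule that)
  obtain c2 where c2: "c2 > 0" "\<And>t0. 0 \<le> t0 \<Longrightarrow> AE t in ivl t0 T. \<forall>x. blinfun_apply (A t x) x \<ge> c2 * norm x powr p"
    by (rule A_coercive) (rule that)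
  \<comment> \<open>Young's inequality spends c1 \<kappa> |z|^p on the cross term, and this \<kappa>
    keeps that at most c2/2 times |z|^p.\<close>
  define \<kappa> where "\<kappa> = c2 / (2 * (c1 + 1))"
  have \<kappa>: "\<kappa> > 0" using c2 a1 by (simp add: \<kappa>_def)
  have c1\<kappa>: "c1 * \<kappa> \<le> c2 / 2"
  proof -
    have "c1 * \<kappa> \<le> (c1 + 1) * \<kappa>" using \<kappa> by (intro mult_right_mono) auto
    also have "\<dots> = c2 / 2"
    proof -
      have "c1 + 1 \<noteq> 0" using a1(1) by linarith
      then show ?thesis by (simp add: \<kappa>_def divide_simps)
    qed
    finally show ?thesis .
  qed
  obtain C where C: "C \<ge> 0" "\<And>r s. r \<ge> 0 \<Longrightarrow> s \<ge> 0 \<Longrightarrow> r * s \<le> \<kappa> * r powr q + C * s powr p"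
    using Young_small[OF pq \<kappa>] by blast
  define G where "G = (\<lambda>t (y::'v). a1 t powr q + (1 + c1 * C) * norm y powr p)"
  show ?thesis
  proof (rule that[of "c2 / 2" G])
    show "c2 / 2 > 0" using c2 by simp
    show "G t y \<ge> 0" for t y using C a1 by (simp add: G_def)
    fix t0 :: real assume t0: "0 \<le> t0"
    show "integrable (ivl t0 T) (\<lambda>t. G t (y t))" if "Lp_fun p {t0<..<T} y" for y
      using Lp_fun_integrable[OF that] Lp_fun_integrable[OF a1(3)[OF t0]] a1(2) by (simp add: G_def)
    show "AE t in ivl t0 T. \<forall>z y. blinfun_apply (A t z) (z - y) \<ge> c2 / 2 * norm z powr p - G t y"
      using a1(4)[OF t0] c2(2)[OF t0]
    proof eventually_elim
      case (elim t)
      show ?case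
      proof (intro allI)
        fix z y :: 'v
        have zz: "(norm z powr (p - 1)) powr q = norm z powr p" by (simp add: powr_powr pm1_q)
        have "A t z y \<le> norm (A t z) * norm y" using dual_pairing_abs_le[of "A t z" y] by linarith
        also have "\<dots> \<le> (a1 t + c1 * norm z powr (p - 1)) * norm y"
          using elim(1) by (intro mult_right_mono) auto
        also have "\<dots> = a1 t * norm y + c1 * (norm z powr (p - 1) * norm y)" by (simp add: algebra_simps)
        also have "\<dots> \<le> (a1 t powr q + norm y powr p) + c1 * (\<kappa> * (norm z powr (p - 1)) powr q + C * norm y powr p)"
          using a1 by (intro add_mono mult_le_powr_add[OF pq] mult_left_mono C) auto
        also have "\<dots> = G t y + (c1 * \<kappa>) * norm z powr p" by (simp add: G_def zz algebra_simps)
        also have "\<dots> \<le> G t y + c2 / 2 * norm z powr p" using c1\<kappa> by (intro add_left_mono mult_right_mono) auto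
        finally show "A t z (z - y) \<ge> c2 / 2 * norm z powr p - G t y"
          using elim(2)[rule_format, of z] by (simp add: blinfun.diff_right)
      qed
    qed
  qed
qed

end

section \<open>Paths\<close>

text \<open>On the compact interval continuity implies boundedness, so membership in the function
  space carries no further condition.\<close>

lemma paths_iff:
  "x \<in> paths T \<longleftrightarrow> x \<in> extensional {0..T} \<and> continuous_on {0..T} (x :: real \<Rightarrow> 'h::metric_space)"
proof -
  have "paths T = {f. (\<forall>x\<in>{0..T}. f x \<in> mspace (euclidean_metric :: 'h metric)) \<and> f \<in> extensional {0..T} \<and>
      continuous_map (top_of_set {0..T}) (mtopology_of euclidean_metric) f}"
    unfolding paths_def path_metric_def
    by (subst compactin_mspace_cfunspace) (simp_all add: compact_space_def[symmetric] compact_space_subtopology)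
  then show ?thesis by auto
qed

lemma paths_continuous: "x \<in> paths T \<Longrightarrow> continuous_on {0..T} x"
  by (simp add: paths_iff)

lemma path_bounded:
  fixes x :: "real \<Rightarrow> 'h::real_normed_vector"
  assumes "x \<in> paths T"
  obtains B where "\<And>t. t \<in> {0..T} \<Longrightarrow> norm (x t) \<le> B"
  using compact_imp_bounded[OF compact_continuous_image[OF paths_continuous[OF assms] compact_Icc]]
  unfolding bounded_iff by blast

lemma sup_norm_upto_bdd:
  fixes x :: "real \<Rightarrow> 'h::real_normed_vector"
  assumes "x \<in> paths T" "t \<le> T"
  shows "bdd_above ((\<lambda>s. norm (x s)) ` {0..t})"
proof -
  obtain B where "\<And>t. t \<in> {0..T} \<Longrightarrow> norm (x t) \<le> B" using path_bounded[OF assms(1)] by blast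
  then show ?thesis using assms(2) by (intro bdd_aboveI2[of _ _ B]) auto
qed

lemma norm_le_sup_norm_upto:
  fixes x :: "real \<Rightarrow> 'h::real_normed_vector"
  assumes "x \<in> paths T" "0 \<le> s" "s \<le> t" "t \<le> T"
  shows "norm (x s) \<le> sup_norm_upto x t"
  unfolding sup_norm_upto_def by (rule cSUP_upper[OF _ sup_norm_upto_bdd[OF assms(1,4)]]) (use assms in auto)

lemma sup_norm_upto_le:
  assumes "0 \<le> t" "\<And>s. 0 \<le> s \<Longrightarrow> s \<le> t \<Longrightarrow> norm (x s) \<le> B"
  shows "sup_norm_upto x t \<le> B"
  unfolding sup_norm_upto_def by (rule cSUP_least) (use assms in auto)

lemma sup_norm_upto_mono:
  fixes x :: "real \<Rightarrow> 'h::real_normed_vector"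
  assumes "x \<in> paths T" "0 \<le> s" "s \<le> t" "t \<le> T"
  shows "sup_norm_upto x s \<le> sup_norm_upto x t"
  by (rule sup_norm_upto_le) (use assms in \<open>auto intro!: norm_le_sup_norm_upto\<close>)

lemma sup_norm_upto_nonneg:
  fixes x :: "real \<Rightarrow> 'h::real_normed_vector"
  assumes "x \<in> paths T" "0 \<le> t" "t \<le> T"
  shows "0 \<le> sup_norm_upto x t"
  using norm_le_sup_norm_upto[OF assms(1) order_refl assms(2,3)] norm_ge_zero[of "x 0"] by linarith

text \<open>The supremum \<open>S\<close> of g weighted with exp(-l (t - a)) satisfies S \<le> C +
  S/2. This form works for measurable bounded g, which suits the running suprema to which it is
  applied.\<close>

lemma Gronwall_bound:
  fixes g :: "real \<Rightarrow> real"
  assumes ab: "a < b" and g: "g \<in> borel_measurable (ivl a b)" and bd: "\<And>t. t \<in> {a..b} \<Longrightarrow> 0 \<le> g t" "\<And>t. t \<in> {a..b} \<Longrightarrow> g t \<le> B"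
    and C: "C \<ge> 0" and k: "k \<ge> 0"
    and le: "\<And>t. t \<in> {a..b} \<Longrightarrow> g t \<le> C + k * (\<integral>s. g s \<partial>ivl a t)"
    and t: "t \<in> {a..b}"
  shows "g t \<le> 2 * C * exp ((2 * k + 1) * (b - a))"
proof -
  \<comment> \<open>A rate of at least 2k halves the integral term, since integrating exp(l (t - a))
    produces the factor 1/l; the added 1 keeps l positive when k = 0.\<close>
  define l where "l = 2 * k + 1"
  have l: "l > 0" "k / l \<le> 1/2" using k by (auto simp: l_def field_simps)
  define S where "S = (SUP t\<in>{a..b}. g t * exp (- l * (t - a)))"
  have e1: "exp (- l * (t - a)) \<le> 1" if "t \<in> {a..b}" for t using that l by auto
  have bb: "bdd_above ((\<lambda>t. g t * exp (- l * (t - a))) ` {a..b})"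
  proof (rule bdd_aboveI2)
    fix t assume t: "t \<in> {a..b}"
    have "g t * exp (- l * (t - a)) \<le> g t * 1" using bd(1)[OF t] e1[OF t] by (intro mult_left_mono) auto
    then show "g t * exp (- l * (t - a)) \<le> B" using bd(2)[OF t] by simp
  qed
  have gS: "g t \<le> S * exp (l * (t - a))" if "t \<in> {a..b}" for t
  proof -
    have "g t * exp (- l * (t - a)) \<le> S" unfolding S_def by (rule cSUP_upper[OF that bb])
    then have "g t * exp (- l * (t - a)) * exp (l * (t - a)) \<le> S * exp (l * (t - a))" by (intro mult_right_mono) auto
    then show ?thesis by (simp add: mult.assoc exp_add[symmetric])
  qed
  have S0: "S \<ge> 0"
  proof -
    have "g a \<le> S" using gS[of a] ab by simp
    then show ?thesis using bd(1)[of a] ab by simp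
  qed
  have "S \<le> C + S / 2"
    unfolding S_def[symmetric]
  proof (subst S_def, rule cSUP_least)
    fix t assume t: "t \<in> {a..b}"
    have ce: "continuous_on {a..t} (\<lambda>s. S * exp (l * (s - a)))" by (intro continuous_intros)
    have gi: "integrable (ivl a t) g"
    proof (rule integrable_ivl_bounded[of _ _ _ B])
      show "g \<in> borel_measurable (ivl a t)" by (rule ivl_mono_measurable[OF g]) (use t in auto)
      show "AE s in ivl a t. norm (g s) \<le> B"
        by (rule AE_I2) (use t bd in auto)
    qed
    have "(\<integral>s. g s \<partial>ivl a t) \<le> (\<integral>s. S * exp (l * (s - a)) \<partial>ivl a t)"
      by (intro integral_mono gi continuous_integrable_ivl ce gS) (use t in auto)
    also have "\<dots> = integral {a..t} (\<lambda>s. S * exp (l * (s - a)))" by (rule ivl_integral_cont[OF ce])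
    also have "\<dots> = S * exp (l * (t - a)) / l - S * exp (l * (a - a)) / l"
    proof (rule integral_unique, rule fundamental_theorem_of_calculus)
      show "a \<le> t" using t by simp
      fix s assume "s \<in> {a..t}"
      show "((\<lambda>s. S * exp (l * (s - a)) / l) has_vector_derivative S * exp (l * (s - a))) (at s within {a..t})"
        unfolding has_real_derivative_iff_has_vector_derivative[symmetric]
        using l(1) by (auto intro!: derivative_eq_intros)
    qed
    also have "\<dots> \<le> S * exp (l * (t - a)) / l" using S0 l by simp
    finally have i: "(\<integral>s. g s \<partial>ivl a t) \<le> S * exp (l * (t - a)) / l" .
    have "g t \<le> C + k * (S * exp (l * (t - a)) / l)"
      using le[OF t] mult_left_mono[OF i k] by linarith
    also have "\<dots> = C + (k / l) * (S * exp (l * (t - a)))" by simp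
    also have "\<dots> \<le> C + (1/2) * (S * exp (l * (t - a)))"
      using l(2) S0 by (intro add_left_mono mult_right_mono) auto
    finally have "g t * exp (- l * (t - a)) \<le> (C + (1/2) * (S * exp (l * (t - a)))) * exp (- l * (t - a))"
      by (intro mult_right_mono) auto
    also have "\<dots> = C * exp (- l * (t - a)) + S / 2"
      by (simp add: distrib_right mult.assoc exp_add[symmetric])
    also have "\<dots> \<le> C * 1 + S / 2" using C e1[OF t] by (intro add_mono mult_left_mono) auto
    finally show "g t * exp (- l * (t - a)) \<le> C + S / 2" by simp
  qed (use ab in auto)
  then have S2: "S \<le> 2 * C" by linarith
  have "g t \<le> S * exp (l * (t - a))" by (rule gS[OF t])
  also have "\<dots> \<le> (2 * C) * exp (l * (b - a))"
    using S2 C t l by (intro mult_mono) auto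
  finally show ?thesis by (simp add: l_def)
qed

section \<open>A priori bounds\<close>

text \<open>Monotone functions are Borel; clamping t to [0,T] extends the running supremum
  monotonically to the whole line.\<close>

lemma measurable_sup_norm_upto:
  fixes x :: "real \<Rightarrow> 'h::real_normed_vector"
  assumes x: "x \<in> paths T" and t0: "0 \<le> t0" "t0 < T"
  shows "sup_norm_upto x \<in> borel_measurable (ivl t0 T)"
proof -
  have "mono (\<lambda>t. sup_norm_upto x (max 0 (min t T)))"
    by (intro monoI sup_norm_upto_mono[OF x]) (use t0 in auto)
  then have "(\<lambda>t. sup_norm_upto x (max 0 (min t T))) \<in> borel_measurable borel" by (rule borel_measurable_mono)
  then have "(\<lambda>t. sup_norm_upto x (max 0 (min t T))) \<in> borel_measurable (ivl t0 T)" by (rule borel_measurable_ivl)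
  moreover have "sup_norm_upto x (max 0 (min t T)) = sup_norm_upto x t" if "t \<in> space (ivl t0 T)" for t
    using that t0 by (simp add: min_def max_def)
  ultimately show ?thesis by (subst measurable_cong[symmetric])
qed

lemma trajectories_subset_paths: "x \<in> trajectories T p q emb A L t0 x0 \<Longrightarrow> x \<in> paths T"
  and trajectories_initial: "x \<in> trajectories T p q emb A L t0 x0 \<Longrightarrow> t \<in> {0..t0} \<Longrightarrow> x t = x0 t"
  by (auto simp: trajectories_def)

context evolution
begin

abbreviation "X L t0 x0 \<equiv> trajectories T p q emb A L t0 x0"
abbreviation "fr t0 x \<equiv> forcing T p q emb A t0 x"

lemma path_continuous_from: "x \<in> paths T \<Longrightarrow> 0 \<le> t0 \<Longrightarrow> continuous_on {t0..T} x"
  using paths_continuous by (rule continuous_on_subset) auto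

text \<open>\<open>forcing\<close> is chosen without reference to the growth bound; uniqueness
  transfers the bound from the witness in \<open>trajectories\<close> to the chosen
  function.\<close>

lemma forcing_sol:
  assumes t0: "0 \<le> t0" "t0 < T" and x: "x \<in> X L t0 x0"
  shows "\<exists>y w. sol t0 x (fr t0 x) y w"
    and "AE t in ivl t0 T. norm (fr t0 x t) \<le> L * (1 + sup_norm_upto x t)"
proof -
  have c: "continuous_on {t0..T} x"
    using path_continuous_from[OF trajectories_subset_paths[OF x] t0(1)] .
  obtain f where f: "solves_evolution T p q emb A t0 x f"
    "AE t in ivl t0 T. norm (f t) \<le> L * (1 + sup_norm_upto x t)"
    using x unfolding trajectories_def by blast
  have "solves_evolution T p q emb A t0 x (fr t0 x)"
    unfolding forcing_def by (rule someI[of "solves_evolution T p q emb A t0 x", OF f(1)])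
  then show s: "\<exists>y w. sol t0 x (fr t0 x) y w" unfolding solves_evolution_iff[OF t0(2) c] .
  then obtain y w where s: "sol t0 x (fr t0 x) y w" by blast
  obtain y' w' where s': "sol t0 x f y' w'" using f(1) unfolding solves_evolution_iff[OF t0(2) c] by blast
  show "AE t in ivl t0 T. norm (fr t0 x t) \<le> L * (1 + sup_norm_upto x t)"
    using f(2) sol_unique[OF t0(2) s s'] by eventually_elim simp
qed

lemma trajectoriesI:
  assumes t0: "0 \<le> t0" "t0 < T" and x: "x \<in> paths T" "\<And>t. t \<in> {0..t0} \<Longrightarrow> x t = x0 t"
    and s: "sol t0 x f y w" and le: "AE t in ivl t0 T. norm (f t) \<le> L * (1 + sup_norm_upto x t)"
  shows "x \<in> X L t0 x0" and "AE t in ivl t0 T. fr t0 x t = f t"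
proof -
  have c: "continuous_on {t0..T} x" using path_continuous_from[OF x(1) t0(1)] .
  have "solves_evolution T p q emb A t0 x f" unfolding solves_evolution_iff[OF t0(2) c] using s by blast
  then show X: "x \<in> X L t0 x0" unfolding trajectories_def using x le by blast
  obtain y' w' where s': "sol t0 x (fr t0 x) y' w'" using forcing_sol(1)[OF t0 X] by blast
  show "AE t in ivl t0 T. fr t0 x t = f t" by (rule sol_unique[OF t0(2) s' s])
qed

lemma sol_energy:
  assumes t0: "0 \<le> t0" "t \<in> {t0..T}" and x: "x \<in> paths T" and s: "sol t0 x f y w"
  shows "(norm (x t))\<^sup>2 - (norm (x t0))\<^sup>2 = 2 * (\<integral>s. w s (y s) \<partial>ivl t0 t)"
proof (rule energy_identity)
  show "t0 \<le> t" using t0 by auto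
  show "continuous_on {t0..t} x" using path_continuous_from[OF x t0(1)] t0(2) by (auto intro: continuous_on_subset)
  show "Lp_fun p {t0<..<t} y" using Lp_fun_mono[OF solD(2)[OF s]] t0 by auto
  show "AE t in ivl t0 t. x t = emb (y t)" using ivl_mono_AE[OF solD(4)[OF s]] t0 by auto
  show "weak_deriv emb t0 t x w" using weak_deriv_mono[OF solD(5)[OF s]] t0 by auto
  show "weak_Lq q {t0<..<t} w" using weak_Lq_mono[OF solD(3)[OF s]] t0 by auto
qed

text \<open>Uniform estimates over the whole trajectory set. The growth bound sees the running
  supremum m rather than |x(t)|, so the energy estimate is closed for (1 + m)^2 with Gronwall's
  lemma.\<close>

lemma trajectory_bounds:
  assumes t0: "0 \<le> t0" "t0 < T" and L: "L \<ge> 0"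
  obtains R K where "R \<ge> 0" "K \<ge> 0" and "\<And>x. x \<in> X L t0 x0 \<Longrightarrow> \<exists>y w. sol t0 x (fr t0 x) y w \<and>
     (\<integral>t. norm (y t) powr p \<partial>ivl t0 T) \<le> K \<and> (\<integral>t. norm (w t) powr q \<partial>ivl t0 T) \<le> K"
    and "\<And>x t. x \<in> X L t0 x0 \<Longrightarrow> t \<in> {0..T} \<Longrightarrow> norm (x t) \<le> R"
    and "\<And>x. x \<in> X L t0 x0 \<Longrightarrow> AE t in ivl t0 T. norm (fr t0 x t) \<le> R"
proof -
  obtain a1 c1 where a1: "c1 \<ge> 0" "\<And>t. a1 t \<ge> 0" "\<And>t0. 0 \<le> t0 \<Longrightarrow> Lp_fun q {t0<..<T} a1"
    "\<And>t0. 0 \<le> t0 \<Longrightarrow> AE t in ivl t0 T. \<forall>x. norm (A t x) \<le> a1 t + c1 * norm x powr (p - 1)"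
    by (rule A_growth) (rule that)
  obtain c2 where c2: "c2 > 0" "\<And>t0. 0 \<le> t0 \<Longrightarrow> AE t in ivl t0 T. \<forall>x. blinfun_apply (A t x) x \<ge> c2 * norm x powr p"
    by (rule A_coercive) (rule that)
  define M0 where "M0 = sup_norm_upto x0 t0"
  \<comment> \<open>Gronwall's constant for (1 + m)^2: bounding m^2 by M0^2 plus 2 L times the
    integral of (1 + m)^2, and inserting this in (1 + m)^2 \<le> 2 + 2 m^2, gives the constant 2 + 2
    M0^2 and the rate 4 L.\<close>
  define G where "G = 2 * (2 + 2 * M0\<^sup>2) * exp ((2 * (4 * L) + 1) * (T - t0))"
  have G0: "G \<ge> 0" by (simp add: G_def)
  define R where "R = sqrt G + L * sqrt G"
  have R0: "R \<ge> 0" "sqrt G \<le> R" "L * sqrt G \<le> R" using G0 L by (auto simp: R_def)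
  \<comment> \<open>\<open>K1\<close> is the bound that coercivity leaves for \<open>y\<close>, and
    \<open>K2\<close> the one for w = f - A(y), where a sum is raised to the power q twice.\<close>
  define K1 where "K1 = (M0\<^sup>2 + 2 * L * ((T - t0) * G)) / (2 * c2)"
  define K2 where "K2 = (T - t0) * (2 powr q * (norm emb * R) powr q) + 2 powr q * (2 powr q * (\<integral>t. norm (a1 t) powr q \<partial>ivl t0 T))
      + 2 powr q * (2 powr q * (c1 powr q * K1))"
  define K where "K = max K1 K2"
  have K1: "K1 \<ge> 0" using c2 L G0 t0 by (auto simp: K1_def intro!: divide_nonneg_nonneg add_nonneg_nonneg mult_nonneg_nonneg)
  have main: "(\<exists>y w. sol t0 x (fr t0 x) y w \<and>
     (\<integral>t. norm (y t) powr p \<partial>ivl t0 T) \<le> K \<and> (\<integral>t. norm (w t) powr q \<partial>ivl t0 T) \<le> K) \<and>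
     (\<forall>t\<in>{0..T}. norm (x t) \<le> R) \<and> (AE t in ivl t0 T. norm (fr t0 x t) \<le> R)"
    if xX: "x \<in> X L t0 x0" for x
  proof -
    have x: "x \<in> paths T" by (rule trajectories_subset_paths[OF xX])
    obtain y w where s: "sol t0 x (fr t0 x) y w" using forcing_sol(1)[OF t0 xX] by blast
    note fb = forcing_sol(2)[OF t0 xX]
    define m where "m = sup_norm_upto x"
    have m0: "m t \<ge> 0" if "t \<in> {t0..T}" for t
      unfolding m_def using that t0 by (intro sup_norm_upto_nonneg[OF x]) auto
    have mx: "norm (x t) \<le> m t" if "t \<in> {t0..T}" for t
      unfolding m_def using that t0 by (intro norm_le_sup_norm_upto[OF x]) auto
    have mT: "m t \<le> m T" if "t \<in> {t0..T}" for t
      unfolding m_def using that t0 by (intro sup_norm_upto_mono[OF x]) auto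
    have mt0: "m t0 = M0"
      unfolding m_def M0_def sup_norm_upto_def using trajectories_initial[OF xX] by (intro SUP_cong) auto
    define g where "g = (\<lambda>t. (1 + m t)\<^sup>2)"
    have gm: "g \<in> borel_measurable (ivl t0 T)"
      using measurable_sup_norm_upto[OF x t0] unfolding g_def m_def by simp
    have g0: "g t \<ge> 0" for t by (simp add: g_def)
    have gT: "g t \<le> (1 + m T)\<^sup>2" if "t \<in> {t0..T}" for t
      unfolding g_def using mT[OF that] m0[OF that] by (intro power_mono) auto
    have gi: "integrable (ivl t0 T) g"
      by (rule integrable_ivl_bounded[OF gm, of "(1 + m T)\<^sup>2"]) (rule AE_I2, use g0 gT in auto)
    note y = solD(2)[OF s] and w = solD(3)[OF s]
    have iy: "integrable (ivl t0 t) (\<lambda>s. norm (y s) powr p)" if "t \<in> {t0..T}" for t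
      by (rule ivl_mono_integrable[OF Lp_fun_integrable[OF y]]) (use that in auto)
    have ig: "integrable (ivl t0 t) g" if "t \<in> {t0..T}" for t
      by (rule ivl_mono_integrable[OF gi]) (use that in auto)
    have energy: "(norm (x t))\<^sup>2 + 2 * c2 * (\<integral>s. norm (y s) powr p \<partial>ivl t0 t) \<le> M0\<^sup>2 + 2 * L * (\<integral>s. g s \<partial>ivl t0 t)"
      if t: "t \<in> {t0..T}" for t
    proof -
      have "AE s in ivl t0 T. w s (y s) \<le> L * g s - c2 * norm (y s) powr p"
        using solD(4)[OF s] solD(6)[OF s] fb c2(2)[OF t0(1)] AE_space[of "ivl t0 T"]
      proof eventually_elim
        case (elim r)
        then have r: "r \<in> {t0..T}" by auto
        have "w r (y r) = (to_dual emb (fr t0 x r) - A r (y r)) (y r)"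
          using elim(2) by (metis add_diff_cancel_right')
        also have "\<dots> = fr t0 x r \<bullet> x r - A r (y r) (y r)" using elim(1) by (simp add: blinfun.diff_left)
        also have "fr t0 x r \<bullet> x r \<le> norm (fr t0 x r) * norm (x r)" by (rule norm_cauchy_schwarz)
        also have "\<dots> \<le> (L * (1 + m r)) * (1 + m r)"
          using elim(3) mx[OF r] m0[OF r] L by (intro mult_mono) (auto simp: m_def)
        finally show ?case using elim(4)[rule_format, of "y r"] by (simp add: g_def power2_eq_square)
      qed
      then have "AE s in ivl t0 t. w s (y s) \<le> L * g s - c2 * norm (y s) powr p"
        by (rule ivl_mono_AE) (use t in auto)
      moreover have "integrable (ivl t0 t) (\<lambda>s. w s (y s))"
        by (rule ivl_mono_integrable[OF integrable_dual_pairing[OF pq w y]]) (use t in auto)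
      ultimately have "(\<integral>s. w s (y s) \<partial>ivl t0 t) \<le> (\<integral>s. L * g s - c2 * norm (y s) powr p \<partial>ivl t0 t)"
        using iy[OF t] ig[OF t] by (intro integral_mono_AE) auto
      also have "\<dots> = L * (\<integral>s. g s \<partial>ivl t0 t) - c2 * (\<integral>s. norm (y s) powr p \<partial>ivl t0 t)"
        using iy[OF t] ig[OF t] by simp
      finally have "(norm (x t))\<^sup>2 - (norm (x t0))\<^sup>2 \<le> 2 * (L * (\<integral>s. g s \<partial>ivl t0 t) - c2 * (\<integral>s. norm (y s) powr p \<partial>ivl t0 t))"
        using sol_energy[OF t0(1) t x s] by simp
      moreover have "(norm (x t0))\<^sup>2 \<le> M0\<^sup>2"
        using mx[of t0] mt0 t0 by (intro power_mono) auto
      ultimately show ?thesis by (simp add: algebra_simps)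
    qed
    have gr: "g t \<le> (2 + 2 * M0\<^sup>2) + 4 * L * (\<integral>s. g s \<partial>ivl t0 t)" if t: "t \<in> {t0..T}" for t
    proof -
      define Q where "Q = M0\<^sup>2 + 2 * L * (\<integral>s. g s \<partial>ivl t0 t)"
      have I0: "(\<integral>s. g s \<partial>ivl t0 r) \<ge> 0" for r using g0 by simp
      have Q0: "Q \<ge> M0\<^sup>2" using L I0 by (simp add: Q_def)
      \<comment> \<open>Times up to t0 are covered by \<open>M0\<close>, later ones by the energy
        estimate at r, whose right-hand side grows with r.\<close>
      have "m t \<le> sqrt Q"
        unfolding m_def
      proof (rule sup_norm_upto_le)
        fix r assume r: "0 \<le> r" "r \<le> t"
        have "(norm (x r))\<^sup>2 \<le> Q"
        proof (cases "r \<le> t0")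
          case True
          then have "norm (x r) \<le> m t0" unfolding m_def using r t0 by (intro norm_le_sup_norm_upto[OF x]) auto
          then have "(norm (x r))\<^sup>2 \<le> M0\<^sup>2" using mt0 by (intro power_mono) auto
          then show ?thesis using Q0 by linarith
        next
          case False
          then have rt: "r \<in> {t0..T}" using r t by auto
          have "0 \<le> 2 * c2 * (\<integral>s. norm (y s) powr p \<partial>ivl t0 r)" using c2 by (auto intro!: mult_nonneg_nonneg)
          then have "(norm (x r))\<^sup>2 \<le> M0\<^sup>2 + 2 * L * (\<integral>s. g s \<partial>ivl t0 r)" using energy[OF rt] by linarith
          also have "(\<integral>s. g s \<partial>ivl t0 r) \<le> (\<integral>s. g s \<partial>ivl t0 t)"
            by (rule ivl_integral_nonneg_mono[OF ig[OF t]]) (use r g0 in auto)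
          then have "M0\<^sup>2 + 2 * L * (\<integral>s. g s \<partial>ivl t0 r) \<le> Q" using L by (simp add: Q_def mult_left_mono)
          finally show ?thesis .
        qed
        then show "norm (x r) \<le> sqrt Q" by (rule real_le_rsqrt)
      qed (use t t0 in auto)
      moreover have "0 \<le> Q" using Q0 by (meson order_trans zero_le_power2)
      ultimately have "(m t)\<^sup>2 \<le> Q" using m0[OF t] by (metis real_sqrt_pow2 power_mono)
      moreover have "g t \<le> 2 + 2 * (m t)\<^sup>2"
      proof -
        have "0 \<le> (1 - m t)\<^sup>2" by simp
        then show ?thesis unfolding g_def power2_eq_square by (simp add: algebra_simps)
      qed
      ultimately show ?thesis by (simp add: Q_def)
    qed
    have gG: "g t \<le> G" if t: "t \<in> {t0..T}" for t
    proof -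
      have "g t \<le> 2 * (2 + 2 * M0\<^sup>2) * exp ((2 * (4 * L) + 1) * (T - t0))"
        by (rule Gronwall_bound[OF t0(2) gm _ gT _ _ _ t]) (use g0 gr L in auto)
      then show ?thesis by (simp add: G_def)
    qed
    have mG: "1 + m t \<le> sqrt G" if t: "t \<in> {t0..T}" for t
      using gG[OF t] by (intro real_le_rsqrt) (simp add: g_def)
    have xR: "norm (x t) \<le> R" if "t \<in> {0..T}" for t
    proof -
      have "norm (x t) \<le> m T" unfolding m_def using that by (intro norm_le_sup_norm_upto[OF x]) auto
      then show ?thesis using mG[of T] t0 R0 by simp
    qed
    have fR: "AE t in ivl t0 T. norm (fr t0 x t) \<le> R"
      using fb AE_space[of "ivl t0 T"]
    proof eventually_elim
      case (elim t)
      have "L * (1 + m t) \<le> L * sqrt G" using mG[of t] L elim by (intro mult_left_mono) auto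
      then show ?case using elim R0 by (simp add: m_def)
    qed
    have yK: "(\<integral>t. norm (y t) powr p \<partial>ivl t0 T) \<le> K1"
    proof -
      have "(\<integral>s. g s \<partial>ivl t0 T) \<le> (\<integral>s. G \<partial>ivl t0 T)"
        using gG by (intro integral_mono gi) auto
      also have "\<dots> = (T - t0) * G" using t0 by (intro ivl_integral_const) auto
      finally have "2 * L * (\<integral>s. g s \<partial>ivl t0 T) \<le> 2 * L * ((T - t0) * G)" using L by (intro mult_left_mono) auto
      moreover have "(norm (x T))\<^sup>2 + 2 * c2 * (\<integral>s. norm (y s) powr p \<partial>ivl t0 T) \<le> M0\<^sup>2 + 2 * L * (\<integral>s. g s \<partial>ivl t0 T)"
        using energy[of T] t0 by auto
      ultimately have "2 * c2 * (\<integral>s. norm (y s) powr p \<partial>ivl t0 T) \<le> M0\<^sup>2 + 2 * L * ((T - t0) * G)"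
        using zero_le_power2[of "norm (x T)"] by linarith
      then show ?thesis using c2(1) by (simp add: K1_def field_simps)
    qed
    have wK: "(\<integral>t. norm (w t) powr q \<partial>ivl t0 T) \<le> K2"
    proof -
      have ia: "integrable (ivl t0 T) (\<lambda>t. norm (a1 t) powr q)" by (rule Lp_fun_integrable[OF a1(3)[OF t0(1)]])
      let ?k = "\<lambda>t. 2 powr q * (norm emb * R) powr q + 2 powr q * (2 powr q * norm (a1 t) powr q)
          + 2 powr q * (2 powr q * (c1 powr q * norm (y t) powr p))"
      have "(\<integral>t. norm (w t) powr q \<partial>ivl t0 T) \<le> (\<integral>t. ?k t \<partial>ivl t0 T)"
      proof (rule integral_mono_AE)
        show "AE t in ivl t0 T. norm (w t) powr q \<le> ?k t"
          using solD(6)[OF s] fR a1(4)[OF t0(1)]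
        proof eventually_elim
          case (elim t)
          have "w t = to_dual emb (fr t0 x t) - A t (y t)" using elim(1) by (metis add_diff_cancel_right')
          then have "norm (w t) \<le> norm (to_dual emb (fr t0 x t)) + norm (A t (y t))"
            by (simp add: norm_triangle_ineq4)
          also have "\<dots> \<le> norm emb * R + (a1 t + c1 * norm (y t) powr (p - 1))"
          proof (rule add_mono)
            show "norm (to_dual emb (fr t0 x t)) \<le> norm emb * R"
              using norm_to_dual_le[of emb "fr t0 x t"] mult_left_mono[OF elim(2) norm_ge_zero[of emb]] by linarith
          qed (use elim(3) in auto)
          finally have "norm (w t) powr q \<le> (norm emb * R + (a1 t + c1 * norm (y t) powr (p - 1))) powr q"
            using q1 by (intro powr_mono2) auto
          also have "\<dots> \<le> 2 powr q * ((norm emb * R) powr q + (a1 t + c1 * norm (y t) powr (p - 1)) powr q)"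
            using q1 R0 a1 by (intro powr_add_le) auto
          also have "\<dots> \<le> 2 powr q * ((norm emb * R) powr q + 2 powr q * (a1 t powr q + (c1 * norm (y t) powr (p - 1)) powr q))"
            using q1 R0 a1 by (intro mult_left_mono add_left_mono powr_add_le) auto
          also have "(c1 * norm (y t) powr (p - 1)) powr q = c1 powr q * norm (y t) powr p"
            using a1 by (simp add: powr_mult powr_powr pm1_q)
          finally show ?case using a1(2)[of t] by (simp add: algebra_simps)
        qed
      qed (use weak_Lq_integrable[OF w] ia Lp_fun_integrable[OF y] in auto)
      also have "\<dots> = (T - t0) * (2 powr q * (norm emb * R) powr q) + 2 powr q * (2 powr q * (\<integral>t. norm (a1 t) powr q \<partial>ivl t0 T))
          + 2 powr q * (2 powr q * (c1 powr q * (\<integral>t. norm (y t) powr p \<partial>ivl t0 T)))"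
        using ia Lp_fun_integrable[OF y] t0 ivl_integral_const[of t0 T] by simp
      also have "\<dots> \<le> K2"
        unfolding K2_def using yK by (intro add_left_mono mult_left_mono) auto
      finally show ?thesis .
    qed
    have "(\<integral>t. norm (y t) powr p \<partial>ivl t0 T) \<le> K" "(\<integral>t. norm (w t) powr q \<partial>ivl t0 T) \<le> K"
      using yK wK by (auto simp: K_def)
    then show ?thesis using s xR fR by blast
  qed
  show ?thesis
    by (rule that[of R K]) (use main R0 K1 in \<open>auto simp: K_def\<close>)
qed

end

section \<open>Weak limits of bounded Hilbert space valued functions\<close>

text \<open>Sets of functions closed under midpoints are all that the parallelogram argument needs of
  the convex hulls of the tails of a sequence.\<close>

inductive_set midpoint_hull :: "(nat \<Rightarrow> 'a \<Rightarrow> 'h::real_vector) \<Rightarrow> nat \<Rightarrow> ('a \<Rightarrow> 'h) set"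
  for f :: "nat \<Rightarrow> 'a \<Rightarrow> 'h" and N :: nat where
  base: "m \<ge> N \<Longrightarrow> f m \<in> midpoint_hull f N"
| mid: "g \<in> midpoint_hull f N \<Longrightarrow> h \<in> midpoint_hull f N \<Longrightarrow> (\<lambda>t. (1/2) *\<^sub>R (g t + h t)) \<in> midpoint_hull f N"

lemma midpoint_hull_mono: "N \<le> M \<Longrightarrow> g \<in> midpoint_hull f M \<Longrightarrow> g \<in> midpoint_hull f N"
proof -
  assume "g \<in> midpoint_hull f M" and NM: "N \<le> M"
  then show ?thesis
    by (induction rule: midpoint_hull.induct) (auto intro: midpoint_hull.intros)
qed

lemma norm_midpoint_le:
  fixes u v :: "'h::real_normed_vector"
  assumes "norm u \<le> c" "norm v \<le> c"
  shows "norm ((1/2) *\<^sub>R (u + v)) \<le> c"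
  using norm_triangle_ineq[of u v] assms by simp

text \<open>The constant c is quantified inside, so that a single null set serves all c and the
  bound may later depend on t.\<close>

lemma midpoint_hull_bound:
  fixes f :: "nat \<Rightarrow> real \<Rightarrow> 'h::real_normed_vector"
  assumes "\<And>n. AE t in ivl a b. norm (f n t) \<le> bd n t" "g \<in> midpoint_hull f N"
  shows "AE t in ivl a b. \<forall>c. (\<forall>m\<ge>N. bd m t \<le> c) \<longrightarrow> norm (g t) \<le> c"
  using assms(2)
proof (induction rule: midpoint_hull.induct)
  case (base m)
  from assms(1)[of m] show ?case by eventually_elim (use base in \<open>auto intro: order_trans\<close>)
next
  case (mid g h)
  from mid.IH show ?case by eventually_elim (blast intro: norm_midpoint_le)
qed

lemma midpoint_hull_measurable:
  fixes f :: "nat \<Rightarrow> real \<Rightarrow> 'h::{real_normed_vector, second_countable_topology}"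
  assumes "\<And>n. f n \<in> borel_measurable M" "g \<in> midpoint_hull f N"
  shows "g \<in> borel_measurable M"
  using assms(2) by (induction rule: midpoint_hull.induct)
    (auto intro!: assms(1) borel_measurable_scaleR borel_measurable_add)

text \<open>As for the element of least norm in a convex set: near-minimizers of the L^2 norm over
  the midpoint hulls of the tails are Cauchy by the parallelogram law. A subsequence converges
  almost everywhere. Pointwise bounds and closeness of integrals hold along the tails, are stable
  under midpoints, and so pass to the limit.\<close>

lemma bounded_weak_limit:
  fixes f :: "nat \<Rightarrow> real \<Rightarrow> 'h::{real_inner, banach, second_countable_topology}"
  assumes ab: "a < b" and fm: "\<And>n. f n \<in> borel_measurable (ivl a b)"
    and fR: "\<And>n. AE t in ivl a b. norm (f n t) \<le> R" and R: "R \<ge> 0"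
    and conv: "\<And>t z. t \<in> {a..b} \<Longrightarrow> (\<lambda>n. \<integral>s. f n s \<bullet> z \<partial>ivl a t) \<longlonglongrightarrow> \<Phi> t z"
    and bd: "\<And>n. AE t in ivl a b. norm (f n t) \<le> bd n t"
    and bdl: "\<And>t. t \<in> {a<..<b} \<Longrightarrow> (\<lambda>n. bd n t) \<longlonglongrightarrow> bd' t"
  obtains g where "g \<in> borel_measurable (ivl a b)" "AE t in ivl a b. norm (g t) \<le> R"
    "AE t in ivl a b. norm (g t) \<le> bd' t"
    "\<And>t z. t \<in> {a..b} \<Longrightarrow> (\<integral>s. g s \<bullet> z \<partial>ivl a t) = \<Phi> t z"
proof -
  let ?H = "midpoint_hull f"
  have Hm: "g \<in> borel_measurable (ivl a b)" if "g \<in> ?H N" for g N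
    by (rule midpoint_hull_measurable[OF fm that])
  have HR: "AE t in ivl a b. norm (g t) \<le> R" if "g \<in> ?H N" for g N
    using midpoint_hull_bound[where bd = "\<lambda>n t. R", OF fR that] by eventually_elim blast
  have Hi: "integrable (ivl a b) g" if "g \<in> ?H N" for g N
    by (rule integrable_ivl_bounded[OF Hm[OF that] HR[OF that]])
  have Hi2: "integrable (ivl a b) (\<lambda>t. (norm (g t))\<^sup>2)" if "g \<in> ?H N" for g N
  proof (rule integrable_ivl_bounded)
    show "(\<lambda>t. (norm (g t))\<^sup>2) \<in> borel_measurable (ivl a b)" using Hm[OF that] by simp
    show "AE t in ivl a b. norm ((norm (g t))\<^sup>2) \<le> R\<^sup>2"
      using HR[OF that] by eventually_elim (auto intro!: power_mono)
  qed
  define J where "J = (\<lambda>g :: real \<Rightarrow> 'h. \<integral>t. (norm (g t))\<^sup>2 \<partial>ivl a b)"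
  have J0: "J g \<ge> 0" for g by (simp add: J_def)
  have JR: "J g \<le> (b - a) * R\<^sup>2" if "g \<in> ?H N" for g N
  proof -
    have "J g \<le> (\<integral>t. R\<^sup>2 \<partial>ivl a b)" unfolding J_def
      by (rule integral_mono_AE[OF Hi2[OF that]]) (use HR[OF that] in \<open>auto elim!: eventually_mono intro: power_mono\<close>)
    also have "\<dots> = (b - a) * R\<^sup>2" by (rule ivl_integral_const) (use ab in simp)
    finally show ?thesis .
  qed
  \<comment> \<open>Smaller hulls have larger infima, so \<open>d\<close> is increasing and bounded,
    and its differences, which control the distance of near-minimizers, tend to 0.\<close>
  define d where "d = (\<lambda>N. INF g\<in>?H N. J g)"
  have bb: "bdd_below (J ` ?H N)" for N using J0 by (auto intro!: bdd_belowI2)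
  have ne: "?H N \<noteq> {}" for N using midpoint_hull.base[of N N f] by blast
  have dle: "d N \<le> J g" if "g \<in> ?H N" for g N unfolding d_def by (rule cINF_lower[OF bb that])
  have dmono: "d N \<le> d M" if "N \<le> M" for N M
    unfolding d_def by (rule cINF_superset_mono[OF ne bb]) (use that in \<open>auto intro: midpoint_hull_mono\<close>)
  have "convergent d"
  proof (rule Bseq_mono_convergent)
    have "\<bar>d N\<bar> \<le> (b - a) * R\<^sup>2" for N
    proof -
      have "f N \<in> ?H N" by (rule midpoint_hull.base) simp
      then have "d N \<le> (b - a) * R\<^sup>2" using dle JR order_trans by blast
      moreover have "0 \<le> d N" unfolding d_def by (rule cINF_greatest[OF ne J0])
      ultimately show ?thesis by simp
    qed
    then show "Bseq d" by (auto intro!: BseqI')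
  qed (use dmono in blast)
  then have dC: "Cauchy d" by (rule convergent_Cauchy)
  have "\<exists>g. g \<in> ?H N \<and> J g < d N + 1 / (real N + 1)" for N
    using cINF_less_iff[OF ne bb, of N "d N + 1 / (real N + 1)"] by (auto simp: d_def)
  then obtain g where g: "\<And>N. g N \<in> ?H N" "\<And>N. J (g N) < d N + 1 / (real N + 1)" by metis
  have par: "(\<integral>t. (norm (g N t - g M t))\<^sup>2 \<partial>ivl a b) \<le> 2 * (d M - d N) + 4 / (real N + 1)" if NM: "N \<le> M" for N M
  proof -
    \<comment> \<open>The hulls decrease, so the midpoint of both near-minimizers is admissible for
      the larger hull and \<open>J\<close> of it is at least \<open>d N\<close>.\<close>
    have gM: "g M \<in> ?H N" by (rule midpoint_hull_mono[OF NM g(1)])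
    let ?m = "\<lambda>t. (1/2) *\<^sub>R (g N t + g M t)"
    have m: "?m \<in> ?H N" by (rule midpoint_hull.mid[OF g(1) gM])
    have pw: "(norm (g N t - g M t))\<^sup>2 = 2 * (norm (g N t))\<^sup>2 + 2 * (norm (g M t))\<^sup>2 - 4 * (norm (?m t))\<^sup>2" for t
      by (simp add: power2_norm_eq_inner inner_add_left inner_add_right inner_diff_left inner_diff_right inner_commute algebra_simps power_mult_distrib)
    have "(\<integral>t. (norm (g N t - g M t))\<^sup>2 \<partial>ivl a b) = 2 * J (g N) + 2 * J (g M) - 4 * J ?m"
      unfolding J_def pw using Hi2[OF g(1)] Hi2[OF m] by (simp del: norm_scaleR)
    also have "\<dots> \<le> 2 * (d N + 1 / (real N + 1)) + 2 * (d M + 1 / (real M + 1)) - 4 * d N"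
    proof -
      have "2 * u + 2 * v - 4 * c \<le> 2 * u' + 2 * v' - 4 * c'" if "u < u'" "v < v'" "c' \<le> c" for u v c u' v' c' :: real
        using that by linarith
      from this[OF g(2)[of N] g(2)[of M] dle[OF m]] show ?thesis .
    qed
    also have "1 / (real M + 1) \<le> 1 / (real N + 1)" using NM by (intro divide_left_mono) auto
    then have "2 * (d N + 1 / (real N + 1)) + 2 * (d M + 1 / (real M + 1)) - 4 * d N \<le> 2 * (d M - d N) + 4 / (real N + 1)"
      by simp
    finally show ?thesis .
  qed
  have L1: "\<exists>N. \<forall>i\<ge>N. \<forall>j\<ge>N. (\<integral>t. norm (g i t - g j t) \<partial>ivl a b) < e" if e: "e > 0" for e
  proof -
    \<comment> \<open>The inequality r \<le> k + r^2 / k passes from L^2 to L^1. This k makes the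
      constant part e/3, and the rest is brought below 2e/3.\<close>
    define k where "k = e / (3 * (b - a))"
    have k: "k > 0" using e ab by (simp add: k_def)
    obtain N1 where N1: "\<And>m n. m \<ge> N1 \<Longrightarrow> n \<ge> N1 \<Longrightarrow> norm (d m - d n) < k * e / 6"
      using CauchyD[OF dC, of "k * e / 6"] k e by auto
    obtain N2 :: nat where N2: "12 / (k * e) < real N2" using reals_Archimedean2 by blast
    have half: "(\<integral>t. norm (g i t - g j t) \<partial>ivl a b) < e" if ij: "i \<ge> max N1 N2" "j \<ge> i" for i j
    proof -
      have i: "integrable (ivl a b) (\<lambda>t. norm (g i t - g j t))" using Hi[OF g(1)] by simp
      have i2: "integrable (ivl a b) (\<lambda>t. (norm (g i t - g j t))\<^sup>2)"
      proof (rule integrable_ivl_bounded)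
        show "(\<lambda>t. (norm (g i t - g j t))\<^sup>2) \<in> borel_measurable (ivl a b)" using Hm[OF g(1)] by simp
        show "AE t in ivl a b. norm ((norm (g i t - g j t))\<^sup>2) \<le> (2 * R)\<^sup>2"
          using HR[OF g(1), of i] HR[OF g(1), of j]
        proof eventually_elim
          case (elim t)
          then have "norm (g i t - g j t) \<le> 2 * R" using norm_triangle_ineq4[of "g i t" "g j t"] by linarith
          then have "(norm (g i t - g j t))\<^sup>2 \<le> (2 * R)\<^sup>2" by (intro power_mono) auto
          then show ?case by simp
        qed
      qed
      have rs: "r \<le> k + r\<^sup>2 / k" if "r \<ge> 0" for r :: real
      proof (cases "r \<le> k")
        case True then show ?thesis using k by (simp add: add_increasing2)
      next
        case False
        then have "r * k \<le> r * r" using that by (intro mult_left_mono) auto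
        then have "r \<le> r\<^sup>2 / k" using k by (simp add: field_simps power2_eq_square)
        then show ?thesis using k by simp
      qed
      have "(\<integral>t. norm (g i t - g j t) \<partial>ivl a b) \<le> (\<integral>t. k + (norm (g i t - g j t))\<^sup>2 / k \<partial>ivl a b)"
        by (intro integral_mono i) (use i2 rs in auto)
      also have "\<dots> = (b - a) * k + (\<integral>t. (norm (g i t - g j t))\<^sup>2 \<partial>ivl a b) / k"
        using i2 ivl_integral_const[of a b k] ab by simp
      also have "(\<integral>t. (norm (g i t - g j t))\<^sup>2 \<partial>ivl a b) \<le> 2 * (d j - d i) + 4 / (real i + 1)" by (rule par[OF ij(2)])
      also have "2 * (d j - d i) + 4 / (real i + 1) < k * e / 3 + k * e / 3"
      proof (rule add_strict_mono)
        have "norm (d j - d i) < k * e / 6" using ij by (intro N1) auto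
        then have "d j - d i < k * e / 6" unfolding real_norm_def by (rule le_less_trans[OF abs_ge_self])
        then show "2 * (d j - d i) < k * e / 3" by (simp add: field_simps)
        have "12 / (k * e) < real i + 1" using N2 ij by auto
        then show "4 / (real i + 1) < k * e / 3" using k e by (simp add: field_simps)
      qed
      then have "(b - a) * k + (2 * (d j - d i) + 4 / (real i + 1)) / k < (b - a) * k + (k * e / 3 + k * e / 3) / k"
        using k by (intro add_strict_left_mono divide_strict_right_mono)
      also have "\<dots> = e"
      proof -
        have "b - a \<noteq> 0" using ab by simp
        then have "(b - a) * k = e / 3" by (simp add: k_def divide_simps)
        moreover have "(k * e / 3 + k * e / 3) / k = 2 * (e / 3)" using k by (simp add: field_simps)
        ultimately show ?thesis by simp
      qed
      finally show ?thesis using k by (simp add: divide_right_mono)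
    qed
    show ?thesis
    proof (intro exI[of _ "max N1 N2"] allI impI)
      fix i j assume ij: "i \<ge> max N1 N2" "j \<ge> max N1 N2"
      show "(\<integral>t. norm (g i t - g j t) \<partial>ivl a b) < e"
        using half[of i j] half[of j i] ij by (cases "i \<le> j") (auto simp: norm_minus_commute)
    qed
  qed
  obtain r where r: "strict_mono (r :: nat \<Rightarrow> nat)" "AE t in ivl a b. Cauchy (\<lambda>i. g (r i) t)"
    using cauchy_L1_AE_cauchy_subseq[OF Hi[OF g(1)] L1] by blast
  define G where "G = (\<lambda>t. lim (\<lambda>i. g (r i) t))"
  have Gm: "G \<in> borel_measurable (ivl a b)" unfolding G_def
    by (rule borel_measurable_lim_metric) (rule Hm[OF g(1)])
  have Gl: "AE t in ivl a b. (\<lambda>i. g (r i) t) \<longlonglongrightarrow> G t"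
    using r(2) by eventually_elim (simp add: G_def convergent_LIMSEQ_iff[symmetric] Cauchy_convergent)
  have gR: "AE t in ivl a b. \<forall>i. norm (g (r i) t) \<le> R"
    unfolding AE_all_countable using HR[OF g(1)] by blast
  have GR: "AE t in ivl a b. norm (G t) \<le> R"
    using Gl gR
  proof eventually_elim
    case (elim t)
    from tendsto_norm[OF elim(1)] show ?case by (rule LIMSEQ_le_const2) (use elim(2) in blast)
  qed
  have "AE t in ivl a b. \<forall>i. \<forall>c. (\<forall>m\<ge>r i. bd m t \<le> c) \<longrightarrow> norm (g (r i) t) \<le> c"
    unfolding AE_all_countable using midpoint_hull_bound[where bd = bd, OF bd g(1)] by blast
  then have Gbd: "AE t in ivl a b. norm (G t) \<le> bd' t"
    using Gl AE_space[of "ivl a b"]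
  proof eventually_elim
    case (elim t)
    show ?case
    proof (rule field_le_epsilon)
      fix e :: real assume e: "e > 0"
      have "\<forall>\<^sub>F n in sequentially. bd n t < bd' t + e"
        by (rule order_tendstoD[OF bdl]) (use elim e in auto)
      then obtain N where N: "\<And>n. n \<ge> N \<Longrightarrow> bd n t < bd' t + e" unfolding eventually_sequentially by blast
      show "norm (G t) \<le> bd' t + e"
      proof (rule LIMSEQ_le_const2[OF tendsto_norm[OF elim(2)]], intro exI[of _ N] allI impI)
        fix i assume "i \<ge> N"
        then have "\<forall>m\<ge>r i. bd m t \<le> bd' t + e"
          using seq_suble[OF r(1), of i] N by (meson less_imp_le order_trans)
        then show "norm (g (r i) t) \<le> bd' t + e" using elim(1) by blast
      qed
    qed
  qed
  have "(\<integral>s. G s \<bullet> z \<partial>ivl a t) = \<Phi> t z" if t: "t \<in> {a..b}" for t z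
  proof (rule LIMSEQ_unique)
    show "(\<lambda>i. \<integral>s. g (r i) s \<bullet> z \<partial>ivl a t) \<longlonglongrightarrow> (\<integral>s. G s \<bullet> z \<partial>ivl a t)"
    proof (rule integral_dominated_convergence[where w = "\<lambda>_. R * norm z"])
      have sub: "AE s in ivl a t. P s" if "AE s in ivl a b. P s" for P
        by (rule ivl_mono_AE[OF that]) (use t in auto)
      have mz: "(\<lambda>s. u s \<bullet> z) \<in> borel_measurable (ivl a t)" if "u \<in> borel_measurable (ivl a b)" for u
        using ivl_mono_measurable[OF that, of a t] t by simp
      show "(\<lambda>s. G s \<bullet> z) \<in> borel_measurable (ivl a t)" by (rule mz[OF Gm])
      show "(\<lambda>s. g (r i) s \<bullet> z) \<in> borel_measurable (ivl a t)" for i by (rule mz[OF Hm[OF g(1)]])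
      show "AE s in ivl a t. (\<lambda>i. g (r i) s \<bullet> z) \<longlonglongrightarrow> G s \<bullet> z"
        using sub[OF Gl] by eventually_elim (intro tendsto_intros)
      show "AE s in ivl a t. norm (g (r i) s \<bullet> z) \<le> R * norm z" for i
        using sub[OF HR[OF g(1), of "r i"]]
      proof eventually_elim
        case (elim s)
        have "\<bar>g (r i) s \<bullet> z\<bar> \<le> norm (g (r i) s) * norm z" by (rule Cauchy_Schwarz_ineq2)
        also have "\<dots> \<le> R * norm z" using elim by (intro mult_right_mono) auto
        finally show ?case by simp
      qed
    qed simp
    have hull_le: "\<bar>(\<integral>s. u s \<bullet> z \<partial>ivl a t) - \<Phi> t z\<bar> \<le> e"
      if "\<And>m. m \<ge> N \<Longrightarrow> \<bar>(\<integral>s. f m s \<bullet> z \<partial>ivl a t) - \<Phi> t z\<bar> \<le> e" "u \<in> ?H N" for u N e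
      using that(2)
    proof (induction rule: midpoint_hull.induct)
      case (base m) then show ?case by (rule that(1))
    next
      case (mid u v)
      have iz: "integrable (ivl a t) (\<lambda>s. u s \<bullet> z)" if "u \<in> ?H N" for u
        using ivl_mono_integrable[OF Hi[OF that], of a t] t by simp
      have "(\<integral>s. ((1/2) *\<^sub>R (u s + v s)) \<bullet> z \<partial>ivl a t) = ((\<integral>s. u s \<bullet> z \<partial>ivl a t) + (\<integral>s. v s \<bullet> z \<partial>ivl a t)) / 2"
        using iz[OF mid.hyps(1)] iz[OF mid.hyps(2)] by (simp add: inner_add_left)
      moreover have "\<bar>X - P\<bar> \<le> e" if "X = (U + V) / 2" "\<bar>U - P\<bar> \<le> e" "\<bar>V - P\<bar> \<le> e" for X U V P :: real
        using that unfolding abs_le_iff by (auto simp: field_simps)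
      ultimately show ?case using mid.IH by blast
    qed
    show "(\<lambda>i. \<integral>s. g (r i) s \<bullet> z \<partial>ivl a t) \<longlonglongrightarrow> \<Phi> t z"
    proof (rule LIMSEQ_I)
      fix e :: real assume e: "e > 0"
      then obtain N where N: "\<And>m. m \<ge> N \<Longrightarrow> norm ((\<integral>s. f m s \<bullet> z \<partial>ivl a t) - \<Phi> t z) < e/2"
        using LIMSEQ_D[OF conv[OF t], of "e/2"] by (metis half_gt_zero)
      show "\<exists>N. \<forall>i\<ge>N. norm ((\<integral>s. g (r i) s \<bullet> z \<partial>ivl a t) - \<Phi> t z) < e"
      proof (intro exI[of _ N] allI impI)
        fix i assume i: "i \<ge> N"
        have "g (r i) \<in> ?H N" by (rule midpoint_hull_mono[OF _ g(1)]) (use seq_suble[OF r(1), of i] i in linarith)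
        then have "\<bar>(\<integral>s. g (r i) s \<bullet> z \<partial>ivl a t) - \<Phi> t z\<bar> \<le> e/2"
          by (rule hull_le[rotated]) (use N in \<open>auto intro: less_imp_le\<close>)
        then show "norm ((\<integral>s. g (r i) s \<bullet> z \<partial>ivl a t) - \<Phi> t z) < e" using e by simp
      qed
    qed
  qed
  then show ?thesis by (rule that[OF Gm GR Gbd])
qed

section \<open>Pointwise convergence along subsequences\<close>

lemma convergent_on_dense:
  fixes \<phi> :: "nat \<Rightarrow> real \<Rightarrow> real"
  assumes ab: "a < b" and t: "t \<in> {a..b}"
    and conv: "\<And>s. s \<in> \<rat> \<inter> {a..b} \<Longrightarrow> convergent (\<lambda>n. \<phi> n s)"
    and equi: "\<And>e. e > 0 \<Longrightarrow> \<exists>d>0. \<forall>n. \<forall>s\<in>{a..b}. \<forall>t\<in>{a..b}. \<bar>s - t\<bar> < d \<longrightarrow> \<bar>\<phi> n s - \<phi> n t\<bar> \<le> e"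
  shows "convergent (\<lambda>n. \<phi> n t)"
proof (rule Cauchy_convergent, rule CauchyI)
  fix e :: real assume e: "e > 0"
  then obtain d where d: "d > 0" "\<And>n s t. s \<in> {a..b} \<Longrightarrow> t \<in> {a..b} \<Longrightarrow> \<bar>s - t\<bar> < d \<Longrightarrow> \<bar>\<phi> n s - \<phi> n t\<bar> \<le> e/4"
    using equi[of "e/4"] by auto
  have "max a (t - d) < min b (t + d)" using ab d(1) t by auto
  then obtain s where s: "s \<in> \<rat>" "max a (t - d) < s" "s < min b (t + d)"
    using Rats_dense_in_real by blast
  have sab: "s \<in> {a..b}" "\<bar>s - t\<bar> < d" using s by auto
  have "Cauchy (\<lambda>n. \<phi> n s)" using conv[of s] s sab by (intro convergent_Cauchy) auto
  then obtain N where N: "\<And>m n. m \<ge> N \<Longrightarrow> n \<ge> N \<Longrightarrow> norm (\<phi> m s - \<phi> n s) < e/4"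
    using CauchyD[of "\<lambda>n. \<phi> n s" "e/4"] e by auto
  show "\<exists>M. \<forall>m\<ge>M. \<forall>n\<ge>M. norm (\<phi> m t - \<phi> n t) < e"
  proof (intro exI[of _ N] allI impI)
    fix m n assume "m \<ge> N" "n \<ge> N"
    then show "norm (\<phi> m t - \<phi> n t) < e"
      using N[of m n] d(2)[OF sab(1) t sab(2), of m] d(2)[OF sab(1) t sab(2), of n] e
      unfolding real_norm_def by linarith
  qed
qed

text \<open>Above the threshold the factor \<kappa> r^(q - 1) is at least 1, so the second term
  alone suffices there.\<close>

lemma truncation_le:
  fixes \<kappa> q r :: real
  assumes "q > 1" "\<kappa> > 0" "r \<ge> 0"
  shows "r \<le> min r ((1 / \<kappa>) powr (1 / (q - 1))) + \<kappa> * r powr q"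
proof (cases "r \<le> (1 / \<kappa>) powr (1 / (q - 1))")
  case False
  then have r: "r > (1 / \<kappa>) powr (1 / (q - 1))" by simp
  moreover have "(1 / \<kappa>) powr (1 / (q - 1)) \<ge> 0" by simp
  ultimately have r: "r > (1 / \<kappa>) powr (1 / (q - 1))" "r > 0" by linarith+
  have "1 / \<kappa> = ((1 / \<kappa>) powr (1 / (q - 1))) powr (q - 1)" using assms by (simp add: powr_powr)
  also have "\<dots> \<le> r powr (q - 1)" using r assms by (intro powr_mono2) auto
  finally have "1 \<le> \<kappa> * r powr (q - 1)" using assms by (simp add: field_simps)
  then have "r * 1 \<le> r * (\<kappa> * r powr (q - 1))" using r by (intro mult_left_mono) auto
  also have "\<dots> = \<kappa> * r powr q" using r by (simp add: powr_diff)
  finally have "r \<le> \<kappa> * r powr q" by simp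
  moreover have "min r ((1 / \<kappa>) powr (1 / (q - 1))) \<ge> 0" using r by simp
  ultimately show ?thesis by linarith
qed (use assms in auto)

text \<open>A bound in L^q with q > 1 gives uniform integrability: what lies above a level
  \<open>N\<close> contributes at most \<kappa> K', and below it dominated convergence
  applies.\<close>

lemma Vitali_Lq:
  fixes g :: "nat \<Rightarrow> real \<Rightarrow> real"
  assumes ab: "a < b" and q: "q > 1" and g: "\<And>n. g n \<in> borel_measurable (ivl a b)" "g' \<in> borel_measurable (ivl a b)"
    and lim: "AE t in ivl a b. (\<lambda>n. g n t) \<longlonglongrightarrow> g' t"
    and gq: "\<And>n. integrable (ivl a b) (\<lambda>t. \<bar>g n t\<bar> powr q)" "\<And>n. (\<integral>t. \<bar>g n t\<bar> powr q \<partial>ivl a b) \<le> K"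
    and g'q: "integrable (ivl a b) (\<lambda>t. \<bar>g' t\<bar> powr q)"
  shows "(\<lambda>n. \<integral>t. \<bar>g n t - g' t\<bar> \<partial>ivl a b) \<longlonglongrightarrow> 0"
proof (rule LIMSEQ_I)
  fix e :: real assume e: "e > 0"
  define K' where "K' = 2 powr q * (K + (\<integral>t. \<bar>g' t\<bar> powr q \<partial>ivl a b))"
  have le: "\<bar>g n t - g' t\<bar> powr q \<le> 2 powr q * (\<bar>g n t\<bar> powr q + \<bar>g' t\<bar> powr q)" for n t
  proof -
    have "\<bar>g n t - g' t\<bar> powr q \<le> (\<bar>g n t\<bar> + \<bar>g' t\<bar>) powr q" using q by (intro powr_mono2) auto
    also have "\<dots> \<le> 2 powr q * (\<bar>g n t\<bar> powr q + \<bar>g' t\<bar> powr q)" using q by (intro powr_add_le) auto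
    finally show ?thesis .
  qed
  have dm: "(\<lambda>t. \<bar>g n t - g' t\<bar>) \<in> borel_measurable (ivl a b)" for n using g by simp
  have i: "integrable (ivl a b) (\<lambda>t. \<bar>g n t - g' t\<bar> powr q)" for n
    by (rule Bochner_Integration.integrable_bound[of _ "\<lambda>t. 2 powr q * (\<bar>g n t\<bar> powr q + \<bar>g' t\<bar> powr q)"])
       (use gq g'q le dm in \<open>auto intro!: AE_I2 measurable_real_powr\<close>)
  have iK: "(\<integral>t. \<bar>g n t - g' t\<bar> powr q \<partial>ivl a b) \<le> K'" for n
  proof -
    have "(\<integral>t. \<bar>g n t - g' t\<bar> powr q \<partial>ivl a b) \<le> (\<integral>t. 2 powr q * (\<bar>g n t\<bar> powr q + \<bar>g' t\<bar> powr q) \<partial>ivl a b)"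
      by (intro integral_mono i) (use gq g'q le in auto)
    also have "\<dots> = 2 powr q * ((\<integral>t. \<bar>g n t\<bar> powr q \<partial>ivl a b) + (\<integral>t. \<bar>g' t\<bar> powr q \<partial>ivl a b))"
      using gq g'q by simp
    also have "\<dots> \<le> K'" unfolding K'_def using gq(2)[of n] by (intro mult_left_mono) auto
    finally show ?thesis .
  qed
  have "0 \<le> (\<integral>t. \<bar>g 0 t - g' t\<bar> powr q \<partial>ivl a b)" by simp
  then have K': "K' \<ge> 0" using iK[of 0] by linarith
  define \<kappa> where "\<kappa> = e / (2 * (K' + 1))"
  have \<kappa>: "\<kappa> > 0" using e K' by (simp add: \<kappa>_def)
  have \<kappa>K: "\<kappa> * K' \<le> e / 2"
  proof -
    have "\<kappa> * K' \<le> \<kappa> * (K' + 1)" using \<kappa> by simp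
    also have "\<dots> = e / 2"
    proof -
      have "K' + 1 \<noteq> 0" using K' by linarith
      then show ?thesis by (simp add: \<kappa>_def divide_simps)
    qed
    finally show ?thesis .
  qed
  define N where "N = (1 / \<kappa>) powr (1 / (q - 1))"
  have N: "N \<ge> 0" by (simp add: N_def)
  have im: "integrable (ivl a b) (\<lambda>t. min \<bar>g n t - g' t\<bar> N)" for n
    by (rule integrable_ivl_bounded[of _ _ _ N]) (use dm N in auto)
  have "(\<lambda>n. \<integral>t. min \<bar>g n t - g' t\<bar> N \<partial>ivl a b) \<longlonglongrightarrow> (\<integral>t. 0 \<partial>ivl a b)"
  proof (rule integral_dominated_convergence[where w = "\<lambda>_. N"])
    show "AE t in ivl a b. (\<lambda>n. min \<bar>g n t - g' t\<bar> N) \<longlonglongrightarrow> 0"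
      using lim
    proof eventually_elim
      case (elim t)
      have "(\<lambda>n. min \<bar>g n t - g' t\<bar> N) \<longlonglongrightarrow> min \<bar>g' t - g' t\<bar> N" by (intro tendsto_intros elim)
      then show ?case using N by simp
    qed
  qed (use dm N in auto)
  then have "(\<lambda>n. \<integral>t. min \<bar>g n t - g' t\<bar> N \<partial>ivl a b) \<longlonglongrightarrow> 0" by simp
  from order_tendstoD(2)[OF this, of "e/2"] obtain n0 where
    n0: "\<And>n. n \<ge> n0 \<Longrightarrow> (\<integral>t. min \<bar>g n t - g' t\<bar> N \<partial>ivl a b) < e / 2"
    using e unfolding eventually_sequentially by auto
  show "\<exists>n0. \<forall>n\<ge>n0. norm ((\<integral>t. \<bar>g n t - g' t\<bar> \<partial>ivl a b) - 0) < e"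
  proof (intro exI[of _ n0] allI impI)
    fix n assume n: "n \<ge> n0"
    have pw: "\<bar>g n t - g' t\<bar> \<le> min \<bar>g n t - g' t\<bar> N + \<kappa> * \<bar>g n t - g' t\<bar> powr q" for t
      using truncation_le[OF q \<kappa>, of "\<bar>g n t - g' t\<bar>"] by (simp add: N_def)
    have "(\<integral>t. \<bar>g n t - g' t\<bar> \<partial>ivl a b) \<le> (\<integral>t. min \<bar>g n t - g' t\<bar> N + \<kappa> * \<bar>g n t - g' t\<bar> powr q \<partial>ivl a b)"
    proof (rule integral_mono')
      show "integrable (ivl a b) (\<lambda>t. min \<bar>g n t - g' t\<bar> N + \<kappa> * \<bar>g n t - g' t\<bar> powr q)"
        using im i by simp
      show "0 \<le> min \<bar>g n t - g' t\<bar> N + \<kappa> * \<bar>g n t - g' t\<bar> powr q" for t using N \<kappa> by simp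
    qed (rule pw)
    also have "\<dots> = (\<integral>t. min \<bar>g n t - g' t\<bar> N \<partial>ivl a b) + \<kappa> * (\<integral>t. \<bar>g n t - g' t\<bar> powr q \<partial>ivl a b)"
      using im i by simp
    also have "\<dots> < e / 2 + \<kappa> * K'" using n0[OF n] iK[of n] \<kappa> by (intro add_less_le_mono mult_left_mono) auto
    also have "\<dots> \<le> e" using \<kappa>K by linarith
    finally have "(\<integral>t. \<bar>g n t - g' t\<bar> \<partial>ivl a b) < e" .
    moreover have "0 \<le> (\<integral>t. \<bar>g n t - g' t\<bar> \<partial>ivl a b)" by simp
    ultimately show "norm ((\<integral>t. \<bar>g n t - g' t\<bar> \<partial>ivl a b) - 0) < e" by simp
  qed
qed

context evolution
begin

lemma dense_sequence:
  obtains v :: "nat \<Rightarrow> 'v" where "\<And>x e. e > 0 \<Longrightarrow> \<exists>i. dist (emb (v i)) x < e"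
proof -
  obtain D :: "'v set" where D: "countable D" "\<And>X. open X \<Longrightarrow> X \<noteq> {} \<Longrightarrow> \<exists>d\<in>D. d \<in> X"
    using countable_dense_setE by blast
  have ne: "D \<noteq> {}" using D(2)[of UNIV] by auto
  show ?thesis
  proof (rule that[of "from_nat_into D"])
    fix x :: 'h and e :: real assume e: "e > 0"
    have "x \<in> closure (range (blinfun_apply emb))" using dense_emb by simp
    then obtain u where u: "dist (emb u) x < e" unfolding closure_approachable using e by blast
    have "open {u. dist (emb u) x < e}" by (intro open_Collect_less continuous_intros)
    then obtain d where "d \<in> D" "dist (emb d) x < e" using D(2)[of "{u. dist (emb u) x < e}"] u by blast
    then show "\<exists>i. dist (emb (from_nat_into D i)) x < e"
      using from_nat_into_surj[OF D(1)] by blast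
  qed
qed

lemma total_of_dense:
  assumes dense: "\<And>x e. e > 0 \<Longrightarrow> \<exists>i. dist (u i) x < e" and z: "\<And>i. x \<bullet> u i = 0"
  shows "x = (0 :: 'h)"
proof (rule ccontr)
  assume "x \<noteq> 0"
  then have n: "norm x > 0" by simp
  obtain i where i: "dist (u i) x < norm x" using dense[OF n] by blast
  have "x \<bullet> x = x \<bullet> (x - u i)" using z[of i] by (simp add: inner_diff_right)
  also have "\<dots> \<le> norm x * norm (x - u i)" by (rule norm_cauchy_schwarz)
  also have "\<dots> < norm x * norm x" using i n by (intro mult_strict_left_mono) (auto simp: dist_norm norm_minus_commute)
  finally show False by (simp add: power2_norm_eq_inner[symmetric] power2_eq_square)
qed

text \<open>Countably many scalars suffice for one diagonal extraction: values at rational times,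
  tested with the \<open>v i\<close>. Equicontinuity in time, from the bounds on \<open>w\<close>
  and on the forcings, extends it to all times; the bound R extends the forcing part to all
  \<open>z\<close>.\<close>

lemma convergent_test_subsequence:
  fixes xn fn :: "nat \<Rightarrow> real \<Rightarrow> 'h" and v :: "nat \<Rightarrow> 'v"
  assumes t0: "0 \<le> t0" "t0 < T" and dense: "\<And>x e. e > 0 \<Longrightarrow> \<exists>i. dist (emb (v i)) x < e"
    and fm: "\<And>n. fn n \<in> borel_measurable (ivl t0 T)" and fR: "\<And>n. AE t in ivl t0 T. norm (fn n t) \<le> R"
    and xR: "\<And>n t. t \<in> {t0..T} \<Longrightarrow> norm (xn n t) \<le> R" and R: "R \<ge> 0"
    and wd: "\<And>n. weak_deriv emb t0 T (xn n) (wn n)" and w: "\<And>n. weak_Lq q {t0<..<T} (wn n)"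
    and wK: "\<And>n. (\<integral>t. norm (wn n t) powr q \<partial>ivl t0 T) \<le> K"
  obtains r :: "nat \<Rightarrow> nat" where "strict_mono r"
    "\<And>t i. t \<in> {t0..T} \<Longrightarrow> convergent (\<lambda>n. xn (r n) t \<bullet> emb (v i))"
    "\<And>t z. t \<in> {t0..T} \<Longrightarrow> convergent (\<lambda>n. \<integral>s. fn (r n) s \<bullet> z \<partial>ivl t0 t)"
proof -
  define F where "F = (\<lambda>n t z. \<integral>s. fn n s \<bullet> z \<partial>ivl t0 t)"
  have fi: "integrable (ivl s t) (\<lambda>s. fn n s \<bullet> z)" if "t0 \<le> s" "t \<le> T" for n s t z
    using ivl_mono_integrable[OF integrable_ivl_bounded[OF fm fR] that] by simp
  have Fb: "\<bar>\<integral>s. fn n s \<bullet> z \<partial>ivl s t\<bar> \<le> (t - s) * (R * norm z)" if st: "t0 \<le> s" "s \<le> t" "t \<le> T" for n s t z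
  proof -
    have "norm (\<integral>s. fn n s \<bullet> z \<partial>ivl s t) \<le> (\<integral>s. R * norm z \<partial>ivl s t)"
    proof (rule norm_integral_le[OF fi])
      show "AE s in ivl s t. norm (fn n s \<bullet> z) \<le> R * norm z"
        using ivl_mono_AE[OF fR st(1,3), of n]
      proof eventually_elim
        case (elim s)
        have "\<bar>fn n s \<bullet> z\<bar> \<le> norm (fn n s) * norm z" by (rule Cauchy_Schwarz_ineq2)
        also have "\<dots> \<le> R * norm z" using elim by (intro mult_right_mono) auto
        finally show ?case by simp
      qed
    qed (use st in auto)
    also have "\<dots> = (t - s) * (R * norm z)" by (rule ivl_integral_const) (use st in auto)
    finally show ?thesis by simp
  qed
  have Fd: "F n t z - F n s z = (\<integral>s. fn n s \<bullet> z \<partial>ivl s t)" if st: "t0 \<le> s" "s \<le> t" "t \<le> T" for n s t z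
    unfolding F_def using ivl_integral_add[OF fi[of t0 t n z], of s] st by simp
  \<comment> \<open>Both components are divided by 1 + |emb (v i)| because the extraction asks for
    one bound over all index pairs; the positive factor does not affect convergence.\<close>
  define \<Psi> where "\<Psi> = (\<lambda>n ti. case ti of (t, i) \<Rightarrow>
     ((xn n t \<bullet> emb (v i)) / (1 + norm (emb (v i))), F n t (emb (v i)) / (1 + norm (emb (v i)))))"
  have "\<exists>k::nat \<Rightarrow> nat. strict_mono k \<and> (\<forall>ti\<in>(\<rat> \<inter> {t0..T}) \<times> UNIV. \<exists>l. (\<lambda>n. \<Psi> (k n) ti) \<longlonglongrightarrow> l)"
  proof (rule function_convergent_subsequence[of "(\<rat> \<inter> {t0..T}) \<times> (UNIV :: nat set)" \<Psi> "R + (T - t0) * R"])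
    show "countable ((\<rat> \<inter> {t0..T}) \<times> (UNIV :: nat set))" using countable_rat by auto
    fix n and ti :: "real \<times> nat" assume "ti \<in> (\<rat> \<inter> {t0..T}) \<times> UNIV"
    then obtain t i where ti: "ti = (t, i)" "t \<in> {t0..T}" by (cases ti) auto
    let ?N = "1 + norm (emb (v i))"
    have N: "?N > 0" by (simp add: add_pos_nonneg)
    have "\<bar>xn n t \<bullet> emb (v i)\<bar> \<le> norm (xn n t) * norm (emb (v i))" by (rule Cauchy_Schwarz_ineq2)
    also have "\<dots> \<le> R * ?N" using xR[OF ti(2)] R by (intro mult_mono) auto
    finally have 1: "\<bar>(xn n t \<bullet> emb (v i)) / ?N\<bar> \<le> R" using N by (simp add: field_simps)
    have "\<bar>F n t (emb (v i))\<bar> \<le> (t - t0) * (R * norm (emb (v i)))"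
      unfolding F_def by (rule Fb) (use ti in auto)
    also have "\<dots> \<le> (T - t0) * (R * ?N)" using ti R by (intro mult_mono) auto
    finally have 2: "\<bar>F n t (emb (v i)) / ?N\<bar> \<le> (T - t0) * R" using N by (simp add: field_simps)
    show "norm (\<Psi> n ti) \<le> R + (T - t0) * R"
      using norm_Pair_le[of "(xn n t \<bullet> emb (v i)) / ?N" "F n t (emb (v i)) / ?N"] 1 2
      by (simp add: \<Psi>_def ti(1))
  next
    fix k :: "nat \<Rightarrow> nat" assume "strict_mono k" "\<And>x. x \<in> (\<rat> \<inter> {t0..T}) \<times> UNIV \<Longrightarrow> \<exists>l. (\<lambda>n. \<Psi> (k n) x) \<longlonglongrightarrow> l"
    then show ?thesis by blast
  qed
  then obtain r :: "nat \<Rightarrow> nat" where r: "strict_mono r"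
    "\<And>t i. t \<in> \<rat> \<inter> {t0..T} \<Longrightarrow> \<exists>l. (\<lambda>n. \<Psi> (r n) (t, i)) \<longlonglongrightarrow> l" by blast
  have cr: "convergent (\<lambda>n. xn (r n) t \<bullet> emb (v i))" "convergent (\<lambda>n. F (r n) t (emb (v i)))"
    if t: "t \<in> \<rat> \<inter> {t0..T}" for t i
  proof -
    let ?N = "1 + norm (emb (v i))"
    have N: "?N \<noteq> 0" using norm_ge_zero[of "emb (v i)"] by linarith
    obtain l where l: "(\<lambda>n. \<Psi> (r n) (t, i)) \<longlonglongrightarrow> l" using r(2)[OF t] by blast
    have "(\<lambda>n. ?N * fst (\<Psi> (r n) (t, i))) \<longlonglongrightarrow> ?N * fst l" "(\<lambda>n. ?N * snd (\<Psi> (r n) (t, i))) \<longlonglongrightarrow> ?N * snd l"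
      by (intro tendsto_intros l)+
    then show "convergent (\<lambda>n. xn (r n) t \<bullet> emb (v i))" "convergent (\<lambda>n. F (r n) t (emb (v i)))"
      using N by (auto simp: \<Psi>_def intro: convergentI)
  qed
  have c1: "convergent (\<lambda>n. xn (r n) t \<bullet> emb (v i))" if t: "t \<in> {t0..T}" for t i
  proof (rule convergent_on_dense[OF t0(2) t cr(1)])
    fix e :: real assume e: "e > 0"
    have "0 \<le> (\<integral>t. norm (wn 0 t) powr q \<partial>ivl t0 T)" by simp
    then have K0: "K \<ge> 0" using wK[of 0] by linarith
    let ?nv = "norm (v i)"
    \<comment> \<open>By Young's inequality the integral of |w| over a short interval is at most
      \<kappa> K plus C times its length; \<kappa> and d make each part at most e/2 after
      multiplication by |v i|.\<close>
    define \<kappa> where "\<kappa> = e / (2 * (?nv + 1) * (K + 1))"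
    have \<kappa>: "\<kappa> > 0" using e K0 by (simp add: \<kappa>_def add_nonneg_pos)
    have \<kappa>K: "?nv * (\<kappa> * K) \<le> e / 2"
    proof -
      have "?nv * (\<kappa> * K) \<le> (?nv + 1) * (\<kappa> * (K + 1))" using \<kappa> K0 by (intro mult_mono) auto
      also have "\<dots> = e / 2"
      proof -
        have "?nv + 1 \<noteq> 0" "K + 1 \<noteq> 0" using norm_ge_zero[of "v i"] K0 by linarith+
        then show ?thesis by (simp add: \<kappa>_def divide_simps)
      qed
      finally show ?thesis .
    qed
    obtain C where C: "C \<ge> 0" "\<And>r s. r \<ge> 0 \<Longrightarrow> s \<ge> 0 \<Longrightarrow> r * s \<le> \<kappa> * r powr q + C * s powr p"
      using Young_small[OF pq \<kappa>] by blast
    define d where "d = e / (2 * (?nv + 1) * (C + 1))"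
    have d: "d > 0" using e C by (simp add: d_def add_nonneg_pos)
    have Cd: "?nv * (C * d) \<le> e / 2"
    proof -
      have "?nv * (C * d) \<le> (?nv + 1) * ((C + 1) * d)" using d C by (intro mult_mono) auto
      also have "\<dots> = e / 2"
      proof -
        have "?nv + 1 \<noteq> 0" "C + 1 \<noteq> 0" using norm_ge_zero[of "v i"] C by linarith+
        then show ?thesis by (simp add: d_def divide_simps)
      qed
      finally show ?thesis .
    qed
    have key: "\<bar>xn n t \<bullet> emb (v i) - xn n s \<bullet> emb (v i)\<bar> \<le> e" if st: "t0 \<le> s" "s \<le> t" "t \<le> T" "t - s < d" for n s t
    proof -
      have iw: "integrable (ivl s t) (\<lambda>r. wn n r (v i))"
        by (rule ivl_mono_integrable[OF weak_Lq_integrable_apply[OF less_imp_le[OF q1] w]]) (use st in auto)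
      have iq: "integrable (ivl s t) (\<lambda>r. norm (wn n r) powr q)"
        by (rule ivl_mono_integrable[OF weak_Lq_integrable[OF w]]) (use st in auto)
      have "xn n t \<bullet> emb (v i) - xn n s \<bullet> emb (v i) = (\<integral>r. wn n r (v i) \<partial>ivl s t)"
        using weak_derivD[OF wd st(1,2,3), of n "v i"] by (simp add: inner_diff_left)
      also have "norm \<dots> \<le> (\<integral>r. ?nv * (\<kappa> * norm (wn n r) powr q + C) \<partial>ivl s t)"
      proof (rule norm_integral_le[OF iw])
        show "AE r in ivl s t. norm (wn n r (v i)) \<le> ?nv * (\<kappa> * norm (wn n r) powr q + C)"
        proof (rule AE_I2)
          fix r
          have "norm (wn n r (v i)) \<le> ?nv * (norm (wn n r) * 1)"
            using norm_blinfun[of "wn n r" "v i"] by (simp add: mult.commute)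
          also have "\<dots> \<le> ?nv * (\<kappa> * norm (wn n r) powr q + C * 1 powr p)"
            by (intro mult_left_mono C) auto
          finally show "norm (wn n r (v i)) \<le> ?nv * (\<kappa> * norm (wn n r) powr q + C)" by simp
        qed
      qed (use iq in simp)
      also have "\<dots> = ?nv * (\<kappa> * (\<integral>r. norm (wn n r) powr q \<partial>ivl s t) + (t - s) * C)"
        using iq ivl_integral_const[OF st(2), of C] by simp
      also have "\<dots> \<le> ?nv * (\<kappa> * K + d * C)"
      proof (intro mult_left_mono add_mono)
        have "(\<integral>r. norm (wn n r) powr q \<partial>ivl s t) \<le> (\<integral>r. norm (wn n r) powr q \<partial>ivl t0 T)"
          by (rule ivl_integral_nonneg_mono[OF weak_Lq_integrable[OF w]]) (use st in auto)
        then show "(\<integral>r. norm (wn n r) powr q \<partial>ivl s t) \<le> K" using wK[of n] by linarith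
        show "(t - s) * C \<le> d * C" using st C by (intro mult_right_mono) auto
      qed (use \<kappa> in auto)
      also have "\<dots> \<le> e" using \<kappa>K Cd by (simp add: distrib_left mult.commute)
      finally show ?thesis by simp
    qed
    have "\<forall>n. \<forall>s\<in>{t0..T}. \<forall>t\<in>{t0..T}. \<bar>s - t\<bar> < d \<longrightarrow> \<bar>xn (r n) s \<bullet> emb (v i) - xn (r n) t \<bullet> emb (v i)\<bar> \<le> e"
    proof (intro allI ballI impI)
      fix n s t assume st: "s \<in> {t0..T}" "t \<in> {t0..T}" "\<bar>s - t\<bar> < d"
      show "\<bar>xn (r n) s \<bullet> emb (v i) - xn (r n) t \<bullet> emb (v i)\<bar> \<le> e"
        using key[of s t "r n"] key[of t s "r n"] st by (cases "s \<le> t") (auto simp: abs_minus_commute)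
    qed
    then show "\<exists>d>0. \<forall>n. \<forall>s\<in>{t0..T}. \<forall>t\<in>{t0..T}. \<bar>s - t\<bar> < d \<longrightarrow> \<bar>xn (r n) s \<bullet> emb (v i) - xn (r n) t \<bullet> emb (v i)\<bar> \<le> e"
      using d by blast
  qed
  have c2: "convergent (\<lambda>n. F (r n) t (emb (v i)))" if t: "t \<in> {t0..T}" for t i
  proof (rule convergent_on_dense[OF t0(2) t cr(2)])
    fix e :: real assume e: "e > 0"
    let ?z = "emb (v i)"
    define d where "d = e / (R * norm ?z + 1)"
    have Rz: "R * norm ?z \<ge> 0" using R by simp
    have d: "d > 0" using e Rz by (simp add: d_def add_nonneg_pos)
    have dR: "d * (R * norm ?z) \<le> e"
    proof -
      have "d * (R * norm ?z) \<le> d * (R * norm ?z + 1)" using d by simp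
      also have "\<dots> = e" using Rz by (simp add: d_def add_nonneg_pos)
      finally show ?thesis .
    qed
    have key: "\<bar>F n t ?z - F n s ?z\<bar> \<le> e" if st: "t0 \<le> s" "s \<le> t" "t \<le> T" "t - s < d" for n s t
    proof -
      have "\<bar>F n t ?z - F n s ?z\<bar> \<le> (t - s) * (R * norm ?z)"
        unfolding Fd[OF st(1-3)] by (rule Fb[OF st(1-3)])
      also have "\<dots> \<le> d * (R * norm ?z)" using st Rz by (intro mult_right_mono) auto
      finally show ?thesis using dR by linarith
    qed
    have "\<forall>n. \<forall>s\<in>{t0..T}. \<forall>t\<in>{t0..T}. \<bar>s - t\<bar> < d \<longrightarrow> \<bar>F (r n) s ?z - F (r n) t ?z\<bar> \<le> e"
    proof (intro allI ballI impI)
      fix n s t assume st: "s \<in> {t0..T}" "t \<in> {t0..T}" "\<bar>s - t\<bar> < d"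
      show "\<bar>F (r n) s ?z - F (r n) t ?z\<bar> \<le> e"
        using key[of s t "r n"] key[of t s "r n"] st by (cases "s \<le> t") (auto simp: abs_minus_commute)
    qed
    then show "\<exists>d>0. \<forall>n. \<forall>s\<in>{t0..T}. \<forall>t\<in>{t0..T}. \<bar>s - t\<bar> < d \<longrightarrow> \<bar>F (r n) s ?z - F (r n) t ?z\<bar> \<le> e"
      using d by blast
  qed
  have c3: "convergent (\<lambda>n. F (r n) t z)" if t: "t \<in> {t0..T}" for t z
  proof (rule Cauchy_convergent, rule CauchyI)
    fix e :: real assume e: "e > 0"
    define \<eta> where "\<eta> = e / (4 * ((T - t0) * R + 1))"
    have TR: "(T - t0) * R \<ge> 0" using t0 R by simp
    have \<eta>: "\<eta> > 0" using e TR by (simp add: \<eta>_def add_nonneg_pos)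
    have \<eta>R: "(T - t0) * (R * \<eta>) \<le> e / 4"
    proof -
      have "(T - t0) * (R * \<eta>) \<le> ((T - t0) * R + 1) * \<eta>" using \<eta> by (simp add: algebra_simps)
      also have "\<dots> = e / 4"
      proof -
        have "(T - t0) * R + 1 \<noteq> 0" using TR by linarith
        then show ?thesis by (simp add: \<eta>_def divide_simps)
      qed
      finally show ?thesis .
    qed
    obtain i where i: "dist (emb (v i)) z < \<eta>" using dense[OF \<eta>] by blast
    have near: "\<bar>F n t z - F n t (emb (v i))\<bar> \<le> e / 4" for n
    proof -
      have "F n t z - F n t (emb (v i)) = F n t (z - emb (v i))"
        unfolding F_def inner_diff_right by (rule Bochner_Integration.integral_diff[symmetric]; rule fi; use t in auto)
      also have "\<bar>\<dots>\<bar> \<le> (t - t0) * (R * norm (z - emb (v i)))"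
        unfolding F_def by (rule Fb) (use t in auto)
      also have "\<dots> \<le> (T - t0) * (R * \<eta>)"
        using t R i by (intro mult_mono) (auto simp: dist_norm norm_minus_commute)
      finally show ?thesis using \<eta>R by linarith
    qed
    obtain N where N: "\<And>m n. m \<ge> N \<Longrightarrow> n \<ge> N \<Longrightarrow> norm (F (r m) t (emb (v i)) - F (r n) t (emb (v i))) < e / 4"
      using CauchyD[OF convergent_Cauchy[OF c2[OF t, of i]], of "e/4"] e by auto
    show "\<exists>M. \<forall>m\<ge>M. \<forall>n\<ge>M. norm (F (r m) t z - F (r n) t z) < e"
    proof (intro exI[of _ N] allI impI)
      fix m n assume "m \<ge> N" "n \<ge> N"
      then have "norm (F (r m) t (emb (v i)) - F (r n) t (emb (v i))) < e / 4" by (rule N)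
      then show "norm (F (r m) t z - F (r n) t z) < e"
        using near[of "r m"] near[of "r n"] e unfolding real_norm_def by linarith
    qed
  qed
  show ?thesis by (rule that[OF r(1) c1 c3[unfolded F_def]])
qed

text \<open>The interpolation inequality splits the distance in H into a small multiple of V-norms,
  whose integrals are bounded, and finitely many coordinates, which converge in L^1 by dominated
  convergence.\<close>

lemma L1_Cauchy:
  fixes xn :: "nat \<Rightarrow> real \<Rightarrow> 'h" and v :: "nat \<Rightarrow> 'v"
  assumes t0: "0 \<le> t0" "t0 < T" and dense: "\<And>x e. e > 0 \<Longrightarrow> \<exists>i. dist (emb (v i)) x < e"
    and xc: "\<And>n. continuous_on {t0..T} (xn n)" and xR: "\<And>n t. t \<in> {t0..T} \<Longrightarrow> norm (xn n t) \<le> R"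
    and y: "\<And>n. Lp_fun p {t0<..<T} (yn n)" and yK: "\<And>n. (\<integral>t. norm (yn n t) powr p \<partial>ivl t0 T) \<le> K"
    and xy: "\<And>n. AE t in ivl t0 T. xn n t = emb (yn n t)"
    and conv: "\<And>t i. t \<in> {t0..T} \<Longrightarrow> convergent (\<lambda>n. xn n t \<bullet> emb (v i))"
    and e: "e > 0"
  shows "\<exists>N. \<forall>m\<ge>N. \<forall>n\<ge>N. (\<integral>t. norm (xn m t - xn n t) \<partial>ivl t0 T) < e"
proof -
  have "0 \<le> (\<integral>t. norm (yn 0 t) powr p \<partial>ivl t0 T)" by simp
  then have K0: "K \<ge> 0" using yK[of 0] by linarith
  \<comment> \<open>Twice the bound on the integral of |yn|, obtained from r \<le> 1 + r^p.\<close>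
  define B where "B = 2 * ((T - t0) + K)"
  have B: "B \<ge> 0" using K0 t0 by (simp add: B_def)
  define \<eta> where "\<eta> = e / (4 * (B + 1))"
  have \<eta>: "\<eta> > 0" using e B by (simp add: \<eta>_def)
  have \<eta>B: "\<eta> * B \<le> e / 4"
  proof -
    have "\<eta> * B \<le> \<eta> * (B + 1)" using \<eta> by simp
    also have "\<dots> = e / 4"
    proof -
      have "B + 1 \<noteq> 0" using B by linarith
      then show ?thesis by (simp add: \<eta>_def divide_simps)
    qed
    finally show ?thesis .
  qed
  obtain k :: nat where k: "\<And>u. norm (emb u) \<le> \<eta> * norm u + real k * (\<Sum>i<k. \<bar>emb u \<bullet> emb (v i)\<bar>)"
    using compact_embedding_interpolation[OF compact_emb total_of_dense[OF dense] \<eta>, of "\<lambda>i. emb (v i)"] by metis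
  define \<phi> where "\<phi> = (\<lambda>i t. lim (\<lambda>n. xn n t \<bullet> emb (v i)))"
  have xm: "(\<lambda>t. xn n t \<bullet> emb (v i)) \<in> borel_measurable (ivl t0 T)" for n i
    using continuous_measurable_ivl[OF xc] by simp
  have \<phi>m: "\<phi> i \<in> borel_measurable (ivl t0 T)" for i
    unfolding \<phi>_def by (rule borel_measurable_lim_metric) (rule xm)
  have \<phi>l: "(\<lambda>n. xn n t \<bullet> emb (v i)) \<longlonglongrightarrow> \<phi> i t" if "t \<in> {t0..T}" for t i
    using conv[OF that] unfolding \<phi>_def convergent_LIMSEQ_iff .
  have xb: "\<bar>xn n t \<bullet> emb (v i)\<bar> \<le> R * norm (emb (v i))" if "t \<in> {t0..T}" for n t i
  proof -
    have "\<bar>xn n t \<bullet> emb (v i)\<bar> \<le> norm (xn n t) * norm (emb (v i))" by (rule Cauchy_Schwarz_ineq2)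
    also have "\<dots> \<le> R * norm (emb (v i))" using xR[OF that] by (intro mult_right_mono) auto
    finally show ?thesis .
  qed
  have \<phi>b: "\<bar>\<phi> i t\<bar> \<le> R * norm (emb (v i))" if "t \<in> {t0..T}" for t i
    by (rule LIMSEQ_le_const2[OF tendsto_rabs[OF \<phi>l[OF that]]]) (use xb[OF that] in blast)
  have di: "integrable (ivl t0 T) (\<lambda>t. \<bar>xn n t \<bullet> emb (v i) - \<phi> i t\<bar>)" for n i
  proof (rule integrable_ivl_bounded[of _ _ _ "2 * (R * norm (emb (v i)))"])
    show "AE t in ivl t0 T. norm \<bar>xn n t \<bullet> emb (v i) - \<phi> i t\<bar> \<le> 2 * (R * norm (emb (v i)))"
    proof (rule AE_I2)
      fix t assume "t \<in> space (ivl t0 T)"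
      then have t: "t \<in> {t0..T}" by auto
      show "norm \<bar>xn n t \<bullet> emb (v i) - \<phi> i t\<bar> \<le> 2 * (R * norm (emb (v i)))"
        using xb[OF t, of n i] \<phi>b[OF t, of i] by simp
    qed
  qed (use xm \<phi>m in auto)
  define D where "D = (\<lambda>i n. \<integral>t. \<bar>xn n t \<bullet> emb (v i) - \<phi> i t\<bar> \<partial>ivl t0 T)"
  have D0: "D i \<longlonglongrightarrow> 0" for i
  proof -
    have "(\<lambda>n. \<integral>t. \<bar>xn n t \<bullet> emb (v i) - \<phi> i t\<bar> \<partial>ivl t0 T) \<longlonglongrightarrow> (\<integral>t. 0 \<partial>ivl t0 T)"
    proof (rule integral_dominated_convergence[where w = "\<lambda>_. 2 * (R * norm (emb (v i)))"])
      show "AE t in ivl t0 T. (\<lambda>n. \<bar>xn n t \<bullet> emb (v i) - \<phi> i t\<bar>) \<longlonglongrightarrow> 0"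
      proof (rule AE_I2)
        fix t assume "t \<in> space (ivl t0 T)"
        then have "(\<lambda>n. \<bar>xn n t \<bullet> emb (v i) - \<phi> i t\<bar>) \<longlonglongrightarrow> \<bar>\<phi> i t - \<phi> i t\<bar>"
          by (intro tendsto_intros \<phi>l) auto
        then show "(\<lambda>n. \<bar>xn n t \<bullet> emb (v i) - \<phi> i t\<bar>) \<longlonglongrightarrow> 0" by simp
      qed
      show "AE t in ivl t0 T. norm \<bar>xn n t \<bullet> emb (v i) - \<phi> i t\<bar> \<le> 2 * (R * norm (emb (v i)))" for n
      proof (rule AE_I2)
        fix t assume "t \<in> space (ivl t0 T)"
        then have t: "t \<in> {t0..T}" by auto
        show "norm \<bar>xn n t \<bullet> emb (v i) - \<phi> i t\<bar> \<le> 2 * (R * norm (emb (v i)))"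
          using xb[OF t, of n i] \<phi>b[OF t, of i] by simp
      qed
    qed (use xm \<phi>m in auto)
    then show ?thesis by (simp add: D_def)
  qed
  have "(\<lambda>n. real k * (\<Sum>i<k. D i n)) \<longlonglongrightarrow> real k * (\<Sum>i<k. 0)" by (intro tendsto_intros D0)
  then have "(\<lambda>n. real k * (\<Sum>i<k. D i n)) \<longlonglongrightarrow> 0" by simp
  from order_tendstoD(2)[OF this, of "e/4"] obtain N where
    N: "\<And>n. n \<ge> N \<Longrightarrow> real k * (\<Sum>i<k. D i n) < e / 4" using e unfolding eventually_sequentially by auto
  have iy: "integrable (ivl t0 T) (\<lambda>t. norm (yn n t))" for n
    by (rule Lp_fun_integrable_norm[OF less_imp_le[OF pq(1)] y])
  have yB: "(\<integral>t. norm (yn n t) \<partial>ivl t0 T) \<le> (T - t0) + K" for n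
  proof -
    have "(\<integral>t. norm (yn n t) \<partial>ivl t0 T) \<le> (\<integral>t. 1 + norm (yn n t) powr p \<partial>ivl t0 T)"
      using iy Lp_fun_integrable[OF y] pq by (intro integral_mono) (auto intro!: le_one_add_powr)
    also have "\<dots> = (T - t0) + (\<integral>t. norm (yn n t) powr p \<partial>ivl t0 T)"
      using Lp_fun_integrable[OF y] ivl_integral_const[of t0 T 1] t0 by simp
    finally show ?thesis using yK[of n] by linarith
  qed
  have main: "(\<integral>t. norm (xn m t - xn n t) \<partial>ivl t0 T) < e" if mn: "m \<ge> N" "n \<ge> N" for m n
  proof -
    let ?E = "\<lambda>t. \<eta> * (norm (yn m t) + norm (yn n t))
        + real k * (\<Sum>i<k. \<bar>xn m t \<bullet> emb (v i) - \<phi> i t\<bar> + \<bar>xn n t \<bullet> emb (v i) - \<phi> i t\<bar>)"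
    have "(\<integral>t. norm (xn m t - xn n t) \<partial>ivl t0 T) \<le> (\<integral>t. ?E t \<partial>ivl t0 T)"
    proof (rule integral_mono_AE)
      show "AE t in ivl t0 T. norm (xn m t - xn n t) \<le> ?E t"
        using xy[of m] xy[of n]
      proof eventually_elim
        case (elim t)
        have x: "xn m t - xn n t = emb (yn m t - yn n t)" using elim by (simp add: blinfun.diff_right)
        have "norm (xn m t - xn n t) \<le> \<eta> * norm (yn m t - yn n t) + real k * (\<Sum>i<k. \<bar>(xn m t - xn n t) \<bullet> emb (v i)\<bar>)"
          unfolding x by (rule k)
        also have "\<dots> \<le> ?E t"
        proof (intro add_mono mult_left_mono sum_mono)
          show "\<bar>(xn m t - xn n t) \<bullet> emb (v i)\<bar> \<le> \<bar>xn m t \<bullet> emb (v i) - \<phi> i t\<bar> + \<bar>xn n t \<bullet> emb (v i) - \<phi> i t\<bar>" for i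
            unfolding inner_diff_left by linarith
        qed (use \<eta> norm_triangle_ineq4 in auto)
        finally show ?case .
      qed
      show "integrable (ivl t0 T) ?E" using iy di by (intro Bochner_Integration.integrable_add integrable_mult_right Bochner_Integration.integrable_sum) auto
      show "integrable (ivl t0 T) (\<lambda>t. norm (xn m t - xn n t))"
        by (intro continuous_integrable_ivl continuous_intros xc)
    qed
    also have "\<dots> = \<eta> * ((\<integral>t. norm (yn m t) \<partial>ivl t0 T) + (\<integral>t. norm (yn n t) \<partial>ivl t0 T))
        + real k * (\<Sum>i<k. D i m + D i n)"
      using iy di unfolding D_def
      by (subst Bochner_Integration.integral_add) (auto simp: Bochner_Integration.integral_sum)
    also have "\<dots> \<le> \<eta> * B + (real k * (\<Sum>i<k. D i m) + real k * (\<Sum>i<k. D i n))"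
    proof (rule add_mono)
      show "\<eta> * ((\<integral>t. norm (yn m t) \<partial>ivl t0 T) + (\<integral>t. norm (yn n t) \<partial>ivl t0 T)) \<le> \<eta> * B"
        using yB[of m] yB[of n] \<eta> by (intro mult_left_mono) (auto simp: B_def)
    qed (simp add: sum.distrib distrib_left)
    also have "\<dots> < e" using \<eta>B N[OF mn(1)] N[OF mn(2)] e by linarith
    finally show ?thesis .
  qed
  then show ?thesis by blast
qed

text \<open>In the energy identity for a difference of trajectories the operator term has a
  favourable sign, and the forcings differ by at most 2R. This converts L^1 convergence into uniform
  convergence.\<close>

lemma trajectory_difference:
  assumes t0: "0 \<le> t0" "t0 < T" and x: "x \<in> paths T" and x': "x' \<in> paths T"
    and s: "sol t0 x f y w" and s': "sol t0 x' f' y' w'" and init: "x t0 = x' t0" and R: "R \<ge> 0"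
    and fR: "AE t in ivl t0 T. norm (f t) \<le> R" "AE t in ivl t0 T. norm (f' t) \<le> R" and t: "t \<in> {t0..T}"
  shows "(norm (x t - x' t))\<^sup>2 \<le> 4 * R * (\<integral>s. norm (x s - x' s) \<partial>ivl t0 T)"
proof -
  have tt: "t0 \<le> t" "t \<le> T" using t by auto
  have c: "continuous_on {t0..T} x" "continuous_on {t0..T} x'"
    using path_continuous_from[OF _ t0(1)] x x' by auto
  have yd: "Lp_fun p {t0<..<T} (\<lambda>t. y t - y' t)"
    using pq by (intro Lp_fun_diff solD(2)[OF s] solD(2)[OF s']) auto
  have wd: "weak_Lq q {t0<..<T} (\<lambda>t. w t - w' t)"
    using q1 by (intro weak_Lq_diff solD(3)[OF s] solD(3)[OF s']) auto
  have "(norm (x t - x' t))\<^sup>2 - (norm (x t0 - x' t0))\<^sup>2 = 2 * (\<integral>s. (w s - w' s) (y s - y' s) \<partial>ivl t0 t)"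
  proof (rule energy_identity[OF tt(1)])
    show "continuous_on {t0..t} (\<lambda>t. x t - x' t)"
      using c tt by (intro continuous_intros) (auto intro: continuous_on_subset)
    show "Lp_fun p {t0<..<t} (\<lambda>t. y t - y' t)" by (rule Lp_fun_mono[OF yd order_refl tt(2)])
    show "weak_Lq q {t0<..<t} (\<lambda>t. w t - w' t)" by (rule weak_Lq_mono[OF wd order_refl tt(2)])
    show "AE t in ivl t0 t. x t - x' t = emb (y t - y' t)"
      using ivl_mono_AE[OF solD(4)[OF s] order_refl tt(2)] ivl_mono_AE[OF solD(4)[OF s'] order_refl tt(2)]
      by eventually_elim (simp add: blinfun.diff_right)
    show "weak_deriv emb t0 t (\<lambda>t. x t - x' t) (\<lambda>t. w t - w' t)"
      unfolding weak_deriv_def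
    proof (intro allI impI)
      fix a b v assume ab: "t0 \<le> a" "a \<le> b" "b \<le> t"
      then have bT: "b \<le> T" using tt by simp
      have i: "integrable (ivl a b) (\<lambda>t. u t v)" if "weak_Lq q {t0<..<T} u" for u :: "real \<Rightarrow> 'v \<Rightarrow>\<^sub>L real"
        by (rule ivl_mono_integrable[OF weak_Lq_integrable_apply[OF less_imp_le[OF q1] that] ab(1) bT])
      show "(x b - x' b - (x a - x' a)) \<bullet> emb v = (\<integral>r. (w r - w' r) v \<partial>ivl a b)"
        using weak_derivD[OF solD(5)[OF s] ab(1,2) bT, of v] weak_derivD[OF solD(5)[OF s'] ab(1,2) bT, of v]
          i[OF solD(3)[OF s]] i[OF solD(3)[OF s']]
        by (simp add: blinfun.diff_left inner_diff_left)
    qed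
  qed
  also have "(\<integral>s. (w s - w' s) (y s - y' s) \<partial>ivl t0 t) \<le> (\<integral>s. 2 * R * norm (x s - x' s) \<partial>ivl t0 t)"
  proof (rule integral_mono_AE)
    show "integrable (ivl t0 t) (\<lambda>s. (w s - w' s) (y s - y' s))"
      by (rule ivl_mono_integrable[OF integrable_dual_pairing[OF pq wd yd] order_refl tt(2)])
    show "integrable (ivl t0 t) (\<lambda>s. 2 * R * norm (x s - x' s))"
      using c tt by (intro continuous_integrable_ivl continuous_intros) (auto intro: continuous_on_subset)
    have "AE s in ivl t0 T. (w s - w' s) (y s - y' s) \<le> 2 * R * norm (x s - x' s)"
      using solD(4)[OF s] solD(4)[OF s'] solD(6)[OF s] solD(6)[OF s'] fR A_monotone[OF t0(1)]
    proof eventually_elim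
      case (elim r)
      have w: "w r = to_dual emb (f r) - A r (y r)" "w' r = to_dual emb (f' r) - A r (y' r)"
        using elim(3,4) by (metis add_diff_cancel_right')+
      have "(w r - w' r) (y r - y' r) = (f r - f' r) \<bullet> (x r - x' r) - (A r (y r) - A r (y' r)) (y r - y' r)"
        unfolding w using elim(1,2)
        by (simp add: blinfun.diff_left blinfun.diff_right inner_diff_left inner_diff_right)
      also have "\<dots> \<le> (f r - f' r) \<bullet> (x r - x' r)" using elim(7) by simp
      also have "\<dots> \<le> norm (f r - f' r) * norm (x r - x' r)" by (rule norm_cauchy_schwarz)
      also have "\<dots> \<le> (2 * R) * norm (x r - x' r)"
        using elim(5,6) norm_triangle_ineq4[of "f r" "f' r"] by (intro mult_right_mono) auto
      finally show ?case .
    qed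
    then show "AE s in ivl t0 t. (w s - w' s) (y s - y' s) \<le> 2 * R * norm (x s - x' s)"
      by (rule ivl_mono_AE[OF _ order_refl tt(2)])
  qed
  also have "(\<integral>s. 2 * R * norm (x s - x' s) \<partial>ivl t0 t) \<le> (\<integral>s. 2 * R * norm (x s - x' s) \<partial>ivl t0 T)"
    using c R tt by (intro ivl_integral_nonneg_mono continuous_integrable_ivl continuous_intros) auto
  finally show ?thesis using init by simp
qed

end

section \<open>Compactness of the set of trajectories\<close>

text \<open>Closed balls are the right test sets for inverting \<open>emb\<close>: their images in H
  are closed, hence Borel.\<close>

lemma borel_measurable_cballI:
  fixes y :: "'a \<Rightarrow> 'v::{metric_space, second_countable_topology}"
  assumes "\<And>v r. y -` cball v r \<inter> space M \<in> sets M"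
  shows "y \<in> borel_measurable M"
proof (rule borel_measurableI)
  fix S :: "'v set" assume S: "open S"
  obtain D :: "'v set" where D: "countable D" "\<And>X. open X \<Longrightarrow> X \<noteq> {} \<Longrightarrow> \<exists>d\<in>D. d \<in> X"
    using countable_dense_setE by blast
  define I where "I = {(d, r). d \<in> D \<and> r \<in> \<rat> \<and> cball d r \<subseteq> S}"
  have cI: "countable I"
    by (rule countable_subset[of _ "D \<times> \<rat>"]) (auto simp: I_def D countable_rat)
  have SU: "S = (\<Union>(d, r)\<in>I. cball d r)"
  proof (intro equalityI subsetI)
    fix g assume "g \<in> S"
    then obtain e where e: "e > 0" "ball g e \<subseteq> S" using S open_contains_ball by blast
    obtain r where r: "r \<in> \<rat>" "e/4 < r" "r < e/2" using Rats_dense_in_real[of "e/4" "e/2"] e by auto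
    obtain d where d: "d \<in> D" "d \<in> ball g (e/4)" using D(2)[of "ball g (e/4)"] e by auto
    have "cball d r \<subseteq> ball g e"
    proof
      fix z assume "z \<in> cball d r"
      then have "dist d z \<le> r" by simp
      then show "z \<in> ball g e" using d r e dist_triangle[of g z d] by (simp add: dist_commute)
    qed
    then have "(d, r) \<in> I" using d r e by (auto simp: I_def)
    moreover have "g \<in> cball d r" using d r by (auto simp: dist_commute)
    ultimately show "g \<in> (\<Union>(d, r)\<in>I. cball d r)" by blast
  qed (auto simp: I_def)
  have "y -` S \<inter> space M = (\<Union>(d, r)\<in>I. y -` cball d r \<inter> space M)"
    by (subst SU) (force split: prod.splits)
  also have "\<dots> \<in> sets M"
    by (rule sets.countable_UN'[OF cI]) (use assms in auto)
  finally show "y -` S \<inter> space M \<in> sets M" .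
qed

lemma closed_frequently_limit:
  fixes X :: "nat \<Rightarrow> 'a::topological_space"
  assumes "closed S" "X \<longlonglongrightarrow> x" "\<exists>\<^sub>F n in sequentially. X n \<in> S"
  shows "x \<in> S"
proof (rule ccontr)
  assume "x \<notin> S"
  then have "\<forall>\<^sub>F n in sequentially. X n \<in> - S"
    using assms(1,2) by (intro topological_tendstoD) auto
  then show False using assms(3) by (simp add: frequently_def)
qed

lemma sup_norm_upto_diff_le:
  fixes x x' :: "real \<Rightarrow> 'h::real_normed_vector"
  assumes "x \<in> paths T" "x' \<in> paths T" "0 \<le> t" "t \<le> T" "\<And>s. s \<in> {0..T} \<Longrightarrow> norm (x s - x' s) \<le> e"
  shows "\<bar>sup_norm_upto x t - sup_norm_upto x' t\<bar> \<le> e"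
proof -
  have le: "sup_norm_upto u t \<le> sup_norm_upto u' t + e"
    if "u \<in> paths T" "u' \<in> paths T" "\<And>s. s \<in> {0..T} \<Longrightarrow> norm (u s - u' s) \<le> e" for u u' :: "real \<Rightarrow> 'h"
  proof (rule sup_norm_upto_le[OF assms(3)])
    fix s assume s: "0 \<le> s" "s \<le> t"
    have "norm (u s) \<le> norm (u' s) + norm (u s - u' s)" by (rule norm_triangle_sub)
    moreover have "norm (u' s) \<le> sup_norm_upto u' t" by (rule norm_le_sup_norm_upto[OF that(2) s assms(4)])
    moreover have "norm (u s - u' s) \<le> e" using s assms(4) by (intro that(3)) auto
    ultimately show "norm (u s) \<le> sup_norm_upto u' t + e" by linarith
  qed
  have "norm (x' s - x s) \<le> e" if "s \<in> {0..T}" for s using assms(5)[OF that] by (simp add: norm_minus_commute)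
  from le[OF assms(1,2,5)] le[OF assms(2,1) this] show ?thesis by linarith
qed

context evolution
begin

text \<open>Fatou's lemma makes the lower limit of |yn n t|^p finite for almost every t. At such t
  infinitely many \<open>xn n t\<close> lie in one embedded ball, which is closed in H, so the limit
  lies in it as well.\<close>

lemma embedded_limit:
  fixes yn :: "nat \<Rightarrow> real \<Rightarrow> 'v"
  assumes y: "\<And>n. Lp_fun p {a<..<b} (yn n)" "\<And>n. (\<integral>t. norm (yn n t) powr p \<partial>ivl a b) \<le> K"
    and xy: "\<And>n. AE t in ivl a b. xn n t = emb (yn n t)"
    and x: "continuous_on {a..b} x" and lim: "\<And>t. t \<in> {a<..<b} \<Longrightarrow> (\<lambda>n. xn n t) \<longlonglongrightarrow> x t"
  obtains u where "Lp_fun p {a<..<b} u" "AE t in ivl a b. x t = emb (u t)"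
proof -
  \<comment> \<open>The pointwise preimage, with default 0 off the range of \<open>emb\<close>. The
    preimage of a ball under \<open>u\<close> is then the preimage of its embedded image under
    \<open>x\<close>, enlarged by the times where \<open>x\<close> leaves the range if the ball
    contains 0.\<close>
  define u where "u = (\<lambda>t. if x t \<in> range (blinfun_apply emb) then inv (blinfun_apply emb) (x t) else 0)"
  have eu: "emb (u t) = x t" if "x t \<in> range (blinfun_apply emb)" for t
    using that by (simp add: u_def f_inv_into_f)
  have xm: "x \<in> borel_measurable (ivl a b)" by (rule continuous_measurable_ivl[OF x])
  have cl: "blinfun_apply emb ` cball v r \<in> sets borel" for v r
    using closed_emb_cball[OF refl] by (rule borel_closed)
  have "range (blinfun_apply emb) = (\<Union>n::nat. blinfun_apply emb ` cball 0 (real n))"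
  proof -
    have "\<exists>n::nat. norm v \<le> real n" for v :: 'v by (rule real_arch_simple)
    then show ?thesis by fastforce
  qed
  then have rg: "range (blinfun_apply emb) \<in> sets borel"
    by (metis (no_types, lifting) cl sets.countable_nat_UN image_subsetI)
  have um: "u \<in> borel_measurable (ivl a b)"
  proof (rule borel_measurable_cballI)
    fix v r
    have in1: "u t \<in> cball v r \<longleftrightarrow> x t \<in> blinfun_apply emb ` cball v r" if "x t \<in> range (blinfun_apply emb)" for t
    proof
      assume "u t \<in> cball v r"
      then show "x t \<in> blinfun_apply emb ` cball v r" using eu[OF that] by (metis imageI)
    next
      assume "x t \<in> blinfun_apply emb ` cball v r"
      then obtain z where "z \<in> cball v r" "x t = emb z" by blast
      moreover then have "z = u t" using eu[OF that] inj_emb by (simp add: inj_eq)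
      ultimately show "u t \<in> cball v r" by simp
    qed
    have "u -` cball v r \<inter> space (ivl a b) = (x -` (blinfun_apply emb ` cball v r) \<inter> space (ivl a b)) \<union>
      (if 0 \<in> cball v r then x -` (- range (blinfun_apply emb)) \<inter> space (ivl a b) else {})"
    proof (rule set_eqI)
      fix t
      show "t \<in> u -` cball v r \<inter> space (ivl a b) \<longleftrightarrow> t \<in> (x -` (blinfun_apply emb ` cball v r) \<inter> space (ivl a b)) \<union>
      (if 0 \<in> cball v r then x -` (- range (blinfun_apply emb)) \<inter> space (ivl a b) else {})"
      proof (cases "x t \<in> range (blinfun_apply emb)")
        case True
        then show ?thesis using in1[OF True] by auto
      next
        case False
        then have "u t = 0" by (simp add: u_def)
        then show ?thesis using False by auto
      qed
    qed
    moreover have "x -` (blinfun_apply emb ` cball v r) \<inter> space (ivl a b) \<in> sets (ivl a b)"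
      by (rule measurable_sets[OF xm cl])
    moreover have "x -` (- range (blinfun_apply emb)) \<inter> space (ivl a b) \<in> sets (ivl a b)"
      by (rule measurable_sets[OF xm borel_comp[OF rg]])
    ultimately show "u -` cball v r \<inter> space (ivl a b) \<in> sets (ivl a b)" by auto
  qed
  define \<phi> where "\<phi> = (\<lambda>t. liminf (\<lambda>n. ennreal (norm (yn n t) powr p)))"
  have nm: "(\<lambda>t. ennreal (norm (yn n t) powr p)) \<in> borel_measurable (ivl a b)" for n
    using Lp_fun_integrable[OF y(1)] by simp
  have \<phi>K: "(\<integral>\<^sup>+t. \<phi> t \<partial>ivl a b) \<le> ennreal K"
  proof -
    have "(\<integral>\<^sup>+t. \<phi> t \<partial>ivl a b) \<le> liminf (\<lambda>n. \<integral>\<^sup>+t. ennreal (norm (yn n t) powr p) \<partial>ivl a b)"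
      unfolding \<phi>_def by (rule nn_integral_liminf[OF nm])
    also have "\<dots> \<le> liminf (\<lambda>n. ennreal K)"
    proof (rule Liminf_mono, rule always_eventually, rule allI)
      fix n
      show "(\<integral>\<^sup>+t. ennreal (norm (yn n t) powr p) \<partial>ivl a b) \<le> ennreal K"
        using nn_integral_eq_integral[OF Lp_fun_integrable[OF y(1)]] y(2)[of n] by (simp add: ennreal_leI)
    qed
    also have "\<dots> = ennreal K" by (simp add: Liminf_const)
    finally show ?thesis .
  qed
  have \<phi>m: "\<phi> \<in> borel_measurable (ivl a b)" unfolding \<phi>_def by (rule borel_measurable_liminf[OF nm])
  have "AE t in ivl a b. \<phi> t \<noteq> \<infinity>"
    by (rule nn_integral_PInf_AE[OF \<phi>m]) (use \<phi>K ennreal_less_top le_less_trans in \<open>auto simp: top_unique\<close>)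
  moreover have "AE t in ivl a b. \<forall>n. xn n t = emb (yn n t)" unfolding AE_all_countable using xy by blast
  ultimately have key: "AE t in ivl a b. x t = emb (u t) \<and> ennreal (norm (u t) powr p) \<le> \<phi> t"
    using AE_space[of "ivl a b"]
  proof eventually_elim
    case (elim t)
    then have t: "t \<in> {a<..<b}" by auto
    obtain k where k: "\<phi> t = ennreal k" "k \<ge> 0" using elim(1) by (cases "\<phi> t") auto
    \<comment> \<open>For each level c above the lower limit, powers below c occur frequently;
      letting c decrease to k recovers the bound by the lower limit itself.\<close>
    have up: "x t = emb (u t) \<and> norm (u t) powr p \<le> c" if c: "c > k" for c
    proof -
      have cpos: "c > 0" using c k by simp
      have "\<exists>\<^sub>F n in sequentially. norm (yn n t) powr p < c"
      proof (rule ccontr)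
        assume "\<not> (\<exists>\<^sub>F n in sequentially. norm (yn n t) powr p < c)"
        then have "\<forall>\<^sub>F n in sequentially. ennreal c \<le> ennreal (norm (yn n t) powr p)"
          by (simp add: not_frequently ennreal_leI not_less)
        then have "ennreal c \<le> \<phi> t" unfolding \<phi>_def by (rule Liminf_bounded)
        then show False using c k by (simp add: ennreal_le_iff)
      qed
      then have "\<exists>\<^sub>F n in sequentially. xn n t \<in> blinfun_apply emb ` cball 0 (c powr (1 / p))"
      proof (rule frequently_elim1)
        fix n assume n: "norm (yn n t) powr p < c"
        have "norm (yn n t) = (norm (yn n t) powr p) powr (1 / p)" using pq by (simp add: powr_powr)
        also have "\<dots> \<le> c powr (1 / p)" using n pq by (intro powr_mono2) auto
        finally show "xn n t \<in> blinfun_apply emb ` cball 0 (c powr (1 / p))" using elim(2) by auto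
      qed
      then have "x t \<in> blinfun_apply emb ` cball 0 (c powr (1 / p))"
        by (rule closed_frequently_limit[OF closed_emb_cball[OF refl] lim[OF t]])
      then obtain z where z: "norm z \<le> c powr (1 / p)" "x t = emb z" by auto
      then have xu: "x t = emb (u t)" using eu[of t] by simp
      then have "z = u t" using z inj_emb by (simp add: inj_eq)
      then have "norm (u t) powr p \<le> (c powr (1 / p)) powr p" using z pq by (intro powr_mono2) auto
      also have "\<dots> = c" using cpos pq by (simp add: powr_powr)
      finally show ?thesis using xu by blast
    qed
    have "norm (u t) powr p \<le> k" by (rule dense_ge) (use up in blast)
    then show ?case using up[of "k + 1"] k by (simp add: ennreal_leI)
  qed
  have "integrable (ivl a b) (\<lambda>t. norm (u t) powr p)"
  proof (rule integrableI_bounded)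
    show "(\<lambda>t. norm (u t) powr p) \<in> borel_measurable (ivl a b)"
      by (intro measurable_real_powr measurable_compose[OF um borel_measurable_norm'])
    have "(\<integral>\<^sup>+t. ennreal (norm (norm (u t) powr p)) \<partial>ivl a b) \<le> (\<integral>\<^sup>+t. \<phi> t \<partial>ivl a b)"
      by (rule nn_integral_mono_AE) (use key in \<open>auto elim!: eventually_mono\<close>)
    also have "\<dots> < \<infinity>" using \<phi>K ennreal_less_top le_less_trans by (auto simp: less_top[symmetric] top_unique)
    finally show "(\<integral>\<^sup>+t. ennreal (norm (norm (u t) powr p)) \<partial>ivl a b) < \<infinity>" .
  qed
  then have "Lp_fun p {a<..<b} u" using um by (simp add: Lp_fun_def)
  moreover have "AE t in ivl a b. x t = emb (u t)" using key by eventually_elim simp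
  ultimately show ?thesis by (rule that)
qed

text \<open>The energy identity and \<open>pairing_limit\<close> show that the integrals of A(t,
  yn)(yn - y) tend to 0. Monotonicity forces the negative parts to 0, with \<open>G\<close> as
  dominating function, so the convergence holds in L^1 and, along a subsequence, almost everywhere.
  Minty's trick then works at each time separately.\<close>

lemma operator_limit:
  fixes yn :: "nat \<Rightarrow> real \<Rightarrow> 'v"
  assumes t0: "0 \<le> t0" "t0 < T" and s: "\<And>n. sol t0 (xn n) (fn n) (yn n) (wn n)"
    and xn: "\<And>n. xn n \<in> paths T" and x: "continuous_on {t0..T} x"
    and lim: "uniform_limit {t0..T} xn x sequentially"
    and R: "R \<ge> 0" "\<And>n. AE t in ivl t0 T. norm (fn n t) \<le> R"
    and wK: "\<And>n. (\<integral>t. norm (wn n t) powr q \<partial>ivl t0 T) \<le> K"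
    and y: "Lp_fun p {t0<..<T} y" "AE t in ivl t0 T. x t = emb (y t)"
  obtains r :: "nat \<Rightarrow> nat" where "strict_mono r"
    "AE t in ivl t0 T. \<forall>v. (\<lambda>n. A t (yn (r n) t) v) \<longlonglongrightarrow> A t (y t) v"
proof -
  obtain c G where cG: "c > 0" "\<And>t0 y. 0 \<le> t0 \<Longrightarrow> Lp_fun p {t0<..<T} y \<Longrightarrow> integrable (ivl t0 T) (\<lambda>t. G t (y t) :: real)"
    "\<And>t0. 0 \<le> t0 \<Longrightarrow> AE t in ivl t0 T. \<forall>z y. blinfun_apply (A t z) (z - y) \<ge> c * norm z powr p - G t y"
    "\<And>t y. G t y \<ge> 0"
    by (rule A_lower_bound) (rule that)
  have xc: "continuous_on {t0..T} (xn n)" for n by (rule path_continuous_from[OF xn t0(1)])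
  \<comment> \<open>Written with the forcing and \<open>w\<close>, whose measurability is at hand;
    by the equation it equals A(t, yn)(yn - y) almost everywhere.\<close>
  define d where "d = (\<lambda>n t. fn n t \<bullet> emb (yn n t - y t) - wn n t (yn n t - y t))"
  have yd: "Lp_fun p {t0<..<T} (\<lambda>t. yn n t - y t)" for n
    using pq by (intro Lp_fun_diff solD(2)[OF s] y(1)) auto
  have f1: "(\<lambda>t. fn n t \<bullet> emb (yn n t - y t)) \<in> borel_measurable (ivl t0 T)" for n
    by (intro borel_measurable_inner Lp_fun_measurable[OF solD(1)[OF s]] measurable_emb Lp_fun_measurable[OF yd])
  have fle: "AE t in ivl t0 T. norm (fn n t \<bullet> emb (yn n t - y t)) \<le> R * norm (xn n t - x t)" for n
    using R(2)[of n] solD(4)[OF s, of n] y(2)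
  proof eventually_elim
    case (elim t)
    have eq: "emb (yn n t - y t) = xn n t - x t" using elim by (simp add: blinfun.diff_right)
    have "\<bar>fn n t \<bullet> (xn n t - x t)\<bar> \<le> norm (fn n t) * norm (xn n t - x t)" by (rule Cauchy_Schwarz_ineq2)
    also have "\<dots> \<le> R * norm (xn n t - x t)" using elim by (intro mult_right_mono) auto
    finally show ?case unfolding eq real_norm_def .
  qed
  have ix: "integrable (ivl t0 T) (\<lambda>t. R * norm (xn n t - x t))" for n
    by (intro continuous_integrable_ivl continuous_intros xc x)
  have f2: "integrable (ivl t0 T) (\<lambda>t. fn n t \<bullet> emb (yn n t - y t))" for n
    by (rule Bochner_Integration.integrable_bound[OF ix f1])
       (use fle R(1) in \<open>auto elim!: eventually_mono simp: abs_mult\<close>)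
  note iw = integrable_dual_pairing[OF pq solD(3)[OF s]]
  have di: "integrable (ivl t0 T) (d n)" for n
    unfolding d_def by (intro Bochner_Integration.integrable_diff f2 iw yd)
  have lim0: "(\<lambda>n. \<integral>t. d n t \<partial>ivl t0 T) \<longlonglongrightarrow> 0"
  proof -
    have deq: "(\<integral>t. d n t \<partial>ivl t0 T) = (\<integral>t. fn n t \<bullet> emb (yn n t - y t) \<partial>ivl t0 T)
        - (((norm (xn n T))\<^sup>2 - (norm (xn n t0))\<^sup>2) / 2 - (\<integral>t. wn n t (y t) \<partial>ivl t0 T))" for n
    proof -
      have "(norm (xn n T))\<^sup>2 - (norm (xn n t0))\<^sup>2 = 2 * (\<integral>t. wn n t (yn n t) \<partial>ivl t0 T)"
        by (rule sol_energy[OF t0(1) _ xn s]) (use t0 in auto)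
      moreover have "(\<integral>t. d n t \<partial>ivl t0 T) = (\<integral>t. fn n t \<bullet> emb (yn n t - y t) \<partial>ivl t0 T) - (\<integral>t. wn n t (yn n t - y t) \<partial>ivl t0 T)"
        unfolding d_def by (rule Bochner_Integration.integral_diff[OF f2 iw[OF yd]])
      moreover have "(\<integral>t. wn n t (yn n t - y t) \<partial>ivl t0 T) = (\<integral>t. wn n t (yn n t) \<partial>ivl t0 T) - (\<integral>t. wn n t (y t) \<partial>ivl t0 T)"
        unfolding blinfun.diff_right by (rule Bochner_Integration.integral_diff[OF iw[OF solD(2)[OF s]] iw[OF y(1)]])
      ultimately show ?thesis by simp
    qed
    have l1: "(\<lambda>n. \<integral>t. fn n t \<bullet> emb (yn n t - y t) \<partial>ivl t0 T) \<longlonglongrightarrow> 0"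
    proof (rule LIMSEQ_I)
      fix e :: real assume e: "e > 0"
      define \<eta> where "\<eta> = e / (2 * ((T - t0) * R + 1))"
      have TR: "(T - t0) * R \<ge> 0" using t0 R by simp
      have \<eta>: "\<eta> > 0" using e TR by (simp add: \<eta>_def add_nonneg_pos)
      have \<eta>R: "(T - t0) * (R * \<eta>) \<le> e / 2"
      proof -
        have "(T - t0) * (R * \<eta>) \<le> ((T - t0) * R + 1) * \<eta>" using \<eta> by (simp add: algebra_simps)
        also have "\<dots> = e / 2"
        proof -
          have "(T - t0) * R + 1 \<noteq> 0" using TR by linarith
          then show ?thesis by (simp add: \<eta>_def divide_simps)
        qed
        finally show ?thesis .
      qed
      obtain N where N: "\<And>n t. n \<ge> N \<Longrightarrow> t \<in> {t0..T} \<Longrightarrow> dist (xn n t) (x t) < \<eta>"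
        using uniform_limitD[OF lim \<eta>] unfolding eventually_sequentially by blast
      show "\<exists>N. \<forall>n\<ge>N. norm ((\<integral>t. fn n t \<bullet> emb (yn n t - y t) \<partial>ivl t0 T) - 0) < e"
      proof (intro exI[of _ N] allI impI)
        fix n assume n: "n \<ge> N"
        have "norm (\<integral>t. fn n t \<bullet> emb (yn n t - y t) \<partial>ivl t0 T) \<le> (\<integral>t. R * \<eta> \<partial>ivl t0 T)"
        proof (rule norm_integral_le[OF f2])
          show "AE t in ivl t0 T. norm (fn n t \<bullet> emb (yn n t - y t)) \<le> R * \<eta>"
            using fle[of n] AE_space[of "ivl t0 T"]
          proof eventually_elim
            case (elim t)
            have "norm (xn n t - x t) \<le> \<eta>" using N[OF n, of t] elim by (auto simp: dist_norm intro: less_imp_le)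
            then have "R * norm (xn n t - x t) \<le> R * \<eta>" using R(1) by (intro mult_left_mono)
            then show ?case using elim by linarith
          qed
        qed simp
        also have "\<dots> = (T - t0) * (R * \<eta>)" by (rule ivl_integral_const) (use t0 in auto)
        finally show "norm ((\<integral>t. fn n t \<bullet> emb (yn n t - y t) \<partial>ivl t0 T) - 0) < e" using \<eta>R e by simp
      qed
    qed
    have px: "(\<lambda>n. xn n t) \<longlonglongrightarrow> x t" if "t \<in> {t0..T}" for t by (rule tendsto_uniform_limitI[OF lim that])
    have l2: "(\<lambda>n. \<integral>t. wn n t (y t) \<partial>ivl t0 T) \<longlonglongrightarrow> ((norm (x T))\<^sup>2 - (norm (x t0))\<^sup>2) / 2"
      by (rule pairing_limit[OF t0(2) x y xc solD(5)[OF s] solD(3)[OF s] wK lim])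
    have l3: "(\<lambda>n. ((norm (xn n T))\<^sup>2 - (norm (xn n t0))\<^sup>2) / 2) \<longlonglongrightarrow> ((norm (x T))\<^sup>2 - (norm (x t0))\<^sup>2) / 2"
      by (intro tendsto_intros px) (use t0 in auto)
    from tendsto_diff[OF l1 tendsto_diff[OF l3 l2]] show ?thesis unfolding deq by simp
  qed
  have dA: "AE t in ivl t0 T. \<forall>n. d n t = A t (yn n t) (yn n t - y t)"
    unfolding AE_all_countable
  proof
    fix n
    show "AE t in ivl t0 T. d n t = A t (yn n t) (yn n t - y t)"
      using solD(6)[OF s, of n]
    proof eventually_elim
      case (elim t)
      have "A t (yn n t) = to_dual emb (fn n t) - wn n t" using elim by (metis add_diff_cancel_left')
      then show ?case by (simp add: d_def blinfun.diff_left)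
    qed
  qed
  have xnx: "AE t in ivl t0 T. \<forall>n. xn n t = emb (yn n t)" unfolding AE_all_countable using solD(4)[OF s] by blast
  define G' where "G' = (\<lambda>t. G t (y t))"
  have G'i: "integrable (ivl t0 T) G'" unfolding G'_def by (rule cG(2)[OF t0(1) y(1)])
  have neg: "AE t in ivl t0 T. (\<lambda>n. max 0 (- d n t)) \<longlonglongrightarrow> 0 \<and> (\<forall>n. max 0 (- d n t) \<le> G' t)"
    using dA xnx y(2) cG(3)[OF t0(1)] A_monotone[OF t0(1)] AE_space[of "ivl t0 T"]
  proof eventually_elim
    case (elim t)
    then have t: "t \<in> {t0..T}" by auto
    have lb: "d n t \<ge> c * norm (yn n t) powr p - G' t" for n
      using elim(1,4) by (simp add: G'_def)
    have nb: "max 0 (- d n t) \<le> G' t" for n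
    proof -
      have "0 \<le> c * norm (yn n t) powr p" using cG(1) by simp
      then show ?thesis using lb[of n] cG(4)[of t "y t"] unfolding G'_def by linarith
    qed
    have xt: "(\<lambda>n. emb (yn n t)) \<longlonglongrightarrow> emb (y t)"
      using tendsto_uniform_limitI[OF lim t] elim(2,3) by simp
    \<comment> \<open>Along a subsequence with d \<le> -e the lower bound keeps \<open>yn\<close>
      bounded in V, hence weakly convergent to \<open>y\<close>. Monotonicity bounds d from below by
      A(t,y)(yn - y), which tends to 0, a contradiction.\<close>
    have "(\<lambda>n. max 0 (- d n t)) \<longlonglongrightarrow> 0"
    proof (rule ccontr)
      assume "\<not> (\<lambda>n. max 0 (- d n t)) \<longlonglongrightarrow> 0"
      then obtain e where e: "e > 0" and "\<not> (\<forall>\<^sub>F n in sequentially. dist (max 0 (- d n t)) 0 < e)"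
        unfolding tendsto_iff by blast
      then have "\<exists>\<^sub>F n in sequentially. \<not> dist (max 0 (- d n t)) 0 < e" by (simp add: frequently_def)
      then have "infinite {n. \<not> dist (max 0 (- d n t)) 0 < e}"
        using frequently_cofinite cofinite_eq_sequentially by metis
      then obtain r :: "nat \<Rightarrow> nat" where r: "strict_mono r" "\<And>k. \<not> dist (max 0 (- d (r k) t)) 0 < e"
        using infinite_enumerate by blast
      have dr: "d (r k) t \<le> - e" for k using r(2)[of k] e by (simp add: dist_real_def max_def split: if_splits)
      have "norm (yn (r k) t) \<le> 1 + G' t / c" for k
      proof -
        have "c * norm (yn (r k) t) powr p \<le> G' t" using lb[of "r k"] dr[of k] e by linarith
        then have "norm (yn (r k) t) powr p \<le> G' t / c" using cG(1) by (simp add: field_simps)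
        then show ?thesis using le_one_add_powr[of "norm (yn (r k) t)" p] pq by simp
      qed
      moreover have "(\<lambda>k. emb (yn (r k) t)) \<longlonglongrightarrow> emb (y t)"
        using LIMSEQ_subseq_LIMSEQ[OF xt r(1)] by (simp add: o_def)
      ultimately have "(\<lambda>k. A t (y t) (yn (r k) t)) \<longlonglongrightarrow> A t (y t) (y t)"
        by (rule weak_convergence_of_embedded[OF refl inj_emb])
      then have w0: "(\<lambda>k. A t (y t) (yn (r k) t) - A t (y t) (y t)) \<longlonglongrightarrow> 0"
        by (rule LIM_zero)
      have "A t (y t) (yn (r k) t) - A t (y t) (y t) \<le> - e" for k
      proof -
        have "0 \<le> (A t (yn (r k) t) - A t (y t)) (yn (r k) t - y t)" using elim(5) by blast
        also have "\<dots> = d (r k) t - (A t (y t) (yn (r k) t) - A t (y t) (y t))"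
          using elim(1) by (simp add: blinfun.diff_left blinfun.diff_right)
        finally show ?thesis using dr[of k] by linarith
      qed
      then have "0 \<le> - e" using LIMSEQ_le_const2[OF w0] by blast
      then show False using e by simp
    qed
    then show ?case using nb by blast
  qed
  have ni: "integrable (ivl t0 T) (\<lambda>t. max 0 (- d n t))" for n using di[of n] by (intro Bochner_Integration.integrable_max) auto
  have "(\<lambda>n. \<integral>t. max 0 (- d n t) \<partial>ivl t0 T) \<longlonglongrightarrow> (\<integral>t. 0 \<partial>ivl t0 T)"
  proof (rule integral_dominated_convergence[where w = G'])
    show "AE t in ivl t0 T. (\<lambda>n. max 0 (- d n t)) \<longlonglongrightarrow> 0" using neg by eventually_elim blast
    show "AE t in ivl t0 T. norm (max 0 (- d n t)) \<le> G' t" for n using neg by eventually_elim simp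
    show "(\<lambda>t. max 0 (- d n t)) \<in> borel_measurable (ivl t0 T)" for n using ni[of n] by (rule borel_measurable_integrable)
  qed (use G'i in auto)
  then have n0: "(\<lambda>n. \<integral>t. max 0 (- d n t) \<partial>ivl t0 T) \<longlonglongrightarrow> 0" by simp
  have "(\<integral>t. norm (d n t) \<partial>ivl t0 T) = (\<integral>t. d n t \<partial>ivl t0 T) + 2 * (\<integral>t. max 0 (- d n t) \<partial>ivl t0 T)" for n
  proof -
    have "norm (d n t) = d n t + 2 * max 0 (- d n t)" for t by (simp add: max_def)
    then show ?thesis using di[of n] ni[of n] by simp
  qed
  then have "(\<lambda>n. \<integral>t. norm (d n t) \<partial>ivl t0 T) \<longlonglongrightarrow> 0"
    using tendsto_add[OF lim0 tendsto_mult[OF tendsto_const n0, of 2]] by simp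
  from tendsto_L1_AE_subseq[OF di this] obtain r :: "nat \<Rightarrow> nat"
    where r: "strict_mono r" "AE t in ivl t0 T. (\<lambda>n. d (r n) t) \<longlonglongrightarrow> 0" by blast
  have "AE t in ivl t0 T. \<forall>v. (\<lambda>n. A t (yn (r n) t) v) \<longlonglongrightarrow> A t (y t) v"
    using dA xnx y(2) cG(3)[OF t0(1)] A_monotone[OF t0(1)] A_hemicontinuous[OF t0(1)] r(2) AE_space[of "ivl t0 T"]
  proof eventually_elim
    case (elim t)
    then have t: "t \<in> {t0..T}" by auto
    show ?case
    proof
      fix v
      have mono: "\<And>x y. (A t x - A t y) (x - y) \<ge> 0" using elim(5) by blast
      have hemi: "\<And>x y v. continuous_on {0..1} (\<lambda>s. A t (x + s *\<^sub>R y) v)" using elim(6) by blast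
      have lbd: "\<And>k. A t (yn (r k) t) (yn (r k) t - y t) \<ge> c * norm (yn (r k) t) powr p - G t (y t)" using elim(4) by blast
      have "(\<lambda>n. xn (r n) t) \<longlonglongrightarrow> x t"
        using LIMSEQ_subseq_LIMSEQ[OF tendsto_uniform_limitI[OF lim t] r(1)] by (simp add: o_def)
      then have l1: "(\<lambda>n. emb (yn (r n) t)) \<longlonglongrightarrow> emb (y t)" using elim(2,3) by simp
      have l2: "(\<lambda>n. A t (yn (r n) t) (yn (r n) t - y t)) \<longlonglongrightarrow> 0" using elim(1,7) by simp
      show "(\<lambda>n. A t (yn (r n) t) v) \<longlonglongrightarrow> A t (y t) v"
        by (rule weak_convergence_pointwise[OF mono hemi cG(1) lbd l1 l2])
    qed
  qed
  with r(1) show ?thesis by (rule that)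
qed

end

section \<open>Limits of solutions and sequential compactness\<close>

context evolution
begin

lemma forced_dual_bound:
  assumes "norm f \<le> R" "norm a \<le> \<alpha> + c * norm u powr (p - 1)" "R \<ge> 0" "\<alpha> \<ge> 0" "c \<ge> 0"
  shows "norm (to_dual emb f - a) powr q
    \<le> 2 powr q * (norm emb * R) powr q + 2 powr q * (2 powr q * \<alpha> powr q) + 2 powr q * (2 powr q * (c powr q * norm u powr p))"
proof -
  have "norm (to_dual emb f - a) \<le> norm (to_dual emb f) + norm a" by (rule norm_triangle_ineq4)
  also have "\<dots> \<le> norm emb * R + (\<alpha> + c * norm u powr (p - 1))"
  proof (rule add_mono)
    show "norm (to_dual emb f) \<le> norm emb * R"
      using norm_to_dual_le[of emb f] mult_left_mono[OF assms(1) norm_ge_zero[of emb]] by linarith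
  qed (rule assms)
  finally have "norm (to_dual emb f - a) powr q \<le> (norm emb * R + (\<alpha> + c * norm u powr (p - 1))) powr q"
    using q1 by (intro powr_mono2) auto
  also have "\<dots> \<le> 2 powr q * ((norm emb * R) powr q + (\<alpha> + c * norm u powr (p - 1)) powr q)"
    using q1 assms by (intro powr_add_le) auto
  also have "\<dots> \<le> 2 powr q * ((norm emb * R) powr q + 2 powr q * (\<alpha> powr q + (c * norm u powr (p - 1)) powr q))"
    using q1 assms by (intro mult_left_mono add_left_mono powr_add_le) auto
  also have "(c * norm u powr (p - 1)) powr q = c powr q * norm u powr p"
    using assms by (simp add: powr_mult powr_powr pm1_q)
  finally show ?thesis by (simp add: algebra_simps)
qed

text \<open>The limit derivative is defined by the limit equation. For each \<open>v\<close> the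
  functions A(t, yn) v converge almost everywhere and are bounded in L^q, hence converge in L^1;
  with the convergence of the forcing integrals this passes to the limit in the increments of
  \<open>xn\<close>.\<close>

lemma weak_deriv_limit:
  assumes t0: "0 \<le> t0" "t0 < T" and s: "\<And>n. sol t0 (xn n) (fn n) (yn n) (wn n)"
    and R: "R \<ge> 0" "\<And>n. AE t in ivl t0 T. norm (fn n t) \<le> R"
    and wK: "\<And>n. (\<integral>t. norm (wn n t) powr q \<partial>ivl t0 T) \<le> K"
    and y: "Lp_fun p {t0<..<T} y"
    and Alim: "AE t in ivl t0 T. \<forall>v. (\<lambda>n. A t (yn n t) v) \<longlonglongrightarrow> A t (y t) v"
    and f: "f \<in> borel_measurable (ivl t0 T)" "AE t in ivl t0 T. norm (f t) \<le> R"
    and flim: "\<And>t z. t \<in> {t0..T} \<Longrightarrow> (\<lambda>n. \<integral>s. fn n s \<bullet> z \<partial>ivl t0 t) \<longlonglongrightarrow> (\<integral>s. f s \<bullet> z \<partial>ivl t0 t)"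
    and xlim: "\<And>t. t \<in> {t0..T} \<Longrightarrow> (\<lambda>n. xn n t) \<longlonglongrightarrow> x t"
  obtains w where "weak_Lq q {t0<..<T} w" "weak_deriv emb t0 T x w"
    "AE t in ivl t0 T. w t + A t (y t) = to_dual emb (f t)"
proof -
  obtain a1 c1 where a1: "c1 \<ge> 0" "\<And>t. a1 t \<ge> 0" "\<And>t0. 0 \<le> t0 \<Longrightarrow> Lp_fun q {t0<..<T} a1"
    "\<And>t0. 0 \<le> t0 \<Longrightarrow> AE t in ivl t0 T. \<forall>x. norm (A t x) \<le> a1 t + c1 * norm x powr (p - 1)"
    by (rule A_growth) (rule that)
  have "AE t in ivl t0 T. \<forall>n. wn n t + A t (yn n t) = to_dual emb (fn n t)"
    unfolding AE_all_countable using solD(6)[OF s] by blast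
  then have "AE t in ivl t0 T. (\<forall>n. wn n t + A t (yn n t) = to_dual emb (fn n t)) \<and>
      (\<forall>v. (\<lambda>n. A t (yn n t) v) \<longlonglongrightarrow> A t (y t) v) \<and> norm (f t) \<le> R \<and>
      norm (A t (y t)) \<le> a1 t + c1 * norm (y t) powr (p - 1)"
    using Alim a1(4)[OF t0(1)] f(2) by eventually_elim blast
  then obtain N where N: "N \<in> sets (ivl t0 T)" "emeasure (ivl t0 T) N = 0"
    "{t \<in> space (ivl t0 T). \<not> ((\<forall>n. wn n t + A t (yn n t) = to_dual emb (fn n t)) \<and>
      (\<forall>v. (\<lambda>n. A t (yn n t) v) \<longlonglongrightarrow> A t (y t) v) \<and> norm (f t) \<le> R \<and>
      norm (A t (y t)) \<le> a1 t + c1 * norm (y t) powr (p - 1))} \<subseteq> N"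
    by (rule AE_E) (rule that)
  \<comment> \<open>A measurable set of full measure on which all relations hold at every point, for
    all n and v at once.\<close>
  define S where "S = space (ivl t0 T) - N"
  have Sm: "S \<in> sets (ivl t0 T)" unfolding S_def using N(1) by (rule sets.compl_sets)
  have SAE: "AE t in ivl t0 T. t \<in> S"
    by (rule AE_I[OF _ N(2,1)]) (auto simp: S_def)
  have S: "\<And>n. wn n t + A t (yn n t) = to_dual emb (fn n t)" "\<And>v. (\<lambda>n. A t (yn n t) v) \<longlonglongrightarrow> A t (y t) v"
    "norm (f t) \<le> R" "norm (A t (y t)) \<le> a1 t + c1 * norm (y t) powr (p - 1)" if "t \<in> S" for t
    using that N(3) unfolding S_def by blast+
  \<comment> \<open>The value 0 off \<open>S\<close> makes \<open>w t v\<close> an everywhere limit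
    of measurable functions; weak measurability follows although A(t, y(t)) is a composition whose
    measurability is not given.\<close>
  define w where "w = (\<lambda>t. if t \<in> S then to_dual emb (f t) - A t (y t) else 0)"
  define g where "g = (\<lambda>n v t. fn n t \<bullet> emb v - wn n t v)"
  define g' where "g' = (\<lambda>v t. f t \<bullet> emb v - w t v)"
  have gS: "g n v t = A t (yn n t) v" if "t \<in> S" for n v t
  proof -
    have "A t (yn n t) = to_dual emb (fn n t) - wn n t" using S(1)[OF that, of n] by (metis add_diff_cancel_left')
    then show ?thesis by (simp add: g_def blinfun.diff_left)
  qed
  have g'S: "g' v t = A t (y t) v" if "t \<in> S" for v t
    using that by (simp add: g'_def w_def blinfun.diff_left)
  have gm: "g n v \<in> borel_measurable (ivl t0 T)" for n v
    unfolding g_def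
    by (intro borel_measurable_diff borel_measurable_inner Lp_fun_measurable[OF solD(1)[OF s]]
        borel_measurable_const weak_Lq_measurable[OF solD(3)[OF s]])
  have wm: "(\<lambda>t. w t v) \<in> borel_measurable (ivl t0 T)" for v
  proof (rule borel_measurable_LIMSEQ_metric[of "\<lambda>n t. if t \<in> S then f t \<bullet> emb v - g n v t else 0"])
    fix n
    show "(\<lambda>t. if t \<in> S then f t \<bullet> emb v - g n v t else 0) \<in> borel_measurable (ivl t0 T)"
    proof (rule measurable_If)
      show "(\<lambda>t. f t \<bullet> emb v - g n v t) \<in> borel_measurable (ivl t0 T)"
        by (intro borel_measurable_diff borel_measurable_inner f(1) borel_measurable_const gm)
      show "{t \<in> space (ivl t0 T). t \<in> S} \<in> sets (ivl t0 T)"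
        using sets.Int[OF sets.top Sm] by (simp add: Int_def)
    qed simp
  next
    fix t assume "t \<in> space (ivl t0 T)"
    show "(\<lambda>n. if t \<in> S then f t \<bullet> emb v - g n v t else 0) \<longlonglongrightarrow> w t v"
    proof (cases "t \<in> S")
      case True
      have "(\<lambda>n. f t \<bullet> emb v - A t (yn n t) v) \<longlonglongrightarrow> f t \<bullet> emb v - A t (y t) v"
        by (intro tendsto_intros S(2)[OF True])
      then show ?thesis using True by (simp add: gS w_def blinfun.diff_left)
    qed (simp add: w_def)
  qed
  have wq: "integrable (ivl t0 T) (\<lambda>t. norm (w t) powr q)"
  proof (rule Bochner_Integration.integrable_bound)
    show "integrable (ivl t0 T) (\<lambda>t. 2 powr q * (norm emb * R) powr q + 2 powr q * (2 powr q * norm (a1 t) powr q)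
        + 2 powr q * (2 powr q * (c1 powr q * norm (y t) powr p)))"
      using Lp_fun_integrable[OF a1(3)[OF t0(1)]] Lp_fun_integrable[OF y] by simp
    show "(\<lambda>t. norm (w t) powr q) \<in> borel_measurable (ivl t0 T)"
      by (intro measurable_real_powr measurable_norm_dual wm)
    show "AE t in ivl t0 T. norm (norm (w t) powr q) \<le> norm (2 powr q * (norm emb * R) powr q + 2 powr q * (2 powr q * norm (a1 t) powr q)
        + 2 powr q * (2 powr q * (c1 powr q * norm (y t) powr p)))"
      using SAE
    proof eventually_elim
      case (elim t)
      have "norm (w t) powr q \<le> 2 powr q * (norm emb * R) powr q + 2 powr q * (2 powr q * a1 t powr q)
        + 2 powr q * (2 powr q * (c1 powr q * norm (y t) powr p))"
        using forced_dual_bound[OF S(3,4)[OF elim] R(1) a1(2,1)] elim by (simp add: w_def)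
      moreover have "0 \<le> norm (w t) powr q" by simp
      ultimately show ?case using a1(2)[of t] by simp
    qed
  qed
  have wL: "weak_Lq q {t0<..<T} w" unfolding weak_Lq_def using wm wq by blast
  have wA: "AE t in ivl t0 T. w t + A t (y t) = to_dual emb (f t)"
    using SAE by eventually_elim (simp add: w_def)
  have glim: "(\<lambda>n. \<integral>t. \<bar>g n v t - g' v t\<bar> \<partial>ivl t0 T) \<longlonglongrightarrow> 0" for v
  proof -
    have g'm: "g' v \<in> borel_measurable (ivl t0 T)"
      unfolding g'_def by (intro borel_measurable_diff borel_measurable_inner f(1) borel_measurable_const wm)
    have bound: "\<bar>h \<bullet> emb v - \<omega> v\<bar> powr q \<le> norm v powr q * (2 powr q * ((norm emb * R) powr q + norm \<omega> powr q))"
      if "norm h \<le> R" for h and \<omega> :: "'v \<Rightarrow>\<^sub>L real"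
    proof -
      have "\<bar>h \<bullet> emb v\<bar> \<le> norm h * norm (emb v)" by (rule Cauchy_Schwarz_ineq2)
      also have "\<dots> \<le> R * (norm emb * norm v)" using that R(1) by (intro mult_mono norm_blinfun) auto
      finally have "\<bar>h \<bullet> emb v - \<omega> v\<bar> \<le> norm v * (norm emb * R + norm \<omega>)"
        using dual_pairing_abs_le[of \<omega> v] by (simp add: algebra_simps)
      then have "\<bar>h \<bullet> emb v - \<omega> v\<bar> powr q \<le> (norm v * (norm emb * R + norm \<omega>)) powr q"
        using q1 by (intro powr_mono2) auto
      also have "\<dots> = norm v powr q * (norm emb * R + norm \<omega>) powr q"
        using R(1) by (simp add: powr_mult)
      also have "\<dots> \<le> norm v powr q * (2 powr q * ((norm emb * R) powr q + norm \<omega> powr q))"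
        using q1 R(1) by (intro mult_left_mono powr_add_le) auto
      finally show ?thesis .
    qed
    let ?b = "\<lambda>\<omega> t. norm v powr q * (2 powr q * ((norm emb * R) powr q + norm (\<omega> t) powr q))"
    have ib: "integrable (ivl t0 T) (?b \<omega>)" if "weak_Lq q {t0<..<T} \<omega>" for \<omega> :: "real \<Rightarrow> 'v \<Rightarrow>\<^sub>L real"
      using weak_Lq_integrable[OF that] by simp
    have gq: "integrable (ivl t0 T) (\<lambda>t. \<bar>h t \<bullet> emb v - \<omega> t v\<bar> powr q) \<and>
        (\<integral>t. \<bar>h t \<bullet> emb v - \<omega> t v\<bar> powr q \<partial>ivl t0 T) \<le> (\<integral>t. ?b \<omega> t \<partial>ivl t0 T)"
      if "(\<lambda>t. h t \<bullet> emb v - \<omega> t v) \<in> borel_measurable (ivl t0 T)" "AE t in ivl t0 T. norm (h t) \<le> R" "weak_Lq q {t0<..<T} \<omega>"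
      for h and \<omega> :: "real \<Rightarrow> 'v \<Rightarrow>\<^sub>L real"
    proof
      have le: "AE t in ivl t0 T. \<bar>h t \<bullet> emb v - \<omega> t v\<bar> powr q \<le> ?b \<omega> t"
        using that(2) by eventually_elim (rule bound)
      show i: "integrable (ivl t0 T) (\<lambda>t. \<bar>h t \<bullet> emb v - \<omega> t v\<bar> powr q)"
        by (rule Bochner_Integration.integrable_bound[OF ib[OF that(3)] measurable_real_powr[OF borel_measurable_abs[OF that(1)]]])
           (use le in \<open>auto elim!: eventually_mono\<close>)
      show "(\<integral>t. \<bar>h t \<bullet> emb v - \<omega> t v\<bar> powr q \<partial>ivl t0 T) \<le> (\<integral>t. ?b \<omega> t \<partial>ivl t0 T)"
        by (rule integral_mono_AE[OF i ib[OF that(3)] le])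
    qed
    show ?thesis
    proof (rule Vitali_Lq[OF t0(2) q1 gm g'm])
      show "AE t in ivl t0 T. (\<lambda>n. g n v t) \<longlonglongrightarrow> g' v t"
        using SAE by eventually_elim (simp add: gS g'S S(2))
      show "integrable (ivl t0 T) (\<lambda>t. \<bar>g' v t\<bar> powr q)"
        using gq[OF g'm[unfolded g'_def] f(2) wL] by (simp add: g'_def)
      show "integrable (ivl t0 T) (\<lambda>t. \<bar>g n v t\<bar> powr q)" for n
        using gq[OF gm[unfolded g_def] R(2) solD(3)[OF s]] by (simp add: g_def)
      show "(\<integral>t. \<bar>g n v t\<bar> powr q \<partial>ivl t0 T) \<le> (T - t0) * (norm v powr q * (2 powr q * (norm emb * R) powr q))
          + norm v powr q * (2 powr q * K)" for n
      proof -
        have "(\<integral>t. \<bar>g n v t\<bar> powr q \<partial>ivl t0 T) \<le> (\<integral>t. ?b (wn n) t \<partial>ivl t0 T)"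
          using gq[OF gm[unfolded g_def] R(2) solD(3)[OF s]] by (simp add: g_def)
        also have "\<dots> = (\<integral>t. norm v powr q * (2 powr q * (norm emb * R) powr q) + norm v powr q * (2 powr q * norm (wn n t) powr q) \<partial>ivl t0 T)"
          by (simp add: distrib_left)
        also have "\<dots> = (\<integral>t. norm v powr q * (2 powr q * (norm emb * R) powr q) \<partial>ivl t0 T)
            + norm v powr q * (2 powr q * (\<integral>t. norm (wn n t) powr q \<partial>ivl t0 T))"
          using weak_Lq_integrable[OF solD(3)[OF s, of n]] by simp
        also have "(\<integral>t. norm v powr q * (2 powr q * (norm emb * R) powr q) \<partial>ivl t0 T) = (T - t0) * (norm v powr q * (2 powr q * (norm emb * R) powr q))"
          by (rule ivl_integral_const) (use t0 in auto)
        finally show ?thesis using wK[of n]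
          by (smt (verit, best) mult_left_mono powr_ge_zero)
      qed
    qed
  qed
  have "weak_deriv emb t0 T x w"
    unfolding weak_deriv_def
  proof (intro allI impI)
    fix a b v assume ab: "t0 \<le> a" "a \<le> b" "b \<le> T"
    have i1: "integrable (ivl t0 T) (\<lambda>t. h t \<bullet> emb v)"
      if "h \<in> borel_measurable (ivl t0 T)" "AE t in ivl t0 T. norm (h t) \<le> R" for h
      using integrable_ivl_bounded[OF that] by simp
    have i2: "integrable (ivl t0 T) (\<lambda>t. \<omega> t v)" if "weak_Lq q {t0<..<T} \<omega>" for \<omega> :: "real \<Rightarrow> 'v \<Rightarrow>\<^sub>L real"
      by (rule weak_Lq_integrable_apply[OF less_imp_le[OF q1] that])
    note ifn = i1[OF Lp_fun_measurable[OF solD(1)[OF s]] R(2)] and if' = i1[OF f]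
    note sub = ivl_mono_integrable[OF _ ab(1,3)]
    have split: "(\<integral>s. h s \<partial>ivl a b) = (\<integral>s. h s \<partial>ivl t0 b) - (\<integral>s. h s \<partial>ivl t0 a)"
      if "integrable (ivl t0 T) h" for h :: "real \<Rightarrow> real"
      using ivl_integral_add[OF ivl_mono_integrable[OF that order_refl ab(3)] ab(1,2)] by simp
    have "(\<lambda>n. \<integral>s. fn n s \<bullet> emb v \<partial>ivl a b) \<longlonglongrightarrow> (\<integral>s. f s \<bullet> emb v \<partial>ivl a b)"
      unfolding split[OF ifn] split[OF if'] using ab by (intro tendsto_diff flim) auto
    moreover have "(\<lambda>n. \<integral>s. g n v s \<partial>ivl a b) \<longlonglongrightarrow> (\<integral>s. g' v s \<partial>ivl a b)"
    proof -
      have ig: "integrable (ivl t0 T) (g n v)" for n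
        unfolding g_def by (intro Bochner_Integration.integrable_diff ifn i2 solD(3)[OF s])
      have ig': "integrable (ivl t0 T) (g' v)"
        unfolding g'_def by (intro Bochner_Integration.integrable_diff if' i2 wL)
      have "norm ((\<integral>s. g n v s \<partial>ivl a b) - (\<integral>s. g' v s \<partial>ivl a b)) \<le> (\<integral>t. \<bar>g n v t - g' v t\<bar> \<partial>ivl t0 T)" for n
      proof -
        have "(\<integral>s. g n v s \<partial>ivl a b) - (\<integral>s. g' v s \<partial>ivl a b) = (\<integral>s. g n v s - g' v s \<partial>ivl a b)"
          using sub[OF ig] sub[OF ig'] by simp
        also have "norm \<dots> \<le> (\<integral>s. \<bar>g n v s - g' v s\<bar> \<partial>ivl a b)"
          using integral_norm_bound[of "ivl a b" "\<lambda>s. g n v s - g' v s"] by simp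
        also have "\<dots> \<le> (\<integral>t. \<bar>g n v t - g' v t\<bar> \<partial>ivl t0 T)"
          by (rule ivl_integral_nonneg_mono) (use ig ig' ab in auto)
        finally show ?thesis .
      qed
      then have "(\<lambda>n. (\<integral>s. g n v s \<partial>ivl a b) - (\<integral>s. g' v s \<partial>ivl a b)) \<longlonglongrightarrow> 0"
        by (rule_tac Lim_null_comparison[OF _ glim[of v]]) simp
      then show ?thesis by (rule LIM_zero_cancel)
    qed
    ultimately have "(\<lambda>n. (\<integral>s. fn n s \<bullet> emb v \<partial>ivl a b) - (\<integral>s. g n v s \<partial>ivl a b))
        \<longlonglongrightarrow> (\<integral>s. f s \<bullet> emb v \<partial>ivl a b) - (\<integral>s. g' v s \<partial>ivl a b)" by (rule tendsto_diff)
    moreover have "(\<integral>s. fn n s \<bullet> emb v \<partial>ivl a b) - (\<integral>s. g n v s \<partial>ivl a b) = (xn n b - xn n a) \<bullet> emb v" for n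
      using weak_derivD[OF solD(5)[OF s] ab, of n v] sub[OF ifn] sub[OF i2[OF solD(3)[OF s]]]
      by (simp add: g_def)
    moreover have "(\<integral>s. f s \<bullet> emb v \<partial>ivl a b) - (\<integral>s. g' v s \<partial>ivl a b) = (\<integral>s. w s v \<partial>ivl a b)"
      using sub[OF if'] sub[OF i2[OF wL]] by (simp add: g'_def)
    ultimately have "(\<lambda>n. (xn n b - xn n a) \<bullet> emb v) \<longlonglongrightarrow> (\<integral>s. w s v \<partial>ivl a b)" by simp
    moreover have "(\<lambda>n. (xn n b - xn n a) \<bullet> emb v) \<longlonglongrightarrow> (x b - x a) \<bullet> emb v"
      using ab by (intro tendsto_intros xlim) auto
    ultimately show "(x b - x a) \<bullet> emb v = (\<integral>s. w s v \<partial>ivl a b)" by (rule LIMSEQ_unique[rotated])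
  qed
  with wL show ?thesis using wA by (rule that)
qed

text \<open>The bound on the forcing survives the limit because running suprema converge with the
  paths and midpoint averages respect pointwise bounds. The forcings converge only after integration
  against a fixed vector, which is all that running integrals with a fixed \<open>z\<close>
  require.\<close>

theorem trajectories_compact:
  assumes t0: "0 \<le> t0" "t0 < T" and L: "L \<ge> 0" and xn: "\<And>n. xn n \<in> X L t0 x0"
  obtains r :: "nat \<Rightarrow> nat" and x where "strict_mono r" "x \<in> X L t0 x0"
    "uniform_limit {0..T} (\<lambda>n. xn (r n)) x sequentially"
    "\<And>t z. t \<in> {t0..T} \<Longrightarrow> (\<lambda>n. \<integral>s. fr t0 (xn (r n)) s \<bullet> z \<partial>ivl t0 t) \<longlonglongrightarrow> (\<integral>s. fr t0 x s \<bullet> z \<partial>ivl t0 t)"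
proof -
  obtain R K where RK: "R \<ge> 0" "K \<ge> 0" and sK: "\<And>x. x \<in> X L t0 x0 \<Longrightarrow> \<exists>y w. sol t0 x (fr t0 x) y w \<and>
     (\<integral>t. norm (y t) powr p \<partial>ivl t0 T) \<le> K \<and> (\<integral>t. norm (w t) powr q \<partial>ivl t0 T) \<le> K"
    and xR: "\<And>x t. x \<in> X L t0 x0 \<Longrightarrow> t \<in> {0..T} \<Longrightarrow> norm (x t) \<le> R"
    and fR: "\<And>x. x \<in> X L t0 x0 \<Longrightarrow> AE t in ivl t0 T. norm (fr t0 x t) \<le> R"
    by (rule trajectory_bounds[OF t0 L]) (rule that)
  have "\<forall>n. \<exists>y w. sol t0 (xn n) (fr t0 (xn n)) y w \<and>
     (\<integral>t. norm (y t) powr p \<partial>ivl t0 T) \<le> K \<and> (\<integral>t. norm (w t) powr q \<partial>ivl t0 T) \<le> K"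
    using sK[OF xn] by blast
  then obtain yn0 wn0 where s0: "\<And>n. sol t0 (xn n) (fr t0 (xn n)) (yn0 n) (wn0 n)"
     "\<And>n. (\<integral>t. norm (yn0 n t) powr p \<partial>ivl t0 T) \<le> K" "\<And>n. (\<integral>t. norm (wn0 n t) powr q \<partial>ivl t0 T) \<le> K"
    by metis
  obtain v :: "nat \<Rightarrow> 'v" where v: "\<And>x e. e > 0 \<Longrightarrow> \<exists>i. dist (emb (v i)) x < e"
    using dense_sequence by blast
  have tsub: "t \<in> {0..T}" if "t \<in> {t0..T}" for t using that t0 by auto
  obtain r1 :: "nat \<Rightarrow> nat" where r1: "strict_mono r1"
    "\<And>t i. t \<in> {t0..T} \<Longrightarrow> convergent (\<lambda>n. xn (r1 n) t \<bullet> emb (v i))"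
    "\<And>t z. t \<in> {t0..T} \<Longrightarrow> convergent (\<lambda>n. \<integral>s. fr t0 (xn (r1 n)) s \<bullet> z \<partial>ivl t0 t)"
    by (rule convergent_test_subsequence[OF t0 v Lp_fun_measurable[OF solD(1)[OF s0(1)]] fR[OF xn]
      xR[OF xn tsub] RK(1) solD(5)[OF s0(1)] solD(3)[OF s0(1)] s0(3)]) (assumption | rule that)+
  define z where "z = (\<lambda>n. xn (r1 n))"
  have zX: "z n \<in> X L t0 x0" for n by (simp add: z_def xn)
  have zp: "z n \<in> paths T" for n by (rule trajectories_subset_paths[OF zX])
  have sz: "sol t0 (z n) (fr t0 (z n)) (yn0 (r1 n)) (wn0 (r1 n))" for n by (simp add: z_def s0)
  have L1: "\<exists>N. \<forall>m\<ge>N. \<forall>n\<ge>N. (\<integral>t. norm (z m t - z n t) \<partial>ivl t0 T) < e" if "e > 0" for e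
  proof (rule L1_Cauchy[where v = v and R = R and K = K and yn = "\<lambda>n. yn0 (r1 n)", OF t0])
    show "\<exists>i. dist (emb (v i)) x < e" if "e > 0" for x e using that by (rule v)
    show "continuous_on {t0..T} (z n)" for n by (rule path_continuous_from[OF zp t0(1)])
    show "norm (z n t) \<le> R" if "t \<in> {t0..T}" for n t by (rule xR[OF zX tsub[OF that]])
    show "Lp_fun p {t0<..<T} (yn0 (r1 n))" for n by (rule solD(2)[OF sz])
    show "(\<integral>t. norm (yn0 (r1 n) t) powr p \<partial>ivl t0 T) \<le> K" for n by (rule s0(2))
    show "AE t in ivl t0 T. z n t = emb (yn0 (r1 n) t)" for n by (rule solD(4)[OF sz])
    show "convergent (\<lambda>n. z n t \<bullet> emb (v i))" if "t \<in> {t0..T}" for t i unfolding z_def by (rule r1(2)[OF that])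
  qed (rule that)
  have "uniformly_Cauchy_on {0..T} z"
    unfolding uniformly_Cauchy_on_def
  proof (intro allI impI)
    fix e :: real assume e: "e > 0"
    \<comment> \<open>Squared distances are at most 4 R times the L^1 distance, and this \<eta>
      keeps that below e^2; the added 1 covers R = 0.\<close>
    define \<eta> where "\<eta> = e\<^sup>2 / (4 * R + 1)"
    have \<eta>: "\<eta> > 0" using e RK by (simp add: \<eta>_def)
    obtain N where N: "\<And>m n. m \<ge> N \<Longrightarrow> n \<ge> N \<Longrightarrow> (\<integral>t. norm (z m t - z n t) \<partial>ivl t0 T) < \<eta>"
      using L1[OF \<eta>] by blast
    show "\<exists>M. \<forall>x\<in>{0..T}. \<forall>m\<ge>M. \<forall>n\<ge>M. dist (z m x) (z n x) < e"
    proof (intro exI[of _ N] ballI allI impI)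
      fix t m n assume t: "t \<in> {0..T}" and mn: "m \<ge> N" "n \<ge> N"
      show "dist (z m t) (z n t) < e"
      proof (cases "t \<le> t0")
        case True
        then have "z m t = z n t" using trajectories_initial[OF zX, of t] t by auto
        then show ?thesis using e by simp
      next
        case False
        then have t': "t \<in> {t0..T}" using t by auto
        have init: "z m t0 = z n t0" using trajectories_initial[OF zX, of t0] t0 by auto
        have "(norm (z m t - z n t))\<^sup>2 \<le> 4 * R * (\<integral>s. norm (z m s - z n s) \<partial>ivl t0 T)"
          by (rule trajectory_difference[OF t0 zp zp sz sz init RK(1) fR[OF zX] fR[OF zX] t'])
        also have "\<dots> \<le> 4 * R * \<eta>" using N[OF mn] RK by (intro mult_left_mono) auto
        also have "\<dots> < (4 * R + 1) * \<eta>" using \<eta> by (simp add: algebra_simps)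
        also have "\<dots> = e\<^sup>2" using RK by (simp add: \<eta>_def)
        finally show ?thesis using e by (simp add: dist_norm power2_less_imp_less)
      qed
    qed
  qed
  then have "uniformly_convergent_on {0..T} z" by (rule Cauchy_uniformly_convergent)
  then obtain l where l: "uniform_limit {0..T} z l sequentially" unfolding uniformly_convergent_on_def by blast
  define x where "x = restrict l {0..T}"
  have lim: "uniform_limit {0..T} z x sequentially"
    using l by (rule uniform_limit_cong'[THEN iffD1, rotated -1]) (auto simp: x_def)
  have xc: "continuous_on {0..T} x"
    by (rule uniform_limit_theorem[OF _ lim]) (use paths_continuous[OF zp] in auto)
  have xp: "x \<in> paths T" unfolding paths_iff using xc by (simp add: x_def)
  have xl: "(\<lambda>n. z n t) \<longlonglongrightarrow> x t" if "t \<in> {0..T}" for t by (rule tendsto_uniform_limitI[OF lim that])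
  have limT: "uniform_limit {t0..T} z x sequentially"
    by (rule uniform_limit_on_subset[OF lim]) (use t0 in auto)
  have xcT: "continuous_on {t0..T} x" by (rule path_continuous_from[OF xp t0(1)])
  obtain y where y: "Lp_fun p {t0<..<T} y" "AE t in ivl t0 T. x t = emb (y t)"
  proof (rule embedded_limit[OF solD(2)[OF sz] s0(2) solD(4)[OF sz] xcT])
    show "(\<lambda>n. z n t) \<longlonglongrightarrow> x t" if "t \<in> {t0<..<T}" for t by (rule xl) (use that t0 in auto)
  qed (rule that)
  obtain r2 :: "nat \<Rightarrow> nat" where r2: "strict_mono r2"
    "AE t in ivl t0 T. \<forall>v. (\<lambda>n. A t (yn0 (r1 (r2 n)) t) v) \<longlonglongrightarrow> A t (y t) v"
    by (rule operator_limit[OF t0 sz zp xcT limT RK(1) fR[OF zX] s0(3) y]) (rule that)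
  have sub: "(\<lambda>n. u (r2 n)) \<longlonglongrightarrow> a" if "u \<longlonglongrightarrow> a" for u :: "nat \<Rightarrow> 'b::topological_space" and a
    using LIMSEQ_subseq_LIMSEQ[OF that r2(1)] by (simp add: o_def)
  define \<Phi> where "\<Phi> = (\<lambda>t u. lim (\<lambda>n. \<integral>s. fr t0 (z n) s \<bullet> u \<partial>ivl t0 t))"
  have \<Phi>: "(\<lambda>n. \<integral>s. fr t0 (z (r2 n)) s \<bullet> u \<partial>ivl t0 t) \<longlonglongrightarrow> \<Phi> t u" if "t \<in> {t0..T}" for t u
    by (rule sub) (use r1(3)[OF that] in \<open>simp add: \<Phi>_def z_def convergent_LIMSEQ_iff\<close>)
  have supl: "(\<lambda>n. L * (1 + sup_norm_upto (z (r2 n)) t)) \<longlonglongrightarrow> L * (1 + sup_norm_upto x t)" if t: "t \<in> {t0<..<T}" for t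
  proof -
    have "(\<lambda>n. sup_norm_upto (z n) t) \<longlonglongrightarrow> sup_norm_upto x t"
    proof (rule LIMSEQ_I)
      fix e :: real assume e: "e > 0"
      then have e2: "e / 2 > 0" by simp
      obtain N where N: "\<And>n t. n \<ge> N \<Longrightarrow> t \<in> {0..T} \<Longrightarrow> dist (z n t) (x t) < e / 2"
        using uniform_limitD[OF lim e2] unfolding eventually_sequentially by blast
      show "\<exists>N. \<forall>n\<ge>N. norm (sup_norm_upto (z n) t - sup_norm_upto x t) < e"
      proof (intro exI[of _ N] allI impI)
        fix n assume n: "n \<ge> N"
        have "\<bar>sup_norm_upto (z n) t - sup_norm_upto x t\<bar> \<le> e / 2"
          by (rule sup_norm_upto_diff_le[OF zp xp])
             (use t t0 N[OF n] in \<open>auto simp: dist_norm intro: less_imp_le\<close>)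
        then show "norm (sup_norm_upto (z n) t - sup_norm_upto x t) < e" using e by simp
      qed
    qed
    then show ?thesis by (intro tendsto_intros sub)
  qed
  obtain f where f: "f \<in> borel_measurable (ivl t0 T)" "AE t in ivl t0 T. norm (f t) \<le> R"
    "AE t in ivl t0 T. norm (f t) \<le> L * (1 + sup_norm_upto x t)"
    "\<And>t u. t \<in> {t0..T} \<Longrightarrow> (\<integral>s. f s \<bullet> u \<partial>ivl t0 t) = \<Phi> t u"
    by (rule bounded_weak_limit[OF t0(2) Lp_fun_measurable[OF solD(1)[OF sz]] fR[OF zX] RK(1) \<Phi> forcing_sol(2)[OF t0 zX] supl])
       (assumption | rule that)+
  have flim: "(\<lambda>n. \<integral>s. fr t0 (z (r2 n)) s \<bullet> u \<partial>ivl t0 t) \<longlonglongrightarrow> (\<integral>s. f s \<bullet> u \<partial>ivl t0 t)" if "t \<in> {t0..T}" for t u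
    unfolding f(4)[OF that] by (rule \<Phi>[OF that])
  obtain w where w: "weak_Lq q {t0<..<T} w" "weak_deriv emb t0 T x w"
    "AE t in ivl t0 T. w t + A t (y t) = to_dual emb (f t)"
    by (rule weak_deriv_limit[OF t0 sz RK(1) fR[OF zX] s0(3) y(1) r2(2) f(1,2) flim sub[OF xl[OF tsub]]])
       (assumption | rule that)+
  have "Lp_fun 2 {t0<..<T} f"
  proof (rule Lp_fun_bound[OF f(1), of "\<lambda>_. R powr 2"])
    show "AE t in ivl t0 T. norm (f t) powr 2 \<le> R powr 2"
      using f(2) by eventually_elim (rule powr_mono2, simp_all)
  qed simp
  then have s: "sol t0 x f y w" unfolding sol_def using y w by blast
  have init: "x t = x0 t" if t: "t \<in> {0..t0}" for t
  proof (rule LIMSEQ_unique[OF xl])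
    show "t \<in> {0..T}" using t t0 by auto
    show "(\<lambda>n. z n t) \<longlonglongrightarrow> x0 t" using trajectories_initial[OF zX t] by simp
  qed
  \<comment> \<open>The constructed \<open>f\<close> need not be the chosen \<open>forcing\<close>
    of the limit; it agrees with it almost everywhere, which identifies the integrals.\<close>
  have tr: "x \<in> X L t0 x0" "AE t in ivl t0 T. fr t0 x t = f t"
    using trajectoriesI[where L = L and ?x0.0 = x0, OF t0 xp _ s f(3)] init by blast+
  show ?thesis
  proof (rule that[of "r1 \<circ> r2" x])
    show "strict_mono (r1 \<circ> r2)" by (rule strict_mono_o[OF r1(1) r2(1)])
    show "x \<in> X L t0 x0" by (rule tr(1))
    show "uniform_limit {0..T} (\<lambda>n. xn ((r1 \<circ> r2) n)) x sequentially"
      using filterlim_compose[OF lim filterlim_subseq[OF r2(1)]] by (simp add: z_def)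
    fix t u assume t: "t \<in> {t0..T}"
    have "(\<integral>s. fr t0 x s \<bullet> u \<partial>ivl t0 t) = (\<integral>s. f s \<bullet> u \<partial>ivl t0 t)"
    proof (rule integral_cong_AE)
      obtain y' w' where s': "sol t0 x (fr t0 x) y' w'" using forcing_sol(1)[OF t0 tr(1)] by blast
      have tT: "t \<le> T" using t by auto
      show "(\<lambda>s. fr t0 x s \<bullet> u) \<in> borel_measurable (ivl t0 t)"
        by (intro borel_measurable_inner borel_measurable_const ivl_mono_measurable[OF Lp_fun_measurable[OF solD(1)[OF s']] order_refl tT])
      show "(\<lambda>s. f s \<bullet> u) \<in> borel_measurable (ivl t0 t)"
        by (intro borel_measurable_inner borel_measurable_const ivl_mono_measurable[OF f(1) order_refl tT])
      show "AE s in ivl t0 t. fr t0 x s \<bullet> u = f s \<bullet> u"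
        using ivl_mono_AE[OF tr(2) order_refl tT] by eventually_elim simp
    qed
    then show "(\<lambda>n. \<integral>s. fr t0 (xn ((r1 \<circ> r2) n)) s \<bullet> u \<partial>ivl t0 t) \<longlonglongrightarrow> (\<integral>s. fr t0 x s \<bullet> u \<partial>ivl t0 t)"
      using flim[OF t, of u] by (simp add: z_def)
  qed
qed

end

section \<open>Concatenation of trajectories\<close>

lemma AE_ivl_join:
  assumes "AE r in ivl a c. P r" "AE r in ivl c b. P r"
  shows "AE r in ivl a b. P r"
proof -
  have "AE r in lebesgue. r \<in> {a<..<c} \<longrightarrow> P r" "AE r in lebesgue. r \<in> {c<..<b} \<longrightarrow> P r"
    using assms by (simp_all add: AE_restrict_space_iff)
  moreover have "AE r in lebesgue. r \<noteq> c"
    by (rule AE_I'[of "{c}"]) auto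
  ultimately have "AE r in lebesgue. r \<in> {a<..<b} \<longrightarrow> P r" by eventually_elim auto
  then show ?thesis by (simp add: AE_restrict_space_iff)
qed

lemma AE_ivlI: "(\<And>r. a < r \<Longrightarrow> r < b \<Longrightarrow> P r) \<Longrightarrow> AE r in ivl a b. P r"
  by (rule AE_I2) auto

abbreviation glue :: "real \<Rightarrow> (real \<Rightarrow> 'a) \<Rightarrow> (real \<Rightarrow> 'a) \<Rightarrow> real \<Rightarrow> 'a" where
  "glue c g g' \<equiv> (\<lambda>t. if t < c then g t else g' t)"

lemma glue_measurable:
  fixes g g' :: "real \<Rightarrow> 'b::real_normed_vector"
  assumes "a \<le> c" "c \<le> b" "g \<in> borel_measurable (ivl a c)" "g' \<in> borel_measurable (ivl c b)"
  shows "glue c g g' \<in> borel_measurable (ivl a b)"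
proof -
  have 1: "(\<lambda>r. indicator {a<..<c} r *\<^sub>R g r) \<in> borel_measurable lebesgue"
    using assms(3) by (subst (asm) borel_measurable_restrict_space_iff) auto
  have 2: "(\<lambda>r. indicator {c<..<b} r *\<^sub>R g' r) \<in> borel_measurable lebesgue"
    using assms(4) by (subst (asm) borel_measurable_restrict_space_iff) auto
  have "(\<lambda>r. if r < c then indicator {a<..<c} r *\<^sub>R g r
      else if r = c then indicator {a<..<b} c *\<^sub>R g' c else indicator {c<..<b} r *\<^sub>R g' r) \<in> borel_measurable lebesgue"
    using 1 2 by (intro measurable_If) auto
  moreover have "(if r < c then indicator {a<..<c} r *\<^sub>R g r
      else if r = c then indicator {a<..<b} c *\<^sub>R g' c else indicator {c<..<b} r *\<^sub>R g' r)
      = indicator {a<..<b} r *\<^sub>R glue c g g' r" for r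
    using assms(1,2) by (auto simp: indicator_def)
  ultimately have "(\<lambda>r. indicator {a<..<b} r *\<^sub>R glue c g g' r) \<in> borel_measurable lebesgue" by simp
  then show ?thesis by (subst borel_measurable_restrict_space_iff) auto
qed

lemma glue_integrable:
  fixes g g' :: "real \<Rightarrow> real"
  assumes ab: "a \<le> c" "c \<le> b" and g: "integrable (ivl a c) g" "integrable (ivl c b) g'"
  shows "integrable (ivl a b) (glue c g g')"
proof -
  have gl: "glue c g g' \<in> borel_measurable (ivl a b)"
    using assms by (intro glue_measurable) auto
  have "integrable lebesgue (\<lambda>r. indicator {a<..<c} r *\<^sub>R g r + indicator {c<..<b} r *\<^sub>R g' r)"
    using g by (intro Bochner_Integration.integrable_add) (simp_all add: integrable_restrict_space)
  moreover have "AE r in lebesgue. indicator {a<..<c} r *\<^sub>R g r + indicator {c<..<b} r *\<^sub>R g' r = indicator {a<..<b} r *\<^sub>R glue c g g' r"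
  proof -
    have "AE r in lebesgue. r \<noteq> c" by (rule AE_I'[of "{c}"]) auto
    then show ?thesis by eventually_elim (use ab in \<open>auto simp: indicator_def\<close>)
  qed
  moreover have "(\<lambda>r. indicator {a<..<b} r *\<^sub>R glue c g g' r) \<in> borel_measurable lebesgue"
    using gl by (subst (asm) borel_measurable_restrict_space_iff) auto
  ultimately have "integrable lebesgue (\<lambda>r. indicator {a<..<b} r *\<^sub>R glue c g g' r)"
    using integrable_cong_AE_imp by blast
  then show ?thesis by (simp add: integrable_restrict_space)
qed

lemma glue_Lp_fun:
  fixes g g' :: "real \<Rightarrow> 'b::real_normed_vector"
  assumes "a \<le> c" "c \<le> b" "Lp_fun p {a<..<c} g" "Lp_fun p {c<..<b} g'"
  shows "Lp_fun p {a<..<b} (glue c g g')"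
proof -
  have "integrable (ivl a b) (glue c (\<lambda>t. norm (g t) powr p) (\<lambda>t. norm (g' t) powr p))"
    using assms by (intro glue_integrable) (auto simp: Lp_fun_def)
  moreover have "glue c (\<lambda>t. norm (g t) powr p) (\<lambda>t. norm (g' t) powr p) = (\<lambda>t. norm (glue c g g' t) powr p)"
    by auto
  ultimately show ?thesis
    using glue_measurable[OF assms(1,2) Lp_fun_measurable[OF assms(3)] Lp_fun_measurable[OF assms(4)]]
    unfolding Lp_fun_def by simp
qed

lemma ivl_integral_cong:
  fixes g h :: "real \<Rightarrow> real"
  shows "(\<And>r. s < r \<Longrightarrow> r < t \<Longrightarrow> g r = h r) \<Longrightarrow> integral\<^sup>L (ivl s t) g = integral\<^sup>L (ivl s t) h"
  by (rule Bochner_Integration.integral_cong) auto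

context evolution
begin

text \<open>The glued data solve the equation, as an increment across \<open>t1\<close> splits
  there. The growth bound refers to the whole past, which both paths share up to \<open>t1\<close>;
  uniqueness then identifies the forcing of the glued path on either side of
  \<open>t1\<close>.\<close>

lemma trajectories_concat:
  assumes t0: "0 \<le> t0" "t0 \<le> t1" "t1 < T" and x: "x \<in> X L t0 x0" and x': "x' \<in> X L t1 x"
  shows "x' \<in> X L t0 x0" and "AE t in ivl t0 t1. fr t0 x' t = fr t0 x t"
    and "AE t in ivl t1 T. fr t0 x' t = fr t1 x' t"
proof -
  have t0T: "t0 < T" and t1: "0 \<le> t1" and t1T: "t1 \<le> T" using t0 by auto
  obtain y w where s: "sol t0 x (fr t0 x) y w" using forcing_sol(1)[OF t0(1) t0T x] by blast
  obtain y' w' where s': "sol t1 x' (fr t1 x') y' w'" using forcing_sol(1)[OF t1 t0(3) x'] by blast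
  have ag: "x' t = x t" if "t \<in> {0..t1}" for t by (rule trajectories_initial[OF x' that])
  note xp = trajectories_subset_paths[OF x] and xp' = trajectories_subset_paths[OF x']
  let ?f = "glue t1 (fr t0 x) (fr t1 x')" and ?y = "glue t1 y y'" and ?w = "glue t1 w w'"
  have split: "AE t in ivl t0 T. P t" if "AE t in ivl t0 t1. P t" "AE t in ivl t1 T. P t" for P
    by (rule AE_ivl_join[OF that])
  have lt: "AE t in ivl t0 t1. t < t1" by (rule AE_ivlI)
  have gt: "AE t in ivl t1 T. t1 < t" by (rule AE_ivlI)
  note m1 = ivl_mono_AE[OF _ order_refl t1T]
  have "sol t0 x' ?f ?y ?w"
    unfolding sol_def
  proof (intro conjI)
    show "Lp_fun 2 {t0<..<T} ?f"
      by (rule glue_Lp_fun[OF t0(2) t1T Lp_fun_mono[OF solD(1)[OF s] order_refl t1T] solD(1)[OF s']])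
    show "Lp_fun p {t0<..<T} ?y"
      by (rule glue_Lp_fun[OF t0(2) t1T Lp_fun_mono[OF solD(2)[OF s] order_refl t1T] solD(2)[OF s']])
    show wL: "weak_Lq q {t0<..<T} ?w"
      using glue_Lp_fun[OF t0(2) t1T, of q w w'] Lp_fun_mono[OF _ order_refl t1T, of q t0 w] solD(3)[OF s] solD(3)[OF s']
      unfolding Lp_fun_dual_iff by blast
    show "AE t in ivl t0 T. x' t = emb (?y t)"
    proof (rule split)
      show "AE t in ivl t0 t1. x' t = emb (?y t)"
        using m1[OF solD(4)[OF s]] AE_space[of "ivl t0 t1"]
        by eventually_elim (use t0 ag in auto)
      show "AE t in ivl t1 T. x' t = emb (?y t)"
        using solD(4)[OF s'] gt by eventually_elim auto
    qed
    show "AE t in ivl t0 T. ?w t + A t (?y t) = to_dual emb (?f t)"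
    proof (rule split)
      show "AE t in ivl t0 t1. ?w t + A t (?y t) = to_dual emb (?f t)"
        using m1[OF solD(6)[OF s]] lt by eventually_elim simp
      show "AE t in ivl t1 T. ?w t + A t (?y t) = to_dual emb (?f t)"
        using solD(6)[OF s'] gt by eventually_elim simp
    qed
    show "weak_deriv emb t0 T x' ?w"
      unfolding weak_deriv_def
    proof (intro allI impI)
      fix a b v assume ab: "t0 \<le> a" "a \<le> b" "b \<le> T"
      have before: "(x' d - x' c) \<bullet> emb v = (\<integral>r. ?w r v \<partial>ivl c d)" if cd: "t0 \<le> c" "c \<le> d" "d \<le> t1" for c d
      proof -
        have "(\<integral>r. ?w r v \<partial>ivl c d) = (\<integral>r. w r v \<partial>ivl c d)"
          by (rule ivl_integral_cong) (use cd in auto)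
        also have "\<dots> = (x d - x c) \<bullet> emb v"
          by (rule weak_derivD[OF solD(5)[OF s]]) (use cd t1T in auto)
        finally show ?thesis using ag[of c] ag[of d] cd t0 by simp
      qed
      have after: "(x' d - x' c) \<bullet> emb v = (\<integral>r. ?w r v \<partial>ivl c d)" if cd: "t1 \<le> c" "c \<le> d" "d \<le> T" for c d
      proof -
        have "(\<integral>r. ?w r v \<partial>ivl c d) = (\<integral>r. w' r v \<partial>ivl c d)"
          by (rule ivl_integral_cong) (use cd in auto)
        also have "\<dots> = (x' d - x' c) \<bullet> emb v"
          by (rule weak_derivD[OF solD(5)[OF s']]) (use cd in auto)
        finally show ?thesis by simp
      qed
      show "(x' b - x' a) \<bullet> emb v = (\<integral>r. ?w r v \<partial>ivl a b)"
      proof (cases "b \<le> t1 \<or> t1 \<le> a")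
        case True
        then show ?thesis using before[OF ab(1,2)] after[OF _ ab(2,3)] by blast
      next
        case False
        then have m: "a \<le> t1" "t1 \<le> b" by auto
        have "integrable (ivl a b) (\<lambda>r. ?w r v)"
          by (rule ivl_mono_integrable[OF weak_Lq_integrable_apply[OF less_imp_le[OF q1] wL] ab(1,3)])
        from ivl_integral_add[OF this m] before[OF ab(1) m(1) order_refl] after[OF order_refl m(2) ab(3)]
        show ?thesis by (simp add: inner_diff_left)
      qed
    qed
  qed
  moreover have "AE t in ivl t0 T. norm (?f t) \<le> L * (1 + sup_norm_upto x' t)"
  proof (rule split)
    show "AE t in ivl t0 t1. norm (?f t) \<le> L * (1 + sup_norm_upto x' t)"
      using m1[OF forcing_sol(2)[OF t0(1) t0T x]] AE_space[of "ivl t0 t1"]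
    proof eventually_elim
      case (elim t)
      have "sup_norm_upto x' t = sup_norm_upto x t"
        unfolding sup_norm_upto_def using elim ag by (intro SUP_cong) auto
      then show ?case using elim by auto
    qed
    show "AE t in ivl t1 T. norm (?f t) \<le> L * (1 + sup_norm_upto x' t)"
      using forcing_sol(2)[OF t1 t0(3) x'] gt by eventually_elim auto
  qed
  moreover have "x' t = x0 t" if "t \<in> {0..t0}" for t
    using ag[of t] trajectories_initial[OF x that] that t0 by auto
  ultimately have X: "x' \<in> X L t0 x0" and f: "AE t in ivl t0 T. fr t0 x' t = ?f t"
    using trajectoriesI[where L = L and ?x0.0 = x0, OF t0(1) t0T xp'] by blast+
  show "x' \<in> X L t0 x0" by (rule X)
  show "AE t in ivl t0 t1. fr t0 x' t = fr t0 x t"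
    using m1[OF f] lt by eventually_elim simp
  show "AE t in ivl t1 T. fr t0 x' t = fr t1 x' t"
    using ivl_mono_AE[OF f t0(2) order_refl] gt by eventually_elim simp
qed

end

section \<open>Continuity with respect to the path metric\<close>

lemma d_inf_le:
  assumes "0 \<le> T" "\<And>r. r \<in> {0..T} \<Longrightarrow> norm (x (min r t) - y (min r s)) \<le> e"
  shows "d_inf T (t, x) (s, y) \<le> \<bar>t - s\<bar> + e"
proof -
  have "(SUP r\<in>{0..T}. norm (x (min r t) - y (min r s))) \<le> e"
    by (rule cSUP_least) (use assms in auto)
  then show ?thesis by (simp add: d_inf_def)
qed

lemma d_inf_agree:
  assumes "0 \<le> T" "t \<in> {0..T}" "\<And>r. r \<in> {0..t} \<Longrightarrow> x r = y r"
  shows "d_inf T (t, x) (t, y) \<le> 0"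
  using d_inf_le[OF assms(1), of x t y t 0] assms(2,3) by (simp add: min_def)

text \<open>The metric compares stopped paths. Moving the stopping time costs the modulus of
  continuity of the fixed path \<open>x\<close>, and changing the path costs the uniform
  distance.\<close>

lemma d_inf_small:
  fixes x :: "real \<Rightarrow> 'h::real_normed_vector"
  assumes T: "0 \<le> T" and x: "x \<in> paths T" and e: "e > 0"
  obtains d where "d > 0" "\<And>s t y. s \<in> {0..T} \<Longrightarrow> t \<in> {0..T} \<Longrightarrow> \<bar>t - s\<bar> < d \<Longrightarrow>
    (\<And>r. r \<in> {0..T} \<Longrightarrow> norm (x r - y r) < d) \<Longrightarrow> d_inf T (t, x) (s, y) < e"
proof -
  have "uniformly_continuous_on {0..T} x"
    by (rule compact_uniformly_continuous[OF paths_continuous[OF x]]) simp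
  then obtain d where d: "d > 0" "\<And>s t. s \<in> {0..T} \<Longrightarrow> t \<in> {0..T} \<Longrightarrow> dist s t < d \<Longrightarrow> dist (x s) (x t) < e/4"
    unfolding uniformly_continuous_on_def using e by (metis zero_less_divide_iff zero_less_numeral)
  show ?thesis
  proof (rule that[of "min d (e/4)"])
    fix s t y assume st: "s \<in> {0..T}" "t \<in> {0..T}" "\<bar>t - s\<bar> < min d (e/4)"
      and y: "\<And>r. r \<in> {0..T} \<Longrightarrow> norm (x r - y r) < min d (e/4)"
    have "d_inf T (t, x) (s, y) \<le> \<bar>t - s\<bar> + e/2"
    proof (rule d_inf_le[OF T])
      fix r assume r: "r \<in> {0..T}"
      have "\<bar>min r t - min r s\<bar> \<le> \<bar>t - s\<bar>" by (simp add: min_def)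
      then have "dist (min r t) (min r s) < d" using st(3) by (simp add: dist_real_def)
      then have "dist (x (min r t)) (x (min r s)) < e/4"
        by (rule d(2)[rotated -1]) (use r st in auto)
      moreover have "norm (x (min r s) - y (min r s)) < e/4" using y[of "min r s"] r st by auto
      ultimately have "norm (x (min r t) - y (min r s)) < e/4 + e/4"
        unfolding dist_norm by (rule norm_diff_triangle_less)
      then show "norm (x (min r t) - y (min r s)) \<le> e/2" by simp
    qed
    then show "d_inf T (t, x) (s, y) < e" using st(3) by linarith
  qed (use d e in auto)
qed

text \<open>Paths that agree up to t are at distance 0, and semicontinuity used in both directions
  turns this into equality: \<open>u\<close> is non-anticipating.\<close>

lemma LSC_on_agree:
  assumes "0 \<le> T" "LSC_on T \<Omega> u" "t \<in> {0..T}" "x \<in> \<Omega>" "y \<in> \<Omega>" "\<And>r. r \<in> {0..t} \<Longrightarrow> x r = y r"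
  shows "u t x = u t y"
proof -
  have le: "u t x \<le> u t y" if xy: "x \<in> \<Omega>" "y \<in> \<Omega>" "\<And>r. r \<in> {0..t} \<Longrightarrow> x r = y r" for x y
  proof (rule field_le_epsilon)
    fix e :: real assume "e > 0"
    then obtain d where "d > 0" "\<And>s y. s \<in> {0..T} \<Longrightarrow> y \<in> \<Omega> \<Longrightarrow> d_inf T (t, x) (s, y) < d \<Longrightarrow> u s y > u t x - e"
      using assms(2,3) xy(1) unfolding LSC_on_def by meson
    from this(2)[OF assms(3) xy(2)] this(1) d_inf_agree[OF assms(1,3) xy(3)]
    show "u t x \<le> u t y + e" by fastforce
  qed
  show ?thesis
    by (rule antisym) (rule le; use assms in auto)+
qed

text \<open>Joint limit in time, path and integral term: only \<open>u\<close> is merely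
  semicontinuous, and it sits on the side where lower semicontinuity helps.\<close>

lemma LSC_on_limit:
  fixes x :: "real \<Rightarrow> 'h::real_normed_vector"
  assumes T: "0 \<le> T" and u: "LSC_on T \<Omega> u" and \<Omega>: "\<Omega> \<subseteq> paths T" and t: "t \<in> {0..T}" "\<And>n. tn n \<in> {0..T}"
    and x: "x \<in> \<Omega>" "\<And>n. xn n \<in> \<Omega>" and lim: "tn \<longlonglongrightarrow> t" "uniform_limit {0..T} xn x sequentially"
    and le: "\<And>n. u (tn n) (xn n) + \<rho>n n \<le> cn n" and \<rho>: "\<rho>n \<longlonglongrightarrow> \<rho>" and c: "cn \<longlonglongrightarrow> c"
  shows "u t x + \<rho> \<le> c"
proof (rule field_le_epsilon)
  fix e :: real assume e: "e > 0"
  obtain d where d: "d > 0" "\<And>s y. s \<in> {0..T} \<Longrightarrow> y \<in> \<Omega> \<Longrightarrow> d_inf T (t, x) (s, y) < d \<Longrightarrow> u s y > u t x - e"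
    using u t(1) x(1) e unfolding LSC_on_def by meson
  obtain d' where d': "d' > 0" "\<And>s t y. s \<in> {0..T} \<Longrightarrow> t \<in> {0..T} \<Longrightarrow> \<bar>t - s\<bar> < d' \<Longrightarrow>
    (\<And>r. r \<in> {0..T} \<Longrightarrow> norm (x r - y r) < d') \<Longrightarrow> d_inf T (t, x) (s, y) < d"
    using d_inf_small[OF T _ d(1), of x] x(1) \<Omega> by blast
  have "\<forall>\<^sub>F n in sequentially. u t x - e + \<rho>n n \<le> cn n"
    using tendstoD[OF lim(1) d'(1)] uniform_limitD[OF lim(2) d'(1)]
  proof eventually_elim
    case (elim n)
    have "d_inf T (t, x) (tn n, xn n) < d"
      using elim by (intro d' t) (auto simp: dist_norm norm_minus_commute abs_minus_commute)
    then have "u (tn n) (xn n) > u t x - e" by (intro d t x)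
    then show ?case using le[of n] by linarith
  qed
  moreover have "(\<lambda>n. u t x - e + \<rho>n n) \<longlonglongrightarrow> u t x - e + \<rho>" by (intro tendsto_intros \<rho>)
  ultimately have "u t x - e + \<rho> \<le> c"
    using tendsto_le[OF trivial_limit_sequentially c] by blast
  then show "u t x + \<rho> \<le> c + e" by simp
qed

section \<open>The Hamiltonian and the running integral along trajectories\<close>

locale evolution_hamiltonian = evolution T p q emb A
  for T p q :: real
    and emb :: "'v::{banach, second_countable_topology} \<Rightarrow>\<^sub>L 'h::{real_inner, banach, second_countable_topology}"
    and A :: "real \<Rightarrow> 'v \<Rightarrow> ('v \<Rightarrow>\<^sub>L real)" +
  fixes F :: "real \<Rightarrow> (real \<Rightarrow> 'h) \<Rightarrow> 'h \<Rightarrow> real"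
  assumes F: "admissible_hamiltonian T p q emb A F"
begin

lemma T0: "0 \<le> T" using T by simp

lemma F_continuous:
  assumes "t \<in> {0..T}" "x \<in> paths T" "e > 0"
  obtains d where "d > 0" "\<And>s y. s \<in> {0..T} \<Longrightarrow> y \<in> paths T \<Longrightarrow> d_inf T (t, x) (s, y) < d \<Longrightarrow> \<bar>F t x z - F s y z\<bar> < e"
proof -
  have "\<exists>d>0. \<forall>s\<in>{0..T}. \<forall>y\<in>paths T. \<forall>z'. d_inf T (t, x) (s, y) + norm (z - z') < d \<longrightarrow> \<bar>F t x z - F s y z'\<bar> < e"
    using F assms unfolding admissible_hamiltonian_def by blast
  then obtain d where d: "d > 0" "\<And>s y z'. s \<in> {0..T} \<Longrightarrow> y \<in> paths T \<Longrightarrow> d_inf T (t, x) (s, y) + norm (z - z') < d \<Longrightarrow> \<bar>F t x z - F s y z'\<bar> < e"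
    by blast
  show ?thesis by (rule that[OF d(1)]) (use d(2)[of _ _ z] in simp)
qed

lemma F_tendsto:
  assumes t: "t \<in> {0..T}" "\<And>n. tn n \<in> {0..T}" and x: "x \<in> paths T" "\<And>n. xn n \<in> paths T"
    and lim: "tn \<longlonglongrightarrow> t" "uniform_limit {0..T} xn x sequentially"
  shows "(\<lambda>n. F (tn n) (xn n) z) \<longlonglongrightarrow> F t x z"
proof (rule tendstoI)
  fix e :: real assume e: "e > 0"
  obtain d where d: "d > 0" "\<And>s y. s \<in> {0..T} \<Longrightarrow> y \<in> paths T \<Longrightarrow> d_inf T (t, x) (s, y) < d \<Longrightarrow> \<bar>F t x z - F s y z\<bar> < e"
    using F_continuous[OF t(1) x(1) e] by blast
  obtain d' where d': "d' > 0" "\<And>s t y. s \<in> {0..T} \<Longrightarrow> t \<in> {0..T} \<Longrightarrow> \<bar>t - s\<bar> < d' \<Longrightarrow>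
    (\<And>r. r \<in> {0..T} \<Longrightarrow> norm (x r - y r) < d') \<Longrightarrow> d_inf T (t, x) (s, y) < d"
    using d_inf_small[OF T0 x(1) d(1)] by blast
  show "\<forall>\<^sub>F n in sequentially. dist (F (tn n) (xn n) z) (F t x z) < e"
    using tendstoD[OF lim(1) d'(1)] uniform_limitD[OF lim(2) d'(1)]
  proof eventually_elim
    case (elim n)
    have "d_inf T (t, x) (tn n, xn n) < d"
      using elim by (intro d' t) (auto simp: dist_norm norm_minus_commute abs_minus_commute)
    then have "\<bar>F t x z - F (tn n) (xn n) z\<bar> < e" by (intro d t x)
    then show ?case by (simp add: dist_real_def abs_minus_commute)
  qed
qed

lemma F_path_continuous:
  assumes "x \<in> paths T"
  shows "continuous_on {0..T} (\<lambda>s. F s x z)"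
  unfolding continuous_on_sequentially
proof (intro allI ballI impI, elim conjE)
  fix tn t assume "t \<in> {0..T}" "\<forall>n. tn n \<in> {0..T}" "tn \<longlonglongrightarrow> t"
  then show "((\<lambda>s. F s x z) \<circ> tn) \<longlonglongrightarrow> F t x z"
    unfolding o_def by (intro F_tendsto assms uniform_limit_const) auto
qed

lemma F_agree:
  assumes t: "t \<in> {0..T}" and xy: "x \<in> paths T" "y \<in> paths T" "\<And>r. r \<in> {0..t} \<Longrightarrow> x r = y r"
  shows "F t x z = F t y z"
proof -
  have "\<bar>F t x z - F t y z\<bar> \<le> e" if e: "e > 0" for e
  proof -
    obtain d where "d > 0" "\<And>s y. s \<in> {0..T} \<Longrightarrow> y \<in> paths T \<Longrightarrow> d_inf T (t, x) (s, y) < d \<Longrightarrow> \<bar>F t x z - F s y z\<bar> < e"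
      using F_continuous[OF t xy(1) e] by blast
    from this(2)[OF t xy(2)] this(1) d_inf_agree[OF T0 t xy(3)] show ?thesis by fastforce
  qed
  then have "\<bar>F t x z - F t y z\<bar> \<le> 0" by (rule dense_ge)
  then show ?thesis by simp
qed

text \<open>Compactness of [0,T]: times at which the estimate fails would have a convergent
  subsequence, along which both values of F tend to the same limit.\<close>

lemma F_uniform:
  assumes x: "x \<in> paths T" "\<And>n. xn n \<in> paths T" and lim: "uniform_limit {0..T} xn x sequentially" and e: "e > 0"
  shows "\<exists>N. \<forall>n\<ge>N. \<forall>s\<in>{0..T}. \<bar>F s (xn n) z - F s x z\<bar> < e"
proof (rule ccontr)
  assume "\<nexists>N. \<forall>n\<ge>N. \<forall>s\<in>{0..T}. \<bar>F s (xn n) z - F s x z\<bar> < e"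
  then have "\<forall>N. \<exists>n s. n \<ge> N \<and> s \<in> {0..T} \<and> \<bar>F s (xn n) z - F s x z\<bar> \<ge> e" by (meson not_less)
  then obtain k s where ks: "\<And>N. k N \<ge> N" "\<And>N. s N \<in> {0..T}" "\<And>N. \<bar>F (s N) (xn (k N)) z - F (s N) x z\<bar> \<ge> e" by metis
  obtain t r where r: "t \<in> {0..T}" "strict_mono (r :: nat \<Rightarrow> nat)" "(s \<circ> r) \<longlonglongrightarrow> t"
    using compact_Icc[of 0 T] ks(2) unfolding compact_def by metis
  \<comment> \<open>\<open>k\<close> need not be monotone; k (r n) \<ge> r n is enough for it to
    tend to infinity.\<close>
  have kt: "filterlim (\<lambda>n. k (r n)) sequentially sequentially"
  proof (rule filterlim_at_top_mono[OF filterlim_subseq[OF r(2)]])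
    show "\<forall>\<^sub>F n in sequentially. r n \<le> k (r n)" using ks(1) by simp
  qed
  have ul: "uniform_limit {0..T} (\<lambda>n. xn (k (r n))) x sequentially"
    by (rule filterlim_compose[OF lim kt])
  have 1: "(\<lambda>n. F (s (r n)) (xn (k (r n))) z) \<longlonglongrightarrow> F t x z"
    by (rule F_tendsto[OF r(1) ks(2) x _ ul]) (use r(3) in \<open>simp add: o_def\<close>)
  have 2: "(\<lambda>n. F (s (r n)) x z) \<longlonglongrightarrow> F t x z"
    by (rule F_tendsto[OF r(1) ks(2) x(1) x(1) _ uniform_limit_const]) (use r(3) in \<open>simp add: o_def\<close>)
  have "(\<lambda>n. \<bar>F (s (r n)) (xn (k (r n))) z - F (s (r n)) x z\<bar>) \<longlonglongrightarrow> \<bar>F t x z - F t x z\<bar>"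
    by (intro tendsto_intros 1 2)
  then have "e \<le> \<bar>F t x z - F t x z\<bar>" by (rule LIMSEQ_le_const) (use ks(3) in blast)
  then show False using e by simp
qed

abbreviation "RI t0 x z t \<equiv> running_integral T p q emb A F t0 x z t"

lemma F_integrable:
  assumes "x \<in> paths T" "0 \<le> s" "t \<le> T"
  shows "integrable (ivl s t) (\<lambda>s. F s x z)"
  by (rule continuous_integrable_ivl[OF continuous_on_subset[OF F_path_continuous[OF assms(1)]]]) (use assms in auto)

lemma forcing_integrable:
  assumes t0: "0 \<le> t0" "t0 < T" and L: "L \<ge> 0" and x: "x \<in> X L t0 x0" and st: "t0 \<le> s" "t \<le> T"
  shows "integrable (ivl s t) (\<lambda>s. fr t0 x s \<bullet> z)"
proof -
  obtain R K where fR: "\<And>x. x \<in> X L t0 x0 \<Longrightarrow> AE t in ivl t0 T. norm (fr t0 x t) \<le> R"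
    by (rule trajectory_bounds[OF t0 L, of x0]) (rule that)
  obtain y w where s: "sol t0 x (fr t0 x) y w" using forcing_sol(1)[OF t0 x] by blast
  have "integrable (ivl t0 T) (\<lambda>s. fr t0 x s \<bullet> z)"
    using integrable_ivl_bounded[OF Lp_fun_measurable[OF solD(1)[OF s]] fR[OF x]] by simp
  then show ?thesis by (rule ivl_mono_integrable[OF _ st])
qed

lemma running_integral_eq:
  assumes t0: "0 \<le> t0" "t0 < T" and L: "L \<ge> 0" and x: "x \<in> X L t0 x0" and t: "t \<le> T"
  shows "RI t0 x z t = (\<integral>s. F s x z \<partial>ivl t0 t) - (\<integral>s. fr t0 x s \<bullet> z \<partial>ivl t0 t)"
proof -
  note i1 = forcing_integrable[OF t0 L x order_refl t, of z]
  note i2 = F_integrable[OF trajectories_subset_paths[OF x] t0(1) t, of z]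
  have i: "integrable (ivl t0 t) (\<lambda>s. (- fr t0 x s) \<bullet> z + F s x z)"
    using i1 i2 by simp
  have "RI t0 x z t = (\<integral>s. (- fr t0 x s) \<bullet> z + F s x z \<partial>ivl t0 t)"
    unfolding running_integral_def by (rule integral_closed_ivl[OF borel_measurable_integrable[OF i]])
  also have "\<dots> = (\<integral>s. F s x z \<partial>ivl t0 t) - (\<integral>s. fr t0 x s \<bullet> z \<partial>ivl t0 t)"
    using i1 i2 by simp
  finally show ?thesis .
qed

lemma running_integral_start: "0 \<le> t0 \<Longrightarrow> t0 < T \<Longrightarrow> L \<ge> 0 \<Longrightarrow> x \<in> X L t0 x0 \<Longrightarrow> RI t0 x z t0 = 0"
  by (subst running_integral_eq) (auto simp: integral_restrict_space)

text \<open>Before \<open>t1\<close> neither F nor the forcing sees the new piece, and after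
  \<open>t1\<close> the forcing with respect to t0 is that with respect to t1; hence the cost of the
  second piece is simply added.\<close>

lemma running_integral_concat:
  assumes t0: "0 \<le> t0" "t0 \<le> t1" "t1 < T" and L: "L \<ge> 0" and x: "x \<in> X L t0 x0" and x': "x' \<in> X L t1 x"
  shows "t \<in> {t0..t1} \<Longrightarrow> RI t0 x' z t = RI t0 x z t"
    and "t \<in> {t1..T} \<Longrightarrow> RI t0 x' z t = RI t0 x z t1 + RI t1 x' z t"
proof -
  have t0T: "t0 < T" and t1: "0 \<le> t1" using t0 by auto
  note c = trajectories_concat[OF t0 x x']
  note xp = trajectories_subset_paths[OF x] and xp' = trajectories_subset_paths[OF x']
  have ag: "x' t = x t" if "t \<in> {0..t1}" for t by (rule trajectories_initial[OF x' that])
  have eq: "RI t0 x' z t = RI t0 x z t" if t: "t \<in> {t0..t1}" for t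
  proof -
    have tT: "t \<le> T" using t t0 by auto
    have "(\<integral>s. F s x' z \<partial>ivl t0 t) = (\<integral>s. F s x z \<partial>ivl t0 t)"
      by (rule ivl_integral_cong) (use t t0 ag in \<open>auto intro!: F_agree xp xp'\<close>)
    moreover have "(\<integral>s. fr t0 x' s \<bullet> z \<partial>ivl t0 t) = (\<integral>s. fr t0 x s \<bullet> z \<partial>ivl t0 t)"
    proof (rule integral_cong_AE)
      show "AE s in ivl t0 t. fr t0 x' s \<bullet> z = fr t0 x s \<bullet> z"
        using ivl_mono_AE[OF c(2) order_refl, of t] t by (auto elim!: eventually_mono)
    qed (use forcing_integrable[OF t0(1) t0T L c(1) order_refl tT] forcing_integrable[OF t0(1) t0T L x order_refl tT] in \<open>auto intro: borel_measurable_integrable\<close>)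
    ultimately show ?thesis
      by (simp add: running_integral_eq[OF t0(1) t0T L c(1) tT] running_integral_eq[OF t0(1) t0T L x tT])
  qed
  show "t \<in> {t0..t1} \<Longrightarrow> RI t0 x' z t = RI t0 x z t" by (rule eq)
  show "RI t0 x' z t = RI t0 x z t1 + RI t1 x' z t" if t: "t \<in> {t1..T}"
  proof -
    have tT: "t \<le> T" and tt: "t1 \<le> t" and t1T: "t1 \<le> T" using t t0 by auto
    note i1 = forcing_integrable[OF t0(1) t0T L c(1) order_refl tT, of z]
    note i2 = F_integrable[OF xp' t0(1) tT, of z]
    have "(\<integral>s. fr t0 x' s \<bullet> z \<partial>ivl t1 t) = (\<integral>s. fr t1 x' s \<bullet> z \<partial>ivl t1 t)"
    proof (rule integral_cong_AE)
      show "AE s in ivl t1 t. fr t0 x' s \<bullet> z = fr t1 x' s \<bullet> z"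
        using ivl_mono_AE[OF c(3) order_refl tT] by (auto elim!: eventually_mono)
    qed (use forcing_integrable[OF t0(1) t0T L c(1) t0(2) tT] forcing_integrable[OF t1 t0(3) L x' order_refl tT] in \<open>auto intro: borel_measurable_integrable\<close>)
    then have "RI t0 x' z t = RI t0 x' z t1 + RI t1 x' z t"
      using ivl_integral_add[OF i1 t0(2) tt] ivl_integral_add[OF i2 t0(2) tt]
      by (simp add: running_integral_eq[OF t0(1) t0T L c(1) tT] running_integral_eq[OF t0(1) t0T L c(1) t1T]
          running_integral_eq[OF t1 t0(3) L x' tT])
    then show ?thesis using eq[of t1] t0 by simp
  qed
qed

text \<open>The end time may move as well. Its effect on the forcing term is controlled by the
  uniform bound R, weak convergence is needed only at the limiting time, and F converges uniformly
  in time.\<close>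

lemma running_integral_tendsto:
  assumes t0: "0 \<le> t0" "t0 < T" and L: "L \<ge> 0" and xn: "\<And>n. xn n \<in> X L t0 x0" and x: "x \<in> X L t0 x0"
    and lim: "uniform_limit {0..T} xn x sequentially"
    and fl: "\<And>t z. t \<in> {t0..T} \<Longrightarrow> (\<lambda>n. \<integral>s. fr t0 (xn n) s \<bullet> z \<partial>ivl t0 t) \<longlonglongrightarrow> (\<integral>s. fr t0 x s \<bullet> z \<partial>ivl t0 t)"
    and t: "t \<in> {t0..T}" "\<And>n. tn n \<in> {t0..T}" "tn \<longlonglongrightarrow> t"
  shows "(\<lambda>n. RI t0 (xn n) z (tn n)) \<longlonglongrightarrow> RI t0 x z t"
proof -
  obtain R K where R: "R \<ge> 0" and fR: "\<And>x. x \<in> X L t0 x0 \<Longrightarrow> AE t in ivl t0 T. norm (fr t0 x t) \<le> R"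
    by (rule trajectory_bounds[OF t0 L, of x0]) (rule that)
  note xp = trajectories_subset_paths[OF x] and xnp = trajectories_subset_paths[OF xn]
  have tT: "t \<le> T" "t0 \<le> t" and tnT: "tn n \<le> T" "t0 \<le> tn n" for n using t(1) t(2)[of n] by auto
  note ifx = forcing_integrable[OF t0 L xn order_refl, where z = z]
  have fb: "\<bar>\<integral>s. fr t0 (xn n) s \<bullet> z \<partial>ivl a b\<bar> \<le> (b - a) * (R * norm z)" if ab: "t0 \<le> a" "a \<le> b" "b \<le> T" for a b n
  proof -
    have "norm (\<integral>s. fr t0 (xn n) s \<bullet> z \<partial>ivl a b) \<le> (\<integral>s. R * norm z \<partial>ivl a b)"
    proof (rule norm_integral_le[OF forcing_integrable[OF t0 L xn ab(1,3)]])
      show "AE s in ivl a b. norm (fr t0 (xn n) s \<bullet> z) \<le> R * norm z"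
        using ivl_mono_AE[OF fR[OF xn] ab(1,3), of n]
      proof eventually_elim
        case (elim s)
        have "\<bar>fr t0 (xn n) s \<bullet> z\<bar> \<le> norm (fr t0 (xn n) s) * norm z" by (rule Cauchy_Schwarz_ineq2)
        also have "\<dots> \<le> R * norm z" using elim by (intro mult_right_mono) auto
        finally show ?case by simp
      qed
    qed simp
    also have "\<dots> = (b - a) * (R * norm z)" by (rule ivl_integral_const[OF ab(2)])
    finally show ?thesis by simp
  qed
  have diff: "\<bar>(\<integral>s. fr t0 (xn n) s \<bullet> z \<partial>ivl t0 (tn n)) - (\<integral>s. fr t0 (xn n) s \<bullet> z \<partial>ivl t0 t)\<bar> \<le> \<bar>tn n - t\<bar> * (R * norm z)" for n
  proof (cases "t \<le> tn n")
    case True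
    then show ?thesis using ivl_integral_add[OF ifx[OF tnT(1)[of n], of n] tT(2) True] fb[OF tT(2) True tnT(1), of n] by simp
  next
    case False
    then have "tn n \<le> t" by simp
    then show ?thesis using ivl_integral_add[OF ifx[OF tT(1), of n] tnT(2)[of n]] fb[OF tnT(2)[of n] _ tT(1), of n] by simp
  qed
  have "(\<lambda>n. \<bar>tn n - t\<bar> * (R * norm z)) \<longlonglongrightarrow> \<bar>t - t\<bar> * (R * norm z)" by (intro tendsto_intros t)
  then have "(\<lambda>n. \<bar>tn n - t\<bar> * (R * norm z)) \<longlonglongrightarrow> 0" by simp
  then have "(\<lambda>n. (\<integral>s. fr t0 (xn n) s \<bullet> z \<partial>ivl t0 (tn n)) - (\<integral>s. fr t0 (xn n) s \<bullet> z \<partial>ivl t0 t)) \<longlonglongrightarrow> 0"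
    by (rule Lim_null_comparison[rotated]) (use diff in simp)
  from tendsto_add[OF this fl[OF t(1), of z]]
  have 1: "(\<lambda>n. \<integral>s. fr t0 (xn n) s \<bullet> z \<partial>ivl t0 (tn n)) \<longlonglongrightarrow> (\<integral>s. fr t0 x s \<bullet> z \<partial>ivl t0 t)" by simp
  have d0: "(\<lambda>n. (\<integral>s. F s (xn n) z \<partial>ivl t0 (tn n)) - (\<integral>s. F s x z \<partial>ivl t0 (tn n))) \<longlonglongrightarrow> 0"
  proof (rule LIMSEQ_I)
    fix e :: real assume e: "e > 0"
    define \<eta> where "\<eta> = e / (2 * (T - t0))"
    have \<eta>: "\<eta> > 0" using e t0 by (simp add: \<eta>_def)
    obtain N where N: "\<And>n s. n \<ge> N \<Longrightarrow> s \<in> {0..T} \<Longrightarrow> \<bar>F s (xn n) z - F s x z\<bar> < \<eta>"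
      using F_uniform[OF xp xnp lim \<eta>, of z] by blast
    show "\<exists>N. \<forall>n\<ge>N. norm ((\<integral>s. F s (xn n) z \<partial>ivl t0 (tn n)) - (\<integral>s. F s x z \<partial>ivl t0 (tn n)) - 0) < e"
    proof (intro exI[of _ N] allI impI)
      fix n assume n: "n \<ge> N"
      note i = F_integrable[OF trajectories_subset_paths[OF xn] t0(1) tnT(1)[of n], where z = z] F_integrable[OF xp t0(1) tnT(1)[of n], where z = z]
      have "(\<integral>s. F s (xn n) z \<partial>ivl t0 (tn n)) - (\<integral>s. F s x z \<partial>ivl t0 (tn n)) = (\<integral>s. F s (xn n) z - F s x z \<partial>ivl t0 (tn n))"
        using i by simp
      also have "norm \<dots> \<le> (\<integral>s. \<eta> \<partial>ivl t0 (tn n))"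
      proof (rule norm_integral_le)
        show "AE s in ivl t0 (tn n). norm (F s (xn n) z - F s x z) \<le> \<eta>"
          by (rule AE_ivlI) (use N[OF n] t0 tnT[of n] in \<open>auto intro!: less_imp_le\<close>)
      qed (use i in auto)
      also have "\<dots> = (tn n - t0) * \<eta>" by (rule ivl_integral_const[OF tnT(2)])
      also have "\<dots> \<le> (T - t0) * \<eta>" using tnT[of n] \<eta> by (intro mult_right_mono) auto
      also have "\<dots> = e / 2"
      proof -
        have "T - t0 \<noteq> 0" using t0 by simp
        then show ?thesis by (simp add: \<eta>_def divide_simps)
      qed
      finally show "norm ((\<integral>s. F s (xn n) z \<partial>ivl t0 (tn n)) - (\<integral>s. F s x z \<partial>ivl t0 (tn n)) - 0) < e" using e by simp
    qed
  qed
  have "(\<lambda>n. \<integral>s. F s x z \<partial>ivl t0 (tn n)) \<longlonglongrightarrow> (\<integral>s. F s x z \<partial>ivl t0 t)"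
    by (rule ivl_integral_shrink[OF F_integrable[OF xp t0(1) order_refl] order_refl tT(1) tendsto_const t(3) order_refl tnT(1)])
  from tendsto_add[OF d0 this] have 2: "(\<lambda>n. \<integral>s. F s (xn n) z \<partial>ivl t0 (tn n)) \<longlonglongrightarrow> (\<integral>s. F s x z \<partial>ivl t0 t)" by simp
  show ?thesis
    unfolding running_integral_eq[OF t0 L xn tnT(1)] running_integral_eq[OF t0 L x tT(1)]
    by (rule tendsto_diff[OF 2 1])
qed

end

section \<open>Decay along trajectories\<close>

text \<open>The sign \<sigma> is 1 for supersolutions and -1, together with the function -u, for
  subsolutions; the integral itself keeps its definition. \<open>dini\<close> unfolds the infimum of
  lower limits: as neither need be attained, it offers arbitrarily short steps with a slack rate e,
  for each e > 0. \<open>z\<close> is fixed, since the trajectory sought may depend on it.\<close>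

locale dini_condition = evolution_hamiltonian T p q emb A F
  for T p q :: real
    and emb :: "'v::{banach, second_countable_topology} \<Rightarrow>\<^sub>L 'h::{real_inner, banach, second_countable_topology}"
    and A :: "real \<Rightarrow> 'v \<Rightarrow> ('v \<Rightarrow>\<^sub>L real)"
    and F :: "real \<Rightarrow> (real \<Rightarrow> 'h) \<Rightarrow> 'h \<Rightarrow> real" +
  fixes L \<sigma> :: real and \<Omega> :: "(real \<Rightarrow> 'h) set" and u :: "real \<Rightarrow> (real \<Rightarrow> 'h) \<Rightarrow> real" and z :: 'h
  assumes L: "L \<ge> 0" and lsc: "LSC_on T \<Omega> u" and \<Omega>: "\<Omega> \<subseteq> paths T"
    and closed: "\<And>t0 x0. t0 \<in> {0..<T} \<Longrightarrow> x0 \<in> \<Omega> \<Longrightarrow> X L t0 x0 \<subseteq> \<Omega>"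
    and dini: "\<And>t0 x0 e d. t0 \<in> {0..<T} \<Longrightarrow> x0 \<in> \<Omega> \<Longrightarrow> e > 0 \<Longrightarrow> d > 0 \<Longrightarrow>
      \<exists>x\<in>X L t0 x0. \<exists>\<delta>. 0 < \<delta> \<and> \<delta> < d \<and> u (t0 + \<delta>) x - u t0 x0 + \<sigma> * RI t0 x z (t0 + \<delta>) \<le> e * \<delta>"
begin

definition decay :: "real \<Rightarrow> (real \<Rightarrow> 'h) \<Rightarrow> real \<Rightarrow> real \<Rightarrow> (real \<Rightarrow> 'h) \<Rightarrow> bool" where
  "decay t0 x0 e t x \<longleftrightarrow> u t x + \<sigma> * RI t0 x z t \<le> u t0 x0 + e * (t - t0)"

text \<open>Decay at all times of \<open>[t0,\<tau>]\<close> would not survive the extension step, since the infinitesimal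
  condition only controls the end point of a short interval; decay on an \<open>e\<close>-net does, and for \<open>e = 0\<close>
  the two notions agree.\<close>

definition decay_upto :: "real \<Rightarrow> (real \<Rightarrow> 'h) \<Rightarrow> real \<Rightarrow> real \<Rightarrow> (real \<Rightarrow> 'h) \<Rightarrow> bool" where
  "decay_upto t0 x0 e \<tau> x \<longleftrightarrow> x \<in> X L t0 x0 \<and> decay t0 x0 e \<tau> x \<and>
     (\<forall>t\<in>{t0..\<tau>}. \<exists>t'\<in>{t0..\<tau>}. \<bar>t - t'\<bar> \<le> e \<and> decay t0 x0 e t' x)"

text \<open>Lower semicontinuity of \<open>u\<close> and continuity of the running integral close
  the inequality under simultaneous limits of slack, time and trajectory.\<close>

lemma decay_limit:
  assumes t0: "t0 \<in> {0..<T}" and x0: "x0 \<in> \<Omega>" and xn: "\<And>n. xn n \<in> X L t0 x0" and x: "x \<in> X L t0 x0"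
    and lim: "uniform_limit {0..T} xn x sequentially"
    and fl: "\<And>t z. t \<in> {t0..T} \<Longrightarrow> (\<lambda>n. \<integral>s. fr t0 (xn n) s \<bullet> z \<partial>ivl t0 t) \<longlonglongrightarrow> (\<integral>s. fr t0 x s \<bullet> z \<partial>ivl t0 t)"
    and t: "t \<in> {t0..T}" "\<And>n. tn n \<in> {t0..T}" "tn \<longlonglongrightarrow> t"
    and en: "en \<longlonglongrightarrow> e" and d: "\<And>n. decay t0 x0 (en n) (tn n) (xn n)"
  shows "decay t0 x0 e t x"
  unfolding decay_def
proof (rule LSC_on_limit[OF T0 lsc \<Omega>, where tn = tn and xn = xn and
      cn = "\<lambda>n. u t0 x0 + en n * (tn n - t0)" and \<rho>n = "\<lambda>n. \<sigma> * RI t0 (xn n) z (tn n)"])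
  have t0': "0 \<le> t0" "t0 < T" using t0 by auto
  show "t \<in> {0..T}" "tn n \<in> {0..T}" for n using t(1) t(2)[of n] t0' by auto
  show "x \<in> \<Omega>" "xn n \<in> \<Omega>" for n using closed[OF t0 x0] x xn by auto
  show "u (tn n) (xn n) + \<sigma> * RI t0 (xn n) z (tn n) \<le> u t0 x0 + en n * (tn n - t0)" for n
    using d[of n] unfolding decay_def .
  show "(\<lambda>n. \<sigma> * RI t0 (xn n) z (tn n)) \<longlonglongrightarrow> \<sigma> * RI t0 x z t"
    by (intro tendsto_mult_left running_integral_tendsto[OF t0' L xn x lim fl t])
  show "(\<lambda>n. u t0 x0 + en n * (tn n - t0)) \<longlonglongrightarrow> u t0 x0 + e * (t - t0)"
    by (intro tendsto_intros en t)
qed (fact t lim)+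

text \<open>Used twice: with constant slack to show that the supremum of reachable times is reached,
  and with slack tending to 0 at the terminal time.\<close>

lemma decay_upto_limit:
  assumes t0: "t0 \<in> {0..<T}" and x0: "x0 \<in> \<Omega>" and \<tau>: "\<And>n. \<tau>n n \<in> {t0..T}" "\<tau>n \<longlonglongrightarrow> \<tau>" and en: "en \<longlonglongrightarrow> e"
    and d: "\<And>n. decay_upto t0 x0 (en n) (\<tau>n n) (xn n)"
  obtains x where "decay_upto t0 x0 e \<tau> x"
proof -
  have t0': "0 \<le> t0" "t0 < T" using t0 by auto
  have xn: "xn n \<in> X L t0 x0" for n using d unfolding decay_upto_def by blast
  obtain r x where r: "strict_mono r" and x: "x \<in> X L t0 x0" and ul: "uniform_limit {0..T} (\<lambda>n. xn (r n)) x sequentially"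
    and fl: "\<And>t z. t \<in> {t0..T} \<Longrightarrow> (\<lambda>n. \<integral>s. fr t0 (xn (r n)) s \<bullet> z \<partial>ivl t0 t) \<longlonglongrightarrow> (\<integral>s. fr t0 x s \<bullet> z \<partial>ivl t0 t)"
    by (rule trajectories_compact[OF t0' L, of xn x0, OF xn]) (rule that)
  have \<tau>T: "\<tau> \<in> {t0..T}" using closed_sequentially[OF closed_atLeastAtMost \<tau>(1) \<tau>(2)] by simp
  have tr: "(\<lambda>n. \<tau>n (r n)) \<longlonglongrightarrow> \<tau>" and er: "(\<lambda>n. en (r n)) \<longlonglongrightarrow> e"
    using LIMSEQ_subseq_LIMSEQ[OF \<tau>(2) r] LIMSEQ_subseq_LIMSEQ[OF en r] by (auto simp: o_def)
  have dr: "decay t0 x0 (en (r n)) (\<tau>n (r n)) (xn (r n))" for n using d unfolding decay_upto_def by blast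
  have "decay t0 x0 e \<tau> x"
    by (rule decay_limit[OF t0 x0 xn x ul fl \<tau>T \<tau>(1) tr er dr])
  moreover have "\<exists>t'\<in>{t0..\<tau>}. \<bar>t - t'\<bar> \<le> e \<and> decay t0 x0 e t' x" if t: "t \<in> {t0..\<tau>}" for t
  proof -
    \<comment> \<open>The horizons \<tau>n may lie below t, so the net condition is applied at the
      minimum of t and \<tau>n, which tends to t.\<close>
    have "\<exists>t'\<in>{t0..\<tau>n (r n)}. \<bar>min t (\<tau>n (r n)) - t'\<bar> \<le> en (r n) \<and> decay t0 x0 (en (r n)) t' (xn (r n))" for n
    proof -
      have "min t (\<tau>n (r n)) \<in> {t0..\<tau>n (r n)}" using t \<tau>(1)[of "r n"] by auto
      then show ?thesis using d[of "r n"] unfolding decay_upto_def by blast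
    qed
    then obtain tn where tn: "\<And>n. tn n \<in> {t0..\<tau>n (r n)}" "\<And>n. \<bar>min t (\<tau>n (r n)) - tn n\<bar> \<le> en (r n)"
      "\<And>n. decay t0 x0 (en (r n)) (tn n) (xn (r n))" by metis
    have tnT: "tn n \<in> {t0..T}" for n using tn(1)[of n] \<tau>(1)[of "r n"] by auto
    obtain t' s where t': "t' \<in> {t0..T}" and s: "strict_mono s" and ts: "(tn \<circ> s) \<longlonglongrightarrow> t'"
      using compact_imp_seq_compact[OF compact_Icc, unfolded seq_compact_def, rule_format, of tn t0 T] tnT by blast
    have ts: "(\<lambda>n. tn (s n)) \<longlonglongrightarrow> t'" using ts by (simp add: o_def)
    have trs: "(\<lambda>n. \<tau>n (r (s n))) \<longlonglongrightarrow> \<tau>" and ers: "(\<lambda>n. en (r (s n))) \<longlonglongrightarrow> e"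
      using LIMSEQ_subseq_LIMSEQ[OF tr s] LIMSEQ_subseq_LIMSEQ[OF er s] by (auto simp: o_def)
    have "t' \<le> \<tau>" by (rule LIMSEQ_le[OF ts trs]) (use tn(1) in auto)
    moreover have "\<bar>min t \<tau> - t'\<bar> \<le> e"
      by (rule LIMSEQ_le[OF tendsto_rabs[OF tendsto_diff[OF tendsto_min[OF tendsto_const trs] ts]] ers]) (use tn(2) in auto)
    moreover have "decay t0 x0 e t' x"
    proof (rule decay_limit[OF t0 x0 xn x _ _ t' tnT ts ers tn(3)])
      show "uniform_limit {0..T} (\<lambda>n. xn (r (s n))) x sequentially"
        by (rule filterlim_compose[OF ul filterlim_subseq[OF s]])
      show "(\<lambda>n. \<integral>v. fr t0 (xn (r (s n))) v \<bullet> z \<partial>ivl t0 t) \<longlonglongrightarrow> (\<integral>v. fr t0 x v \<bullet> z \<partial>ivl t0 t)" if "t \<in> {t0..T}" for t z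
        using LIMSEQ_subseq_LIMSEQ[OF fl[OF that] s] by (simp add: o_def)
    qed
    ultimately show ?thesis using t t' by (intro bexI[of _ t']) (auto simp: min_def)
  qed
  ultimately show thesis using x by (intro that) (auto simp: decay_upto_def)
qed

lemma decay_upto_extend:
  assumes t0: "t0 \<in> {0..<T}" and x0: "x0 \<in> \<Omega>" and e: "e > 0" and \<tau>: "t0 \<le> \<tau>" "\<tau> < T" and x: "decay_upto t0 x0 e \<tau> x"
  obtains \<tau>' x' where "\<tau> < \<tau>'" "\<tau>' \<le> T" "decay_upto t0 x0 e \<tau>' x'"
proof -
  have t0': "0 \<le> t0" "t0 < T" "0 \<le> \<tau>" and \<tau>': "\<tau> \<in> {0..<T}" using t0 \<tau> by auto
  have xX: "x \<in> X L t0 x0" using x by (simp add: decay_upto_def)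
  then have xO: "x \<in> \<Omega>" using closed[OF t0 x0] by auto
  \<comment> \<open>A step shorter than e lets \<tau> itself be the net point for all new times; a
    step shorter than T - \<tau> stays within the horizon.\<close>
  have "min e (T - \<tau>) > 0" using e \<tau> by simp
  from dini[OF \<tau>' xO e this] obtain x' \<delta> where x': "x' \<in> X L \<tau> x" and \<delta>: "0 < \<delta>" "\<delta> < e" "\<delta> < T - \<tau>"
    and le: "u (\<tau> + \<delta>) x' - u \<tau> x + \<sigma> * RI \<tau> x' z (\<tau> + \<delta>) \<le> e * \<delta>" by auto
  have x'O: "x' \<in> \<Omega>" using closed[OF \<tau>' xO] x' by auto
  have x'X: "x' \<in> X L t0 x0" by (rule trajectories_concat(1)[OF t0'(1) \<tau> xX x'])
  have old: "decay t0 x0 e t x'" if t: "t \<in> {t0..\<tau>}" and dt: "decay t0 x0 e t x" for t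
  proof -
    have "u t x' = u t x"
      by (rule LSC_on_agree[OF T0 lsc _ x'O xO]) (use t t0' \<tau> trajectories_initial[OF x'] in auto)
    then show ?thesis using dt running_integral_concat(1)[OF t0'(1) \<tau> L xX x' t] by (simp add: decay_def)
  qed
  have d\<tau>: "decay t0 x0 e \<tau> x" using x by (simp add: decay_upto_def)
  have new: "decay t0 x0 e (\<tau> + \<delta>) x'"
  proof -
    have "RI t0 x' z (\<tau> + \<delta>) = RI t0 x z \<tau> + RI \<tau> x' z (\<tau> + \<delta>)"
      by (rule running_integral_concat(2)[OF t0'(1) \<tau> L xX x']) (use \<delta> in auto)
    then show ?thesis using le d\<tau> by (simp add: decay_def algebra_simps)
  qed
  have "\<exists>t'\<in>{t0..\<tau> + \<delta>}. \<bar>t - t'\<bar> \<le> e \<and> decay t0 x0 e t' x'" if t: "t \<in> {t0..\<tau> + \<delta>}" for t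
  proof (cases "t \<le> \<tau>")
    case True
    then obtain t' where t': "t' \<in> {t0..\<tau>}" "\<bar>t - t'\<bar> \<le> e" "decay t0 x0 e t' x"
      using t x unfolding decay_upto_def by (meson atLeastAtMost_iff)
    then show ?thesis using old[OF t'(1,3)] \<delta> by (intro bexI[of _ t']) auto
  next
    case False
    then show ?thesis using old[OF _ d\<tau>] t \<delta> \<tau> by (intro bexI[of _ \<tau>]) auto
  qed
  then show thesis using new x'X \<delta> by (intro that[of "\<tau> + \<delta>" x']) (auto simp: decay_upto_def)
qed

text \<open>The set of reachable times contains t0 and, by compactness, its supremum; a supremum
  below T could be extended.\<close>

lemma decay_upto_terminal:
  assumes t0: "t0 \<in> {0..<T}" and x0: "x0 \<in> \<Omega>" and e: "e > 0"
  obtains x where "decay_upto t0 x0 e T x"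
proof -
  define S where "S = {\<tau>\<in>{t0..T}. \<exists>x. decay_upto t0 x0 e \<tau> x}"
  have t0': "0 \<le> t0" "t0 < T" using t0 by auto
  \<comment> \<open>Here \<open>dini\<close> serves only to show that the trajectory set is
    nonempty; any trajectory has decay at t0, where the integral vanishes and non-anticipation gives
    equality.\<close>
  obtain x where x: "x \<in> X L t0 x0" using dini[OF t0 x0 e, of 1] by auto
  then have xO: "x \<in> \<Omega>" using closed[OF t0 x0] by auto
  have "u t0 x = u t0 x0"
    by (rule LSC_on_agree[OF T0 lsc _ xO x0]) (use t0' trajectories_initial[OF x] in auto)
  then have "decay t0 x0 e t0 x" using running_integral_start[OF t0' L x] by (simp add: decay_def)
  then have "decay_upto t0 x0 e t0 x" using x e by (auto simp: decay_upto_def)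
  then have ne: "S \<noteq> {}" using t0' unfolding S_def by force
  have bdd: "bdd_above S" unfolding S_def by (rule bdd_aboveI[of _ T]) auto
  have "Sup S \<in> closure S" by (rule closure_contains_Sup[OF ne(1) bdd])
  then obtain \<tau>n where \<tau>n: "\<And>n. \<tau>n n \<in> S" "\<tau>n \<longlonglongrightarrow> Sup S" by (auto simp: closure_sequential)
  have \<tau>nT: "\<tau>n n \<in> {t0..T}" for n using \<tau>n(1)[of n] unfolding S_def by auto
  have "\<exists>x. decay_upto t0 x0 e (\<tau>n n) x" for n using \<tau>n(1)[of n] unfolding S_def by auto
  then obtain xn where xn: "\<And>n. decay_upto t0 x0 e (\<tau>n n) (xn n)" by metis
  obtain x' where x': "decay_upto t0 x0 e (Sup S) x'"
    by (rule decay_upto_limit[OF t0 x0 \<tau>nT \<tau>n(2) tendsto_const xn]) (rule that)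
  have ST: "Sup S \<in> {t0..T}" using closed_sequentially[OF closed_atLeastAtMost \<tau>nT \<tau>n(2)] by simp
  have "Sup S = T"
  proof (rule ccontr)
    assume "Sup S \<noteq> T"
    then have lt: "t0 \<le> Sup S" "Sup S < T" using ST by auto
    obtain \<tau>' x'' where "Sup S < \<tau>'" "\<tau>' \<le> T" "decay_upto t0 x0 e \<tau>' x''"
      by (rule decay_upto_extend[OF t0 x0 e lt x']) (rule that)
    then have "\<tau>' \<in> S" "Sup S < \<tau>'" using lt unfolding S_def by auto
    then show False using cSup_upper[OF _ bdd] by force
  qed
  then show thesis using x' that by simp
qed

text \<open>With slack 1/(n + 1) the net becomes finer together with the rate; in the limit of slack
  0 it consists of all times.\<close>

lemma decay_trajectory:
  assumes t0: "t0 \<in> {0..<T}" and x0: "x0 \<in> \<Omega>"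
  shows "\<exists>x\<in>X L t0 x0. \<forall>t\<in>{t0..T}. u t x + \<sigma> * RI t0 x z t \<le> u t0 x0"
proof -
  have pos: "0 < inverse (real (Suc n))" for n by simp
  have "\<exists>x. decay_upto t0 x0 (inverse (real (Suc n))) T x" for n
    by (rule decay_upto_terminal[OF t0 x0 pos[of n]]) blast
  then obtain xn where xn: "\<And>n. decay_upto t0 x0 (inverse (real (Suc n))) T (xn n)" by metis
  have TT: "T \<in> {t0..T}" using t0 by simp
  obtain x where x: "decay_upto t0 x0 0 T x"
    by (rule decay_upto_limit[OF t0 x0 TT tendsto_const LIMSEQ_inverse_real_of_nat xn]) (rule that)
  have "decay t0 x0 0 t x" if t: "t \<in> {t0..T}" for t
  proof -
    obtain t' where "\<bar>t - t'\<bar> \<le> 0" "decay t0 x0 0 t' x" using x t unfolding decay_upto_def by blast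
    then show ?thesis by simp
  qed
  then show ?thesis using x by (intro bexI[of _ x]) (auto simp: decay_upto_def decay_def)
qed

end

section \<open>The infinitesimal condition in the extended reals\<close>

lemma Liminf_at_right_quotient_le_0:
  fixes g :: "real \<Rightarrow> real"
  assumes "d > 0" "\<And>\<delta>. 0 < \<delta> \<Longrightarrow> \<delta> < d \<Longrightarrow> g \<delta> \<le> 0"
  shows "Liminf (at_right 0) (\<lambda>\<delta>. ereal (1 / \<delta> * g \<delta>)) \<le> 0"
proof -
  have "\<forall>\<^sub>F \<delta> in at_right 0. ereal (1 / \<delta> * g \<delta>) \<le> 0"
    using eventually_at_right_real[OF assms(1)]
    by eventually_elim (use assms(2) in \<open>auto simp: divide_nonpos_pos\<close>)
  then have "Limsup (at_right 0) (\<lambda>\<delta>. ereal (1 / \<delta> * g \<delta>)) \<le> 0" by (rule Limsup_bounded)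
  then show ?thesis
    by (rule order_trans[OF Liminf_le_Limsup[OF trivial_limit_at_right_real]])
qed

lemma Liminf_at_right_quotient_less:
  fixes g :: "real \<Rightarrow> real"
  assumes "Liminf (at_right 0) (\<lambda>\<delta>. ereal (1 / \<delta> * g \<delta>)) < ereal e" "d > 0"
  obtains \<delta> where "0 < \<delta>" "\<delta> < d" "g \<delta> \<le> e * \<delta>"
proof (rule ccontr)
  assume no: "\<not> thesis"
  have "\<forall>\<^sub>F \<delta> in at_right 0. ereal e \<le> ereal (1 / \<delta> * g \<delta>)"
    using eventually_at_right_real[OF assms(2)]
  proof eventually_elim
    case (elim \<delta>)
    then have "\<delta> > 0" "e * \<delta> < g \<delta>" using no that by force+
    then show ?case by (simp add: field_simps)
  qed
  then have "ereal e \<le> Liminf (at_right 0) (\<lambda>\<delta>. ereal (1 / \<delta> * g \<delta>))" by (rule Liminf_bounded)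
  then show False using assms(1) by simp
qed

text \<open>An infimum at most 0 lies strictly below each e > 0, so some member of \<open>S\<close>
  has its lower limit below e, and then arbitrarily small steps realize a quotient of at most
  e.\<close>

lemma INF_Liminf_quotient_less:
  fixes g :: "'a \<Rightarrow> real \<Rightarrow> real"
  assumes "(INF x\<in>S. Liminf (at_right 0) (\<lambda>\<delta>. ereal (1 / \<delta> * g x \<delta>))) \<le> 0" "e > 0" "d > 0"
  shows "\<exists>x\<in>S. \<exists>\<delta>. 0 < \<delta> \<and> \<delta> < d \<and> g x \<delta> \<le> e * \<delta>"
proof -
  have "(INF x\<in>S. Liminf (at_right 0) (\<lambda>\<delta>. ereal (1 / \<delta> * g x \<delta>))) < ereal e"
    using assms(1,2) by (simp add: le_less_trans zero_ereal_def)
  then obtain x where x: "x \<in> S" and l: "Liminf (at_right 0) (\<lambda>\<delta>. ereal (1 / \<delta> * g x \<delta>)) < ereal e"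
    by (auto simp: INF_less_iff)
  obtain \<delta> where "0 < \<delta>" "\<delta> < d" "g x \<delta> \<le> e * \<delta>"
    by (rule Liminf_at_right_quotient_less[OF l assms(3)]) (rule that)
  then show ?thesis using x by blast
qed

lemma SUP_Limsup_quotient_eq:
  fixes g :: "'a \<Rightarrow> real \<Rightarrow> real"
  shows "(SUP x\<in>S. Limsup (at_right 0) (\<lambda>\<delta>. ereal (1 / \<delta> * g x \<delta>)))
    = - (INF x\<in>S. Liminf (at_right 0) (\<lambda>\<delta>. ereal (1 / \<delta> * - g x \<delta>)))"
proof -
  have "Liminf (at_right 0) (\<lambda>\<delta>. ereal (1 / \<delta> * - g x \<delta>)) = - Limsup (at_right 0) (\<lambda>\<delta>. ereal (1 / \<delta> * g x \<delta>))" for x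
    using ereal_Liminf_uminus[of "at_right 0" "\<lambda>\<delta>. ereal (1 / \<delta> * g x \<delta>)"] by simp
  then show ?thesis by (simp add: ereal_INF_uminus_eq)
qed

lemma LSC_on_uminus: "USC_on T \<Omega> u \<Longrightarrow> LSC_on T \<Omega> (\<lambda>t x. - u t x)"
  unfolding USC_on_def LSC_on_def by (smt (verit, ccfv_SIG))

context evolution_hamiltonian
begin

text \<open>The trajectory form makes every quotient nonpositive for steps below T - t0. In the
  other direction the infinitesimal condition is used at all starting points in \<Omega> at once, as
  the trajectory under construction is restarted at its own later points; this is where invariance
  of \<Omega> enters.\<close>

lemma infinitesimal_iff_trajectory:
  assumes L: "L \<ge> 0" and lsc: "LSC_on T \<Omega> u" and \<Omega>: "\<Omega> \<subseteq> paths T"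
    and cl: "\<And>t0 x0. t0 \<in> {0..<T} \<Longrightarrow> x0 \<in> \<Omega> \<Longrightarrow> X L t0 x0 \<subseteq> \<Omega>"
  shows "(\<forall>t0\<in>{0..<T}. \<forall>x0\<in>\<Omega>. \<forall>z. (INF x\<in>X L t0 x0. Liminf (at_right 0) (\<lambda>\<delta>. ereal (1 / \<delta> *
            (u (t0 + \<delta>) x - u t0 x0 + \<sigma> * RI t0 x z (t0 + \<delta>))))) \<le> 0)
     \<longleftrightarrow> (\<forall>t0\<in>{0..<T}. \<forall>x0\<in>\<Omega>. \<forall>z. \<exists>x\<in>X L t0 x0 \<inter> \<Omega>. \<forall>t\<in>{t0..T}. u t x + \<sigma> * RI t0 x z t \<le> u t0 x0)"
  (is "?inf \<longleftrightarrow> ?traj")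
proof
  assume i: ?inf
  show ?traj
  proof (intro ballI allI)
    fix t0 x0 z assume t0: "t0 \<in> {0..<T}" and x0: "x0 \<in> \<Omega>"
    interpret dini_condition T p q emb A F L \<sigma> \<Omega> u z
    proof unfold_locales
      show "\<exists>x\<in>X L t0 x0. \<exists>\<delta>. 0 < \<delta> \<and> \<delta> < d \<and> u (t0 + \<delta>) x - u t0 x0 + \<sigma> * RI t0 x z (t0 + \<delta>) \<le> e * \<delta>"
        if "t0 \<in> {0..<T}" "x0 \<in> \<Omega>" "e > 0" "d > 0" for t0 x0 e d
        by (rule INF_Liminf_quotient_less[OF _ that(3,4)]) (use i that(1,2) in blast)
    qed (use L lsc \<Omega> cl in auto)
    show "\<exists>x\<in>X L t0 x0 \<inter> \<Omega>. \<forall>t\<in>{t0..T}. u t x + \<sigma> * RI t0 x z t \<le> u t0 x0"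
      using decay_trajectory[OF t0 x0] cl[OF t0 x0] by blast
  qed
next
  assume r: ?traj
  show ?inf
  proof (intro ballI allI)
    fix t0 x0 z assume t0: "t0 \<in> {0..<T}" and x0: "x0 \<in> \<Omega>"
    obtain x where x: "x \<in> X L t0 x0" and le: "\<And>t. t \<in> {t0..T} \<Longrightarrow> u t x + \<sigma> * RI t0 x z t \<le> u t0 x0"
      using r t0 x0 by blast
    show "(INF x\<in>X L t0 x0. Liminf (at_right 0) (\<lambda>\<delta>. ereal (1 / \<delta> *
            (u (t0 + \<delta>) x - u t0 x0 + \<sigma> * RI t0 x z (t0 + \<delta>))))) \<le> 0"
    proof (rule INF_lower2[OF x], rule Liminf_at_right_quotient_le_0)
      show "T - t0 > 0" using t0 by simp
      show "u (t0 + \<delta>) x - u t0 x0 + \<sigma> * RI t0 x z (t0 + \<delta>) \<le> 0" if "0 < \<delta>" "\<delta> < T - t0" for \<delta>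
        using le[of "t0 + \<delta>"] that by simp
    qed
  qed
qed

end

theorem proposition3p8:
  fixes T p q L :: real
    and emb :: "'v::{banach, second_countable_topology} \<Rightarrow>\<^sub>L 'h::{real_inner, banach, second_countable_topology}"
    and A :: "real \<Rightarrow> 'v \<Rightarrow> ('v \<Rightarrow>\<^sub>L real)"
    and F :: "real \<Rightarrow> (real \<Rightarrow> 'h) \<Rightarrow> 'h \<Rightarrow> real"
    and h :: "(real \<Rightarrow> 'h) \<Rightarrow> real"
    and xstar :: 'h
    and \<Omega> :: "(real \<Rightarrow> 'h) set"
    and u :: "real \<Rightarrow> (real \<Rightarrow> 'h) \<Rightarrow> real"
  assumes "T > 0" and "p \<ge> 2" and "q > 1" and "1 / p + 1 / q = 1"
    and "reflexive_space TYPE('v)"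
    and "compact_dense_embedding emb"
    and "admissible_operator T p q A"
    and "admissible_terminal T h"
    and "admissible_hamiltonian T p q emb A F"
    and "L \<ge> 0"
    and "trajectories T p q emb A L 0 (const_path T xstar) \<subseteq> \<Omega>" and "\<Omega> \<subseteq> paths T"
    \<comment> \<open>\<open>u(t0 + \<delta>, x)\<close> below is only defined for paths \<open>x\<close> in \<open>\<Omega>\<close>\<close>
    and "\<forall>t0\<in>{0..<T}. \<forall>x0\<in>\<Omega>. trajectories T p q emb A L t0 x0 \<subseteq> \<Omega>"
  shows
    "(LSC_on T \<Omega> u \<longrightarrow>
       (minimax_supersolution T p q emb A F h L \<Omega> u \<longleftrightarrow>
         (\<forall>x\<in>\<Omega>. u T x \<ge> h x) \<and>
         (\<forall>t0\<in>{0..<T}. \<forall>x0\<in>\<Omega>. \<forall>z.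
            (INF x\<in>trajectories T p q emb A L t0 x0.
               Liminf (at_right 0) (\<lambda>\<delta>. ereal (1 / \<delta> *
                 (u (t0 + \<delta>) x - u t0 x0 + running_integral T p q emb A F t0 x z (t0 + \<delta>))))) \<le> 0))) \<and>
     (USC_on T \<Omega> u \<longrightarrow>
       (minimax_subsolution T p q emb A F h L \<Omega> u \<longleftrightarrow>
         (\<forall>x\<in>\<Omega>. u T x \<le> h x) \<and>
         (\<forall>t0\<in>{0..<T}. \<forall>x0\<in>\<Omega>. \<forall>z.
            (SUP x\<in>trajectories T p q emb A L t0 x0.
               Limsup (at_right 0) (\<lambda>\<delta>. ereal (1 / \<delta> *
                 (u (t0 + \<delta>) x - u t0 x0 + running_integral T p q emb A F t0 x z (t0 + \<delta>))))) \<ge> 0)))"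
proof -
  interpret evolution_hamiltonian T p q emb A F
    by unfold_locales (use assms in auto)
  have cl: "X L t0 x0 \<subseteq> \<Omega>" if "t0 \<in> {0..<T}" "x0 \<in> \<Omega>" for t0 x0 using assms(13) that by blast
  show ?thesis
  proof (intro conjI impI)
    assume lsc: "LSC_on T \<Omega> u"
    have le: "u t x + 1 * RI t0 x z t \<le> u t0 x0 \<longleftrightarrow> RI t0 x z t + u t x \<le> u t0 x0" for t x z t0 x0
      by (simp add: add.commute)

    note iff = infinitesimal_iff_trajectory[OF assms(10) lsc assms(12) cl, where \<sigma> = 1]
    show "minimax_supersolution T p q emb A F h L \<Omega> u \<longleftrightarrow>
         (\<forall>x\<in>\<Omega>. u T x \<ge> h x) \<and>
         (\<forall>t0\<in>{0..<T}. \<forall>x0\<in>\<Omega>. \<forall>z.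
            (INF x\<in>X L t0 x0. Liminf (at_right 0) (\<lambda>\<delta>. ereal (1 / \<delta> *
                 (u (t0 + \<delta>) x - u t0 x0 + RI t0 x z (t0 + \<delta>))))) \<le> 0)"
      using iff unfolding minimax_supersolution_def le by (simp only: lsc simp_thms mult_1_left)
  next
    assume usc: "USC_on T \<Omega> u"
    note iff = infinitesimal_iff_trajectory[OF assms(10) LSC_on_uminus[OF usc] assms(12) cl, where \<sigma> = "- 1"]
    \<comment> \<open>Negation turns the supremum of upper limits for \<open>u\<close> into the
      infimum of lower limits for -u, with the integral entering with the sign \<sigma> =
      -1.\<close>
    have sup: "(SUP x\<in>X L t0 x0. Limsup (at_right 0) (\<lambda>\<delta>. ereal (1 / \<delta> *
            (u (t0 + \<delta>) x - u t0 x0 + RI t0 x z (t0 + \<delta>))))) \<ge> 0 \<longleftrightarrow>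
       (INF x\<in>X L t0 x0. Liminf (at_right 0) (\<lambda>\<delta>. ereal (1 / \<delta> *
            (- u (t0 + \<delta>) x - - u t0 x0 + - 1 * RI t0 x z (t0 + \<delta>))))) \<le> 0" for t0 x0 z
    proof -
      have e: "- (u (t0 + \<delta>) x - u t0 x0 + RI t0 x z (t0 + \<delta>)) = - u (t0 + \<delta>) x - - u t0 x0 + - 1 * RI t0 x z (t0 + \<delta>)" for \<delta> x
        by simp
      show ?thesis unfolding SUP_Limsup_quotient_eq e by (rule ereal_0_le_uminus_iff)
    qed
    have le: "- u t x + - 1 * RI t0 x z t \<le> - u t0 x0 \<longleftrightarrow> u t0 x0 \<le> RI t0 x z t + u t x" for t x z t0 x0
      by auto
    show "minimax_subsolution T p q emb A F h L \<Omega> u \<longleftrightarrow>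
         (\<forall>x\<in>\<Omega>. u T x \<le> h x) \<and>
         (\<forall>t0\<in>{0..<T}. \<forall>x0\<in>\<Omega>. \<forall>z.
            (SUP x\<in>X L t0 x0. Limsup (at_right 0) (\<lambda>\<delta>. ereal (1 / \<delta> *
                 (u (t0 + \<delta>) x - u t0 x0 + RI t0 x z (t0 + \<delta>))))) \<ge> 0)"
      using iff unfolding minimax_subsolution_def sup le by (simp only: usc simp_thms)
  qed
qed

end
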